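(* Let $Q$ be a finite quiver with two distinct distinguished vertices $0,1\in Q_0$, let $Q^{T}$ be the quiver obtained from $Q$ by adding a two-cycle between $0$ and $1$, and let $Q^{L}$ be the linked quiver. Then there are maps $\mathsf{d}_k\colon\overline{\mathcal{H}}^{(k+1)}_{Q^{T}}\to\overline{\mathcal{H}}^{(k)}_{Q^{T}}$ ($k\ge0$) of $\mathbb{N}Q_0$-graded vector spaces, of cohomological degree $-1$, and a surjection $\overline{\mathcal{H}}^{(0)}_{Q^T}\twoheadrightarrow\mathcal{H}_Q$ of graded vector spaces, fitting into a chain resolution of $\mathcal{H}_Q$, i.e. an exact sequence $$0\longleftarrow\mathcal{H}_Q\longleftarrow\overline{\mathcal{H}}^{(0)}_{Q^{T}}\xleftarrow{\ \mathsf{d}_0\ }\overline{\mathcal{H}}^{(1)}_{Q^{T}}\xleftarrow{\ \mathsf{d}_1\ }\cdots.$$ In particular, this makes $\mathcal{H}_{Q^{L}}\cong\bigoplus_{k\in\mathbb{N}}\overline{\mathcal{H}}^{(k)}_{Q^{T}}$ a DG vector space quasi-isomorphic to $\mathcal{H}_Q$ (with zero differential).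
   Context: Quivers: arrows $a\colon i\to j$ have source $i$, target $j$; $e_i$ denote the standard basis vectors of $\mathbb{N}Q_0$. $\chi_Q(\delta,\delta')=\sum_{i}\delta_i\delta'_i-\sum_{a\colon i\to j\in Q_1}\delta_j\delta'_i$. $R_\delta(Q)=\prod_{a\colon i\to j}\mathrm{Mat}_{\mathbb{C}}(\delta_j,\delta_i)$, $GL_\delta=\prod_iGL_{\delta_i}(\mathbb{C})$ acts by base change, $\mathcal{M}_\delta(Q)=[R_\delta(Q)/GL_\delta]$. Cohomology has $\mathbb{Q}$-coefficients; cohomology of a quotient stack is equivariant cohomology; $V[m]^n=V^{n+m}$. For any quiver $Q$, $\mathcal{H}_Q=\bigoplus_\delta\mathcal{H}_{Q,\delta}$ with $\mathcal{H}_{Q,\delta}=H^\bullet(\mathcal{M}_\delta(Q))[-\chi_Q(\delta,\delta)]$, an $\mathbb{N}Q_0\times\mathbb{Z}$-graded vector space. $Q^{T}$: same vertices as $Q$, arrows $Q_1\sqcup\{c\colon0\to1,\ d\colon1\to0\}$. $Q^{L}$: vertices $Q_0\sqcup\{\blacksquare\}$; arrows $\alpha\colon0\to1$, $\beta\colon1\to0$ and for each $a\colon i\to j$ in $Q_1$: if $i,j\notin\{0,1\}$, one arrow $a\colon i\to j$; if $i\in\{0,1\},j\notin\{0,1\}$, arrows $a\colon i\to j$, $a^\blacksquare\colon\blacksquare\to j$; if $i\notin\{0,1\},j\in\{0,1\}$, arrows $a\colon i\to j$, $a_\blacksquare\colon i\to\blacksquare$; if $i,j\in\{0,1\}$, arrows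 $a\colon i\to j$, $a^\blacksquare\colon\blacksquare\to j$, $a_\blacksquare\colon i\to\blacksquare$, $a^\blacksquare_\blacksquare\colon\blacksquare\to\blacksquare$. Dimension vectors of $Q^L$ are written $(\delta,k)$ with $\delta\in\mathbb{N}Q_0$, $k\in\mathbb{N}$ the dimension at $\blacksquare$. Framed representations: for $\delta\in\mathbb{N}Q_0$, $k\in\mathbb{N}$, $X_\delta^{(k)}=\{(\rho,f)\in R_\delta(Q^T)\times\mathrm{Mat}_{\mathbb{C}}(k,\delta_0)\mid\mathrm{rk}f=\mathrm{rk}(f\circ\rho_d)=k\}$, with action of $GL_\delta$ by base change and of $GL_k$ by base change on the target $\mathbb{C}^k$ of $f$; $\overline{\mathcal{X}}_\delta^{(k)}=[X_\delta^{(k)}/(GL_\delta\times GL_k)]$, and $$\overline{\mathcal{H}}^{(k)}_{Q^T}=\bigoplus_{\delta\in\mathbb{N}Q_0}H^\bullet(\overline{\mathcal{X}}^{(k)}_\delta,\mathbb{Q})[-\chi_{Q^T}(\delta,\delta)-k^2].$$ The isomorphism $\mathcal{H}_{Q^L}\cong\bigoplus_k\overline{\mathcal{H}}^{(k)}_{Q^T}$ identifies $\mathcal{H}_{Q^L,(\delta,k)}$ with the summand of $\overline{\mathcal{H}}^{(k)}_{Q^T}$ for dimension vector $\delta+k(e_0+e_1)$ (it is the pullback along a homotopy equivalence $\mathcal{M}_{(\delta,k)}(Q^L)\to\overline{\mathcal{X}}^{(k)}_{\delta+k(e_0+e_1)}$). *)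

theory Defs
  imports
    "HOL-Analysis.Analysis"
    "HOL-Homology.Homology"
    "HOL-Algebra.Group_Action"
    "HOL-Algebra.Product_Groups"
    "Graph_Theory.Digraph"
    "Jordan_Normal_Form.DL_Rank"
begin

section \<open>Quivers and dimension vectors\<close>

text \<open>A finite quiver is a \<open>fin_digraph\<close>: loops and parallel arrows are allowed, and an arrow
  \<open>a : i \<rightarrow> j\<close> has \<open>tail Q a = i\<close> and \<open>head Q a = j\<close>.\<close>

definition dimvecs :: "('v, 'a) pre_digraph \<Rightarrow> ('v \<Rightarrow> nat) set" where
  "dimvecs Q = {\<delta>. \<forall>i. i \<notin> verts Q \<longrightarrow> \<delta> i = 0}"

definition euler_form :: "('v, 'a) pre_digraph \<Rightarrow> ('v \<Rightarrow> nat) \<Rightarrow> ('v \<Rightarrow> nat) \<Rightarrow> int" where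
  "euler_form Q \<delta> \<delta>' =
     (\<Sum>i\<in>verts Q. int (\<delta> i) * int (\<delta>' i))
     - (\<Sum>a\<in>arcs Q. int (\<delta> (head Q a)) * int (\<delta>' (tail Q a)))"

datatype 'a cycle_arrow = Orig 'a | Arrow_c | Arrow_d

definition add_two_cycle :: "'v \<Rightarrow> 'v \<Rightarrow> ('v, 'a) pre_digraph \<Rightarrow> ('v, 'a cycle_arrow) pre_digraph" where
  "add_two_cycle v0 v1 Q =
     \<lparr> verts = verts Q,
       arcs = Orig ` arcs Q \<union> {Arrow_c, Arrow_d},
       tail = (\<lambda>b. case b of Orig a \<Rightarrow> tail Q a | Arrow_c \<Rightarrow> v0 | Arrow_d \<Rightarrow> v1),
       head = (\<lambda>b. case b of Orig a \<Rightarrow> head Q a | Arrow_c \<Rightarrow> v1 | Arrow_d \<Rightarrow> v0) \<rparr>"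

text \<open>In the linked quiver, \<open>None\<close> is the new vertex (the black square). The arrows \<open>From_square a\<close>,
  \<open>To_square a\<close> and \<open>Loop_square a\<close> are the copies of \<open>a\<close> whose source, whose target,
  respectively both of whose ends have been moved to the square.\<close>

datatype 'a linked_arrow =
  Arrow_alpha | Arrow_beta | Plain 'a | From_square 'a | To_square 'a | Loop_square 'a

definition linked_quiver ::
    "'v \<Rightarrow> 'v \<Rightarrow> ('v, 'a) pre_digraph \<Rightarrow> ('v option, 'a linked_arrow) pre_digraph" where
  "linked_quiver v0 v1 Q =
     \<lparr> verts = insert None (Some ` verts Q),
       arcs = {Arrow_alpha, Arrow_beta} \<union> Plain ` arcs Q
         \<union> From_square ` {a \<in> arcs Q. tail Q a \<in> {v0, v1}}
         \<union> To_square ` {a \<in> arcs Q. head Q a \<in> {v0, v1}}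
         \<union> Loop_square ` {a \<in> arcs Q. tail Q a \<in> {v0, v1} \<and> head Q a \<in> {v0, v1}},
       tail = (\<lambda>b. case b of Arrow_alpha \<Rightarrow> Some v0 | Arrow_beta \<Rightarrow> Some v1 | Plain a \<Rightarrow> Some (tail Q a)
         | From_square a \<Rightarrow> None | To_square a \<Rightarrow> Some (tail Q a) | Loop_square a \<Rightarrow> None),
       head = (\<lambda>b. case b of Arrow_alpha \<Rightarrow> Some v1 | Arrow_beta \<Rightarrow> Some v0 | Plain a \<Rightarrow> Some (head Q a)
         | From_square a \<Rightarrow> Some (head Q a) | To_square a \<Rightarrow> None | Loop_square a \<Rightarrow> None) \<rparr>"

text \<open>The dimension vector \<open>(\<delta>, k)\<close> of the linked quiver, and \<open>\<delta> + k (e_0 + e_1)\<close>.\<close>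

definition linked_dim :: "('v \<Rightarrow> nat) \<Rightarrow> nat \<Rightarrow> 'v option \<Rightarrow> nat" where
  "linked_dim \<delta> k = case_option k \<delta>"

definition shift_dim :: "'v \<Rightarrow> 'v \<Rightarrow> nat \<Rightarrow> ('v \<Rightarrow> nat) \<Rightarrow> 'v \<Rightarrow> nat" where
  "shift_dim v0 v1 k \<delta> = (\<lambda>i. \<delta> i + k * (of_bool (i = v0) + of_bool (i = v1)))"


section \<open>Representation spaces and base change\<close>

text \<open>Matrices over the complex numbers with \<open>m\<close> rows and \<open>n\<close> columns, with the Euclidean topology
  in the entries.\<close>

definition mat_topology :: "nat \<Rightarrow> nat \<Rightarrow> complex mat topology" where
  "mat_topology m n =
     pullback_topology (carrier_mat m n) (\<lambda>A. \<lambda>ij\<in>{..<m} \<times> {..<n}. A $$ ij)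
       (product_topology (\<lambda>_. euclidean) ({..<m} \<times> {..<n}))"

definition GL :: "nat \<Rightarrow> complex mat monoid" where
  "GL n = units_of (ring_mat TYPE(complex) n ())"

definition GL_dim :: "('v, 'a) pre_digraph \<Rightarrow> ('v \<Rightarrow> nat) \<Rightarrow> ('v \<Rightarrow> complex mat) monoid" where
  "GL_dim Q \<delta> = product_group (verts Q) (\<lambda>i. GL (\<delta> i))"

definition rep_topology :: "('v, 'a) pre_digraph \<Rightarrow> ('v \<Rightarrow> nat) \<Rightarrow> ('a \<Rightarrow> complex mat) topology" where
  "rep_topology Q \<delta> =
     product_topology (\<lambda>a. mat_topology (\<delta> (head Q a)) (\<delta> (tail Q a))) (arcs Q)"

definition base_change ::
    "('v, 'a) pre_digraph \<Rightarrow> ('v \<Rightarrow> nat) \<Rightarrow> ('v \<Rightarrow> complex mat)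
      \<Rightarrow> ('a \<Rightarrow> complex mat) \<Rightarrow> 'a \<Rightarrow> complex mat" where
  "base_change Q \<delta> g \<rho> =
     (\<lambda>a\<in>arcs Q. g (head Q a) * \<rho> a * inv\<^bsub>GL (\<delta> (tail Q a))\<^esub> g (tail Q a))"

definition framed_reps ::
    "('v, 'a) pre_digraph \<Rightarrow> 'v \<Rightarrow> 'v \<Rightarrow> nat \<Rightarrow> ('v \<Rightarrow> nat)
      \<Rightarrow> (('a cycle_arrow \<Rightarrow> complex mat) \<times> complex mat) set" where
  "framed_reps Q v0 v1 k \<delta> =
     {(\<rho>, f). \<rho> \<in> topspace (rep_topology (add_two_cycle v0 v1 Q) \<delta>) \<and> f \<in> carrier_mat k (\<delta> v0)
        \<and> vec_space.rank k f = k \<and> vec_space.rank k (f * \<rho> Arrow_d) = k}"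

definition framed_topology ::
    "('v, 'a) pre_digraph \<Rightarrow> 'v \<Rightarrow> 'v \<Rightarrow> nat \<Rightarrow> ('v \<Rightarrow> nat)
      \<Rightarrow> (('a cycle_arrow \<Rightarrow> complex mat) \<times> complex mat) topology" where
  "framed_topology Q v0 v1 k \<delta> =
     subtopology
       (prod_topology (rep_topology (add_two_cycle v0 v1 Q) \<delta>) (mat_topology k (\<delta> v0)))
       (framed_reps Q v0 v1 k \<delta>)"

definition framed_base_change ::
    "('v, 'a) pre_digraph \<Rightarrow> 'v \<Rightarrow> 'v \<Rightarrow> ('v \<Rightarrow> nat) \<Rightarrow> ('v \<Rightarrow> complex mat) \<times> complex mat
      \<Rightarrow> ('a cycle_arrow \<Rightarrow> complex mat) \<times> complex mat
      \<Rightarrow> ('a cycle_arrow \<Rightarrow> complex mat) \<times> complex mat" where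
  "framed_base_change Q v0 v1 \<delta> = (\<lambda>(g, h) (\<rho>, f).
     (base_change (add_two_cycle v0 v1 Q) \<delta> g \<rho>, h * f * inv\<^bsub>GL (\<delta> v0)\<^esub> g v0))"


section \<open>Homotopy quotients\<close>

text \<open>The model of \<open>EGL_n\<close> is the space of complex linearly independent \<open>n\<close>-tuples (frames) in the
  Banach space of bounded complex sequences, i.e. of injective linear maps from \<open>\<complex>^n\<close>, with
  \<open>g\<close> acting by precomposition with the inverse of \<open>g\<close>. The action is free with local
  slices (on the open set where a given \<open>n \<times> n\<close> minor does not vanish, normalise that minor to the
  identity matrix). The space is contractible: if \<open>S\<close> is the right shift, then \<open>(1 - t) e + t S e\<close>,
  repeated \<open>n\<close> times, moves a frame \<open>e\<close> through frames to one whose first \<open>n\<close> coordinates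
  vanish, and such a frame is joined to the standard one by a segment of frames.\<close>

definition frames :: "nat \<Rightarrow> (nat \<Rightarrow> (nat \<Rightarrow>\<^sub>C complex)) set" where
  "frames n = {e \<in> extensional {..<n}. \<forall>c :: nat \<Rightarrow> complex.
     (\<forall>r. (\<Sum>i<n. c i * apply_bcontfun (e i) r) = 0) \<longrightarrow> (\<forall>i<n. c i = 0)}"

definition frame_topology :: "nat \<Rightarrow> (nat \<Rightarrow> (nat \<Rightarrow>\<^sub>C complex)) topology" where
  "frame_topology n = subtopology (product_topology (\<lambda>_. euclidean) {..<n}) (frames n)"

definition frame_action ::
    "nat \<Rightarrow> complex mat \<Rightarrow> (nat \<Rightarrow> (nat \<Rightarrow>\<^sub>C complex)) \<Rightarrow> nat \<Rightarrow> (nat \<Rightarrow>\<^sub>C complex)" where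
  "frame_action n g e =
     (\<lambda>j\<in>{..<n}. Bcontfun (\<lambda>r. \<Sum>i<n. apply_bcontfun (e i) r * (inv\<^bsub>GL n\<^esub> g) $$ (i, j)))"

definition EGL_topology ::
    "('v, 'a) pre_digraph \<Rightarrow> ('v \<Rightarrow> nat) \<Rightarrow> ('v \<Rightarrow> nat \<Rightarrow> (nat \<Rightarrow>\<^sub>C complex)) topology" where
  "EGL_topology Q \<delta> = product_topology (\<lambda>i. frame_topology (\<delta> i)) (verts Q)"

definition EGL_action ::
    "('v, 'a) pre_digraph \<Rightarrow> ('v \<Rightarrow> nat) \<Rightarrow> ('v \<Rightarrow> complex mat)
      \<Rightarrow> ('v \<Rightarrow> nat \<Rightarrow> (nat \<Rightarrow>\<^sub>C complex)) \<Rightarrow> 'v \<Rightarrow> nat \<Rightarrow> (nat \<Rightarrow>\<^sub>C complex)" where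
  "EGL_action Q \<delta> g e = (\<lambda>i\<in>verts Q. frame_action (\<delta> i) (g i) (e i))"

definition quotient_topology :: "'x topology \<Rightarrow> ('x \<Rightarrow> 'y) \<Rightarrow> 'y topology" where
  "quotient_topology X p =
     topology (\<lambda>U. U \<subseteq> p ` topspace X \<and> openin X {x \<in> topspace X. p x \<in> U})"

lemma openin_quotient_topology:
  "openin (quotient_topology X p) U \<longleftrightarrow>
     U \<subseteq> p ` topspace X \<and> openin X {x \<in> topspace X. p x \<in> U}"
proof -
  have "istopology (\<lambda>U. U \<subseteq> p ` topspace X \<and> openin X {x \<in> topspace X. p x \<in> U})"
    unfolding istopology_def
  proof (intro conjI allI impI)
    fix S T
    assume "S \<subseteq> p ` topspace X \<and> openin X {x \<in> topspace X. p x \<in> S}"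
      and "T \<subseteq> p ` topspace X \<and> openin X {x \<in> topspace X. p x \<in> T}"
    moreover have "{x \<in> topspace X. p x \<in> S \<inter> T} =
        {x \<in> topspace X. p x \<in> S} \<inter> {x \<in> topspace X. p x \<in> T}"
      by auto
    ultimately show "S \<inter> T \<subseteq> p ` topspace X" "openin X {x \<in> topspace X. p x \<in> S \<inter> T}"
      by auto
  next
    fix \<K>
    assume K: "\<forall>K\<in>\<K>. K \<subseteq> p ` topspace X \<and> openin X {x \<in> topspace X. p x \<in> K}"
    have "{x \<in> topspace X. p x \<in> \<Union>\<K>} = (\<Union>K\<in>\<K>. {x \<in> topspace X. p x \<in> K})"
      by auto
    with K show "\<Union>\<K> \<subseteq> p ` topspace X" "openin X {x \<in> topspace X. p x \<in> \<Union>\<K>}"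
      by auto
  qed
  then show ?thesis
    by (simp add: quotient_topology_def topology_inverse')
qed

lemma quotient_map_quotient_topology: "quotient_map X (quotient_topology X p) p"
proof -
  have "openin (quotient_topology X p) (p ` topspace X)"
    by (auto simp: openin_quotient_topology intro: back_subst[of "openin X", OF openin_topspace])
  then have "topspace (quotient_topology X p) = p ` topspace X"
    by (meson openin_quotient_topology openin_subset openin_topspace subset_antisym)
  then show ?thesis
    by (auto simp: quotient_map_def openin_quotient_topology)
qed

text \<open>The Borel construction: the quotient of \<open>E \<times> X\<close> by the diagonal action of \<open>G\<close>.\<close>

definition borel_construction ::
    "'g monoid \<Rightarrow> 'e topology \<Rightarrow> ('g \<Rightarrow> 'e \<Rightarrow> 'e) \<Rightarrow> 'x topology \<Rightarrow> ('g \<Rightarrow> 'x \<Rightarrow> 'x)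
      \<Rightarrow> ('e \<times> 'x) set topology" where
  "borel_construction G E act_E X act_X =
     quotient_topology (prod_topology E X) (orbit G (\<lambda>g (e, x). (act_E g e, act_X g x)))"

text \<open>\<open>rep_stack Q \<delta>\<close> and \<open>framed_stack Q v0 v1 k \<delta>\<close> are the homotopy quotients representing the
  quotient stacks of representations, respectively of framed representations of the quiver
  with added two-cycle.\<close>

definition rep_stack ::
    "('v, 'a) pre_digraph \<Rightarrow> ('v \<Rightarrow> nat)
      \<Rightarrow> (('v \<Rightarrow> nat \<Rightarrow> (nat \<Rightarrow>\<^sub>C complex)) \<times> ('a \<Rightarrow> complex mat)) set topology" where
  "rep_stack Q \<delta> =
     borel_construction (GL_dim Q \<delta>) (EGL_topology Q \<delta>) (EGL_action Q \<delta>)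
       (rep_topology Q \<delta>) (base_change Q \<delta>)"

definition framed_stack ::
    "('v, 'a) pre_digraph \<Rightarrow> 'v \<Rightarrow> 'v \<Rightarrow> nat \<Rightarrow> ('v \<Rightarrow> nat)
      \<Rightarrow> ((('v \<Rightarrow> nat \<Rightarrow> (nat \<Rightarrow>\<^sub>C complex)) \<times> (nat \<Rightarrow> (nat \<Rightarrow>\<^sub>C complex)))
          \<times> (('a cycle_arrow \<Rightarrow> complex mat) \<times> complex mat)) set topology" where
  "framed_stack Q v0 v1 k \<delta> =
     borel_construction (GL_dim Q \<delta> \<times>\<times> GL k)
       (prod_topology (EGL_topology Q \<delta>) (frame_topology k))
       (\<lambda>(g, h) (e, e'). (EGL_action Q \<delta> g e, frame_action k h e'))
       (framed_topology Q v0 v1 k \<delta>) (framed_base_change Q v0 v1 \<delta>)"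


section \<open>Complexes and singular cohomology\<close>

text \<open>The fields \<open>mult\<close> and \<open>one\<close> of a \<open>module\<close> record play no role for vector spaces.\<close>

definition subquotient :: "('r, 'm) module \<Rightarrow> 'm set \<Rightarrow> 'm set \<Rightarrow> ('r, 'm set) module" where
  "subquotient M Z B =
     \<lparr> carrier = (\<lambda>x. B +>\<^bsub>M\<^esub> x) ` Z, mult = undefined, one = undefined,
       zero = B, add = (\<lambda>S T. S <+>\<^bsub>M\<^esub> T),
       smult = (\<lambda>c S. \<Union>x\<in>S. B +>\<^bsub>M\<^esub> (c \<odot>\<^bsub>M\<^esub> x)) \<rparr>"

text \<open>The map into a quotient by \<open>B\<close> induced by \<open>f\<close>, with classes regarded as cosets.\<close>

definition induced_map :: "('r, 'n) module \<Rightarrow> 'n set \<Rightarrow> ('m \<Rightarrow> 'n) \<Rightarrow> 'm set \<Rightarrow> 'n set" where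
  "induced_map N B f S = (\<Union>x\<in>S. B +>\<^bsub>N\<^esub> f x)"

text \<open>A complex has components \<open>C n\<close> and differentials \<open>d n\<close> from \<open>C n\<close> to \<open>C (n + s)\<close>; the
  degree \<open>s\<close> of the differential is \<open>1\<close> for cochains and \<open>- 1\<close> for the resolution.\<close>

definition complex_boundaries ::
    "int \<Rightarrow> (int \<Rightarrow> ('r, 'm) module) \<Rightarrow> (int \<Rightarrow> 'm \<Rightarrow> 'm) \<Rightarrow> int \<Rightarrow> 'm set" where
  "complex_boundaries s C d n = d (n - s) ` carrier (C (n - s))"

definition complex_homology ::
    "int \<Rightarrow> (int \<Rightarrow> ('r, 'm) module) \<Rightarrow> (int \<Rightarrow> 'm \<Rightarrow> 'm) \<Rightarrow> int \<Rightarrow> ('r, 'm set) module" where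
  "complex_homology s C d n =
     subquotient (C n) {x \<in> carrier (C n). d n x = \<zero>\<^bsub>C (n + s)\<^esub>} (complex_boundaries s C d n)"

definition dg_space ::
    "'r ring \<Rightarrow> int \<Rightarrow> (int \<Rightarrow> ('r, 'm) module) \<Rightarrow> (int \<Rightarrow> 'm \<Rightarrow> 'm) \<Rightarrow> bool" where
  "dg_space K s C d \<longleftrightarrow>
     (\<forall>n. linear_map K (C n) (C (n + s)) (d n)
        \<and> (\<forall>x\<in>carrier (C n). d (n + s) (d n x) = \<zero>\<^bsub>C (n + s + s)\<^esub>))"

definition quasi_isomorphism ::
    "'r ring \<Rightarrow> int \<Rightarrow> (int \<Rightarrow> ('r, 'm) module) \<Rightarrow> (int \<Rightarrow> 'm \<Rightarrow> 'm)
      \<Rightarrow> (int \<Rightarrow> ('r, 'n) module) \<Rightarrow> (int \<Rightarrow> 'n \<Rightarrow> 'n) \<Rightarrow> (int \<Rightarrow> 'm \<Rightarrow> 'n) \<Rightarrow> bool" where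
  "quasi_isomorphism K s C d C' d' f \<longleftrightarrow>
     (\<forall>n. linear_map K (C n) (C' n) (f n)
        \<and> (\<forall>x\<in>carrier (C n). f (n + s) (d n x) = d' n (f n x))
        \<and> bij_betw (induced_map (C' n) (complex_boundaries s C' d' n) (f n))
            (carrier (complex_homology s C d n)) (carrier (complex_homology s C' d' n)))"

text \<open>Rational singular cochains as functions on singular simplices, zero in negative degrees.\<close>

definition cochain_space ::
    "'x topology \<Rightarrow> int \<Rightarrow> (rat, ((nat \<Rightarrow> real) \<Rightarrow> 'x) \<Rightarrow> rat) module" where
  "cochain_space X n =
     \<lparr> carrier = {\<phi>. \<forall>\<sigma>. \<phi> \<sigma> \<noteq> 0 \<longrightarrow> 0 \<le> n \<and> singular_simplex (nat n) X \<sigma>},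
       mult = undefined, one = undefined,
       zero = (\<lambda>\<sigma>. 0), add = (\<lambda>\<phi> \<psi> \<sigma>. \<phi> \<sigma> + \<psi> \<sigma>), smult = (\<lambda>c \<phi> \<sigma>. c * \<phi> \<sigma>) \<rparr>"

definition coboundary ::
    "'x topology \<Rightarrow> int \<Rightarrow> (((nat \<Rightarrow> real) \<Rightarrow> 'x) \<Rightarrow> rat) \<Rightarrow> ((nat \<Rightarrow> real) \<Rightarrow> 'x) \<Rightarrow> rat" where
  "coboundary X n \<phi> = (\<lambda>\<sigma>.
     if 0 \<le> n \<and> singular_simplex (Suc (nat n)) X \<sigma>
     then \<Sum>k\<le>Suc (nat n). (- 1) ^ k * \<phi> (singular_face (Suc (nat n)) k \<sigma>) else 0)"

definition singular_cohomology ::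
    "'x topology \<Rightarrow> int \<Rightarrow> (rat, (((nat \<Rightarrow> real) \<Rightarrow> 'x) \<Rightarrow> rat) set) module" where
  "singular_cohomology X = complex_homology 1 (cochain_space X) (coboundary X)"

definition cochain_pullback ::
    "'x topology \<Rightarrow> ('x \<Rightarrow> 'y) \<Rightarrow> int \<Rightarrow> (((nat \<Rightarrow> real) \<Rightarrow> 'y) \<Rightarrow> rat)
      \<Rightarrow> ((nat \<Rightarrow> real) \<Rightarrow> 'x) \<Rightarrow> rat" where
  "cochain_pullback X h n \<phi> = (\<lambda>\<sigma>.
     if 0 \<le> n \<and> singular_simplex (nat n) X \<sigma> then \<phi> (simplex_map (nat n) h \<sigma>) else 0)"

definition cohomology_pullback ::
    "'x topology \<Rightarrow> ('x \<Rightarrow> 'y) \<Rightarrow> int \<Rightarrow> (((nat \<Rightarrow> real) \<Rightarrow> 'y) \<Rightarrow> rat) set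
      \<Rightarrow> (((nat \<Rightarrow> real) \<Rightarrow> 'x) \<Rightarrow> rat) set" where
  "cohomology_pullback X h n =
     induced_map (cochain_space X n) (complex_boundaries 1 (cochain_space X) (coboundary X) n)
       (cochain_pullback X h n)"

definition homotopy_equivalence :: "'x topology \<Rightarrow> 'y topology \<Rightarrow> ('x \<Rightarrow> 'y) \<Rightarrow> bool" where
  "homotopy_equivalence X Y f \<longleftrightarrow>
     continuous_map X Y f \<and>
     (\<exists>g. continuous_map Y X g \<and> homotopic_with (\<lambda>_. True) X X (g \<circ> f) id
        \<and> homotopic_with (\<lambda>_. True) Y Y (f \<circ> g) id)"


section \<open>The graded vector spaces\<close>

text \<open>A graded vector space is the family of its homogeneous components: here \<open>\<delta>\<close> is the dimension
  vector and \<open>n\<close> the cohomological degree after the shift.\<close>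

definition coha ::
    "('v, 'a) pre_digraph \<Rightarrow> ('v \<Rightarrow> nat) \<Rightarrow> int
      \<Rightarrow> (rat, (((nat \<Rightarrow> real) \<Rightarrow> (('v \<Rightarrow> nat \<Rightarrow> (nat \<Rightarrow>\<^sub>C complex)) \<times> ('a \<Rightarrow> complex mat)) set) \<Rightarrow> rat) set)
          module" where
  "coha Q \<delta> n = singular_cohomology (rep_stack Q \<delta>) (n - euler_form Q \<delta> \<delta>)"

definition framed_coha ::
    "('v, 'a) pre_digraph \<Rightarrow> 'v \<Rightarrow> 'v \<Rightarrow> nat \<Rightarrow> ('v \<Rightarrow> nat) \<Rightarrow> int
      \<Rightarrow> (rat, (((nat \<Rightarrow> real) \<Rightarrow>
            ((('v \<Rightarrow> nat \<Rightarrow> (nat \<Rightarrow>\<^sub>C complex)) \<times> (nat \<Rightarrow> (nat \<Rightarrow>\<^sub>C complex)))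
              \<times> (('a cycle_arrow \<Rightarrow> complex mat) \<times> complex mat)) set) \<Rightarrow> rat) set) module" where
  "framed_coha Q v0 v1 k \<delta> n =
     singular_cohomology (framed_stack Q v0 v1 k \<delta>)
       (n - euler_form (add_two_cycle v0 v1 Q) \<delta> \<delta> - (int k)\<^sup>2)"

definition direct_sum_space ::
    "'i set \<Rightarrow> ('i \<Rightarrow> ('r, 'm) module) \<Rightarrow> ('r, 'i \<Rightarrow> 'm) module" where
  "direct_sum_space I M =
     \<lparr> carrier = {x \<in> \<Pi>\<^sub>E i\<in>I. carrier (M i). finite {i \<in> I. x i \<noteq> \<zero>\<^bsub>M i\<^esub>}},
       mult = undefined, one = undefined,
       zero = (\<lambda>i\<in>I. \<zero>\<^bsub>M i\<^esub>), add = (\<lambda>x y. \<lambda>i\<in>I. x i \<oplus>\<^bsub>M i\<^esub> y i),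
       smult = (\<lambda>c x. \<lambda>i\<in>I. c \<odot>\<^bsub>M i\<^esub> x i) \<rparr>"

definition summand_inj :: "'i set \<Rightarrow> ('i \<Rightarrow> ('r, 'm) module) \<Rightarrow> 'i \<Rightarrow> 'm \<Rightarrow> 'i \<Rightarrow> 'm" where
  "summand_inj I M i x = (\<lambda>j\<in>I. if j = i then x else \<zero>\<^bsub>M j\<^esub>)"

text \<open>The parts of cohomological degree \<open>n\<close> of the total spaces.\<close>

definition coha_total where
  "coha_total Q n = direct_sum_space (dimvecs Q) (\<lambda>\<delta>. coha Q \<delta> n)"

definition framed_total where
  "framed_total Q v0 v1 n =
     direct_sum_space (UNIV \<times> dimvecs Q) (\<lambda>(k, \<delta>). framed_coha Q v0 v1 k \<delta> n)"

end

theory Submission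
  imports Defs "HOL-Library.Function_Algebras" "HOL-Computational_Algebra.Formal_Power_Series"
begin

text \<open>The orbit spaces are filtered by Schubert cells of even dimension, so the cohomology of a
representation stack lives in even degrees and has Poincare series \<open>\<Prod>\<^sub>i W (\<delta> i)\<close>, where
\<open>W n = 1 / ((1 - X) \<dots> (1 - X ^ n))\<close>. In a framed representation the frame of the target of the
rank-\<open>k\<close> map can be split off from the frames at the vertices \<open>0\<close> and \<open>1\<close>; followed by straight-line
homotopies this gives the homotopy equivalence with the stack of the linked quiver, and hence the
Poincare series of the framed stack, which at the two vertices is \<open>W k * W (a - k) * W (b - k)\<close>.
With the shifts this equals \<open>\<Sum>r. ee r k * TT a b r\<close>, where \<open>\<Sum>r. TT a b r = W a * W b\<close> counts pairs of
partitions by Durfee rectangles and \<open>ee r k\<close> is the \<open>k\<close>-th elementary symmetric polynomial in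
\<open>1, X, \<dots>, X ^ (r - 1)\<close>. Separating the monomials of \<open>ee r k\<close> that contain the variable \<open>1\<close> writes the dimension of the \<open>k\<close>-th term
of the sequence as \<open>R k + R (k + 1)\<close> with \<open>R 0\<close> the dimension of the resolved space; differentials
that identify the two summands \<open>R (k + 1)\<close> make the sequence exact.\<close>

text \<open>The statement asks only for the existence of differentials. Over a field exactness can
  be arranged by hand once the dimensions split in the right way, and the parity of the cells leaves
  no connecting map to compute, so the dimensions are forced. The cells have finite codimension but
  infinite dimension; hence open charts are attached in order of increasing weight, and what counts
  is the homology of a chart relative to the complement of its cell. The linked isomorphism, by
  contrast, has to be the pullback along an honest homotopy equivalence. Its obstacle: a surjection
  out of \<complex>^n has no right inverse that varies equivariantly under GL_n. The frame
  coordinate of the Borel construction repairs this. It induces a Hermitian form on \<complex>^n,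
  and the right inverse orthogonal to the kernel is equivariant for pairs of a frame and a
  surjection. Bases of the kernel exist only locally, so the inverse map is defined with values in
  the orbit space. Series have natural coefficients, where 1 - X cannot be inverted; identities
  between them are proved by uniqueness of the solution of A = C + X^m A.\<close>

type_synonym bseq = "nat \<Rightarrow>\<^sub>C complex"
type_synonym ('v, 'a) frep = "('v => nat => bseq) \<times> ('a => complex mat)"

abbreviation (input) "vsp \<equiv> vectorspace class_ring"
abbreviation (input) "lmap \<equiv> linear_map class_ring"
abbreviation (input) "dirsum \<equiv> direct_sum_space"
abbreviation (input) "ap \<equiv> apply_bcontfun"
abbreviation (input) "cor \<equiv> complex_of_real"
abbreviation (input) ginv :: "nat => complex mat => complex mat" ("ginv[_] _" [0, 81] 80)
	where "ginv[n] A \<equiv> inv\<^bsub>GL n\<^esub> A"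
abbreviation (input) "cyc p X \<equiv> singular_relcycle p X {}"
abbreviation (input) "hclass p X \<equiv> homologous_rel_set p X {}"
abbreviation (input) "cyl X \<equiv> prod_topology (top_of_set {0..1::real}) X"
abbreviation (input) "cfun X \<equiv> continuous_map X euclidean"

section \<open>Rational cohomology as the dual of homology\<close>

text \<open>The Kronecker pairing: an arbitrary rational function on simplices is evaluated on an
  integral chain. Statements about cochains are phrased through it, so that facts about integral
  chains and homology transfer directly.\<close>

definition frag_pair :: "('b => rat) => ('b \<Rightarrow>\<^sub>0 int) => rat" where
	"frag_pair \<phi> c = (\<Sum>sg\<in>Poly_Mapping.keys c. of_int (Poly_Mapping.lookup c sg) * \<phi> sg)"

lemma frag_pair_superset:
	assumes "finite S" "Poly_Mapping.keys c <= S"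
	shows "frag_pair \<phi> c = (\<Sum>sg\<in>S. of_int (Poly_Mapping.lookup c sg) * \<phi> sg)"
	unfolding frag_pair_def
	by (rule sum.mono_neutral_left) (use assms in \<open>auto simp: in_keys_iff\<close>)

lemma frag_pair_0 [simp]: "frag_pair \<phi> 0 = 0"
	by (simp add: frag_pair_def)

lemma frag_pair_zero [simp]: "frag_pair (%sg. 0) c = 0"
	by (simp add: frag_pair_def)

lemma frag_pair_of [simp]: "frag_pair \<phi> (frag_of sg) = \<phi> sg"
	by (simp add: frag_pair_def keys_frag_of)

lemma frag_pair_add: "frag_pair \<phi> (a + b) = frag_pair \<phi> a + frag_pair \<phi> b"
proof -
	let ?S = "Poly_Mapping.keys a Un Poly_Mapping.keys b"
	have "Poly_Mapping.keys (a + b) <= ?S" by (rule Poly_Mapping.keys_add)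
	then show ?thesis
		by (simp add: frag_pair_superset[of ?S] lookup_add algebra_simps sum.distrib)
qed

lemma frag_pair_cmul: "frag_pair \<phi> (frag_cmul k a) = of_int k * frag_pair \<phi> a"
proof -
	have "Poly_Mapping.keys (frag_cmul k a) <= Poly_Mapping.keys a"
		by (auto simp: in_keys_iff)
	then show ?thesis
		by (simp add: frag_pair_superset[of "Poly_Mapping.keys a"] sum_distrib_left mult.assoc)
qed

lemma frag_pair_diff: "frag_pair \<phi> (a - b) = frag_pair \<phi> a - frag_pair \<phi> b"
	using frag_pair_add[of \<phi> "a - b" b] by simp

lemma frag_pair_sum: "frag_pair \<phi> (\<Sum>i\<in>I. c i) = (\<Sum>i\<in>I. frag_pair \<phi> (c i))"
	by (induction I rule: infinite_finite_induct) (auto simp: frag_pair_add)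

lemma frag_pair_extend:
	"frag_pair \<phi> (frag_extend f c) = frag_pair (%sg. frag_pair \<phi> (f sg)) c"
	by (simp add: frag_extend_def frag_pair_sum frag_pair_cmul frag_pair_def[of "%sg. frag_pair \<phi> (f sg)"])

lemma frag_pair_add_left: "frag_pair (%sg. \<phi> sg + \<psi> sg) c = frag_pair \<phi> c + frag_pair \<psi> c"
	by (simp add: frag_pair_def algebra_simps sum.distrib)

lemma frag_pair_scale_left: "frag_pair (%sg. k * \<phi> sg) c = k * frag_pair \<phi> c"
	by (simp add: frag_pair_def sum_distrib_left mult_ac)

lemma frag_pair_cong:
	"(!!sg. sg \<in> Poly_Mapping.keys c ==> \<phi> sg = \<psi> sg) ==> frag_pair \<phi> c = frag_pair \<psi> c"
	by (simp add: frag_pair_def)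

text \<open>\<open>h\<close> is only known to be additive on a set \<open>A\<close> without declared
  group structure, so compatibility with integer multiples is derived by induction; closure of
  \<open>A\<close> is carried along in the same statement.\<close>

lemma additive_cmul:
	assumes add: "!!x y. x \<in> A ==> y \<in> A ==> x + y \<in> A & h (x + y) = h x + (h y :: rat)"
		and neg: "!!x. x \<in> A ==> - x \<in> A" and zero: "0 \<in> A" and x: "x \<in> A"
	shows "frag_cmul k x \<in> A & h (frag_cmul k x) = of_int k * h x"
proof -
	have h0: "h 0 = 0" using add[OF zero zero] by simp
	have nat: "frag_cmul (int n) x \<in> A & h (frag_cmul (int n) x) = of_nat n * h x" for n
	proof (induction n)
		case (Suc n)
		have "frag_cmul (int (Suc n)) x = frag_cmul (int n) x + x"
			by (simp add: frag_cmul_distrib)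
		then show ?case using Suc add[of "frag_cmul (int n) x" x] x by (simp add: algebra_simps)
	qed (use zero h0 in auto)
	show ?thesis
	proof (cases k)
		case (nonneg n) then show ?thesis using nat by simp
	next
		case (neg n)
		have "frag_cmul (int (Suc n)) x \<in> A" using nat by blast
		then have "- frag_cmul (int (Suc n)) x \<in> A & h (- frag_cmul (int (Suc n)) x) = - h (frag_cmul (int (Suc n)) x)"
			using add[of "frag_cmul (int (Suc n)) x" "- frag_cmul (int (Suc n)) x"] assms(2) h0
			by (metis add.right_inverse add_eq_0_iff)
		moreover have "frag_cmul k x = - frag_cmul (int (Suc n)) x"
			by (rule poly_mapping_eqI) (simp add: neg)
		moreover have "of_int k = - (of_nat (Suc n) :: rat)" by (simp add: neg)
		ultimately show ?thesis using nat[of "Suc n"] by (metis mult_minus_left)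
	qed
qed

text \<open>Clears denominators, so that a rational relation between finitely many integral chains
  becomes an integral one.\<close>

lemma common_denominator:
	assumes "finite S"
	shows "EX N>0. ALL x:S. EX k. of_int N * (q x :: rat) = of_int k"
	using assms
proof induction
	case empty then show ?case by (auto intro: exI[of _ 1])
next
	case (insert a S)
	then obtain N where N: "N > 0" "ALL x:S. EX k. of_int N * q x = of_int k" by blast
	obtain n d where nd: "quotient_of (q a) = (n, d)" by fastforce
	then have d: "d > 0" "q a = of_int n / of_int d"
		using quotient_of_denom_pos quotient_of_div by auto
	have "EX k. of_int (N * d) * q x = of_int k" if x: "x \<in> insert a S" for x
	proof (cases "x = a")
		case True
		then have "of_int (N * d) * q x = of_int (N * n)" using d by simp
		then show ?thesis by (intro exI[of _ "N * n"])
	next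
		case False
		then obtain k where "of_int N * q x = of_int k" using N x False by blast
		then have "of_int (N * d) * q x = of_int (k * d)" by (simp add: mult_ac)
		then show ?thesis by (intro exI[of _ "k * d"])
	qed
	then show ?case using N(1) d(1) by (intro exI[of _ "N * d"]) auto
qed

lemma sum_fun_apply': "(\<Sum>i\<in>I. F i) = (%x. \<Sum>i\<in>I. F i x)"
	by (induction I rule: infinite_finite_induct) (auto simp: fun_eq_iff)

text \<open>This rests on the divisibility of the rationals.\<close>

lemma extend_to_frag:
	assumes add: "!!x y. x \<in> A ==> y \<in> A ==> x + y \<in> A & h (x + y) = h x + (h y :: rat)"
		and neg: "!!x. x \<in> A ==> - x \<in> A" and zero: "0 \<in> A"
	shows "EX \<phi> :: 'b => rat. ALL c:A. frag_pair \<phi> c = h c"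
proof -
	interpret V: vector_space "%(k::rat) (f::'b => rat) x. k * f x"
		by unfold_locales (auto simp: fun_eq_iff algebra_simps)
	interpret R: vector_space "(*) :: rat => rat => rat"
		by unfold_locales (auto simp: algebra_simps)
	interpret P: vector_space_pair "%(k::rat) (f::'b => rat) x. k * f x" "(*) :: rat => rat => rat" ..
	define emb where "emb c = (%sg. of_int (Poly_Mapping.lookup c sg) :: rat)" for c :: "'b \<Rightarrow>\<^sub>0 int"
	have inj: "inj emb"
		by (intro injI poly_mapping_eqI) (simp add: emb_def fun_eq_iff)
	\<comment> \<open>A rational basis of the span of \<open>A\<close> chosen inside \<open>A\<close>
	  itself. Prescribing \<open>g\<close> on it by \<open>h\<close> leaves only the agreement with
	  \<open>h\<close> on the rest of \<open>A\<close> to be checked.\<close>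
	obtain B where B: "B <= emb ` A" "\<not> V.dependent B" "emb ` A <= V.span B"
		using V.maximal_independent_subset[of "emb ` A"] by metis
	define h' where "h' v = h (inv_into UNIV emb v)" for v
	obtain g where g: "Vector_Spaces.linear (%k f x. k * f x) (*) g" "!!b. b \<in> B ==> g b = h' b"
		using P.linear_independent_extend[OF B(2), of h'] by blast
	interpret g: Vector_Spaces.linear "%(k::rat) (f::'b => rat) x. k * f x" "(*) :: rat => rat => rat" g
		by (rule g(1))
	have gscale: "g (%x. k * u x) = k * g u" for k u
		using g.scale[of k u] by simp
	have gsum: "g (%x. \<Sum>i\<in>I. F i x) = (\<Sum>i\<in>I. g (F i))" for F and I :: "'c set"
		using g.sum[of F I] by (simp add: sum_fun_apply')
	have Asum: "(\<Sum>i\<in>I. f i) \<in> A & h (\<Sum>i\<in>I. f i) = (\<Sum>i\<in>I. h (f i))"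
		if "finite I" "!!i. i \<in> I ==> f i \<in> A" for I :: "('b => rat) set" and f
		using that by (induction I) (use zero add[OF zero zero] add in auto)
	have key: "g (emb c) = h c" if c: "c \<in> A" for c
	proof -
		have "emb c \<in> V.span B" using B c by auto
		then obtain S q where S: "finite S" "S <= B" "emb c = (\<Sum>v\<in>S. (%x. q v * v x))"
			unfolding V.span_explicit by auto
		then have S3: "emb c x = (\<Sum>v\<in>S. q v * v x)" for x by (simp add: sum_fun_apply')
		\<comment> \<open>Additivity of \<open>h\<close> controls integral relations only. Multiplied by
		  \<open>N\<close>, the expansion of \<open>c\<close> in the basis is such a relation, and
		  \<open>N\<close> is cancelled at the end in the rationals.\<close>
		obtain N where N: "N > 0" "ALL v:S. EX k. of_int N * q v = of_int k"
			using common_denominator[OF S(1), of q] by blast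
		then obtain k where k: "!!v. v \<in> S ==> of_int N * q v = of_int (k v)" by metis
		define a where "a v = inv_into UNIV emb v" for v
		have a: "a v \<in> A" "emb (a v) = v" if v: "v \<in> S" for v
		proof -
			obtain x where "x \<in> A" "v = emb x" using v S(2) B(1) by blast
			then show "a v \<in> A" "emb (a v) = v" using inj by (simp_all add: a_def)
		qed
		have "frag_cmul N c = (\<Sum>v\<in>S. frag_cmul (k v) (a v))"
		proof (rule poly_mapping_eqI)
			fix x
			have "of_int (N * Poly_Mapping.lookup c x) = of_int N * emb c x" by (simp add: emb_def)
			also have "\<dots> = (\<Sum>v\<in>S. of_int (k v) * emb (a v) x)"
				unfolding S3 sum_distrib_left
				by (rule sum.cong) (use a k in \<open>auto simp flip: mult.assoc\<close>)
			also have "\<dots> = of_int (\<Sum>v\<in>S. k v * Poly_Mapping.lookup (a v) x)"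
				by (simp add: emb_def)
			finally have "N * Poly_Mapping.lookup c x = (\<Sum>v\<in>S. k v * Poly_Mapping.lookup (a v) x)"
				using of_int_eq_iff by blast
			then show "Poly_Mapping.lookup (frag_cmul N c) x = Poly_Mapping.lookup (\<Sum>v\<in>S. frag_cmul (k v) (a v)) x"
				by (simp add: lookup_sum)
		qed
		moreover have "h (frag_cmul N c) = of_int N * h c"
			using additive_cmul[of A h c N, OF add neg zero c] by blast
		moreover have "h (\<Sum>v\<in>S. frag_cmul (k v) (a v)) = (\<Sum>v\<in>S. of_int (k v) * h (a v))"
			using Asum[of S "%v. frag_cmul (k v) (a v)", OF S(1)] additive_cmul[of A h, OF add neg zero a(1)]
			by simp
		moreover have "g (emb c) = (\<Sum>v\<in>S. q v * h (a v))"
		proof -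
			have "emb c = (%x. \<Sum>v\<in>S. q v * v x)" using S3 by (rule ext)
			then have "g (emb c) = g (%x. \<Sum>v\<in>S. q v * v x)" by (rule arg_cong)
			also have "\<dots> = (\<Sum>v\<in>S. q v * g v)" by (simp add: gsum gscale)
			also have "\<dots> = (\<Sum>v\<in>S. q v * h (a v))"
				using S(2) g(2) by (intro sum.cong) (auto simp: h'_def a_def)
			finally show ?thesis .
		qed
		ultimately have "of_int N * h c = of_int N * g (emb c)"
			by (simp add: sum_distrib_left k flip: mult.assoc cong: sum.cong)
		then show ?thesis using N(1) by simp
	qed
	\<comment> \<open>The functional \<open>g\<close> becomes a function on simplices by evaluation on
	  indicator functions, which extends \<open>h\<close> from \<open>A\<close> to all chains.\<close>
	define \<phi> where "\<phi> sg = g (%x. if x = sg then 1 else 0)" for sg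
	have "frag_pair \<phi> c = g (emb c)" for c
	proof -
		have "emb c = (%x. \<Sum>sg\<in>Poly_Mapping.keys c. of_int (Poly_Mapping.lookup c sg) * (if x = sg then 1 else 0))"
			by (auto simp: fun_eq_iff emb_def if_distrib in_keys_iff cong: if_cong)
		then show ?thesis
			unfolding frag_pair_def \<phi>_def by (simp only: gsum gscale)
	qed
	then show ?thesis using key by metis
qed

text \<open>Stokes' formula. The restriction to chains in \<open>X\<close> matters, since
  \<open>coboundary X\<close> is set to zero off the singular simplices of \<open>X\<close>.\<close>

lemma frag_pair_boundary:
	assumes "singular_chain (Suc p) X c"
	shows "frag_pair (coboundary X (int p) \<phi>) c = frag_pair \<phi> (chain_boundary (Suc p) c)"
proof -
	have "frag_pair (coboundary X (int p) \<phi>) c =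
			frag_pair (%sg. \<Sum>k\<le>Suc p. (- 1) ^ k * \<phi> (singular_face (Suc p) k sg)) c"
		using assms by (intro frag_pair_cong) (auto simp: coboundary_def singular_chain_def)
	also have "\<dots> = frag_pair \<phi> (chain_boundary (Suc p) c)"
		by (simp add: chain_boundary_def frag_pair_extend frag_pair_sum frag_pair_cmul del: sum.atMost_Suc)
	finally show ?thesis .
qed

text \<open>Degrees as natural numbers, to match the chain groups. The integer grading of
  \<open>cochain_space\<close> adds only zero spaces in negative degrees, which are treated
  separately.\<close>

definition hcochain :: "'x topology => nat => (((nat => real) => 'x) => rat) set" where
	"hcochain X p = {\<phi>. ALL sg. \<phi> sg ~= 0 --> singular_simplex p X sg}"

definition hcocycle :: "'x topology => nat => (((nat => real) => 'x) => rat) set" where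
	"hcocycle X p = {\<phi>\<in>hcochain X p. coboundary X (int p) \<phi> = (%sg. 0)}"

definition hcobound :: "'x topology => nat => (((nat => real) => 'x) => rat) set" where
	"hcobound X p = complex_boundaries 1 (cochain_space X) (coboundary X) (int p)"

lemma carrier_cochain_space: "carrier (cochain_space X (int p)) = hcochain X p"
	by (auto simp: cochain_space_def hcochain_def)

lemma cochain_space_neg: "n < 0 ==> carrier (cochain_space X n) = {%sg. 0}"
	by (auto simp: cochain_space_def fun_eq_iff)

lemma hcobound_0: "hcobound X 0 = {%sg. 0}"
	by (simp add: hcobound_def complex_boundaries_def cochain_space_neg coboundary_def)

lemma hcobound_Suc: "hcobound X (Suc p) = coboundary X (int p) ` hcochain X p"
	by (simp add: hcobound_def complex_boundaries_def carrier_cochain_space)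

lemma restrict_hcochain:
	"(%sg. if singular_simplex p X sg then \<phi> sg else 0) \<in> hcochain X p"
	by (simp add: hcochain_def)

lemma frag_pair_restrict:
	"singular_chain p X c ==> frag_pair (%sg. if singular_simplex p X sg then \<phi> sg else 0) c = frag_pair \<phi> c"
	by (intro frag_pair_cong) (auto simp: singular_chain_def)

lemma hcochain_eqI:
	assumes "\<phi> \<in> hcochain X p" "\<psi> \<in> hcochain X p"
		"!!c. singular_chain p X c ==> frag_pair \<phi> c = frag_pair \<psi> c"
	shows "\<phi> = \<psi>"
proof
	fix sg
	show "\<phi> sg = \<psi> sg"
	proof (cases "singular_simplex p X sg")
		case True
		then show ?thesis using assms(3)[of "frag_of sg"] by (simp add: singular_chain_of)
	next
		case False
		then have "\<phi> sg = 0" "\<psi> sg = 0" using assms(1,2) unfolding hcochain_def by blast+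
		then show ?thesis by simp
	qed
qed

lemma coboundary_hcochain: "coboundary X (int p) \<phi> \<in> hcochain X (Suc p)"
	by (simp add: hcochain_def coboundary_def)

lemma hcocycle_iff:
	"\<phi> \<in> hcocycle X p \<longleftrightarrow> \<phi> \<in> hcochain X p &
		(ALL c. singular_chain (Suc p) X c --> frag_pair \<phi> (chain_boundary (Suc p) c) = 0)"
proof -
	have "coboundary X (int p) \<phi> = (%sg. 0) \<longleftrightarrow>
			(ALL c. singular_chain (Suc p) X c --> frag_pair \<phi> (chain_boundary (Suc p) c) = 0)" (is "?L = ?R")
	proof
		assume ?L
		then show ?R using frag_pair_boundary[of p X _ \<phi>] by (metis frag_pair_zero)
	next
		assume R: ?R
		show ?L
		proof (rule hcochain_eqI[OF coboundary_hcochain])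
			show "(%sg. 0) \<in> hcochain X (Suc p)" by (simp add: hcochain_def)
		next
			fix c assume "singular_chain (Suc p) X c"
			then show "frag_pair (coboundary X (int p) \<phi>) c = frag_pair (%sg. 0) c"
				using frag_pair_boundary[of p X c \<phi>] R by simp
		qed
	qed
	then show ?thesis by (simp add: hcocycle_def)
qed

lemma hcobound_subset: "hcobound X p <= hcocycle X p"
proof (cases p)
	case 0
	then show ?thesis by (auto simp: hcobound_0 hcocycle_iff hcochain_def)
next
	case (Suc q)
	have "frag_pair (coboundary X (int q) \<phi>) (chain_boundary (Suc (Suc q)) c) = 0"
		if "singular_chain (Suc (Suc q)) X c" for c \<phi>
		using frag_pair_boundary[of q X "chain_boundary (Suc (Suc q)) c" \<phi>] that
			singular_chain_boundary[OF that] chain_boundary_boundary_alt[of "Suc q" X c]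
		by simp
	then show ?thesis
		unfolding Suc hcobound_Suc using coboundary_hcochain by (auto simp: hcocycle_iff)
qed

text \<open>Vanishing of Ext with values in the rationals: a cocycle that kills all cycles factors
  through the boundary map, hence defines an additive function on boundaries, and
  \<open>extend_to_frag\<close> extends that function to a primitive of the cocycle.\<close>

lemma hcobound_iff:
	"\<phi> \<in> hcobound X p \<longleftrightarrow> \<phi> \<in> hcocycle X p & (ALL z. cyc p X z --> frag_pair \<phi> z = 0)"
	(is "_ \<longleftrightarrow> _ & ?R")
proof safe
	assume "\<phi> \<in> hcobound X p"
	then show "\<phi> \<in> hcocycle X p" using hcobound_subset by blast
next
	fix z assume \<phi>: "\<phi> \<in> hcobound X p" and z: "cyc p X z"
	show "frag_pair \<phi> z = 0"
	proof (cases p)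
		case 0
		then show ?thesis using \<phi> by (simp add: hcobound_0)
	next
		case (Suc q)
		then obtain \<psi> where "\<phi> = coboundary X (int q) \<psi>" using \<phi> by (auto simp: hcobound_Suc)
		then show ?thesis using z Suc frag_pair_boundary[of q X z \<psi>] by (simp add: singular_cycle)
	qed
next
	assume coc: "\<phi> \<in> hcocycle X p" and R: ?R
	show "\<phi> \<in> hcobound X p"
	proof (cases p)
		case 0
		have "\<phi> = (%sg. 0)"
		proof (rule hcochain_eqI)
			show "\<phi> \<in> hcochain X p" "(%sg. 0) \<in> hcochain X p"
				using coc by (auto simp: hcocycle_def hcochain_def)
			show "frag_pair \<phi> c = frag_pair (%sg. 0) c" if "singular_chain p X c" for c
				using R that by (simp add: 0 singular_cycle chain_boundary_def)
		qed
		then show ?thesis by (simp add: 0 hcobound_0)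
	next
		case (Suc q)
		define A where "A = chain_boundary p ` singular_chain_set p X"
		\<comment> \<open>A chosen chain with given boundary. Two such chains differ by a cycle, on which
		  \<open>\<phi>\<close> vanishes, so \<open>h\<close> does not depend on the choice.\<close>
		define pick where "pick b = (SOME c. singular_chain p X c & chain_boundary p c = b)" for b
		define h where "h b = frag_pair \<phi> (pick b)" for b
		have h: "h (chain_boundary p c) = frag_pair \<phi> c" if c: "singular_chain p X c" for c
		proof -
			have "singular_chain p X (pick (chain_boundary p c)) &
					chain_boundary p (pick (chain_boundary p c)) = chain_boundary p c"
				unfolding pick_def by (rule someI[of _ c]) (use c in auto)
			then have "cyc p X (c - pick (chain_boundary p c))"
				using c by (simp add: singular_cycle singular_chain_diff chain_boundary_diff)
			then have "frag_pair \<phi> (c - pick (chain_boundary p c)) = 0" using R by blast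
			then show ?thesis by (simp add: h_def frag_pair_diff)
		qed
		have "EX \<psi>. ALL c:A. frag_pair \<psi> c = h c"
		proof (rule extend_to_frag[of A h])
			fix x y assume "x \<in> A" "y \<in> A"
			then obtain c d where cd: "singular_chain p X c" "singular_chain p X d"
				"x = chain_boundary p c" "y = chain_boundary p d" by (auto simp: A_def)
			then have "singular_chain p X (c + d)" "x + y = chain_boundary p (c + d)"
				by (auto simp: singular_chain_add chain_boundary_add)
			then show "x + y \<in> A & h (x + y) = h x + h y"
				using h cd by (simp add: A_def frag_pair_add)
		next
			fix x assume "x \<in> A"
			then obtain c where "singular_chain p X c" "x = chain_boundary p c" by (auto simp: A_def)
			then have "singular_chain p X (- c)" "- x = chain_boundary p (- c)"
				by (simp_all add: singular_chain_minus chain_boundary_minus)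
			then show "- x \<in> A" unfolding A_def by blast
		next
			show "0 \<in> A" unfolding A_def by (rule image_eqI[of _ _ 0]) auto
		qed
		then obtain \<psi> where \<psi>: "!!c. c \<in> A ==> frag_pair \<psi> c = h c" by blast
		\<comment> \<open>The extension may be nonzero on simplices outside \<open>X\<close>. Truncation
		  makes it a cochain of \<open>X\<close> and leaves its values on chains in \<open>X\<close>
		  unchanged.\<close>
		define \<psi>' where "\<psi>' = (%sg. if singular_simplex q X sg then \<psi> sg else 0)"
		have "\<phi> = coboundary X (int q) \<psi>'"
		proof (rule hcochain_eqI)
			show "\<phi> \<in> hcochain X p" using coc by (auto simp: hcocycle_def)
			show "coboundary X (int q) \<psi>' \<in> hcochain X p" unfolding Suc by (rule coboundary_hcochain)
		next
			fix c assume c: "singular_chain p X c"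
			have "frag_pair (coboundary X (int q) \<psi>') c = frag_pair \<psi>' (chain_boundary p c)"
				using frag_pair_boundary[of q X c \<psi>'] c Suc by simp
			also have "\<dots> = frag_pair \<psi> (chain_boundary p c)"
				unfolding \<psi>'_def by (rule frag_pair_restrict) (use singular_chain_boundary[OF c] Suc in simp)
			also have "\<dots> = frag_pair \<phi> c" using \<psi> h c by (simp add: A_def)
			finally show "frag_pair \<phi> c = frag_pair (coboundary X (int q) \<psi>') c" by simp
		qed
		then show ?thesis unfolding Suc hcobound_Suc \<psi>'_def using restrict_hcochain by (rule image_eqI)
	qed
qed

text \<open>Surjectivity of the map from cohomology to the homomorphisms from homology to the
  rationals: a function on cycles extends to all chains by divisibility, and its vanishing on
  boundaries makes the extension a cocycle.\<close>

lemma hcocycle_exists: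
	assumes add: "!!x y. cyc p X x ==> cyc p X y ==> h (x + y) = h x + (h y :: rat)"
		and bd: "!!x. singular_relboundary p X {} x ==> h x = 0"
	shows "EX \<phi>:hcocycle X p. ALL z. cyc p X z --> frag_pair \<phi> z = h z"
proof -
	have "EX \<psi>. ALL c:singular_relcycle_set p X {}. frag_pair \<psi> c = h c"
		by (rule extend_to_frag) (simp_all add: add singular_relcycle_add singular_relcycle_minus)
	then obtain \<psi> where \<psi>: "!!c. cyc p X c ==> frag_pair \<psi> c = h c"
		by auto
	define \<phi> where "\<phi> = (%sg. if singular_simplex p X sg then \<psi> sg else 0)"
	have z: "frag_pair \<phi> z = h z" if "cyc p X z" for z
		using that \<psi>[OF that] frag_pair_restrict[of p X z \<psi>] by (simp add: \<phi>_def singular_cycle)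
	have "frag_pair \<phi> (chain_boundary (Suc p) c) = 0" if "singular_chain (Suc p) X c" for c
	proof -
		have b: "singular_relboundary p X {} (chain_boundary (Suc p) c)"
			using that singular_boundary by blast
		show ?thesis using z[OF singular_relboundary_imp_relcycle[OF b]] bd[OF b] by simp
	qed
	then have "\<phi> \<in> hcocycle X p" by (simp add: hcocycle_iff restrict_hcochain \<phi>_def)
	then show ?thesis using z by blast
qed

section \<open>Cohomology groups as vector spaces of cosets\<close>

lemma vectorspace_class_ringI:
	fixes V :: "('f::field, 'm) module"
	assumes "!!x y. x \<in> carrier V ==> y \<in> carrier V ==> x \<oplus>\<^bsub>V\<^esub> y \<in> carrier V"
		and "\<zero>\<^bsub>V\<^esub> \<in> carrier V"
		and "!!x y z. x \<in> carrier V ==> y \<in> carrier V ==> z \<in> carrier V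
			==> (x \<oplus>\<^bsub>V\<^esub> y) \<oplus>\<^bsub>V\<^esub> z = x \<oplus>\<^bsub>V\<^esub> (y \<oplus>\<^bsub>V\<^esub> z)"
		and "!!x y. x \<in> carrier V ==> y \<in> carrier V ==> x \<oplus>\<^bsub>V\<^esub> y = y \<oplus>\<^bsub>V\<^esub> x"
		and "!!x. x \<in> carrier V ==> \<zero>\<^bsub>V\<^esub> \<oplus>\<^bsub>V\<^esub> x = x"
		and "!!x. x \<in> carrier V ==> (- 1) \<odot>\<^bsub>V\<^esub> x \<oplus>\<^bsub>V\<^esub> x = \<zero>\<^bsub>V\<^esub>"
		and smult: "!!c x. x \<in> carrier V ==> c \<odot>\<^bsub>V\<^esub> x \<in> carrier V"
		and "!!c d x. x \<in> carrier V ==> (c + d) \<odot>\<^bsub>V\<^esub> x = c \<odot>\<^bsub>V\<^esub> x \<oplus>\<^bsub>V\<^esub> d \<odot>\<^bsub>V\<^esub> x"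
		and "!!c x y. x \<in> carrier V ==> y \<in> carrier V
			==> c \<odot>\<^bsub>V\<^esub> (x \<oplus>\<^bsub>V\<^esub> y) = c \<odot>\<^bsub>V\<^esub> x \<oplus>\<^bsub>V\<^esub> c \<odot>\<^bsub>V\<^esub> y"
		and "!!c d x. x \<in> carrier V ==> (c * d) \<odot>\<^bsub>V\<^esub> x = c \<odot>\<^bsub>V\<^esub> (d \<odot>\<^bsub>V\<^esub> x)"
		and "!!x. x \<in> carrier V ==> 1 \<odot>\<^bsub>V\<^esub> x = x"
	shows "vsp V"
proof -
	have "abelian_group V"
		by (rule abelian_groupI) (use assms in \<open>auto intro!: bexI[of _ "(- 1) \<odot>\<^bsub>V\<^esub> _"]\<close>)
	moreover have fld: "field (class_ring :: 'f ring)" by (rule class_field.field_axioms)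
	moreover have "cring (class_ring :: 'f ring)"
		using fld by (simp add: field_def domain_def)
	ultimately have "module class_ring V"
		by (intro moduleI) (use assms in auto)
	then show ?thesis using fld by (rule vectorspace.intro)
qed

lemma lin_class_ringI:
	fixes V :: "('f::field, 'm) module"
	assumes "vsp V" "vsp W"
		and "!!x. x \<in> carrier V ==> f x \<in> carrier W"
		and "!!x y. x \<in> carrier V ==> y \<in> carrier V ==> f (x \<oplus>\<^bsub>V\<^esub> y) = f x \<oplus>\<^bsub>W\<^esub> f y"
		and "!!c x. x \<in> carrier V ==> f (c \<odot>\<^bsub>V\<^esub> x) = c \<odot>\<^bsub>W\<^esub> f x"
	shows "lmap V W f"
	using assms
	by (auto simp: linear_map_def mod_hom_def mod_hom_axioms_def module_hom_def vectorspace_def)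

definition fun_subspace :: "('b => rat) set => bool" where
	"fun_subspace B \<longleftrightarrow> (%sg. 0) \<in> B & (ALL x:B. ALL y:B. (%sg. x sg + y sg) \<in> B) & (ALL c. ALL x:B. (%sg. c * x sg) \<in> B)"

lemma fun_subspace_add:
	"fun_subspace B ==> x \<in> B ==> y \<in> B ==> (%sg. x sg + y sg) \<in> B"
	by (simp add: fun_subspace_def)

lemma fun_subspace_scale:
	"fun_subspace B ==> x \<in> B ==> (%sg. c * x sg) \<in> B"
	by (simp add: fun_subspace_def)

lemma fun_subspace_diff:
	assumes "fun_subspace B" "x \<in> B" "y \<in> B"
	shows "(%sg. x sg - y sg) \<in> B"
	using fun_subspace_add[OF assms(1,2) fun_subspace_scale[OF assms(1,3), of "- 1"]] by simp

text \<open>A coset written as a set of functions, free of record operations.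
  \<open>r_coset_cochain\<close> translates, and computations in cohomology are carried out on this
  form.\<close>

definition cls :: "('b => rat) set => ('b => rat) => ('b => rat) set" where
	"cls B \<phi> = {\<psi>. (%sg. \<psi> sg - \<phi> sg) \<in> B}"

lemma cls_eq_iff:
	assumes "fun_subspace B"
	shows "cls B \<phi> = cls B \<psi> \<longleftrightarrow> (%sg. \<phi> sg - \<psi> sg) \<in> B"
proof
	assume "cls B \<phi> = cls B \<psi>"
	moreover have "\<phi> \<in> cls B \<phi>" using assms by (simp add: cls_def fun_subspace_def)
	ultimately show "(%sg. \<phi> sg - \<psi> sg) \<in> B" by (simp add: cls_def)
next
	assume *: "(%sg. \<phi> sg - \<psi> sg) \<in> B"
	show "cls B \<phi> = cls B \<psi>"
	proof (safe, goal_cases)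
		case (1 \<theta>)
		then have "(%sg. \<theta> sg - \<phi> sg) \<in> B" by (simp add: cls_def)
		from fun_subspace_add[OF assms this *] show ?case by (simp add: cls_def)
	next
		case (2 \<theta>)
		then have "(%sg. \<theta> sg - \<psi> sg) \<in> B" by (simp add: cls_def)
		from fun_subspace_diff[OF assms this *] show ?case by (simp add: cls_def)
	qed
qed

lemma cls_self: "fun_subspace B ==> \<phi> \<in> cls B \<phi>"
	by (simp add: cls_def fun_subspace_def)

lemma cls_zero: "cls B (%sg. 0) = B"
	by (simp add: cls_def)

lemma r_coset_cochain:
	assumes "fun_subspace B"
	shows "B +>\<^bsub>cochain_space X n\<^esub> \<phi> = cls B \<phi>"
proof -
	have "cls B \<phi> = (%\<beta> sg. \<beta> sg + \<phi> sg) ` B"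
	proof (safe, goal_cases)
		case (1 \<psi>)
		then show ?case
			by (intro image_eqI[of _ _ "%sg. \<psi> sg - \<phi> sg"]) (auto simp: cls_def)
	qed (simp add: cls_def)
	then show ?thesis
		by (auto simp: a_r_coset_def' cochain_space_def)
qed

lemma set_add_cochain:
	assumes "fun_subspace B"
	shows "cls B \<phi> <+>\<^bsub>cochain_space X n\<^esub> cls B \<psi> = cls B (%sg. \<phi> sg + \<psi> sg)"
proof -
	have "x \<in> cls B (%sg. \<phi> sg + \<psi> sg) \<longleftrightarrow> (EX u:cls B \<phi>. EX v:cls B \<psi>. x = (%sg. u sg + v sg))" for x
	proof
		assume x: "x \<in> cls B (%sg. \<phi> sg + \<psi> sg)"
		have "(%sg. x sg - \<psi> sg) \<in> cls B \<phi>" using x by (simp add: cls_def algebra_simps)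
		then show "EX u:cls B \<phi>. EX v:cls B \<psi>. x = (%sg. u sg + v sg)"
			using cls_self[OF assms, of \<psi>] by (intro bexI[of _ "%sg. x sg - \<psi> sg"] bexI[of _ \<psi>]) auto
	next
		assume "EX u:cls B \<phi>. EX v:cls B \<psi>. x = (%sg. u sg + v sg)"
		then obtain u v where uv: "u \<in> cls B \<phi>" "v \<in> cls B \<psi>" "x = (%sg. u sg + v sg)" by blast
		then have "(%sg. u sg - \<phi> sg) \<in> B" "(%sg. v sg - \<psi> sg) \<in> B" by (simp_all add: cls_def)
		from fun_subspace_add[OF assms this] show "x \<in> cls B (%sg. \<phi> sg + \<psi> sg)" by (simp add: cls_def uv algebra_simps)
	qed
	then show ?thesis by (auto simp: set_add_def' cochain_space_def)
qed

text \<open>Scalar multiplication and induced maps on a quotient are defined as unions over all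
  representatives; the union collapses to a single coset as soon as the map respects the
  subspaces.\<close>

lemma UN_cls:
	assumes "fun_subspace B" "fun_subspace B'"
		and "!!\<psi>. \<psi> \<in> cls B \<phi> ==> (%sg. f \<psi> sg - f \<phi> sg) \<in> B'"
	shows "(\<Union>x\<in>cls B \<phi>. cls B' (f x)) = cls B' (f \<phi>)"
proof -
	have "cls B' (f \<psi>) = cls B' (f \<phi>)" if "\<psi> \<in> cls B \<phi>" for \<psi>
		using assms that by (simp add: cls_eq_iff)
	then show ?thesis using cls_self[OF assms(1), of \<phi>] by blast
qed

lemma smult_cls:
	assumes "fun_subspace B"
	shows "(\<Union>x\<in>cls B \<phi>. cls B (%sg. c * x sg)) = cls B (%sg. c * \<phi> sg)"
proof (rule UN_cls[OF assms assms])
	fix \<psi> assume "\<psi> \<in> cls B \<phi>"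
	then have "(%sg. \<psi> sg - \<phi> sg) \<in> B" by (simp add: cls_def)
	from fun_subspace_scale[OF assms this, of c] show "(%sg. c * \<psi> sg - c * \<phi> sg) \<in> B" by (simp add: algebra_simps)
qed

definition zcyc :: "'x topology => int => (((nat => real) => 'x) => rat) set" where
	"zcyc X n = {\<phi>\<in>carrier (cochain_space X n). coboundary X n \<phi> = (%sg. 0)}"

abbreviation zbd :: "'x topology => int => (((nat => real) => 'x) => rat) set" where
	"zbd X n \<equiv> complex_boundaries 1 (cochain_space X) (coboundary X) n"

lemma fun_subspace_cochain: "fun_subspace (carrier (cochain_space X n))"
proof -
	have "\<phi> \<in> carrier (cochain_space X n) \<longleftrightarrow> (ALL sg. \<not> (0 <= n & singular_simplex (nat n) X sg) --> \<phi> sg = 0)" for \<phi>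
		unfolding cochain_space_def by auto
	then show ?thesis
		unfolding fun_subspace_def by simp
qed

lemma coboundary_add: "coboundary X n (%sg. \<phi> sg + \<psi> sg) = (%sg. coboundary X n \<phi> sg + coboundary X n \<psi> sg)"
	by (auto simp: coboundary_def fun_eq_iff algebra_simps sum.distrib simp del: sum.atMost_Suc)

lemma coboundary_scale: "coboundary X n (%sg. c * \<phi> sg) = (%sg. c * coboundary X n \<phi> sg)"
	by (auto simp: coboundary_def fun_eq_iff sum_distrib_left algebra_simps simp del: sum.atMost_Suc)

lemma coboundary_zero: "coboundary X n (%sg. 0) = (%sg. 0)"
	by (auto simp: coboundary_def fun_eq_iff)

lemma fun_subspace_zcyc: "fun_subspace (zcyc X n)"
	using fun_subspace_cochain[of X n]
	by (simp add: fun_subspace_def zcyc_def coboundary_add coboundary_scale coboundary_zero)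

lemma fun_subspace_image:
	assumes A: "fun_subspace A"
		and "!!x y. f (%sg. x sg + y sg) = (%sg. f x sg + f y sg)"
		and "!!c x. f (%sg. c * x sg) = (%sg. c * f x sg)" and "f (%sg. 0) = (%sg. 0)"
	shows "fun_subspace (f ` A)"
	unfolding fun_subspace_def
proof (intro conjI ballI allI)
	show "(%sg. 0) \<in> f ` A"
		using A assms(4)[symmetric] unfolding fun_subspace_def by (intro image_eqI) auto
next
	fix u v assume "u \<in> f ` A" "v \<in> f ` A"
	then obtain x y where "x \<in> A" "y \<in> A" "u = f x" "v = f y" by blast
	then show "(%sg. u sg + v sg) \<in> f ` A"
		using fun_subspace_add[OF A, of x y] assms(2)[of x y]
		by (intro image_eqI[where x = "%sg. x sg + y sg"]) auto
next
	fix c u assume "u \<in> f ` A"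
	then obtain x where "x \<in> A" "u = f x" by blast
	then show "(%sg. c * u sg) \<in> f ` A"
		using fun_subspace_scale[OF A, of x c] assms(3)[of c x]
		by (intro image_eqI[where x = "%sg. c * x sg"]) auto
qed

lemma fun_subspace_zbd: "fun_subspace (zbd X n)"
	unfolding complex_boundaries_def
	by (rule fun_subspace_image[OF fun_subspace_cochain])
		(simp_all add: coboundary_add coboundary_scale coboundary_zero)

lemma zcyc_int: "zcyc X (int p) = hcocycle X p"
	by (simp add: zcyc_def hcocycle_def carrier_cochain_space)

lemma zcyc_neg: "n < 0 ==> zcyc X n = {%sg. 0}"
	by (auto simp: zcyc_def cochain_space_neg coboundary_def)

lemma cohomology_simps:
	shows "carrier (singular_cohomology X n) = cls (zbd X n) ` zcyc X n"
		and "\<zero>\<^bsub>singular_cohomology X n\<^esub> = zbd X n"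
		and "cls (zbd X n) \<phi> \<oplus>\<^bsub>singular_cohomology X n\<^esub> cls (zbd X n) \<psi> = cls (zbd X n) (%sg. \<phi> sg + \<psi> sg)"
		and "c \<odot>\<^bsub>singular_cohomology X n\<^esub> cls (zbd X n) \<phi> = cls (zbd X n) (%sg. c * \<phi> sg)"
proof -
	have z: "{x \<in> carrier (cochain_space X n). coboundary X n x = \<zero>\<^bsub>cochain_space X (n + 1)\<^esub>} = zcyc X n"
		by (simp add: zcyc_def cochain_space_def)
	have s: "c \<odot>\<^bsub>cochain_space X n\<^esub> x = (%sg. c * x sg)" for c x
		by (simp add: cochain_space_def)
	note d = singular_cohomology_def complex_homology_def z subquotient_def
		r_coset_cochain[OF fun_subspace_zbd] set_add_cochain[OF fun_subspace_zbd] s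
	show "carrier (singular_cohomology X n) = cls (zbd X n) ` zcyc X n"
		"\<zero>\<^bsub>singular_cohomology X n\<^esub> = zbd X n"
		"cls (zbd X n) \<phi> \<oplus>\<^bsub>singular_cohomology X n\<^esub> cls (zbd X n) \<psi> = cls (zbd X n) (%sg. \<phi> sg + \<psi> sg)"
		"c \<odot>\<^bsub>singular_cohomology X n\<^esub> cls (zbd X n) \<phi> = cls (zbd X n) (%sg. c * \<phi> sg)"
		by (simp_all add: d smult_cls[OF fun_subspace_zbd])
qed

lemma vectorspace_cohomology: "vsp (singular_cohomology X n)"
proof -
	note Z = fun_subspace_zcyc[of X n, unfolded fun_subspace_def]
	have z: "zbd X n = cls (zbd X n) (%sg. 0)" by (simp add: cls_zero)
	have zero: "\<zero>\<^bsub>singular_cohomology X n\<^esub> = cls (zbd X n) (%sg. 0)"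
		by (simp add: cohomology_simps cls_zero)
	show ?thesis
		by (rule vectorspace_class_ringI)
			(use Z in \<open>auto simp: cohomology_simps(1,3,4) zero algebra_simps\<close>)
qed

text \<open>Dimension is recorded as a linear coordinate bijection rather than by a basis. Taking
  coordinate vectors extensional on \<open>{..<N}\<close> makes the target a set on which the map
  can be bijective.\<close>

definition coords :: "(rat, 'm) module => nat => ('m => nat => rat) => bool" where
	"coords V N g \<longleftrightarrow> bij_betw g (carrier V) ({..<N} \<rightarrow>\<^sub>E UNIV)
		& (ALL x:carrier V. ALL y:carrier V. g (x \<oplus>\<^bsub>V\<^esub> y) = (\<lambda>i\<in>{..<N}. g x i + g y i))
		& (ALL c. ALL x:carrier V. g (c \<odot>\<^bsub>V\<^esub> x) = (\<lambda>i\<in>{..<N}. c * g x i))"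

definition has_dim :: "(rat, 'm) module => nat => bool" where
	"has_dim V N \<longleftrightarrow> (EX g. coords V N g)"

definition rathom :: "('g, 'e) monoid_scheme => ('g => rat) set" where
	"rathom G = {h. ALL x:carrier G. ALL y:carrier G. h (x \<otimes>\<^bsub>G\<^esub> y) = h x + h y}"

text \<open>\<open>rat_rank G N\<close>: the rational dual of the abelian group \<open>G\<close> has dimension \<open>N\<close>, and is
	coordinatised by evaluation at \<open>N\<close> elements of \<open>G\<close>.\<close>

definition rat_rank :: "('g, 'e) monoid_scheme => nat => bool" where
	"rat_rank G N \<longleftrightarrow> (EX b. (ALL i<N. b i \<in> carrier G)
		& (ALL v. EX h:rathom G. ALL i<N. h (b i) = v i)
		& (ALL h:rathom G. (ALL i<N. h (b i) = 0) --> (ALL x:carrier G. h x = 0)))"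

lemma has_dim_cohomology_neg:
	assumes "n < 0" shows "has_dim (singular_cohomology X n) 0"
proof -
	have "carrier (singular_cohomology X n) = {cls (zbd X n) (%sg. 0)}"
		using assms by (simp add: cohomology_simps zcyc_neg)
	\<comment> \<open>The constant \<open>undefined\<close> is the only element of
	  \<open>{..<0} \<rightarrow>\<^sub>E UNIV\<close>, so no other coordinate map is possible.\<close>
	then have "coords (singular_cohomology X n) 0 (%_ _. undefined)"
		by (auto simp: coords_def bij_betw_def cohomology_simps restrict_def)
	then show ?thesis unfolding has_dim_def by blast
qed

lemma relcycle_homologous_add:
	assumes "cyc p X x" "cyc p X y"
	shows "hclass p X (x + y) =
		hclass p X x \<otimes>\<^bsub>homology_group (int p) X\<^esub> hclass p X y"
proof -
	have "(\<Union>r\<in>hclass p X x. \<Union>s\<in>hclass p X y. {r + s}) = hclass p X (x + y)"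
	proof (safe, goal_cases)
		case (1 _ r s) then show ?case by (simp add: homologous_rel_add)
	next
		case (2 z)
		have "homologous_rel p X {} y (z - x)"
			using homologous_rel_diff[OF 2, of x x] by simp
		then show ?case by (intro UN_I[of x] UN_I[of "z - x"]) auto
	qed
	then show ?thesis by (simp add: mult_relative_homology_group)
qed

text \<open>Universal coefficients: the coordinates of a class are its pairings with cycles
  representing the elements \<open>b i\<close>. Injectivity comes from \<open>hcobound_iff\<close>,
  surjectivity from \<open>hcocycle_exists\<close>.\<close>

lemma has_dim_cohomology:
	assumes "rat_rank (homology_group (int p) X) N"
	shows "has_dim (singular_cohomology X (int p)) N"
proof -
	let ?G = "homology_group (int p) X" and ?H = "singular_cohomology X (int p)"
	let ?c = "hclass p X"
	from assms obtain b where B: "(ALL i<N. b i \<in> carrier ?G)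
		& (ALL v. EX h:rathom ?G. ALL i<N. h (b i) = v i)
		& (ALL h:rathom ?G. (ALL i<N. h (b i) = 0) --> (ALL x:carrier ?G. h x = 0))"
		unfolding rat_rank_def by (rule exE)
	note b = B[THEN conjunct1, rule_format] and ex = B[THEN conjunct2, THEN conjunct1, THEN spec]
		and uniq = B[THEN conjunct2, THEN conjunct2, THEN bspec, THEN mp]
	have "ALL i. EX z. i < N --> cyc p X z & b i = ?c z"
	proof
		fix i
		show "EX z. i < N --> cyc p X z & b i = ?c z"
		proof (cases "i < N")
			case True
			then have "b i \<in> ?c ` singular_relcycle_set p X {}"
				using b[of i] by (simp only: carrier_relative_homology_group)
			then show ?thesis by blast
		qed simp
	qed
	then obtain z where z: "!!i. i < N ==> cyc p X (z i) & b i = ?c (z i)"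
		by metis
	have zbd: "zbd X (int p) = hcobound X p" by (simp add: hcobound_def)
	\<comment> \<open>Any representative of the class may be chosen, because coboundaries pair to zero
	  with the cycles \<open>z i\<close>.\<close>
	define g where "g S = (\<lambda>i\<in>{..<N}. frag_pair (SOME \<phi>. \<phi> \<in> S) (z i))" for S
	have g: "g (cls (zbd X (int p)) \<phi>) = (\<lambda>i\<in>{..<N}. frag_pair \<phi> (z i))" for \<phi>
	proof -
		define \<psi> where "\<psi> = (SOME \<psi>. \<psi> \<in> cls (zbd X (int p)) \<phi>)"
		have "\<psi> \<in> cls (zbd X (int p)) \<phi>"
			unfolding \<psi>_def by (rule someI[of _ \<phi>]) (rule cls_self[OF fun_subspace_zbd])
		then have "(%sg. \<psi> sg - \<phi> sg) \<in> hcobound X p" by (simp add: cls_def zbd)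
		then have "frag_pair (%sg. \<psi> sg - \<phi> sg) (z i) = 0" if "i < N" for i
			using that z hcobound_iff by blast
		then have "frag_pair \<psi> (z i) = frag_pair \<phi> (z i)" if "i < N" for i
			using that frag_pair_add_left[of "%sg. \<psi> sg - \<phi> sg" \<phi> "z i"] by simp
		then show ?thesis unfolding g_def \<psi>_def[symmetric] by (rule restrict_ext) simp
	qed
	\<comment> \<open>A cocycle takes equal values on homologous cycles, so it defines a homomorphism
	  on homology, to which \<open>uniq\<close> can be applied.\<close>
	have pair_hom: "EX h:rathom ?G. ALL w. cyc p X w --> h (?c w) = frag_pair \<phi> w"
		if \<phi>: "\<phi> \<in> hcocycle X p" for \<phi>
	proof -
		define h where "h S = frag_pair \<phi> (SOME w. w \<in> S)" for S
		have h: "h (?c w) = frag_pair \<phi> w" if w: "cyc p X w" for w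
		proof -
			define u where "u = (SOME u. u \<in> ?c w)"
			have "u \<in> ?c w" unfolding u_def by (rule someI[of _ w]) simp
			then obtain d where "singular_chain (Suc p) X d" "w - u = chain_boundary (Suc p) d"
				by (auto simp: homologous_rel_def singular_boundary)
			then have "frag_pair \<phi> (w - u) = 0" using \<phi> hcocycle_iff by metis
			then show ?thesis by (simp add: h_def u_def frag_pair_diff)
		qed
		have "h \<in> rathom ?G"
		proof -
			have "h (?c x \<otimes>\<^bsub>?G\<^esub> ?c y) = h (?c x) + h (?c y)"
				if "cyc p X x" "cyc p X y" for x y
				using that h singular_relcycle_add[OF that]
				by (simp add: frag_pair_add flip: relcycle_homologous_add)
			then show ?thesis by (auto simp: rathom_def carrier_relative_homology_group)
		qed
		then show ?thesis using h by blast
	qed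
	have inj: "inj_on g (carrier ?H)"
	proof (rule inj_onI)
		fix S T assume "S \<in> carrier ?H" "T \<in> carrier ?H" and eq: "g S = g T"
		then obtain \<phi> \<psi> where S: "S = cls (zbd X (int p)) \<phi>" "\<phi> \<in> hcocycle X p"
			and T: "T = cls (zbd X (int p)) \<psi>" "\<psi> \<in> hcocycle X p"
			by (auto simp: cohomology_simps zcyc_int)
		define \<theta> where "\<theta> = (%sg. \<phi> sg - \<psi> sg)"
		have \<theta>: "\<theta> \<in> hcocycle X p"
			using S T fun_subspace_diff[OF fun_subspace_zcyc, of \<phi> X "int p" \<psi>] by (simp add: zcyc_int \<theta>_def)
		have pd: "frag_pair \<theta> c = frag_pair \<phi> c - frag_pair \<psi> c" for c
			using frag_pair_add_left[of \<theta> \<psi> c] by (simp add: \<theta>_def)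
		obtain h where h: "h \<in> rathom ?G" "!!w. cyc p X w ==> h (?c w) = frag_pair \<theta> w"
			using pair_hom[OF \<theta>] by blast
		have "h (b i) = 0" if "i < N" for i
			using z[OF that] h(2) pd fun_cong[OF eq, of i] that by (simp add: S T g)
		then have "ALL x:carrier ?G. h x = 0" using uniq h(1) by blast
		then have "ALL w. cyc p X w --> frag_pair \<theta> w = 0"
			using h(2) by (auto simp: carrier_relative_homology_group)
		then have "\<theta> \<in> hcobound X p" using \<theta> hcobound_iff by blast
		then show "S = T" unfolding S T cls_eq_iff[OF fun_subspace_zbd] by (simp add: zbd \<theta>_def)
	qed
	have surj: "g ` carrier ?H = {..<N} \<rightarrow>\<^sub>E UNIV"
	proof (intro equalityI subsetI, goal_cases)
		case (1 v)
		then obtain S where "v = g S" by blast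
		then show ?case unfolding g_def by (simp only: restrict_PiE_iff) simp
	next
		case (2 v)
		obtain h where h: "h \<in> rathom ?G" "ALL i<N. h (b i) = v i" using ex by blast
		have "EX \<phi>:hcocycle X p. ALL w. cyc p X w --> frag_pair \<phi> w = h (?c w)"
		proof (rule hcocycle_exists)
			fix x y assume "cyc p X x" "cyc p X y"
			then show "h (?c (x + y)) = h (?c x) + h (?c y)"
				using h(1) by (auto simp: relcycle_homologous_add rathom_def carrier_relative_homology_group)
		next
			fix x assume x: "singular_relboundary p X {} x"
			have m: "Group.monoid ?G" by (rule group.is_monoid[OF group_relative_homology_group])
			have "h (\<one>\<^bsub>?G\<^esub> \<otimes>\<^bsub>?G\<^esub> \<one>\<^bsub>?G\<^esub>) = h \<one>\<^bsub>?G\<^esub> + h \<one>\<^bsub>?G\<^esub>"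
				using h(1) monoid.one_closed[OF m] unfolding rathom_def by blast
			then have "h \<one>\<^bsub>?G\<^esub> = 0"
				unfolding monoid.l_one[OF m monoid.one_closed[OF m]] by linarith
			then show "h (?c x) = 0" using x homologous_rel_set_eq_relboundary[of p X "{}" x] by simp
		qed
		then obtain \<phi> where \<phi>: "\<phi> \<in> hcocycle X p"
			"!!w. cyc p X w ==> frag_pair \<phi> w = h (?c w)" by blast
		have "v = g (cls (zbd X (int p)) \<phi>)"
		proof (rule extensionalityI[of _ "{..<N}"])
			show "v \<in> extensional {..<N}" using 2 by (auto simp: PiE_def)
			show "g (cls (zbd X (int p)) \<phi>) \<in> extensional {..<N}" by (simp add: g)
			show "v i = g (cls (zbd X (int p)) \<phi>) i" if "i \<in> {..<N}" for i
				using that z \<phi> h by (simp add: g)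
		qed
		then show ?case using \<phi>(1) by (auto simp: cohomology_simps zcyc_int)
	qed
	have "coords ?H N g"
		unfolding coords_def bij_betw_def
		using inj surj
		by (auto simp: cohomology_simps g frag_pair_add_left frag_pair_scale_left fun_eq_iff)
	then show ?thesis unfolding has_dim_def by blast
qed

section \<open>Functoriality and homotopy invariance of cohomology\<close>

lemma frag_pair_pullback:
	assumes "singular_chain p X c"
	shows "frag_pair (cochain_pullback X h (int p) \<phi>) c = frag_pair \<phi> (chain_map p h c)"
proof -
	have "frag_pair (cochain_pullback X h (int p) \<phi>) c = frag_pair (%sg. \<phi> (simplex_map p h sg)) c"
		using assms by (intro frag_pair_cong) (auto simp: cochain_pullback_def singular_chain_def)
	also have "\<dots> = frag_pair \<phi> (chain_map p h c)"
		by (simp add: chain_map_def frag_pair_extend)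
	finally show ?thesis .
qed

lemma pullback_hcocycle:
	assumes h: "continuous_map X Y h" and \<phi>: "\<phi> \<in> hcocycle Y p"
	shows "cochain_pullback X h (int p) \<phi> \<in> hcocycle X p"
	unfolding hcocycle_iff
proof (intro conjI allI impI)
	show "cochain_pullback X h (int p) \<phi> \<in> hcochain X p"
		by (simp add: hcochain_def cochain_pullback_def)
next
	fix c assume c: "singular_chain (Suc p) X c"
	have "frag_pair (cochain_pullback X h (int p) \<phi>) (chain_boundary (Suc p) c)
			= frag_pair \<phi> (chain_map p h (chain_boundary (Suc p) c))"
		using singular_chain_boundary[OF c] by (simp add: frag_pair_pullback)
	also have "\<dots> = frag_pair \<phi> (chain_boundary (Suc p) (chain_map (Suc p) h c))"
		using chain_boundary_chain_map[OF c, of h] by simp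
	also have "\<dots> = 0"
		using \<phi> singular_chain_chain_map[OF c h] by (simp add: hcocycle_iff)
	finally show "frag_pair (cochain_pullback X h (int p) \<phi>) (chain_boundary (Suc p) c) = 0" .
qed

lemma pullback_hcobound:
	assumes h: "continuous_map X Y h" and \<phi>: "\<phi> \<in> hcobound Y p"
	shows "cochain_pullback X h (int p) \<phi> \<in> hcobound X p"
	unfolding hcobound_iff
proof (intro conjI allI impI)
	show "cochain_pullback X h (int p) \<phi> \<in> hcocycle X p"
		using pullback_hcocycle[OF h] \<phi> hcobound_iff by blast
next
	fix z assume z: "cyc p X z"
	have "cyc p Y (chain_map p h z)"
		using singular_relcycle_chain_map[OF z h, of "{}"] by simp
	then have "frag_pair \<phi> (chain_map p h z) = 0" using \<phi> hcobound_iff by blast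
	then show "frag_pair (cochain_pullback X h (int p) \<phi>) z = 0"
		using z by (simp add: frag_pair_pullback singular_cycle)
qed

lemma pullback_diff:
	"cochain_pullback X h n (%sg. \<phi> sg - \<psi> sg) = (%sg. cochain_pullback X h n \<phi> sg - cochain_pullback X h n \<psi> sg)"
	by (auto simp: cochain_pullback_def)

lemma pullback_zbd:
	assumes h: "continuous_map X Y h" and \<phi>: "\<phi> \<in> zbd Y n"
	shows "cochain_pullback X h n \<phi> \<in> zbd X n"
proof (cases "n < 0")
	case True
	then have "cochain_pullback X h n \<phi> = (%sg. 0)" by (auto simp: cochain_pullback_def)
	then show ?thesis using fun_subspace_zbd[of X n] by (simp add: fun_subspace_def)
next
	case False
	then obtain p where "n = int p" by (metis nonneg_int_cases not_less)
	then show ?thesis using pullback_hcobound[OF h, of \<phi> p] \<phi> by (simp add: hcobound_def)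
qed

lemma pullback_zcyc:
	assumes h: "continuous_map X Y h" and \<phi>: "\<phi> \<in> zcyc Y n"
	shows "cochain_pullback X h n \<phi> \<in> zcyc X n"
proof (cases "n < 0")
	case True
	then have "cochain_pullback X h n \<phi> = (%sg. 0)" by (auto simp: cochain_pullback_def)
	then show ?thesis using fun_subspace_zcyc[of X n] by (simp add: fun_subspace_def)
next
	case False
	then obtain p where "n = int p" by (metis nonneg_int_cases not_less)
	then show ?thesis using pullback_hcocycle[OF h, of \<phi> p] \<phi> by (simp add: zcyc_int)
qed

lemma cohomology_pullback_cls:
	assumes h: "continuous_map X Y h"
	shows "cohomology_pullback X h n (cls (zbd Y n) \<phi>) = cls (zbd X n) (cochain_pullback X h n \<phi>)"
	unfolding cohomology_pullback_def induced_map_def r_coset_cochain[OF fun_subspace_zbd]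
proof (rule UN_cls[OF fun_subspace_zbd fun_subspace_zbd])
	fix \<psi> assume "\<psi> \<in> cls (zbd Y n) \<phi>"
	then have "(%sg. \<psi> sg - \<phi> sg) \<in> zbd Y n" by (simp add: cls_def)
	from pullback_zbd[OF h this]
	show "(%sg. cochain_pullback X h n \<psi> sg - cochain_pullback X h n \<phi> sg) \<in> zbd X n"
		by (simp add: pullback_diff)
qed

lemma lin_cohomology_pullback:
	assumes h: "continuous_map X Y h"
	shows "lmap (singular_cohomology Y n) (singular_cohomology X n) (cohomology_pullback X h n)"
proof (rule lin_class_ringI[OF vectorspace_cohomology vectorspace_cohomology])
	have a: "cochain_pullback X h n (%sg. \<phi> sg + \<psi> sg) = (%sg. cochain_pullback X h n \<phi> sg + cochain_pullback X h n \<psi> sg)"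
		and s: "cochain_pullback X h n (%sg. c * \<phi> sg) = (%sg. c * cochain_pullback X h n \<phi> sg)" for \<phi> \<psi> c
		by (auto simp: cochain_pullback_def)
	fix S c assume "S \<in> carrier (singular_cohomology Y n)"
	then obtain \<phi> where S: "S = cls (zbd Y n) \<phi>" "\<phi> \<in> zcyc Y n" by (auto simp: cohomology_simps)
	show "cohomology_pullback X h n S \<in> carrier (singular_cohomology X n)"
		using S pullback_zcyc[OF h] by (auto simp: cohomology_pullback_cls[OF h] cohomology_simps)
	show "cohomology_pullback X h n (c \<odot>\<^bsub>singular_cohomology Y n\<^esub> S)
			= c \<odot>\<^bsub>singular_cohomology X n\<^esub> cohomology_pullback X h n S"
		by (simp add: S cohomology_pullback_cls[OF h] cohomology_simps s)
	fix T assume "T \<in> carrier (singular_cohomology Y n)"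
	then obtain \<psi> where T: "T = cls (zbd Y n) \<psi>" "\<psi> \<in> zcyc Y n" by (auto simp: cohomology_simps)
	show "cohomology_pullback X h n (S \<oplus>\<^bsub>singular_cohomology Y n\<^esub> T)
			= cohomology_pullback X h n S \<oplus>\<^bsub>singular_cohomology X n\<^esub> cohomology_pullback X h n T"
		by (simp add: S T cohomology_pullback_cls[OF h] cohomology_simps a)
qed

text \<open>Homotopic maps send every cycle to homologous cycles, so the difference of the two
  pullbacks kills all cycles and is a coboundary by \<open>hcobound_iff\<close>. This avoids
  dualising a chain homotopy. In negative degrees both pullbacks are zero.\<close>

lemma cls_pullback_homotopic:
	assumes H: "homotopic_with (%_. True) X Y f g" and \<phi>: "\<phi> \<in> zcyc Y n"
	shows "cls (zbd X n) (cochain_pullback X f n \<phi>) = cls (zbd X n) (cochain_pullback X g n \<phi>)"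
proof (cases "n < 0")
	case False
	then obtain p where p: "n = int p" by (metis nonneg_int_cases not_less)
	have c: "continuous_map X Y f" "continuous_map X Y g" using homotopic_with_imp_continuous_maps[OF H] by auto
	let ?\<theta> = "%sg. cochain_pullback X f n \<phi> sg - cochain_pullback X g n \<phi> sg"
	have "?\<theta> \<in> hcobound X p"
		unfolding hcobound_iff
	proof (intro conjI allI impI)
		show "?\<theta> \<in> hcocycle X p"
			using fun_subspace_diff[OF fun_subspace_zcyc pullback_zcyc[OF c(1) \<phi>] pullback_zcyc[OF c(2) \<phi>]]
			by (simp add: zcyc_int p)
		fix z assume z: "cyc p X z"
		have "homologous_rel p Y {} (chain_map p f z) (chain_map p g z)"
			using homotopic_imp_homologous_rel_chain_maps[OF _ z, of "{}" Y f g] H by simp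
		then obtain d where "singular_chain (Suc p) Y d" "chain_map p f z - chain_map p g z = chain_boundary (Suc p) d"
			by (auto simp: homologous_rel_def singular_boundary)
		then have "frag_pair \<phi> (chain_map p f z - chain_map p g z) = 0"
			using \<phi> by (simp add: hcocycle_iff zcyc_int p)
		moreover have "frag_pair ?\<theta> z + frag_pair (cochain_pullback X g n \<phi>) z = frag_pair (cochain_pullback X f n \<phi>) z"
			by (simp flip: frag_pair_add_left)
		ultimately show "frag_pair ?\<theta> z = 0"
			using z by (simp add: frag_pair_pullback singular_cycle p frag_pair_diff)
	qed
	then show ?thesis unfolding cls_eq_iff[OF fun_subspace_zbd] by (simp add: p hcobound_def)
qed (simp add: cochain_pullback_def)

lemma pullback_comp:
	"continuous_map X Y f ==>
		cochain_pullback X f n (cochain_pullback Y g n \<phi>) = cochain_pullback X (g \<circ> f) n \<phi>"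
	by (auto simp: cochain_pullback_def simplex_map_compose singular_simplex_simplex_map fun_eq_iff)

lemma pullback_id: "\<phi> \<in> zcyc X n ==> cochain_pullback X id n \<phi> = \<phi>"
	by (auto simp: zcyc_def cochain_space_def cochain_pullback_def simplex_map_id_gen fun_eq_iff simp del: simplex_map_id)

lemma bij_betw_cohomology_pullback:
	assumes h: "homotopy_equivalence X Y h"
	shows "bij_betw (cohomology_pullback X h n) (carrier (singular_cohomology Y n))
		(carrier (singular_cohomology X n))"
proof -
	obtain g where h: "continuous_map X Y h" and g: "continuous_map Y X g"
		and H: "homotopic_with (%_. True) X X (g \<circ> h) id" "homotopic_with (%_. True) Y Y (h \<circ> g) id"
		using h unfolding homotopy_equivalence_def by blast
	show ?thesis
		by (rule bij_betw_byWitness[where f'="cohomology_pullback Y g n"])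
			(auto simp: cohomology_simps cohomology_pullback_cls[OF h] cohomology_pullback_cls[OF g] pullback_comp[OF h]
				pullback_comp[OF g] cls_pullback_homotopic[OF H(1)] cls_pullback_homotopic[OF H(2)] pullback_id
				pullback_zcyc[OF h] pullback_zcyc[OF g])
qed

section \<open>Homology of spaces with an even cell filtration\<close>

lemma rat_rank_triv: "trivial_group G ==> rat_rank G 0"
	unfolding rat_rank_def
proof (intro exI[of _ "%_. undefined"] conjI allI ballI impI)
	assume G: "trivial_group G"
	show "EX h:rathom G. ALL i<0. h undefined = v i" for v :: "nat => rat"
		by (rule bexI[of _ "%_. 0"]) (auto simp: rathom_def)
	fix h x assume h: "h \<in> rathom G" and x: "x \<in> carrier G"
	have "x = \<one>\<^bsub>G\<^esub>" "\<one>\<^bsub>G\<^esub> \<otimes>\<^bsub>G\<^esub> \<one>\<^bsub>G\<^esub> = \<one>\<^bsub>G\<^esub>" "\<one>\<^bsub>G\<^esub> \<in> carrier G"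
		using G x by (auto simp: trivial_group_def group.is_monoid monoid.l_one)
	moreover have "h (\<one>\<^bsub>G\<^esub> \<otimes>\<^bsub>G\<^esub> \<one>\<^bsub>G\<^esub>) = h \<one>\<^bsub>G\<^esub> + h \<one>\<^bsub>G\<^esub>"
		using h \<open>\<one>\<^bsub>G\<^esub> \<in> carrier G\<close> unfolding rathom_def by blast
	ultimately show "h x = 0" by simp
qed simp

lemma rat_rank_iso:
	assumes f: "f \<in> iso G H" and G: "group G" and H: "group H" and N: "rat_rank G N"
	shows "rat_rank H N"
proof -
	have hom: "f \<in> hom G H" and bij: "bij_betw f (carrier G) (carrier H)" using f by (auto simp: iso_def)
	from N obtain b where b: "ALL i<N. b i \<in> carrier G"
		"ALL v. EX h:rathom G. ALL i<N. h (b i) = v i"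
		"ALL h:rathom G. (ALL i<N. h (b i) = 0) --> (ALL x:carrier G. h x = 0)"
		unfolding rat_rank_def by (elim exE conjE) auto
	define g where "g = inv_into (carrier G) f"
	have g: "g \<in> hom H G" "!!x. x \<in> carrier G ==> g (f x) = x" "!!y. y \<in> carrier H ==> f (g y) = y"
		"!!y. y \<in> carrier H ==> g y \<in> carrier G"
		using group.iso_set_sym[OF G f] bij unfolding g_def
		by (auto simp: iso_def bij_betw_def f_inv_into_f inv_into_into)
	show ?thesis
		unfolding rat_rank_def
	proof (intro exI[of _ "%i. f (b i)"] conjI allI ballI impI)
		show "f (b i) \<in> carrier H" if "i < N" for i using that b(1) hom by (auto simp: hom_def)
	next
		fix v :: "nat => rat"
		obtain h where h: "h \<in> rathom G" "ALL i<N. h (b i) = v i" using b(2) by blast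
		have "h \<circ> g \<in> rathom H" using h(1) g(1) by (auto simp: rathom_def hom_def Pi_iff)
		then show "EX h:rathom H. ALL i<N. h (f (b i)) = v i"
			using h(2) g(2) b(1) by (intro bexI[of _ "h \<circ> g"]) auto
	next
		fix h y assume h: "h \<in> rathom H" "ALL i<N. h (f (b i)) = 0" and y: "y \<in> carrier H"
		have "h \<circ> f \<in> rathom G" using h(1) hom by (auto simp: rathom_def hom_def Pi_iff)
		then have "(h \<circ> f) (g y) = 0" using b(3) h(2) g(4)[OF y] by auto
		then show "h y = 0" using g(3)[OF y] by simp
	qed
qed

lemma rathom_one: "group G ==> h \<in> rathom G ==> h \<one>\<^bsub>G\<^esub> = 0"
proof -
	assume G: "group G" and h: "h \<in> rathom G"
	then interpret group G by simp
	have "h (\<one>\<^bsub>G\<^esub> \<otimes>\<^bsub>G\<^esub> \<one>\<^bsub>G\<^esub>) = h \<one>\<^bsub>G\<^esub> + h \<one>\<^bsub>G\<^esub>"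
		using h one_closed unfolding rathom_def by blast
	then show ?thesis by simp
qed

lemma rathom_int_pow:
	assumes "group G" "h \<in> rathom G" "x \<in> carrier G"
	shows "h (x [^]\<^bsub>G\<^esub> (k::int)) = of_int k * h x"
proof -
	interpret group G by fact
	have h: "h (x \<otimes>\<^bsub>G\<^esub> y) = h x + h y" if "x \<in> carrier G" "y \<in> carrier G" for x y
		using assms(2) that by (auto simp: rathom_def)
	have nat: "h (x [^]\<^bsub>G\<^esub> n) = of_nat n * h x" for n :: nat
		by (induction n) (use assms(3) rathom_one[OF assms(1,2)] in \<open>auto simp: h algebra_simps\<close>)
	show ?thesis
	proof (cases k)
		case (nonneg n)
		then show ?thesis using nat[of n] by (simp add: int_pow_int)
	next
		case (neg n)
		have "x [^]\<^bsub>G\<^esub> k \<otimes>\<^bsub>G\<^esub> x [^]\<^bsub>G\<^esub> Suc n = \<one>\<^bsub>G\<^esub>"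
			using assms(3) neg by (simp only: int_pow_neg_int[of x "Suc n"]) (simp del: nat_pow_Suc)
		then have "h (x [^]\<^bsub>G\<^esub> k) + h (x [^]\<^bsub>G\<^esub> Suc n) = 0"
			using h[of "x [^]\<^bsub>G\<^esub> k" "x [^]\<^bsub>G\<^esub> Suc n"] assms(3) rathom_one[OF assms(1,2)] by simp
		then have "h (x [^]\<^bsub>G\<^esub> k) = - (of_nat (Suc n) * h x)" unfolding nat by linarith
		moreover have "of_int k = - (of_nat (Suc n) :: rat)" by (simp add: neg)
		ultimately show ?thesis by (metis mult_minus_left)
	qed
qed

text \<open>The infinite cyclic quotient is free, so the extension splits: a preimage
  \<open>s\<close> of 1 gives a retraction \<open>\<alpha>\<close> onto \<open>A\<close>, and
  \<open>s\<close> joins the test elements of \<open>A\<close> as the last one.\<close>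

lemma rat_rank_extension:
	assumes A: "group A" and G: "comm_group G" and f: "f \<in> hom A G" "inj_on f (carrier A)"
		and g: "g \<in> hom G integer_group" "g ` carrier G = UNIV"
		and ex: "kernel G integer_group g = f ` carrier A" and N: "rat_rank A N"
	shows "rat_rank G (Suc N)"
proof -
	interpret A: group A by fact
	interpret G: comm_group G by fact
	from N obtain b where b: "ALL i<N. b i \<in> carrier A"
		"ALL v. EX h:rathom A. ALL i<N. h (b i) = v i"
		"ALL h:rathom A. (ALL i<N. h (b i) = 0) --> (ALL x:carrier A. h x = 0)"
		unfolding rat_rank_def by (elim exE conjE) auto
	obtain s where s: "s \<in> carrier G" "g s = 1" using g(2) by (metis UNIV_I imageE)
	have gm: "g (x \<otimes>\<^bsub>G\<^esub> y) = g x + g y" if "x \<in> carrier G" "y \<in> carrier G" for x y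
		using g(1) that by (simp add: hom_def)
	have gpow: "g (s [^]\<^bsub>G\<^esub> k) = k" for k :: int
	proof -
		have "(%x. of_int (g x)) \<in> rathom G" by (simp add: rathom_def gm)
		from rathom_int_pow[OF G.is_group this s(1), of k] show ?thesis using s(2) by simp
	qed
	have fc: "f a \<in> carrier G" if "a \<in> carrier A" for a using f(1) that by (auto simp: hom_def)
	have gf: "g (f a) = 0" if "a \<in> carrier A" for a
		using ex that by (auto simp: kernel_def)
	\<comment> \<open>Corrected by a power of \<open>s\<close>, the element \<open>x\<close> lies in
	  the kernel of \<open>g\<close>, hence in the image of \<open>A\<close>.\<close>
	define \<alpha> where "\<alpha> x = inv_into (carrier A) f (x \<otimes>\<^bsub>G\<^esub> s [^]\<^bsub>G\<^esub> (- g x))" for x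
	have \<alpha>: "\<alpha> x \<in> carrier A & f (\<alpha> x) = x \<otimes>\<^bsub>G\<^esub> s [^]\<^bsub>G\<^esub> (- g x)" if x: "x \<in> carrier G" for x
	proof -
		have "g (x \<otimes>\<^bsub>G\<^esub> s [^]\<^bsub>G\<^esub> (- g x)) = 0" using x s gm gpow by simp
		then have "x \<otimes>\<^bsub>G\<^esub> s [^]\<^bsub>G\<^esub> (- g x) \<in> f ` carrier A"
			unfolding ex[symmetric] using x s by (simp add: kernel_def)
		then show ?thesis unfolding \<alpha>_def by (simp add: f_inv_into_f inv_into_into)
	qed
	have \<alpha>I: "\<alpha> x = a" if "x \<in> carrier G" "a \<in> carrier A" "f a = x \<otimes>\<^bsub>G\<^esub> s [^]\<^bsub>G\<^esub> (- g x)" for x a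
		using that \<alpha>[OF that(1)] f(2) by (metis inj_onD)
	have \<alpha>m: "\<alpha> (x \<otimes>\<^bsub>G\<^esub> y) = \<alpha> x \<otimes>\<^bsub>A\<^esub> \<alpha> y" if xy: "x \<in> carrier G" "y \<in> carrier G" for x y
	proof (rule \<alpha>I)
		have "s [^]\<^bsub>G\<^esub> (- g (x \<otimes>\<^bsub>G\<^esub> y)) = s [^]\<^bsub>G\<^esub> (- g x) \<otimes>\<^bsub>G\<^esub> s [^]\<^bsub>G\<^esub> (- g y)"
			using s xy by (simp add: gm flip: G.int_pow_mult)
		then show "f (\<alpha> x \<otimes>\<^bsub>A\<^esub> \<alpha> y) = x \<otimes>\<^bsub>G\<^esub> y \<otimes>\<^bsub>G\<^esub> s [^]\<^bsub>G\<^esub> (- g (x \<otimes>\<^bsub>G\<^esub> y))"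
			using \<alpha>[OF xy(1)] \<alpha>[OF xy(2)] f(1) s xy by (simp add: hom_mult G.m_ac)
	qed (use xy \<alpha> in auto)
	have \<alpha>f: "\<alpha> (f a) = a" if "a \<in> carrier A" for a
		by (rule \<alpha>I) (use that fc gf in auto)
	have \<alpha>s: "\<alpha> s = \<one>\<^bsub>A\<^esub>"
		by (rule \<alpha>I) (use s f(1) A.is_group G.is_group in \<open>auto simp: hom_one G.int_pow_neg G.int_pow_1\<close>)
	have dec: "x = f (\<alpha> x) \<otimes>\<^bsub>G\<^esub> s [^]\<^bsub>G\<^esub> (g x)" if "x \<in> carrier G" for x
		using \<alpha>[OF that] that s by (simp add: G.m_assoc flip: G.int_pow_mult)
	let ?b = "%i. if i < N then f (b i) else s"
	show ?thesis
		unfolding rat_rank_def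
	proof (intro exI[of _ ?b] conjI allI ballI impI)
		show "?b i \<in> carrier G" if "i < Suc N" for i using b(1) fc s by auto
	next
		fix v :: "nat => rat"
		obtain h where h: "h \<in> rathom A" "ALL i<N. h (b i) = v i" using b(2) by blast
		define H where "H x = h (\<alpha> x) + of_int (g x) * v N" for x
		have "H \<in> rathom G"
			using h(1) \<alpha> by (auto simp: rathom_def H_def \<alpha>m gm algebra_simps)
		moreover have "H (?b i) = v i" if "i < Suc N" for i
			using that b(1) h(2) \<alpha>f gf \<alpha>s s rathom_one[OF A h(1)] by (cases "i = N") (auto simp: H_def)
		ultimately show "EX h:rathom G. ALL i<Suc N. h (?b i) = v i" by blast
	next
		fix h x assume h: "h \<in> rathom G" "ALL i<Suc N. h (?b i) = 0" and x: "x \<in> carrier G"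
		have "h \<circ> f \<in> rathom A" using h(1) f(1) fc by (auto simp: rathom_def hom_mult)
		moreover have "(h \<circ> f) (b i) = 0" if "i < N" for i using h(2)[rule_format, of i] that by simp
		ultimately have "(h \<circ> f) (\<alpha> x) = 0" using b(3)[rule_format, of "h \<circ> f" "\<alpha> x"] \<alpha>[OF x] by blast
		then have "h (f (\<alpha> x)) = 0" by simp
		moreover have "h s = 0" using h(2)[rule_format, of N] by simp
		moreover have "h x = h (f (\<alpha> x)) + h (s [^]\<^bsub>G\<^esub> (g x))"
		proof -
			have "f (\<alpha> x) \<in> carrier G" by (rule fc) (use \<alpha>[OF x] in blast)
			moreover have "s [^]\<^bsub>G\<^esub> (g x) \<in> carrier G" using s by simp
			ultimately have "h (f (\<alpha> x) \<otimes>\<^bsub>G\<^esub> s [^]\<^bsub>G\<^esub> (g x)) = h (f (\<alpha> x)) + h (s [^]\<^bsub>G\<^esub> (g x))"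
				using h(1) unfolding rathom_def by blast
			then show ?thesis by (subst dec[OF x])
		qed
		ultimately show "h x = 0" using rathom_int_pow[OF G.is_group h(1) s(1)] by simp
	qed
qed

text \<open>The homology of a neighbourhood relative to the complement of a stratum of complex
  codimension \<open>d\<close>: the same as that of \<complex>^d relative to the complement of the
  origin.\<close>

definition cell_pair :: "'x topology => 'x set => nat => bool" where
	"cell_pair Y S d \<longleftrightarrow> relative_homology_group (2 * int d) Y S \<cong> integer_group
		& (ALL q. q ~= 2 * int d --> trivial_group (relative_homology_group q Y S))"

text \<open>Every added real coordinate shifts the homology relative to the complement of a closed
  set by one degree, so 2d of them lead back to a point.\<close>

lemma cell_pair_Euclidean:
	"cell_pair (Euclidean_space (2 * d)) (topspace (Euclidean_space (2 * d)) - {%_. 0}) d"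
proof -
	have top: "topspace (Euclidean_space 0) = {%_. 0}" by (auto simp: topspace_Euclidean_space)
	have cl: "closedin (Euclidean_space 0) {%_. 0}"
		using closedin_topspace[of "Euclidean_space 0"] by (simp add: top)
	have iso: "homology_group (q - 2 * int d) (Euclidean_space 0) \<cong>
			relative_homology_group q (Euclidean_space (2 * d)) (topspace (Euclidean_space (2 * d)) - {%_. 0})" for q
		using relative_homology_group_Euclidean_complement_step[OF cl, of "q - 2 * int d" "2 * d"]
		by (simp add: top)
	have "homology_group 0 (Euclidean_space 0) \<cong> integer_group"
		by (rule homology_coefficients[OF top])
	moreover have "trivial_group (homology_group q (Euclidean_space 0))" if "q ~= 0" for q
		by (rule homology_dimension_axiom[OF top that])
	moreover have "homology_group 0 (Euclidean_space 0) \<cong>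
			relative_homology_group (2 * int d) (Euclidean_space (2 * d)) (topspace (Euclidean_space (2 * d)) - {%_. 0})"
		using iso[of "2 * int d"] by simp
	ultimately show ?thesis
		unfolding cell_pair_def
	proof (intro conjI allI impI)
		fix q assume "q ~= 2 * int d"
		then have "trivial_group (homology_group (q - 2 * int d) (Euclidean_space 0))"
			using \<open>!!q. q ~= 0 ==> trivial_group (homology_group q (Euclidean_space 0))\<close> by simp
		then show "trivial_group (relative_homology_group q (Euclidean_space (2 * d)) (topspace (Euclidean_space (2 * d)) - {%_. 0}))"
			using isomorphic_group_triviality[OF iso[of q]] by simp
	qed (meson group_relative_homology_group group.iso_sym iso_trans)
qed

lemma cell_pair_homotopy:
	assumes "cell_pair Y T d"
		and "continuous_map X Y f" "f \<in> S \<rightarrow> T" "continuous_map Y X g" "g \<in> T \<rightarrow> S"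
		and "homotopic_with (%h. h \<in> S \<rightarrow> S) X X (g \<circ> f) id"
		and "homotopic_with (%k. k \<in> T \<rightarrow> T) Y Y (f \<circ> g) id"
	shows "cell_pair X S d"
proof -
	have "relative_homology_group q X S \<cong> relative_homology_group q Y T" for q
		by (rule homotopy_equivalent_space_imp_isomorphic_relative_homology_groups[OF assms(2-7)])
	then show ?thesis
		using assms(1) unfolding cell_pair_def
		by (meson group_relative_homology_group iso_trans isomorphic_group_triviality)
qed

text \<open>By excision the pair (\<open>U Un N\<close>, \<open>U\<close>) has the homology of
  (\<open>N\<close>, \<open>N Int U\<close>), which is concentrated in degree 2d. The long exact
  sequence can then change only the degrees 2d - 1 and 2d; if the homology of \<open>U\<close>
  vanishes in degree 2d - 1, the group in degree 2d gains an infinite cyclic quotient.\<close>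

lemma attach_cell:
	fixes X :: "'x topology"
	assumes U: "openin X U" and N: "openin X N"
		and cell: "cell_pair (subtopology X N) (N Int U) d"
	shows "!!q. 2 * int d ~= q ==> 2 * int d ~= q + 1 ==>
			hom_induced q (subtopology X U) {} (subtopology X (U Un N)) {} id
				\<in> iso (homology_group q (subtopology X U)) (homology_group q (subtopology X (U Un N)))"
		and "!!q. 2 * int d ~= q ==> trivial_group (homology_group q (subtopology X U)) ==>
			trivial_group (homology_group q (subtopology X (U Un N)))"
		and "trivial_group (homology_group (2 * int d - 1) (subtopology X U)) ==>
			rat_rank (homology_group (2 * int d) (subtopology X U)) n ==>
			rat_rank (homology_group (2 * int d) (subtopology X (U Un N))) (Suc n)"
proof -
	let ?W = "subtopology X (U Un N)"
	have UX: "U <= topspace X" and NX: "N <= topspace X" using U N by (auto dest: openin_subset)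
	have sub: "subtopology ?W U = subtopology X U" "subtopology ?W N = subtopology X N"
		by (simp_all add: subtopology_subtopology Int_absorb1)
	have opU: "openin ?W U" and opN: "openin ?W N"
		using U N by (auto simp: openin_subtopology_alt)
	\<comment> \<open>The excised set is closed because \<open>N\<close> is open, and it lies in the
	  open set \<open>U\<close>: this is the closure condition of excision.\<close>
	have "closedin ?W (U - N)"
	proof -
		have "U - N = topspace ?W - N" using UX NX by auto
		then show ?thesis using opN by (metis closedin_diff closedin_topspace)
	qed
	then have "?W closure_of (U - N) <= ?W interior_of U"
		using opU by (simp add: closure_of_closedin interior_of_openin)
	from homology_excision_axiom[OF this, of "U Un N"]
	have "hom_induced q (subtopology ?W ((U Un N) - (U - N))) (U - (U - N)) (subtopology ?W (U Un N)) U id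
		\<in> iso (relative_homology_group q (subtopology ?W ((U Un N) - (U - N))) (U - (U - N)))
					(relative_homology_group q (subtopology ?W (U Un N)) U)" for q
		by simp
	moreover have "(U Un N) - (U - N) = N" "U - (U - N) = N Int U" "subtopology ?W (U Un N) = ?W"
		by (auto simp: subtopology_subtopology)
	ultimately have exc: "relative_homology_group q (subtopology X N) (N Int U) \<cong> relative_homology_group q ?W U" for q
		using sub by (metis is_isoI)
	then have cellW: "cell_pair ?W U d"
		using cell unfolding cell_pair_def
		by (meson group.iso_sym group_relative_homology_group iso_trans isomorphic_group_triviality)
	let ?i = "%q. hom_induced q (subtopology X U) {} ?W {} id"
	let ?j = "%q. hom_induced q ?W {} ?W U id"
	let ?d = "%q. hom_boundary q ?W U"
	have hi: "?i q \<in> hom (homology_group q (subtopology X U)) (homology_group q ?W)"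
		and hj: "?j q \<in> hom (homology_group q ?W) (relative_homology_group q ?W U)" for q
		by (simp_all add: hom_induced_hom)
	have e1: "kernel (relative_homology_group q ?W U) (homology_group (q-1) (subtopology X U)) (?d q)
			= ?j q ` carrier (homology_group q ?W)" for q
		using homology_exactness_axiom_1[of q ?W U] unfolding sub by simp
	have e2: "kernel (homology_group (q-1) (subtopology X U)) (homology_group (q-1) ?W) (?i (q-1))
			= ?d q ` carrier (relative_homology_group q ?W U)" for q
		using homology_exactness_axiom_2[of q ?W U] unfolding sub by simp
	have e3: "kernel (homology_group q ?W) (relative_homology_group q ?W U) (?j q)
			= ?i q ` carrier (homology_group q (subtopology X U))" for q
		using homology_exactness_axiom_3[of q ?W U] unfolding sub by simp
	have hd: "?d q \<in> hom (relative_homology_group q ?W U) (homology_group (q-1) (subtopology X U))" for q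
		using hom_boundary_hom[of q ?W U] unfolding sub by simp
	have triv: "trivial_group (relative_homology_group q ?W U)" if "q ~= 2 * int d" for q
		using cellW that unfolding cell_pair_def by blast
	have inj: "inj_on (?i q) (carrier (homology_group q (subtopology X U)))" if "q + 1 ~= 2 * int d" for q
	proof -
		have "?d (q+1) ` carrier (relative_homology_group (q+1) ?W U) = {\<one>\<^bsub>homology_group q (subtopology X U)\<^esub>}"
			using triv[OF that] hd[of "q+1"] by (auto simp: trivial_group_def hom_one)
		then have "kernel (homology_group q (subtopology X U)) (homology_group q ?W) (?i q)
				= {\<one>\<^bsub>homology_group q (subtopology X U)\<^esub>}"
			using e2[of "q+1"] by simp
		then show ?thesis
			using hi[of q] group_hom.inj_iff_trivial_ker[of _ _ "?i q"]
			by (metis group_hom_axioms_def group_hom_def group_relative_homology_group)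
	qed
	have surj: "?i q ` carrier (homology_group q (subtopology X U)) = carrier (homology_group q ?W)"
		if "q ~= 2 * int d" for q
		using triv[OF that] hj[of q] unfolding e3[symmetric]
		by (auto simp: kernel_def trivial_group_def hom_def)
	show "?i q \<in> iso (homology_group q (subtopology X U)) (homology_group q ?W)"
		if "2 * int d ~= q" "2 * int d ~= q + 1" for q
		using that inj surj hi by (auto simp: iso_def bij_betw_def)
	show "trivial_group (homology_group q ?W)"
		if "2 * int d ~= q" "trivial_group (homology_group q (subtopology X U))" for q
	proof -
		have "carrier (homology_group q ?W) = {\<one>\<^bsub>homology_group q ?W\<^esub>}"
			using surj[of q] that hi[of q] by (auto simp: trivial_group_def hom_one)
		then show ?thesis by (simp add: trivial_group_def)
	qed
	show "rat_rank (homology_group (2 * int d) ?W) (Suc n)"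
		if t: "trivial_group (homology_group (2 * int d - 1) (subtopology X U))"
			and r: "rat_rank (homology_group (2 * int d) (subtopology X U)) n"
	proof -
		let ?q = "2 * int d"
		\<comment> \<open>The boundary map lands in a trivial group, so by exactness every relative class
		  lifts.\<close>
		have js: "?j ?q ` carrier (homology_group ?q ?W) = carrier (relative_homology_group ?q ?W U)"
			using t hd[of ?q] unfolding e1[symmetric]
			by (auto simp: kernel_def trivial_group_def hom_def)
		obtain \<phi> where \<phi>: "\<phi> \<in> iso (relative_homology_group ?q ?W U) integer_group"
			using cellW unfolding cell_pair_def is_iso_def by blast
		then have \<phi>': "\<phi> \<in> hom (relative_homology_group ?q ?W U) integer_group"
			"inj_on \<phi> (carrier (relative_homology_group ?q ?W U))"
			"\<phi> ` carrier (relative_homology_group ?q ?W U) = UNIV"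
			by (auto simp: iso_def bij_betw_def)
		have "kernel (homology_group ?q ?W) integer_group (\<phi> \<circ> ?j ?q)
				= kernel (homology_group ?q ?W) (relative_homology_group ?q ?W U) (?j ?q)"
		proof -
			have one: "\<phi> \<one>\<^bsub>relative_homology_group ?q ?W U\<^esub> = 0"
				using hom_one[OF \<phi>'(1)] by simp
			have "\<phi> y = 0 \<longleftrightarrow> y = \<one>\<^bsub>relative_homology_group ?q ?W U\<^esub>"
				if "y \<in> carrier (relative_homology_group ?q ?W U)" for y
				using that \<phi>'(2) one group.is_monoid[OF group_relative_homology_group]
				by (metis inj_onD monoid.one_closed)
			moreover have "?j ?q x \<in> carrier (relative_homology_group ?q ?W U)" if "x \<in> carrier (homology_group ?q ?W)" for x
				using hj[of ?q] that by (auto simp: hom_def)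
			ultimately show ?thesis by (auto simp: kernel_def)
		qed
		then have "kernel (homology_group ?q ?W) integer_group (\<phi> \<circ> ?j ?q)
				= ?i ?q ` carrier (homology_group ?q (subtopology X U))"
			using e3 by simp
		moreover have "\<phi> \<circ> ?j ?q \<in> hom (homology_group ?q ?W) integer_group"
			using hom_compose[OF hj \<phi>'(1)] .
		moreover have "(\<phi> \<circ> ?j ?q) ` carrier (homology_group ?q ?W) = UNIV"
			using js \<phi>'(3) by (metis image_comp)
		ultimately show ?thesis
			using rat_rank_extension[OF group_relative_homology_group abelian_homology_group hi inj _ _ _ r]
			by force
	qed
qed

text \<open>\<open>N i\<close> is an open chart around the stratum \<open>e i\<close>. The last two
  axioms say together that the charts of smaller weight, along with any others of equal weight,
  cover exactly \<open>N i - e i\<close> within \<open>N i\<close>; attaching charts by increasing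
  weight thus attaches cells of codimension \<open>dd i\<close>. Finiteness in the weight makes
  every stage finite, finiteness in the codimension makes each homology group stabilise.\<close>

locale cell_decomposition =
	fixes X :: "'x topology" and I :: "'i set" and N e :: "'i => 'x set" and wt dd :: "'i => nat"
	assumes finite_wt: "finite {i\<in>I. wt i <= w}"
		and finite_dd: "finite {i\<in>I. dd i = c}"
		and openN: "i \<in> I ==> openin X (N i)"
		and cover: "topspace X = (\<Union>i\<in>I. N i)"
		and cell: "i \<in> I ==> cell_pair (subtopology X (N i)) (N i - e i) (dd i)"
		and avoid: "i \<in> I ==> j \<in> I ==> j ~= i ==> wt j <= wt i ==> N j Int N i Int e i = {}"
		and below: "i \<in> I ==> x \<in> N i ==> x ~: e i ==> EX j:I. wt j < wt i & x \<in> N j"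
begin

definition UL :: "'i set => 'x set" where "UL L = (\<Union>i\<in>L. N i)"

definition lower :: "'i set => bool" where
	"lower L \<longleftrightarrow> L <= I & (ALL i:L. ALL j:I. wt j < wt i --> j \<in> L)"

abbreviation HU :: "int => 'i set => 'x chain set monoid" where
	"HU q L \<equiv> homology_group q (subtopology X (UL L))"

abbreviation incl :: "int => 'i set => 'i set => 'x chain set => 'x chain set" where
	"incl q L M \<equiv> hom_induced q (subtopology X (UL L)) {} (subtopology X (UL M)) {} id"

lemma open_UL: "L <= I ==> openin X (UL L)"
	unfolding UL_def using openN by blast

lemma UL_insert: "UL (insert i L) = UL L Un N i"
	by (auto simp: UL_def)

text \<open>Since \<open>i\<close> is new and of greatest weight in a down-set, the rest
  \<open>L\<close> is a down-set that contains every lighter index. The axioms then identify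
  \<open>N i Int UL L\<close> with \<open>N i - e i\<close>.\<close>

lemma attach:
	assumes "lower (insert i L)" "ALL j:L. wt j <= wt i" "i ~: L"
	shows "lower L" "openin X (UL L)" "openin X (N i)"
		"cell_pair (subtopology X (N i)) (N i Int UL L) (dd i)"
proof -
	show low: "lower L"
		using assms unfolding lower_def by (metis insertE insert_subset insertI2 leD)
	then show "openin X (UL L)" "openin X (N i)"
		using assms(1) openN by (auto simp: lower_def intro: open_UL)
	have "N i Int UL L = N i - e i"
	proof (intro equalityI subsetI)
		fix x assume "x \<in> N i Int UL L"
		then obtain j where j: "j \<in> L" "x \<in> N j" "x \<in> N i" by (auto simp: UL_def)
		then have "N j Int N i Int e i = {}"
			using assms avoid[of i j] unfolding lower_def by blast
		then show "x \<in> N i - e i" using j by blast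
	next
		fix x assume x: "x \<in> N i - e i"
		then obtain j where "j \<in> I" "wt j < wt i" "x \<in> N j" using below[of i x] assms(1) by (auto simp: lower_def)
		then show "x \<in> N i Int UL L" using assms(1) x unfolding lower_def UL_def by blast
	qed
	then show "cell_pair (subtopology X (N i)) (N i Int UL L) (dd i)"
		using cell[of i] assms(1) by (simp add: lower_def)
qed

text \<open>Induction along increasing weight. Vanishing in odd degrees is carried along, because a
  cell of codimension d is known to raise the rank in degree 2d only if degree 2d - 1 is
  trivial.\<close>

lemma rank_lower:
	assumes "finite L" "lower L"
	shows "(ALL q. (ALL c. q ~= 2 * int c) --> trivial_group (HU q L))
		& (ALL c. rat_rank (HU (2 * int c) L) (card {i\<in>L. dd i = c}))
		& (ALL c. {i\<in>L. dd i = c} = {} --> trivial_group (HU (2 * int c) L))"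
	using assms
proof (induction L rule: finite_ranking_induct[where f = wt])
	case empty
	have "trivial_group (HU q {})" for q
		by (rule trivial_homology_group_empty) (simp add: UL_def)
	then show ?case using rat_rank_triv by auto
next
	case (insert i L)
	show ?case
	proof (cases "i \<in> L")
		case True
		then have "insert i L = L" by blast
		then show ?thesis using insert by simp
	next
		case False
		have le: "ALL j:L. wt j <= wt i" using insert.hyps(2) by blast
		note at = attach[OF insert.prems le False]
		note IH = insert.IH[OF at(1)]
		note att = attach_cell[OF at(2-4), folded UL_insert]
		have odd: "(ALL c. 2 * int (dd i) - 1 ~= 2 * int c)" by presburger
		show ?thesis
		proof (intro conjI allI impI)
			fix q assume q: "ALL c. q ~= 2 * int c"
			then show "trivial_group (HU q (insert i L))" using att(2)[of q] IH by metis
		next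
			fix c
			show "rat_rank (HU (2 * int c) (insert i L)) (card {j\<in>insert i L. dd j = c})"
			proof (cases "c = dd i")
				case True
				have "{j\<in>insert i L. dd j = c} = insert i {j\<in>L. dd j = c}" using True by auto
				then have "card {j\<in>insert i L. dd j = c} = Suc (card {j\<in>L. dd j = c})"
					using False insert.hyps(1) by simp
				then show ?thesis using att(3)[of "card {j\<in>L. dd j = c}"] IH odd True by simp
			next
				case False
				have eq: "{j\<in>insert i L. dd j = c} = {j\<in>L. dd j = c}" using False by auto
				have iso: "incl (2 * int c) L (insert i L) \<in> iso (HU (2 * int c) L) (HU (2 * int c) (insert i L))"
					by (rule att(1)) (use False in presburger)+
				show ?thesis unfolding eq
					by (rule rat_rank_iso[OF iso group_relative_homology_group group_relative_homology_group])
						(rule IH[THEN conjunct2, THEN conjunct1, THEN spec])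
			qed
		next
			fix c assume e: "{j\<in>insert i L. dd j = c} = {}"
			then have "{j\<in>L. dd j = c} = {}" "2 * int (dd i) ~= 2 * int c" by auto
			then show "trivial_group (HU (2 * int c) (insert i L))"
				using IH by (intro att(2)) blast+
		qed
	qed
qed

text \<open>A cell acts only in the degrees 2 \<open>dd i\<close> and 2 \<open>dd i\<close> - 1. If
  \<open>q\<close> is neither, attaching finitely many such cells composes isomorphisms.\<close>

lemma incl_iso:
	assumes "finite S" and low: "lower L" and "lower (L Un S)" "!!i j. i \<in> S ==> j \<in> L ==> wt j <= wt i"
		"!!i. i \<in> S ==> 2 * int (dd i) ~= q & 2 * int (dd i) ~= q + 1"
	shows "incl q L (L Un S) \<in> iso (HU q L) (HU q (L Un S))"
	using assms(1,3-5)
proof (induction S rule: finite_ranking_induct[where f = wt])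
	case empty
	have "incl q L L x = x" if "x \<in> carrier (HU q L)" for x
		by (rule hom_induced_id[OF that])
	then have "incl q L L \<in> iso (HU q L) (HU q L)"
		using hom_induced_hom[of q "subtopology X (UL L)" "{}" "subtopology X (UL L)" "{}" id]
		by (auto simp: iso_def bij_betw_def inj_on_def image_def)
	then show ?case by (simp only: Un_empty_right)
next
	case (insert i S)
	show ?case
	proof (cases "i \<in> L Un S")
		case True
		show ?thesis
		proof (cases "i \<in> S")
			case True
			then have "insert i S = S" by blast
			then show ?thesis using insert by simp
		next
			case False
			then have eq: "L Un insert i S = L Un S" using True by blast
			show ?thesis unfolding eq
				by (rule insert.IH) (use insert.prems eq in auto)
		qed
	next
		case False
		have low': "lower (insert i (L Un S))" using insert.prems(1) by simp
		have le: "ALL j:L Un S. wt j <= wt i" using insert by auto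
		note at = attach[OF low' le False]
		have IH: "incl q L (L Un S) \<in> iso (HU q L) (HU q (L Un S))"
			by (rule insert.IH) (use insert.prems at in auto)
		have 2: "incl q (L Un S) (insert i (L Un S)) \<in> iso (HU q (L Un S)) (HU q (insert i (L Un S)))"
			using attach_cell(1)[OF at(2-4), of q] insert.prems(3) by (simp add: UL_insert)
		have "incl q (L Un S) (insert i (L Un S)) \<circ> incl q L (L Un S) = incl q L (insert i (L Un S))"
			by (subst hom_induced_compose[symmetric])
				(auto simp: continuous_map_in_subtopology UL_def continuous_map_from_subtopology)
		then show ?thesis
			using iso_set_trans[OF IH 2] by (simp only: Un_insert_right)
	qed
qed

definition Lw :: "nat => 'i set" where "Lw w = {i\<in>I. wt i <= w}"

lemma Lw: "finite (Lw w)" "lower (Lw w)" "w <= w' ==> Lw w <= Lw w'"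
	using finite_wt by (auto simp: Lw_def lower_def)

lemma compact_in_stage:
	assumes "compactin X K" shows "EX w. K <= UL (Lw w)"
proof -
	have "K <= topspace X" using assms by (rule compactin_subset_topspace)
	also have "\<dots> = \<Union>(range (%w. UL (Lw w)))"
		by (auto simp: cover UL_def Lw_def)
	finally have "K <= \<Union>(range (%w. UL (Lw w)))" .
	moreover have "openin X U" if "U \<in> range (%w. UL (Lw w))" for U
		using that by (auto intro!: open_UL simp: Lw_def)
	ultimately obtain \<F> where F: "finite \<F>" "\<F> <= range (%w. UL (Lw w))" "K <= \<Union>\<F>"
		using assms unfolding compactin_def by meson
	then obtain W where W: "finite W" "\<F> = (%w. UL (Lw w)) ` W" using finite_subset_image by meson
	have "UL (Lw w) <= UL (Lw (Max W))" if "w \<in> W" for w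
		using Lw(3)[of w "Max W"] that W(1) by (auto simp: UL_def)
	then show ?thesis using F(3) W by blast
qed

text \<open>The simplices of a chain are finitely many and compact, so the increasing open stages
  exhaust the chains as well.\<close>

lemma chain_in_stage:
	assumes c: "singular_chain p X c"
	shows "EX w. singular_chain p (subtopology X (UL (Lw w))) c"
proof -
	have "ALL sg:Poly_Mapping.keys c. EX w. sg ` standard_simplex p <= UL (Lw w)"
	proof
		fix sg assume "sg \<in> Poly_Mapping.keys c"
		then have "singular_simplex p X sg" using c by (auto simp: singular_chain_def)
		then have "continuous_map (subtopology (powertop_real UNIV) (standard_simplex p)) X sg"
			by (simp add: singular_simplex_def)
		moreover have "compactin (subtopology (powertop_real UNIV) (standard_simplex p)) (standard_simplex p)"
			using compactin_standard_simplex[of p] by (simp add: compactin_subtopology)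
		ultimately show "EX w. sg ` standard_simplex p <= UL (Lw w)"
			using image_compactin compact_in_stage by blast
	qed
	then obtain w where w: "!!sg. sg \<in> Poly_Mapping.keys c ==> sg ` standard_simplex p <= UL (Lw (w sg))"
		by metis
	define m where "m = Max (w ` Poly_Mapping.keys c)"
	have "sg ` standard_simplex p <= UL (Lw m)" if "sg \<in> Poly_Mapping.keys c" for sg
	proof -
		have "w sg <= m" using that by (simp add: m_def)
		then have "UL (Lw (w sg)) <= UL (Lw m)" using Lw(3) by (auto simp: UL_def)
		then show ?thesis using w[OF that] by blast
	qed
	then show ?thesis using c by (auto simp: singular_chain_subtopology)
qed

text \<open>Cycles, and the chains that bound them, live in some stage, so the homology of
  \<open>X\<close> is the limit of the stages. Beyond weight \<open>w0\<close> no cell affects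
  degree \<open>p\<close>, hence the limit is already attained there.\<close>

lemma iso_limit:
	assumes stable: "!!i. i \<in> I ==> w0 < wt i ==> 2 * int (dd i) ~= int p & 2 * int (dd i) ~= int p + 1"
	shows "hom_induced (int p) (subtopology X (UL (Lw w0))) {} X {} id
		\<in> iso (HU (int p) (Lw w0)) (homology_group (int p) X)"
proof -
	let ?A = "%w. subtopology X (UL (Lw w))"
	let ?J = "hom_induced (int p) (?A w0) {} X {} id"
	have cA: "continuous_map (?A w) X id" for w by (simp add: continuous_map_from_subtopology)
	have stage: "incl (int p) (Lw w0) (Lw w) \<in> iso (HU (int p) (Lw w0)) (HU (int p) (Lw w))" if "w0 <= w" for w
	proof -
		have eq: "Lw w = Lw w0 Un (Lw w - Lw w0)" using Lw(3)[OF that] by blast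
		have "incl (int p) (Lw w0) (Lw w0 Un (Lw w - Lw w0)) \<in> iso (HU (int p) (Lw w0)) (HU (int p) (Lw w0 Un (Lw w - Lw w0)))"
		proof (rule incl_iso)
			show "lower (Lw w0 Un (Lw w - Lw w0))" using eq Lw(2) by metis
		qed (use Lw stable in \<open>auto simp: Lw_def\<close>)
		then show ?thesis using eq by metis
	qed
	have rep: "?J (homologous_rel_set p (?A w0) {} z) = hclass p X z"
		if "singular_relcycle p (?A w0) {} z" for z
	proof -
		have "chain_map p id z = z"
			using that by (intro chain_map_id_gen) (auto simp: singular_cycle)
		then show ?thesis using hom_induced_chain_map[OF cA _ that, of "{}"] by simp
	qed
	have rep': "incl (int p) (Lw w0) (Lw w) (homologous_rel_set p (?A w0) {} z) = homologous_rel_set p (?A w) {} z"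
		if "singular_relcycle p (?A w0) {} z" "w0 <= w" for z w
	proof -
		have "chain_map p id z = z"
			using that by (intro chain_map_id_gen) (auto simp: singular_cycle)
		moreover have "continuous_map (?A w0) (?A w) id"
			using Lw(3)[OF that(2)] by (auto simp: continuous_map_in_subtopology UL_def continuous_map_from_subtopology)
		ultimately show ?thesis using hom_induced_chain_map[OF _ _ that(1), of "?A w" id "{}"] by simp
	qed
	have mono: "singular_chain r (?A w) c" if "singular_chain r (?A v) c" "v <= w" for r c v w
		using that Lw(3)[OF that(2)] by (intro singular_chain_mono[OF that(1)]) (auto simp: UL_def)
	have "inj_on ?J (carrier (HU (int p) (Lw w0)))"
	proof (rule inj_onI)
		fix x y assume x: "x \<in> carrier (HU (int p) (Lw w0))" and y: "y \<in> carrier (HU (int p) (Lw w0))" and eq: "?J x = ?J y"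
		obtain z where z: "singular_relcycle p (?A w0) {} z" "x = homologous_rel_set p (?A w0) {} z"
			using x unfolding carrier_relative_homology_group by blast
		obtain u where u: "singular_relcycle p (?A w0) {} u" "y = homologous_rel_set p (?A w0) {} u"
			using y unfolding carrier_relative_homology_group by blast
		have "hclass p X z = hclass p X u" using eq rep z u by simp
		then have "homologous_rel p X {} z u" by (simp add: homologous_rel_set_eq)
		then obtain c where c: "singular_chain (Suc p) X c" "chain_boundary (Suc p) c = z - u"
			by (auto simp: homologous_rel_def singular_boundary)
		obtain w1 where w1: "singular_chain (Suc p) (?A w1) c" using chain_in_stage[OF c(1)] by blast
		\<comment> \<open>The bounding chain may need a later stage than \<open>w0\<close>, but
		  \<open>stage\<close> makes the passage to it injective.\<close>
		define w where "w = max w0 w1"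
		have w: "w0 <= w" "singular_chain (Suc p) (?A w) c" using mono[OF w1, of w] by (auto simp: w_def)
		have "homologous_rel p (?A w) {} z u"
			using w(2) c(2) by (auto simp: homologous_rel_def singular_boundary)
		then have "incl (int p) (Lw w0) (Lw w) x = incl (int p) (Lw w0) (Lw w) y"
			using rep' z u w(1) by (simp add: homologous_rel_set_eq)
		then show "x = y" using stage[OF w(1)] x y by (auto simp: iso_def bij_betw_def inj_on_def)
	qed
	moreover have "carrier (homology_group (int p) X) <= ?J ` carrier (HU (int p) (Lw w0))"
	proof
		fix x assume "x \<in> carrier (homology_group (int p) X)"
		then obtain z where z: "cyc p X z" "x = hclass p X z"
			unfolding carrier_relative_homology_group by blast
		obtain w1 where w1: "singular_chain p (?A w1) z" using chain_in_stage z(1) by (auto simp: singular_cycle)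
		define w where "w = max w0 w1"
		have w: "w0 <= w" "singular_chain p (?A w) z" using mono[OF w1, of w] by (auto simp: w_def)
		have zw: "singular_relcycle p (?A w) {} z" using w(2) z(1) by (simp add: singular_cycle)
		have "homologous_rel_set p (?A w) {} z \<in> carrier (HU (int p) (Lw w))"
			using zw unfolding carrier_relative_homology_group by blast
		then obtain y where y: "y \<in> carrier (HU (int p) (Lw w0))"
			"incl (int p) (Lw w0) (Lw w) y = homologous_rel_set p (?A w) {} z"
		proof -
			have "incl (int p) (Lw w0) (Lw w) ` carrier (HU (int p) (Lw w0)) = carrier (HU (int p) (Lw w))"
				using stage[OF w(1)] by (simp add: iso_def bij_betw_def)
			then have "homologous_rel_set p (?A w) {} z \<in> incl (int p) (Lw w0) (Lw w) ` carrier (HU (int p) (Lw w0))"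
				using \<open>homologous_rel_set p (?A w) {} z \<in> carrier (HU (int p) (Lw w))\<close> by (simp only:)
			then show ?thesis by (elim imageE) (rule that, simp_all only:)
		qed
		have "?J y = hom_induced (int p) (?A w) {} X {} id (incl (int p) (Lw w0) (Lw w) y)"
			using Lw(3)[OF w(1)] cA
			by (subst hom_induced_compose')
				(auto simp: continuous_map_in_subtopology UL_def continuous_map_from_subtopology)
		also have "\<dots> = x"
		proof -
			have "chain_map p id z = z" using w(2) by (rule chain_map_id_gen) auto
			then show ?thesis using hom_induced_chain_map[OF cA _ zw, of "{}"] y z(2) by simp
		qed
		finally show "x \<in> ?J ` carrier (HU (int p) (Lw w0))" using y(1) by blast
	qed
	ultimately show ?thesis
		using hom_induced_hom[of "int p" "?A w0" "{}" X "{}" id]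
		by (auto simp: iso_def bij_betw_def hom_def)
qed

theorem rank_homology:
	shows "rat_rank (homology_group (int (2 * c)) X) (card {i\<in>I. dd i = c})"
		and "odd p ==> rat_rank (homology_group (int p) X) 0"
proof -
	have stab: "EX w0. ALL i:I. w0 < wt i --> dd i ~= c" for c
	proof -
		have "wt i <= Max (wt ` {i\<in>I. dd i = c})" if "i \<in> I" "dd i = c" for i
			using that finite_dd[of c] by auto
		then show ?thesis by (meson leD)
	qed
	obtain w where w: "ALL i:I. w < wt i --> dd i ~= c" using stab by blast
	have "{i\<in>Lw w. dd i = c} = {i\<in>I. dd i = c}" using w by (auto simp: Lw_def)
	then have "rat_rank (HU (2 * int c) (Lw w)) (card {i\<in>I. dd i = c})"
		using rank_lower[OF Lw(1,2), of w] by metis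
	moreover have "hom_induced (int (2 * c)) (subtopology X (UL (Lw w))) {} X {} id
		\<in> iso (HU (int (2 * c)) (Lw w)) (homology_group (int (2 * c)) X)"
		by (rule iso_limit) (use w in \<open>auto; presburger\<close>)
	ultimately show "rat_rank (homology_group (int (2 * c)) X) (card {i\<in>I. dd i = c})"
		using rat_rank_iso[OF _ group_relative_homology_group group_relative_homology_group] by fastforce
next
	assume p: "odd p"
	have stab: "EX w0. ALL i:I. w0 < wt i --> dd i ~= c" for c
	proof -
		have "wt i <= Max (wt ` {i\<in>I. dd i = c})" if "i \<in> I" "dd i = c" for i
			using that finite_dd[of c] by auto
		then show ?thesis by (meson leD)
	qed
	\<comment> \<open>For odd \<open>p\<close> the only cells that could interfere are those with 2
	  \<open>dd i\<close> = \<open>p\<close> + 1.\<close>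
	obtain w where w: "ALL i:I. w < wt i --> dd i ~= Suc p div 2" using stab by blast
	have "trivial_group (HU (int p) (Lw w))"
	proof -
		have "ALL c. int p ~= 2 * int c" using p by presburger
		then show ?thesis using rank_lower[OF Lw(1,2), of w] by blast
	qed
	then have "rat_rank (HU (int p) (Lw w)) 0" by (rule rat_rank_triv)
	moreover have "hom_induced (int p) (subtopology X (UL (Lw w))) {} X {} id
		\<in> iso (HU (int p) (Lw w)) (homology_group (int p) X)"
	proof (rule iso_limit)
		fix i assume "i \<in> I" "w < wt i"
		then have "dd i ~= Suc p div 2" using w by blast
		then show "2 * int (dd i) ~= int p & 2 * int (dd i) ~= int p + 1" using p by presburger
	qed
	ultimately show "rat_rank (homology_group (int p) X) 0"
		using rat_rank_iso[OF _ group_relative_homology_group group_relative_homology_group] by blast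
qed

end

section \<open>Quotients by group actions\<close>

text \<open>\<open>act\<close> is total on its type, whereas the laws are demanded on
  \<open>S\<close> only: the identity law fails, for instance, on functions that are not
  extensional.\<close>

definition acts_on :: "('g, 'e) monoid_scheme => ('g => 'y => 'y) => 'y set => bool" where
	"acts_on G act S \<longleftrightarrow> group G & (ALL g:carrier G. ALL y:S. act g y \<in> S)
		& (ALL y:S. act \<one>\<^bsub>G\<^esub> y = y)
		& (ALL g:carrier G. ALL h:carrier G. ALL y:S. act (g \<otimes>\<^bsub>G\<^esub> h) y = act g (act h y))"

lemma orbit_act:
	assumes "acts_on G act S" "g \<in> carrier G" "y \<in> S"
	shows "orbit G act (act g y) = orbit G act y"
proof -
	interpret group G using assms(1) by (simp add: acts_on_def)
	have m: "act (a \<otimes>\<^bsub>G\<^esub> b) y = act a (act b y)" if "a \<in> carrier G" "b \<in> carrier G" for a b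
		using assms that by (simp add: acts_on_def)
	show ?thesis
		unfolding orbit_def
	proof (intro equalityI subsetI; clarify)
		fix h assume h: "h \<in> carrier G"
		then show "EX ga. act h (act g y) = act ga y & ga \<in> carrier G"
			using assms(2) m[of h g] by (intro exI[of _ "h \<otimes>\<^bsub>G\<^esub> g"]) simp
	next
		fix h assume h: "h \<in> carrier G"
		have "act (h \<otimes>\<^bsub>G\<^esub> inv\<^bsub>G\<^esub> g) (act g y) = act h y"
			using assms h m[of "h \<otimes>\<^bsub>G\<^esub> inv\<^bsub>G\<^esub> g" g, symmetric] by (simp add: m_assoc)
		then show "EX ga. act h y = act ga (act g y) & ga \<in> carrier G"
			using assms(2) h by (intro exI[of _ "h \<otimes>\<^bsub>G\<^esub> inv\<^bsub>G\<^esub> g"]) simp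
	qed
qed

lemma orbit_eq_iff:
	assumes "acts_on G act S" "y \<in> S" "z \<in> S"
	shows "orbit G act y = orbit G act z \<longleftrightarrow> (EX g:carrier G. z = act g y)"
proof
	assume eq: "orbit G act y = orbit G act z"
	have "z = act \<one>\<^bsub>G\<^esub> z" "\<one>\<^bsub>G\<^esub> \<in> carrier G"
		using assms by (auto simp: acts_on_def group.is_monoid monoid.one_closed)
	then have "z \<in> orbit G act z" unfolding orbit_def by blast
	then show "EX g:carrier G. z = act g y" using eq unfolding orbit_def by blast
next
	assume "EX g:carrier G. z = act g y"
	then show "orbit G act y = orbit G act z" using orbit_act[OF assms(1) _ assms(2)] by metis
qed

text \<open>A homotopy upstairs that is compatible with the fibres of a quotient map descends, because
	the product of a quotient map with the identity of the unit interval is a quotient map.\<close>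

lemma homotopic_with_descend:
	assumes q: "quotient_map Y B p"
		and H: "continuous_map (cyl Y) Z H"
		and compat: "!!t y z. t \<in> {0..1::real} ==> y \<in> topspace Y ==> z \<in> topspace Y ==> p y = p z ==> H (t, y) = H (t, z)"
		and f: "!!y. y \<in> topspace Y ==> H (0, y) = f (p y)"
		and g: "!!y. y \<in> topspace Y ==> H (1, y) = g (p y)"
		and P: "!!h k. (!!x. x \<in> topspace B ==> h x = k x) ==> P h \<longleftrightarrow> P k"
		and PH: "!!k t. t \<in> {0..1} ==> (!!y. y \<in> topspace Y ==> k (p y) = H (t, y)) ==> P k"
	shows "homotopic_with P B Z f g"
proof -
	have q2: "quotient_map (cyl Y) (cyl B) (%(x,y). (x, p y))"
	proof (rule quotient_map_prod_right)
		have "compact_space (top_of_set {0..1::real})"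
			by (simp add: compact_space_def)
		then show "locally_compact_space (top_of_set {0..1::real})"
			by (intro compact_imp_locally_compact_space)
		show "Hausdorff_space (top_of_set {0..1::real}) \<or> regular_space (top_of_set {0..1::real})"
			by (simp add: Hausdorff_space_subtopology)
	qed (rule q)
	have compat': "H x = H y"
		if "x \<in> topspace (cyl Y)" "y \<in> topspace (cyl Y)"
			"(%(x,y). (x, p y)) x = (%(x,y). (x, p y)) y" for x y
		using that compat[of "fst x" "snd x" "snd y"] by (cases x; cases y) simp
	obtain K where K: "continuous_map (cyl B) Z K"
		and "K ` topspace (cyl B) = H ` topspace (cyl Y)"
		and K': "!!x. x \<in> topspace (cyl Y) ==> K ((%(x,y). (x, p y)) x) = H x"
		by (rule quotient_map_lift_exists[OF q2 H]) (erule (2) compat', rule that)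
	have K2: "K (t, p y) = H (t, y)" if "t \<in> {0..1::real}" "y \<in> topspace Y" for t y
		using K'[of "(t, y)"] that by simp
	have top: "topspace B = p ` topspace Y" using q by (simp add: quotient_map_def)
	have "EX h. continuous_map (cyl B) Z h &
			(ALL x:topspace B. h (0, x) = f x) & (ALL x:topspace B. h (1, x) = g x) & (ALL t:{0..1::real}. P (%x. h (t, x)))"
		by (intro exI[of _ K] conjI ballI) (use K K2 f g in \<open>auto simp: top intro: PH\<close>)
	then show ?thesis by (subst homotopic_with[OF P]) auto
qed

lemma cts_descend:
	assumes "quotient_map Y B p" "continuous_map Y Z h"
		and "!!y z. y \<in> topspace Y ==> z \<in> topspace Y ==> p y = p z ==> h y = h z"
	obtains h' where "continuous_map B Z h'" "!!y. y \<in> topspace Y ==> h' (p y) = h y"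
	using quotient_map_lift_exists[OF assms(1,2)] assms(3) by metis

text \<open>Neither map has to lift: \<open>u\<close> and \<open>v\<close> start upstairs but take
  values in the orbit spaces. This admits an inverse that is defined through local choices
  upstairs.\<close>

lemma hequiv_quots:
	assumes qY: "quotient_map Y B p" and qY': "quotient_map Y' B' p'"
		and u: "continuous_map Y B' u" "!!y z. y \<in> topspace Y ==> z \<in> topspace Y ==> p y = p z ==> u y = u z"
		and v: "continuous_map Y' B v" "!!y z. y \<in> topspace Y' ==> z \<in> topspace Y' ==> p' y = p' z ==> v y = v z"
		and uv: "!!u' v'. continuous_map B B' u' ==> (!!y. y \<in> topspace Y ==> u' (p y) = u y) ==>
				continuous_map B' B v' ==> (!!y. y \<in> topspace Y' ==> v' (p' y) = v y) ==>
				homotopic_with (%_. True) B B (v' \<circ> u') id & homotopic_with (%_. True) B' B' (u' \<circ> v') id"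
	shows "EX h. homotopy_equivalence B B' h"
proof -
	obtain u' where u': "continuous_map B B' u'" "!!y. y \<in> topspace Y ==> u' (p y) = u y"
		using cts_descend[OF qY u] by blast
	obtain v' where v': "continuous_map B' B v'" "!!y. y \<in> topspace Y' ==> v' (p' y) = v y"
		using cts_descend[OF qY' v] by blast
	show ?thesis
		unfolding homotopy_equivalence_def using uv[OF u' v'] u' v' by blast
qed

section \<open>Continuity of matrix operations, and the general linear groups\<close>

lemma cts_add':
	fixes f g :: "'x => 'b::real_normed_vector"
	assumes "cfun X f" "cfun X g"
	shows "cfun X (%x. f x + g x)"
	using assms by (rule continuous_map_add)

lemma cts_bilinear:
	assumes "bounded_bilinear h" "cfun X f" "cfun X g"
	shows "cfun X (%x. h (f x) (g x))"
proof -
	interpret bounded_bilinear h by fact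
	have "continuous_on UNIV (%p. h (fst p) (snd p))"
		by (intro continuous_on continuous_on_fst continuous_on_snd continuous_on_id)
	then have "cfun euclidean (%p. h (fst p) (snd p))" by simp
	moreover have "cfun X (%x. (f x, g x))"
		using assms(2,3) by (simp add: continuous_map_pairwise o_def flip: prod_topology_euclidean)
	ultimately show ?thesis
		using continuous_map_compose[of X euclidean "%x. (f x, g x)" euclidean "%p. h (fst p) (snd p)"]
		by (simp add: o_def)
qed

lemmas cts_mult' = cts_bilinear[OF bounded_bilinear_mult]

lemma cts_sum':
	fixes f :: "'i => 'x => 'b::real_normed_vector"
	shows "(!!i. i \<in> I ==> cfun X (f i)) ==> cfun X (%x. \<Sum>i\<in>I. f i x)"
	by (induction I rule: infinite_finite_induct) (auto intro: cts_add')

lemma cts_prod':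
	fixes f :: "'i => 'x => complex"
	shows "(!!i. i \<in> I ==> cfun X (f i)) ==> cfun X (%x. \<Prod>i\<in>I. f i x)"
	by (induction I rule: infinite_finite_induct) (auto intro: cts_mult')

lemma cts_compose_UNIV:
	assumes "cfun X f" "continuous_on UNIV h"
	shows "cfun X (%x. h (f x))"
	using continuous_map_compose[of X euclidean f euclidean h] assms by (simp add: o_def)

lemma cts_inverse':
	fixes f :: "'x => complex"
	assumes "cfun X f" "!!x. x \<in> topspace X ==> f x ~= 0"
	shows "cfun X (%x. inverse (f x))"
proof -
	have "continuous_map X (top_of_set (UNIV - {0})) f"
		using assms by (auto simp: continuous_map_in_subtopology)
	moreover have "continuous_map (top_of_set (UNIV - {0::complex})) euclidean inverse"
		by (simp, intro continuous_intros) auto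
	ultimately show ?thesis
		using continuous_map_compose[of X "top_of_set (UNIV - {0})" f euclidean inverse] by (simp add: o_def)
qed

lemma mdim: "A \<in> carrier_mat m n ==> dim_row A = m & dim_col A = n"
	by auto

lemma tops_mat_top [simp]: "topspace (mat_topology m n) = carrier_mat m n"
	by (auto simp: mat_topology_def topspace_pullback_topology)

lemma cts_mat:
	"continuous_map X (mat_topology m n) F \<longleftrightarrow> (ALL x:topspace X. F x \<in> carrier_mat m n)
		& (ALL i<m. ALL j<n. cfun X (%x. F x $$ (i,j)))" (is "?L \<longleftrightarrow> ?R")
proof
	assume L: ?L
	have "cfun (mat_topology m n) (%A. A $$ (i,j))" if "i < m" "j < n" for i j
	proof -
		have "continuous_map (product_topology (%_. euclidean) ({..<m} \<times> {..<n})) euclidean (%f. f (i,j) :: complex)"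
			by (rule continuous_map_product_projection) (use that in auto)
		from continuous_map_pullback[OF this, of "carrier_mat m n" "%A. \<lambda>ij\<in>{..<m} \<times> {..<n}. A $$ ij"]
		show ?thesis using that by (simp add: mat_topology_def o_def)
	qed
	then have "cfun X (%x. F x $$ (i,j))" if "i < m" "j < n" for i j
		using continuous_map_compose[OF L, of euclidean "%A. A $$ (i,j)"] that by (simp add: o_def)
	then show ?R
		using continuous_map_funspace[OF L] by (simp add: Pi_iff)
next
	assume R: ?R
	have "continuous_map X (product_topology (%_. euclidean) ({..<m} \<times> {..<n}))
			((%A. \<lambda>ij\<in>{..<m} \<times> {..<n}. A $$ ij) \<circ> F)"
		using R by (auto simp: continuous_map_componentwise o_def)
	then show ?L
		unfolding mat_topology_def using R by (intro continuous_map_pullback') auto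
qed

lemma cts_mat_entry:
	"continuous_map X (mat_topology m n) F ==> i < m ==> j < n ==> cfun X (%x. F x $$ (i,j))"
	by (simp add: cts_mat)

lemma cts_mat_c:
	"continuous_map X (mat_topology m n) F ==> x \<in> topspace X ==> F x \<in> carrier_mat m n"
	by (simp add: cts_mat)

lemma cts_eq': "continuous_map X Y f ==> (!!x. x \<in> topspace X ==> f x = g x) ==> continuous_map X Y g"
	by (rule continuous_map_eq)

lemma mat_mult_entry:
	assumes "A \<in> carrier_mat m n" "B \<in> carrier_mat n l" "i < m" "j < l"
	shows "(A * B) $$ (i,j) = (\<Sum>k<n. A $$ (i,k) * B $$ (k,j))"
	using assms by (simp add: scalar_prod_def atLeast0LessThan)

lemma cts_mat_mult:
	assumes "continuous_map X (mat_topology m n) F" "continuous_map X (mat_topology n l) H"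
	shows "continuous_map X (mat_topology m l) (%x. F x * H x)"
	unfolding cts_mat
proof (intro conjI ballI allI impI)
	note c = cts_mat_c[OF assms(1)] cts_mat_c[OF assms(2)]
	show "F x * H x \<in> carrier_mat m l" if "x \<in> topspace X" for x using c[OF that] by simp
	fix i j assume ij: "i < m" "j < l"
	have "cfun X (%x. \<Sum>k<n. F x $$ (i,k) * H x $$ (k,j))"
		using assms ij by (intro cts_sum' cts_mult') (auto simp: cts_mat)
	then show "cfun X (%x. (F x * H x) $$ (i,j))"
		by (rule cts_eq') (use ij in \<open>simp only: mat_mult_entry[OF c]\<close>)
qed

lemma cts_det:
	assumes "continuous_map X (mat_topology n n) F"
	shows "cfun X (%x. det (F x))"
proof -
	have "cfun X (%x. \<Sum>p\<in>{p. p permutes {0..<n}}. signof p * (\<Prod>i\<in>{0..<n}. F x $$ (i, p i)))"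
	proof (intro cts_sum' cts_mult' cts_prod')
		fix p i assume "p \<in> {p. p permutes {0..<n}}" "i \<in> {0..<n}"
		then have "p i < n" "i < n" using permutes_in_image[of p "{0..<n}" i] by auto
		then show "cfun X (%x. F x $$ (i, p i))"
			using assms by (simp add: cts_mat)
	qed simp
	then show ?thesis
		by (rule cts_eq') (simp only: det_def'[OF cts_mat_c[OF assms]])
qed

lemma GL_iff: "A \<in> carrier (GL n) \<longleftrightarrow> A \<in> carrier_mat n n & det A ~= 0"
proof -
	have U: "carrier (GL n) = Units (ring_mat TYPE(complex) n ())" by (simp add: GL_def units_of_def)
	show ?thesis
		unfolding U
	proof
		assume A: "A \<in> Units (ring_mat TYPE(complex) n ())"
		from monoid.Units_closed[OF ring.is_monoid[OF ring_mat] this]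
		have "A \<in> carrier_mat n n" by (simp add: ring_mat_def)
		then show "A \<in> carrier_mat n n & det A ~= 0" using unit_imp_det_non_zero[OF A] by blast
	qed (auto intro: det_non_zero_imp_unit)
qed

lemma GL_simps [simp]: "A \<otimes>\<^bsub>GL n\<^esub> B = A * B" "\<one>\<^bsub>GL n\<^esub> = 1\<^sub>m n"
	by (simp_all add: GL_def units_of_def ring_mat_def)

lemma group_GL: "group (GL n)"
	unfolding GL_def by (rule monoid.units_group[OF ring.is_monoid[OF ring_mat]])

lemma GL_inv:
	assumes "A \<in> carrier (GL n)"
	shows "ginv[n] A \<in> carrier (GL n)" "ginv[n] A \<in> carrier_mat n n"
		"A * ginv[n] A = 1\<^sub>m n" "ginv[n] A * A = 1\<^sub>m n"
proof -
	interpret group "GL n" by (rule group_GL)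
	show i: "ginv[n] A \<in> carrier (GL n)" using assms by simp
	then show "ginv[n] A \<in> carrier_mat n n" using GL_iff by blast
	show "A * ginv[n] A = 1\<^sub>m n" "ginv[n] A * A = 1\<^sub>m n"
		using r_inv[OF assms] l_inv[OF assms] by simp_all
qed

lemma GL_c_mat: "A \<in> carrier (GL n) ==> A \<in> carrier_mat n n"
	by (simp add: GL_iff)

lemma GL_invI:
	assumes "A \<in> carrier_mat n n" "B \<in> carrier_mat n n" "A * B = 1\<^sub>m n"
	shows "A \<in> carrier (GL n)" "B \<in> carrier (GL n)" "ginv[n] A = B" "ginv[n] B = A" "B * A = 1\<^sub>m n"
proof -
	have "det A * det B = 1" using det_mult[OF assms(1,2)] assms(3) by simp
	then show A: "A \<in> carrier (GL n)" and B: "B \<in> carrier (GL n)" using assms GL_iff by auto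
	interpret group "GL n" by (rule group_GL)
	show "ginv[n] A = B" using inv_equality[of B A] A B assms(3) l_inv r_inv inv_comm[of A B] by auto
	then show "ginv[n] B = A" using A by auto
	show "B * A = 1\<^sub>m n" using GL_inv(4)[OF A] \<open>ginv[n] A = B\<close> by simp
qed

text \<open>Cramer's rule: the entries of the inverse are quotients of determinants, from which
  \<open>cts_GL_inv\<close> obtains continuity.\<close>

lemma GL_inv_adj:
	assumes "A \<in> carrier (GL n)"
	shows "ginv[n] A = inverse (det A) \<cdot>\<^sub>m adj_mat A"
proof (rule GL_invI(3))
	have A: "A \<in> carrier_mat n n" "det A ~= 0" using assms GL_iff by auto
	show "A \<in> carrier_mat n n" "inverse (det A) \<cdot>\<^sub>m adj_mat A \<in> carrier_mat n n"
		using A adj_mat(1)[OF A(1)] by auto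
	have "A * (inverse (det A) \<cdot>\<^sub>m adj_mat A) = inverse (det A) \<cdot>\<^sub>m (A * adj_mat A)"
		using A adj_mat(1)[OF A(1)] by (simp add: mult_smult_distrib)
	also have "\<dots> = 1\<^sub>m n" unfolding adj_mat(2)[OF A(1)] using A by (auto intro!: eq_matI)
	finally show "A * (inverse (det A) \<cdot>\<^sub>m adj_mat A) = 1\<^sub>m n" .
qed

lemma cts_GL_inv:
	assumes F: "continuous_map X (mat_topology n n) F" and inv: "!!x. x \<in> topspace X ==> F x \<in> carrier (GL n)"
	shows "continuous_map X (mat_topology n n) (%x. ginv[n] (F x))"
	unfolding cts_mat
proof (intro conjI ballI allI impI)
	show "ginv[n] (F x) \<in> carrier_mat n n" if "x \<in> topspace X" for x using GL_inv inv that by blast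
	fix i j assume ij: "i < n" "j < n"
	have "continuous_map X (mat_topology (n - 1) (n - 1)) (%x. mat_delete (F x) j i)"
		unfolding cts_mat
	proof (intro conjI ballI allI impI)
		show "mat_delete (F x) j i \<in> carrier_mat (n - 1) (n - 1)" if "x \<in> topspace X" for x
			using cts_mat_c[OF F that] by (rule mat_delete_carrier)
		fix a b assume ab: "a < n - 1" "b < n - 1"
		have "cfun X (%x. F x $$ (if a < j then a else Suc a, if b < i then b else Suc b))"
			using ab by (intro cts_mat_entry[OF F]) auto
		then show "cfun X (%x. mat_delete (F x) j i $$ (a, b))"
		proof (rule cts_eq')
			fix x assume "x \<in> topspace X"
			then have "F x \<in> carrier_mat n n" using cts_mat_c[OF F] by blast
			then show "F x $$ (if a < j then a else Suc a, if b < i then b else Suc b) = mat_delete (F x) j i $$ (a, b)"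
				using ab by (simp add: mat_delete_def)
		qed
	qed
	then have "cfun X (%x. inverse (det (F x)) * ((- 1) ^ (j + i) * det (mat_delete (F x) j i)))"
		by (intro cts_mult' cts_inverse' cts_det[OF F] cts_det)
			(use inv in \<open>auto simp: GL_iff\<close>)
	then show "cfun X (%x. (ginv[n] F x) $$ (i, j))"
	proof (rule cts_eq')
		fix x assume x: "x \<in> topspace X"
		then have "F x \<in> carrier_mat n n" using cts_mat_c[OF F] by blast
		then show "inverse (det (F x)) * ((- 1) ^ (j + i) * det (mat_delete (F x) j i)) = (ginv[n] F x) $$ (i, j)"
			using ij by (simp add: GL_inv_adj[OF inv[OF x]] adj_mat_def cofactor_def)
	qed
qed

lemma GL_kernel:
	assumes "A \<in> carrier_mat n n" "!!c :: nat => complex. (ALL i<n. (\<Sum>j<n. A $$ (i,j) * c j) = 0) ==> (ALL j<n. c j = 0)"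
	shows "A \<in> carrier (GL n)"
proof (rule ccontr)
	assume "A ~: carrier (GL n)"
	then have "det A = 0" using assms(1) GL_iff by blast
	then obtain v where v: "v \<in> carrier_vec n" "v ~= 0\<^sub>v n" "A *\<^sub>v v = 0\<^sub>v n"
		using det_0_iff_vec_prod_zero[OF assms(1)] by blast
	have "(\<Sum>j<n. A $$ (i,j) * v $ j) = 0" if "i < n" for i
	proof -
		have "(A *\<^sub>v v) $ i = 0" using v(3) that by simp
		then show ?thesis using that v(1) assms(1) by (simp add: scalar_prod_def atLeast0LessThan)
	qed
	then have "ALL j<n. v $ j = 0" using assms(2)[of "%j. v $ j"] by blast
	then have "v = 0\<^sub>v n" using v(1) by (intro eq_vecI) auto
	then show False using v(2) by blast
qed

lemma GL_kernelD:
	assumes "A \<in> carrier (GL n)" "ALL i<n. (\<Sum>j<n. A $$ (i,j) * c j) = 0" "j < n"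
	shows "c j = (0::complex)"
proof -
	have A: "A \<in> carrier_mat n n" using assms(1) GL_iff by blast
	note B = GL_inv(2,4)[OF assms(1)]
	have "A *\<^sub>v vec n c = 0\<^sub>v n"
		using assms(2) A by (intro eq_vecI) (auto simp: scalar_prod_def atLeast0LessThan)
	moreover have "ginv[n] A *\<^sub>v 0\<^sub>v n = 0\<^sub>v n"
		using B(1) by (intro eq_vecI) (auto simp: scalar_prod_def)
	ultimately have "ginv[n] A * A *\<^sub>v vec n c = 0\<^sub>v n"
		using A B(1) by (simp add: assoc_mult_mat_vec[of _ n n A n "vec n c"])
	then have "vec n c = 0\<^sub>v n" using B(2) by simp
	then have "vec n c $ j = 0\<^sub>v n $ j" by simp
	then show ?thesis using assms(3) by simp
qed

section \<open>Frames of bounded sequences\<close>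

definition cmul :: "complex => bseq => bseq" where
	"cmul c x = Bcontfun (%r. c * ap x r)"

lemma bcontfun_nat_iff: "f \<in> bcontfun \<longleftrightarrow> bounded (range (f :: nat => complex))"
	by (simp add: bcontfun_def)

lemma apply_cmul [simp]: "ap (cmul c x) r = c * ap x r"
proof -
	have "bounded (range (ap x))" using apply_bcontfun[of x] by (simp add: bcontfun_nat_iff)
	then have "bounded ((%z. c * z) ` range (ap x))"
		by (rule bounded_linear_image) (rule bounded_linear_mult_right)
	then have "(%r. c * ap x r) \<in> bcontfun"
		by (simp add: bcontfun_nat_iff image_comp o_def)
	then show ?thesis by (simp add: cmul_def Bcontfun_inverse)
qed

lemma bounded_bilinear_cmul: "bounded_bilinear cmul"
proof
	show "EX K. ALL a b. norm (cmul a b) <= norm a * norm b * K"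
	proof (intro exI[of _ 1] allI)
		fix a b
		have "norm (ap (cmul a b) r) <= norm a * norm b" for r
			using norm_bounded[of b r] by (simp add: norm_mult mult_left_mono)
		then show "norm (cmul a b) <= norm a * norm b * 1" by (simp add: norm_bound)
	qed
qed (auto intro!: bcontfun_eqI simp: algebra_simps scaleR_conv_of_real)

lemma apply_sum_bcontfun: "ap (\<Sum>i\<in>I. f i) r = (\<Sum>i\<in>I. ap (f i) r)"
	by (induction I rule: infinite_finite_induct) auto

text \<open>A frame is an injective linear map given by the images of the basis vectors, and
  \<open>fmul\<close> is precomposition with the linear map of a matrix. The group action, the
  restriction to a subspace and the pullback along a surjection all become instances.\<close>

definition fmul :: "nat => nat => (nat => bseq) => complex mat => nat => bseq" where
	"fmul n m e A = (\<lambda>j\<in>{..<m}. \<Sum>i<n. cmul (A $$ (i,j)) (e i))"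

lemma apply_fmul: "j < m ==> ap (fmul n m e A j) r = (\<Sum>i<n. ap (e i) r * A $$ (i,j))"
	by (simp add: fmul_def apply_sum_bcontfun mult.commute)

lemma frame_action_fmul: "frame_action n g e = fmul n n e (ginv[n] g)"
proof
	fix j
	have "(%r. \<Sum>i<n. ap (e i) r * (ginv[n] g) $$ (i, j))
			= ap (\<Sum>i<n. cmul ((ginv[n] g) $$ (i, j)) (e i))"
		by (simp add: fun_eq_iff apply_sum_bcontfun mult.commute)
	then show "frame_action n g e j = fmul n n e (ginv[n] g) j"
		by (simp add: frame_action_def fmul_def apply_bcontfun_inverse)
qed

lemma fmul_fmul:
	assumes "A \<in> carrier_mat n m" "B \<in> carrier_mat m l"
	shows "fmul m l (fmul n m e A) B = fmul n l e (A * B)"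
proof
	fix j
	show "fmul m l (fmul n m e A) B j = fmul n l e (A * B) j"
	proof (cases "j < l")
		case True
		show ?thesis
		proof (rule bcontfun_eqI)
			fix r
			have "(\<Sum>k<m. (\<Sum>i<n. ap (e i) r * A $$ (i,k)) * B $$ (k,j))
					= (\<Sum>i<n. ap (e i) r * (\<Sum>k<m. A $$ (i,k) * B $$ (k,j)))"
				by (simp add: sum_distrib_left sum_distrib_right mult.assoc) (rule sum.swap)
			then show "ap (fmul m l (fmul n m e A) B j) r = ap (fmul n l e (A * B) j) r"
				using True by (simp add: apply_fmul mat_mult_entry[OF assms])
		qed
	qed (simp add: fmul_def)
qed

lemma fmul_one: "e \<in> extensional {..<n} ==> fmul n n e (1\<^sub>m n) = e"
proof
	fix j assume e: "e \<in> extensional {..<n}"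
	show "fmul n n e (1\<^sub>m n) j = e j"
	proof (cases "j < n")
		case True
		show ?thesis
			by (rule bcontfun_eqI)
				(use True in \<open>simp add: apply_fmul if_distrib[of "%x. _ * x"] cong: if_cong\<close>)
	qed (use e in \<open>simp add: fmul_def extensional_def\<close>)
qed

definition mat_inj :: "nat => nat => complex mat => bool" where
	"mat_inj n m A \<longleftrightarrow> (ALL c. (ALL i<n. (\<Sum>j<m. A $$ (i,j) * c j) = 0) --> (ALL j<m. c j = 0))"

lemma framesD:
	"e \<in> frames n ==> (!!r. (\<Sum>i<n. c i * ap (e i) r) = 0) ==> i < n ==> c i = 0"
	unfolding frames_def by blast

lemma framesI:
	"e \<in> extensional {..<n} ==>
		(!!c i. (!!r. (\<Sum>i<n. c i * ap (e i) r) = 0) ==> i < n ==> c i = 0) ==> e \<in> frames n"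
	unfolding frames_def by blast

lemma fmul_frames:
	assumes e: "e \<in> frames n" and A: "mat_inj n m A"
	shows "fmul n m e A \<in> frames m"
proof (rule framesI)
	show "fmul n m e A \<in> extensional {..<m}" by (simp add: fmul_def)
	fix c j assume *: "!!r. (\<Sum>i<m. c i * ap (fmul n m e A i) r) = 0" and j: "j < m"
	have "(\<Sum>j<m. A $$ (i,j) * c j) = 0" if "i < n" for i
	proof (rule framesD[OF e _ that])
		fix r
		have "(\<Sum>i<n. (\<Sum>j<m. A $$ (i,j) * c j) * ap (e i) r)
				= (\<Sum>j<m. c j * (\<Sum>i<n. ap (e i) r * A $$ (i,j)))"
			by (simp add: sum_distrib_left sum_distrib_right mult_ac) (rule sum.swap)
		also have "\<dots> = (\<Sum>i<m. c i * ap (fmul n m e A i) r)" by (simp add: apply_fmul)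
		finally show "(\<Sum>i<n. (\<Sum>j<m. A $$ (i,j) * c j) * ap (e i) r) = 0" using * by simp
	qed
	then show "c j = 0" using A j unfolding mat_inj_def by blast
qed

lemma mat_inj_GL: "A \<in> carrier (GL n) ==> mat_inj n n A"
	unfolding mat_inj_def using GL_kernelD by blast

lemma frame_action_frames: "g \<in> carrier (GL n) ==> e \<in> frames n ==> frame_action n g e \<in> frames n"
	unfolding frame_action_fmul by (rule fmul_frames) (auto intro: mat_inj_GL GL_inv)

lemma frames_extensional: "e \<in> frames n ==> e \<in> extensional {..<n}"
	by (simp add: frames_def)

lemma frame_action_one: "e \<in> frames n ==> frame_action n (1\<^sub>m n) e = e"
proof -
	assume e: "e \<in> frames n"
	have "ginv[n] (1\<^sub>m n) = 1\<^sub>m n" by (rule GL_invI(3)) auto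
	then show ?thesis using e by (simp add: frame_action_fmul fmul_one frames_extensional)
qed

lemma GL_inv_mult:
	assumes "g \<in> carrier (GL n)" "h \<in> carrier (GL n)"
	shows "ginv[n] (g * h) = ginv[n] h * ginv[n] g"
	using group.inv_mult_group[OF group_GL assms] by simp

lemma frame_action_mult:
	assumes "g \<in> carrier (GL n)" "h \<in> carrier (GL n)"
	shows "frame_action n (g * h) e = frame_action n g (frame_action n h e)"
	using assms GL_inv(2) by (simp add: frame_action_fmul fmul_fmul GL_inv_mult)

lemma tops_frame_top [simp]: "topspace (frame_topology n) = frames n"
	by (auto simp: frame_topology_def frames_def PiE_def)

lemma cts_frame:
	"continuous_map X (frame_topology n) F \<longleftrightarrow>
		(ALL x:topspace X. F x \<in> frames n) & (ALL i<n. cfun X (%x. F x i))"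
	unfolding frame_topology_def continuous_map_in_subtopology continuous_map_componentwise
	using frames_extensional by (auto simp: image_subset_iff)

lemma cts_apply_bcontfun:
	assumes "cfun X F"
	shows "cfun X (%x. ap (F x) (r::nat) :: complex)"
proof (rule cts_compose_UNIV[OF assms])
	have "bounded_linear (%f. ap f r :: complex)"
		by (rule bounded_linear_intro[of _ 1]) (auto simp: norm_bounded)
	then show "continuous_on UNIV (%f. ap f r :: complex)"
		by (rule bounded_linear.continuous_on) (rule continuous_on_id)
qed

lemma cts_fmul:
	assumes "!!i. i < n ==> cfun X (%x. e x i)" "continuous_map X (mat_topology n m) A" "j < m"
	shows "cfun X (%x. fmul n m (e x) (A x) j)"
	unfolding fmul_def using assms
	by (simp, intro cts_sum' cts_bilinear[OF bounded_bilinear_cmul])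
		(auto simp: cts_mat)

section \<open>Representation stacks as orbit spaces\<close>

lemma GL_dim_iff: "g \<in> carrier (GL_dim Q dm) \<longleftrightarrow> g \<in> extensional (verts Q) & (ALL i:verts Q. g i \<in> carrier (GL (dm i)))"
	by (auto simp: GL_dim_def PiE_def)

lemma group_GL_dim: "group (GL_dim Q dm)"
	unfolding GL_dim_def by (rule product_group) (rule group_GL)

lemma GL_dim_simps [simp]:
	"g \<otimes>\<^bsub>GL_dim Q dm\<^esub> h = (\<lambda>i\<in>verts Q. g i * h i)" "\<one>\<^bsub>GL_dim Q dm\<^esub> = (\<lambda>i\<in>verts Q. 1\<^sub>m (dm i))"
	by (simp_all add: GL_dim_def)

lemma tops_EGL: "topspace (EGL_topology Q dm) = (\<Pi>\<^sub>E i\<in>verts Q. frames (dm i))"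
	by (simp add: EGL_topology_def)

lemma tops_rep: "topspace (rep_topology Q dm) = (\<Pi>\<^sub>E a\<in>arcs Q. carrier_mat (dm (head Q a)) (dm (tail Q a)))"
	by (simp add: rep_topology_def)

lemma cts_EGL:
	"continuous_map X (EGL_topology Q dm) F \<longleftrightarrow> (ALL x:topspace X. F x \<in> extensional (verts Q))
		& (ALL i:verts Q. continuous_map X (frame_topology (dm i)) (%x. F x i))"
	by (auto simp: EGL_topology_def continuous_map_componentwise image_subset_iff)

lemma cts_rep:
	"continuous_map X (rep_topology Q dm) F \<longleftrightarrow> (ALL x:topspace X. F x \<in> extensional (arcs Q))
		& (ALL a:arcs Q. continuous_map X (mat_topology (dm (head Q a)) (dm (tail Q a))) (%x. F x a))"
	by (auto simp: rep_topology_def continuous_map_componentwise image_subset_iff)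

lemma acts_on_EGL: "acts_on (GL_dim Q dm) (EGL_action Q dm) (topspace (EGL_topology Q dm))"
	unfolding acts_on_def
proof (intro conjI ballI)
	fix g e assume g: "g \<in> carrier (GL_dim Q dm)" and e: "e \<in> topspace (EGL_topology Q dm)"
	show "EGL_action Q dm g e \<in> topspace (EGL_topology Q dm)"
		using g e by (auto simp: EGL_action_def tops_EGL GL_dim_iff intro: frame_action_frames)
next
	fix e assume e: "e \<in> topspace (EGL_topology Q dm)"
	show "EGL_action Q dm \<one>\<^bsub>GL_dim Q dm\<^esub> e = e"
	proof
		fix i show "EGL_action Q dm \<one>\<^bsub>GL_dim Q dm\<^esub> e i = e i"
			using e frame_action_one[of "e i" "dm i"]
			by (cases "i \<in> verts Q") (auto simp: EGL_action_def tops_EGL PiE_iff extensional_def)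
	qed
next
	fix g h e assume "g \<in> carrier (GL_dim Q dm)" "h \<in> carrier (GL_dim Q dm)"
	then show "EGL_action Q dm (g \<otimes>\<^bsub>GL_dim Q dm\<^esub> h) e = EGL_action Q dm g (EGL_action Q dm h e)"
		by (auto simp: EGL_action_def GL_dim_iff fun_eq_iff frame_action_mult)
qed (rule group_GL_dim)

lemma acts_on_rep:
	assumes "fin_digraph Q"
	shows "acts_on (GL_dim Q dm) (base_change Q dm) (topspace (rep_topology Q dm))"
proof -
	interpret fin_digraph Q by fact
	note w [simp] = head_in_verts tail_in_verts
	show ?thesis
	unfolding acts_on_def
proof (intro conjI ballI)
	fix g \<rho> assume g: "g \<in> carrier (GL_dim Q dm)" and r: "\<rho> \<in> topspace (rep_topology Q dm)"
	show "base_change Q dm g \<rho> \<in> topspace (rep_topology Q dm)"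
		unfolding tops_rep base_change_def
	proof (rule restrict_PiE_iff[THEN iffD2], rule ballI)
		fix a assume a: "a \<in> arcs Q"
		have "g (head Q a) \<in> carrier_mat (dm (head Q a)) (dm (head Q a))"
			"ginv[dm (tail Q a)] g (tail Q a) \<in> carrier_mat (dm (tail Q a)) (dm (tail Q a))"
			"\<rho> a \<in> carrier_mat (dm (head Q a)) (dm (tail Q a))"
			using a g r GL_inv(2) GL_c_mat by (auto simp: GL_dim_iff tops_rep)
		then show "g (head Q a) * \<rho> a * ginv[dm (tail Q a)] g (tail Q a) \<in> carrier_mat (dm (head Q a)) (dm (tail Q a))"
			by auto
	qed
next
	fix \<rho> assume r: "\<rho> \<in> topspace (rep_topology Q dm)"
	show "base_change Q dm \<one>\<^bsub>GL_dim Q dm\<^esub> \<rho> = \<rho>"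
	proof
		fix a show "base_change Q dm \<one>\<^bsub>GL_dim Q dm\<^esub> \<rho> a = \<rho> a"
		proof (cases "a \<in> arcs Q")
			case True
			have "ginv[n] (1\<^sub>m n) = 1\<^sub>m n" for n by (rule GL_invI(3)) auto
			moreover have "\<rho> a \<in> carrier_mat (dm (head Q a)) (dm (tail Q a))" using r True by (auto simp: tops_rep)
			ultimately show ?thesis using True by (simp add: base_change_def)
		next
			case False then show ?thesis using r by (auto simp: base_change_def tops_rep PiE_def extensional_def)
		qed
	qed
next
	fix g h \<rho> assume g: "g \<in> carrier (GL_dim Q dm)" and h: "h \<in> carrier (GL_dim Q dm)"
		and r: "\<rho> \<in> topspace (rep_topology Q dm)"
	show "base_change Q dm (g \<otimes>\<^bsub>GL_dim Q dm\<^esub> h) \<rho> = base_change Q dm g (base_change Q dm h \<rho>)"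
	proof
		fix a show "base_change Q dm (g \<otimes>\<^bsub>GL_dim Q dm\<^esub> h) \<rho> a = base_change Q dm g (base_change Q dm h \<rho>) a"
		proof (cases "a \<in> arcs Q")
			case a: True
			let ?n = "dm (head Q a)" and ?m = "dm (tail Q a)"
			have G: "g (head Q a) \<in> carrier (GL ?n)" "h (head Q a) \<in> carrier (GL ?n)"
				"g (tail Q a) \<in> carrier (GL ?m)" "h (tail Q a) \<in> carrier (GL ?m)"
				using a g h by (auto simp: GL_dim_iff)
			have r: "\<rho> a \<in> carrier_mat ?n ?m" using r a by (auto simp: tops_rep)
			note c = G(1,2)[THEN GL_c_mat] G(3,4)[THEN GL_inv(2)] r
			have "g (head Q a) * h (head Q a) * \<rho> a * (ginv[?m] h (tail Q a) * ginv[?m] g (tail Q a))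
					= g (head Q a) * (h (head Q a) * \<rho> a * ginv[?m] h (tail Q a)) * ginv[?m] g (tail Q a)"
				using c by (simp add: assoc_mult_mat[of _ ?n ?n _ ?n _ ?m] assoc_mult_mat[of _ ?n ?n _ ?m _ ?m] assoc_mult_mat[of _ ?n ?m _ ?m _ ?m] mult_carrier_mat)
			then show ?thesis using a by (simp add: base_change_def GL_inv_mult[OF G(3,4)])
		qed (simp add: base_change_def)
	qed
qed (rule group_GL_dim)
qed

lemma cts_frame_action:
	assumes g: "continuous_map X (mat_topology n n) g" "!!x. x \<in> topspace X ==> g x \<in> carrier (GL n)"
		and e: "continuous_map X (frame_topology n) e"
	shows "continuous_map X (frame_topology n) (%x. frame_action n (g x) (e x))"
	unfolding cts_frame
proof (intro conjI ballI allI impI)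
	fix x assume "x \<in> topspace X"
	then show "frame_action n (g x) (e x) \<in> frames n"
		using frame_action_frames g(2) e by (auto simp: cts_frame)
next
	fix i assume "i < n"
	then show "cfun X (%x. frame_action n (g x) (e x) i)"
		unfolding frame_action_fmul
		using e by (intro cts_fmul cts_GL_inv g) (auto simp: cts_frame)
qed

lemma cts_EGL_action:
	assumes g: "!!i. i \<in> verts Q ==> continuous_map X (mat_topology (dm i) (dm i)) (%x. g x i)"
		"!!x. x \<in> topspace X ==> g x \<in> carrier (GL_dim Q dm)"
		and e: "continuous_map X (EGL_topology Q dm) e"
	shows "continuous_map X (EGL_topology Q dm) (%x. EGL_action Q dm (g x) (e x))"
	unfolding cts_EGL
proof (intro conjI ballI)
	fix i assume i: "i \<in> verts Q"
	have "continuous_map X (frame_topology (dm i)) (%x. frame_action (dm i) (g x i) (e x i))"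
		using g i e by (intro cts_frame_action) (auto simp: GL_dim_iff cts_EGL)
	then show "continuous_map X (frame_topology (dm i)) (%x. EGL_action Q dm (g x) (e x) i)"
		using i by (simp add: EGL_action_def)
qed (simp add: EGL_action_def)

lemma cts_base_change:
	assumes Q: "fin_digraph Q"
		and g: "!!i. i \<in> verts Q ==> continuous_map X (mat_topology (dm i) (dm i)) (%x. g x i)"
		"!!x. x \<in> topspace X ==> g x \<in> carrier (GL_dim Q dm)"
		and r: "continuous_map X (rep_topology Q dm) r"
	shows "continuous_map X (rep_topology Q dm) (%x. base_change Q dm (g x) (r x))"
	unfolding cts_rep
proof (intro conjI ballI)
	interpret fin_digraph Q by fact
	fix a assume a: "a \<in> arcs Q"
	let ?n = "dm (head Q a)" and ?m = "dm (tail Q a)"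
	have "continuous_map X (mat_topology ?n ?m) (%x. g x (head Q a) * r x a * ginv[?m] (g x (tail Q a)))"
		using a g r
		by (intro cts_mat_mult[of _ ?n ?m] cts_mat_mult[of _ ?n ?n] cts_GL_inv)
			(auto simp: cts_rep GL_dim_iff)
	then show "continuous_map X (mat_topology ?n ?m) (%x. base_change Q dm (g x) (r x) a)"
		using a by (simp add: base_change_def)
qed (simp add: base_change_def)

lemma acts_on_prod:
	assumes "acts_on G act S" "acts_on G act' T"
	shows "acts_on G (%g (x, y). (act g x, act' g y)) (S \<times> T)"
	using assms by (auto simp: acts_on_def)

definition stk_act :: "('v, 'a) pre_digraph => ('v => nat) => ('v => complex mat)
		=> ('v => nat => bseq) \<times> ('a => complex mat) => ('v => nat => bseq) \<times> ('a => complex mat)" where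
	"stk_act Q dm = (%g (e, x). (EGL_action Q dm g e, base_change Q dm g x))"

definition stk_top where
	"stk_top Q dm = prod_topology (EGL_topology Q dm) (rep_topology Q dm)"

definition stk_proj where
	"stk_proj Q dm = orbit (GL_dim Q dm) (stk_act Q dm)"

lemma quot_map_stk: "quotient_map (stk_top Q dm) (rep_stack Q dm) (stk_proj Q dm)"
	unfolding rep_stack_def borel_construction_def stk_top_def stk_proj_def stk_act_def
	by (rule quotient_map_quotient_topology)

lemma acts_on_stk: "fin_digraph Q ==> acts_on (GL_dim Q dm) (stk_act Q dm) (topspace (stk_top Q dm))"
	unfolding stk_act_def stk_top_def topspace_prod_topology
	by (intro acts_on_prod acts_on_EGL acts_on_rep)

lemma cts_stk_act:
	assumes "fin_digraph Q"
		and "!!i. i \<in> verts Q ==> continuous_map X (mat_topology (dm i) (dm i)) (%x. g x i)"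
		"!!x. x \<in> topspace X ==> g x \<in> carrier (GL_dim Q dm)"
		and "continuous_map X (stk_top Q dm) f"
	shows "continuous_map X (stk_top Q dm) (%x. stk_act Q dm (g x) (f x))"
proof -
	have "continuous_map X (EGL_topology Q dm) (%x. EGL_action Q dm (g x) (fst (f x)))"
		"continuous_map X (rep_topology Q dm) (%x. base_change Q dm (g x) (snd (f x)))"
		using assms by (auto intro!: cts_EGL_action cts_base_change
				simp: stk_top_def continuous_map_pairwise o_def)
	then show ?thesis by (simp add: stk_top_def stk_act_def continuous_map_pairwise o_def case_prod_unfold)
qed

section \<open>Schubert cells of representation stacks\<close>

text \<open>Padded with zero rows, the equations form a square matrix that cannot be invertible and
  therefore has a kernel vector.\<close>

lemma underdetermined:
	fixes a :: "'r => 'i => complex"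
	assumes S: "finite S" and C: "finite C" and lt: "card S < card C"
	shows "EX c. (EX i:C. c i ~= 0) & (ALL r:S. (\<Sum>i\<in>C. c i * a r i) = 0)"
proof -
	obtain f where f: "bij_betw f {..<card S} S"
		using S by (metis bij_betw_from_nat_into_finite)
	obtain g where g: "bij_betw g {..<card C} C"
		using C by (metis bij_betw_from_nat_into_finite)
	let ?n = "card C"
	define M where "M = mat ?n ?n (%(p,i). if p < card S then a (f p) (g i) else 0)"
	have M: "M \<in> carrier_mat ?n ?n" by (simp add: M_def)
	\<comment> \<open>Row \<open>card S\<close> of \<open>M\<close> is zero, so the corresponding
	  diagonal entry of \<open>M\<close> times an inverse would be 0 instead of 1.\<close>
	have "M ~: carrier (GL ?n)"
	proof
		assume G: "M \<in> carrier (GL ?n)"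
		have "(M * ginv[?n] M) $$ (card S, card S) = 0"
			using lt mat_mult_entry[OF M GL_inv(2)[OF G], of "card S" "card S"] by (simp add: M_def)
		then show False using GL_inv(3)[OF G] lt by simp
	qed
	then obtain v where v: "ALL i<?n. (\<Sum>j<?n. M $$ (i,j) * v j) = 0" "EX j<?n. v j ~= 0"
		using GL_kernel[OF M] by blast
	define c where "c i = v (inv_into {..<?n} g i)" for i
	have cg: "c (g j) = v j" if "j < ?n" for j
		using g that by (simp add: c_def bij_betw_def)
	have "(\<Sum>i\<in>C. c i * a r i) = 0" if r: "r \<in> S" for r
	proof -
		obtain p where p: "p < card S" "r = f p" using f r unfolding bij_betw_def by blast
		have "(\<Sum>i\<in>C. c i * a r i) = (\<Sum>j<?n. c (g j) * a r (g j))"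
			by (rule sum.reindex_bij_betw[OF g, symmetric])
		also have "\<dots> = (\<Sum>j<?n. M $$ (p,j) * v j)"
			using p lt by (intro sum.cong) (auto simp: M_def cg)
		finally show ?thesis using v(1) p lt by simp
	qed
	moreover have "EX i:C. c i ~= 0"
		using v(2) cg g unfolding bij_betw_def by (metis imageI lessThan_iff)
	ultimately show ?thesis by blast
qed

section \<open>Minors, pivot forms and the comparison of cells\<close>

definition nm :: "nat set => nat => nat" where "nm S k = sorted_list_of_set S ! k"

lemma bij_betw_nm: "finite S ==> bij_betw (nm S) {..<card S} S"
	unfolding nm_def by (rule bij_betw_nth) auto

definition minor :: "nat => nat set => (nat => bseq) => complex mat" where
	"minor n S e = mat n n (%(r,c). ap (e c) (nm S r))"

definition rows_indep :: "nat => nat set => (nat => bseq) => bool" where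
	"rows_indep n S e \<longleftrightarrow> (ALL c. (ALL r:S. (\<Sum>i<n. c i * ap (e i) r) = 0) --> (ALL i<n. c i = 0))"

lemma minor_c: "minor n S e \<in> carrier_mat n n"
	by (simp add: minor_def)

lemma minor_GL_iff:
	assumes "finite S" "card S = n"
	shows "minor n S e \<in> carrier (GL n) \<longleftrightarrow> rows_indep n S e"
proof -
	have S: "nm S ` {..<n} = S" using bij_betw_nm[OF assms(1)] assms(2) by (simp add: bij_betw_def)
	have eq: "(\<Sum>j<n. minor n S e $$ (i,j) * c j) = (\<Sum>j<n. c j * ap (e j) (nm S i))" if "i < n" for c i
		using that by (simp add: minor_def mult.commute)
	have iff: "(ALL i<n. (\<Sum>j<n. minor n S e $$ (i,j) * c j) = 0) \<longleftrightarrow> (ALL r:S. (\<Sum>i<n. c i * ap (e i) r) = 0)" for c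
	proof -
		have "(ALL r:nm S ` {..<n}. (\<Sum>i<n. c i * ap (e i) r) = 0)
				\<longleftrightarrow> (ALL i<n. (\<Sum>j<n. minor n S e $$ (i,j) * c j) = 0)"
			using eq by auto
		then show ?thesis unfolding S by blast
	qed
	show ?thesis
	proof
		assume "minor n S e \<in> carrier (GL n)"
		then show "rows_indep n S e" unfolding rows_indep_def iff[symmetric] using GL_kernelD by blast
	next
		assume "rows_indep n S e"
		then show "minor n S e \<in> carrier (GL n)"
			unfolding rows_indep_def iff[symmetric] using minor_c by (intro GL_kernel) blast+
	qed
qed

lemma minor_frame_action:
	assumes g: "g \<in> carrier (GL n)"
	shows "minor n S (frame_action n g e) = minor n S e * ginv[n] g"
proof (rule eq_matI)
	note c = minor_c[of n S e] GL_inv(2)[OF g]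
	show "dim_row (minor n S (frame_action n g e)) = dim_row (minor n S e * ginv[n] g)"
		"dim_col (minor n S (frame_action n g e)) = dim_col (minor n S e * ginv[n] g)"
		using c by (auto simp: minor_def)
	fix i j assume "i < dim_row (minor n S e * ginv[n] g)" "j < dim_col (minor n S e * ginv[n] g)"
	then have "i < n" "j < n" using c by auto
	then show "minor n S (frame_action n g e) $$ (i, j) = (minor n S e * ginv[n] g) $$ (i, j)"
		by (simp add: mat_mult_entry[OF c]) (simp add: minor_def frame_action_fmul apply_fmul)
qed

lemma rows_indep_frame: "rows_indep n S e ==> e \<in> extensional {..<n} ==> e \<in> frames n"
	unfolding rows_indep_def frames_def by blast

text \<open>Independent rows are collected one at a time. While fewer than \<open>n\<close> are
  chosen, some nontrivial combination of the frame vectors vanishes on all of them; independence of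
  the frame gives a row where it does not vanish, and that row is independent of the earlier
  ones.\<close>

lemma exists_rows_indep:
	assumes e: "e \<in> frames n"
	shows "EX S. finite S & card S = n & rows_indep n S e"
proof -
	have "EX S. finite S & card S = k &
			(ALL a. (ALL i<n. (\<Sum>r\<in>S. a r * ap (e i) r) = 0) --> (ALL r:S. a r = 0))" if "k <= n" for k
		using that
	proof (induction k)
		case 0 then show ?case by (intro exI[of _ "{}"]) auto
	next
		case (Suc k)
		then obtain S where S: "finite S" "card S = k"
			"!!a. (ALL i<n. (\<Sum>r\<in>S. a r * ap (e i) r) = 0) ==> (ALL r:S. a r = 0)" by auto
		obtain c where c: "EX i:{..<n}. c i ~= 0" "ALL r:S. (\<Sum>i\<in>{..<n}. c i * ap (e i) r) = 0"
			using underdetermined[OF S(1), of "{..<n}" "%r i. ap (e i) r"] S(2) Suc.prems by auto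
		then obtain r where r: "(\<Sum>i<n. c i * ap (e i) r) ~= 0"
			using framesD[OF e, of c] by (metis lessThan_iff)
		have rS: "r ~: S" using c(2) r by auto
		have new: "ALL s:insert r S. a s = 0"
			if a: "ALL i<n. (\<Sum>s\<in>insert r S. a s * ap (e i) s) = 0" for a
		proof -
			have "0 = (\<Sum>i<n. c i * (\<Sum>s\<in>insert r S. a s * ap (e i) s))" using a by simp
			also have "\<dots> = (\<Sum>s\<in>insert r S. a s * (\<Sum>i<n. c i * ap (e i) s))"
				unfolding sum_distrib_left by (subst sum.swap) (simp add: mult_ac)
			also have "\<dots> = a r * (\<Sum>i<n. c i * ap (e i) r)"
				using c(2) rS S(1) by simp
			finally have ar: "a r = 0" using r by simp
			then have "ALL i<n. (\<Sum>s\<in>S. a s * ap (e i) s) = 0" using a rS S(1) by simp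
			then show ?thesis using S(3)[of a] ar by blast
		qed
		show ?case
		proof (intro exI[of _ "insert r S"] conjI allI impI)
			show "finite (insert r S)" "card (insert r S) = Suc k" using S(1,2) rS by auto
		qed (rule new)
	qed
	from this[OF order_refl] obtain S where S: "finite S" "card S = n"
		and S3: "ALL a. (ALL i<n. (\<Sum>r\<in>S. a r * ap (e i) r) = 0) --> (ALL r:S. a r = 0)"
		by (elim exE conjE)
	have b: "bij_betw (nm S) {..<n} S" using bij_betw_nm S by blast
	\<comment> \<open>Independence of the rows is injectivity of the transposed minor; the determinant
	  carries invertibility over to the minor itself.\<close>
	have "transpose_mat (minor n S e) \<in> carrier (GL n)"
	proof (rule GL_kernel)
		fix v assume v: "ALL i<n. (\<Sum>j<n. transpose_mat (minor n S e) $$ (i,j) * v j) = 0"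
		define a where "a r = v (inv_into {..<n} (nm S) r)" for r
		have an: "a (nm S j) = v j" if "j < n" for j
			using b that by (simp add: a_def bij_betw_def)
		have "(\<Sum>r\<in>S. a r * ap (e i) r) = 0" if "i < n" for i
		proof -
			have "(\<Sum>r\<in>S. a r * ap (e i) r) = (\<Sum>j<n. a (nm S j) * ap (e i) (nm S j))"
				by (rule sum.reindex_bij_betw[OF b, symmetric])
			also have "\<dots> = (\<Sum>j<n. transpose_mat (minor n S e) $$ (i,j) * v j)"
				using that by (intro sum.cong) (auto simp: minor_def an)
			finally show ?thesis using v that by simp
		qed
		then have "ALL r:S. a r = 0" using S3[rule_format, of a] by blast
		then show "ALL j<n. v j = 0" using an b unfolding bij_betw_def by (metis imageI lessThan_iff)
	qed (simp add: minor_def)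
	then have "minor n S e \<in> carrier (GL n)"
		using det_transpose[OF minor_c[of n S e]] minor_c[of n S e] by (simp add: GL_iff)
	then show ?thesis using minor_GL_iff S(1,2) by blast
qed

definition pivot_form :: "nat => nat set => (nat => bseq) => bool" where
	"pivot_form n S e \<longleftrightarrow> (ALL c<n. ALL r<n. ap (e c) (nm S r) = of_bool (r = c))"

lemma pivot_form_minor: "pivot_form n S e \<longleftrightarrow> minor n S e = 1\<^sub>m n"
	by (auto simp: pivot_form_def minor_def mat_eq_iff)

text \<open>At the remaining pivots a vanishing combination shows its coefficients, so all of them
  but the one at \<open>c\<close> are zero; the nonzero entry in row \<open>r\<close> removes that
  one.\<close>

lemma exchange_pivot:
	assumes S: "finite S" "card S = n" and e: "pivot_form n S e" and c: "c < n" and r: "r ~: S"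
		and nz: "ap (e c) r ~= 0"
	shows "rows_indep n (insert r (S - {nm S c})) e"
	unfolding rows_indep_def
proof (intro allI impI)
	fix a i assume a: "ALL r:insert r (S - {nm S c}). (\<Sum>i<n. a i * ap (e i) r) = 0" and i: "i < n"
	have b: "bij_betw (nm S) {..<n} S" using bij_betw_nm S by blast
	have other: "a j = 0" if "j < n" "j ~= c" for j
	proof -
		have "nm S j \<in> S - {nm S c}" using b that c unfolding bij_betw_def inj_on_def by blast
		then have "(\<Sum>i<n. a i * ap (e i) (nm S j)) = 0" using a by blast
		moreover have "(\<Sum>i<n. a i * ap (e i) (nm S j)) = (\<Sum>i<n. if i = j then a i else 0)"
			by (rule sum.cong) (use e that in \<open>auto simp: pivot_form_def\<close>)
		ultimately show ?thesis using that by simp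
	qed
	have "(\<Sum>i<n. a i * ap (e i) r) = (\<Sum>i<n. if i = c then a c * ap (e c) r else 0)"
		by (rule sum.cong) (use other in auto)
	then have "a c * ap (e c) r = 0" using a c by simp
	then show "a i = 0" using other nz i by (cases "i = c") auto
qed

text \<open>On the cell, the vectors with pivot at least \<open>t\<close> vanish in all rows smaller
  than \<open>t\<close>. If \<open>T\<close> had more rows smaller than \<open>t\<close> than
  \<open>S\<close>, fewer rows than such vectors would be left in \<open>T\<close>, and a nontrivial
  combination of these vectors would vanish on all of \<open>T\<close>.\<close>

lemma cell_rows_count:
	assumes S: "finite S" "card S = n" and e: "pivot_form n S e"
		and cell: "!!c r. c < n ==> r ~: S ==> r < nm S c ==> ap (e c) r = 0"
		and T: "finite T" "card T = n" "rows_indep n T e"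
	shows "card (T Int {..<t}) <= card (S Int {..<t})"
proof (rule ccontr)
	assume gt: "\<not> card (T Int {..<t}) <= card (S Int {..<t})"
	have b: "bij_betw (nm S) {..<n} S" using bij_betw_nm S by blast
	define C where "C = {c. c < n & t <= nm S c}"
	have "bij_betw (nm S) C (S - {..<t})"
	proof (rule bij_betw_imageI)
		show "inj_on (nm S) C"
			using b unfolding bij_betw_def C_def by (rule conjE) (erule inj_on_subset, auto)
		show "nm S ` C = S - {..<t}"
		proof (intro equalityI subsetI)
			fix s assume "s \<in> S - {..<t}"
			moreover then obtain k where "k < n" "s = nm S k" using b unfolding bij_betw_def by blast
			ultimately show "s \<in> nm S ` C" by (auto simp: C_def)
		qed (use b in \<open>auto simp: C_def bij_betw_def\<close>)
	qed
	then have cC: "card C = card (S - {..<t})" by (rule bij_betw_same_card)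
	have split: "card (A Int {..<t}) + card (A - {..<t}) = card A" if "finite A" for A :: "nat set"
		using card_Un_disjoint[of "A Int {..<t}" "A - {..<t}"] that by (simp add: Int_Diff_Un Int_Diff_disjoint)
	have "card (T - {..<t}) < card C"
		using split[OF S(1)] split[OF T(1)] gt cC S T by linarith
	then obtain c where c: "EX i:C. c i ~= 0" "ALL r:T - {..<t}. (\<Sum>i\<in>C. c i * ap (e i) r) = 0"
		using underdetermined[of "T - {..<t}" C "%r i. ap (e i) r"] T(1)
		by (auto simp: C_def)
	define a where "a i = (if i \<in> C then c i else 0)" for i
	have sumC: "(\<Sum>i<n. a i * ap (e i) r) = (\<Sum>i\<in>C. c i * ap (e i) r)" for r
		unfolding a_def
		by (rule sum.mono_neutral_cong_right) (auto simp: C_def)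
	have "(\<Sum>i<n. a i * ap (e i) r) = 0" if r: "r \<in> T" for r
	proof (cases "r < t")
		case False
		then show ?thesis using sumC c(2) r by simp
	next
		case True
		have "ap (e i) r = 0" if i: "i \<in> C" for i
		proof (cases "r \<in> S")
			case False
			then show ?thesis using cell[of i r] i True by (auto simp: C_def)
		next
			case rS: True
			then obtain k where k: "k < n" "r = nm S k" using b by (auto simp: bij_betw_def)
			then have "k ~= i" using i True by (auto simp: C_def)
			then show ?thesis using e k i by (auto simp: pivot_form_def C_def)
		qed
		then show ?thesis unfolding sumC by simp
	qed
	then have "ALL i<n. a i = 0" using T(3) unfolding rows_indep_def by blast
	then show False using c(1) by (auto simp: a_def C_def)
qed

text \<open>Double counting: each element \<open>s\<close> contributes \<open>s\<close> to the first
  sum and M - 1 - \<open>s\<close> to the second.\<close>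

lemma sum_eq_counts:
	assumes "finite S" "S <= {..<M::nat}"
	shows "\<Sum>S + (\<Sum>t\<in>{1..<M}. card (S Int {..<t})) = (M - 1) * card S"
	using assms
proof (induction S rule: finite_induct)
	case (insert s S)
	have "card (insert s S Int {..<t}) = card (S Int {..<t}) + of_bool (s < t)" for t
		using insert.hyps by (cases "s < t") auto
	then have "(\<Sum>t\<in>{1..<M}. card (insert s S Int {..<t})) = (\<Sum>t\<in>{1..<M}. card (S Int {..<t})) + (\<Sum>t\<in>{1..<M}. of_bool (s < t))"
		by (simp add: sum.distrib)
	moreover have "(\<Sum>t\<in>{1..<M}. of_bool (s < t) :: nat) = card {t\<in>{1..<M}. s < t}"
		by (simp add: of_bool_def flip: sum.inter_filter)
	moreover have "{t\<in>{1..<M}. s < t} = {Suc s..<M}" by auto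
	ultimately have A: "(\<Sum>t\<in>{1..<M}. card (insert s S Int {..<t})) = (\<Sum>t\<in>{1..<M}. card (S Int {..<t})) + (M - Suc s)"
		by simp
	have "card (insert s S) = Suc (card S)" "\<Sum>(insert s S) = s + \<Sum>S" "s < M" using insert.hyps insert.prems by auto
	moreover have "\<Sum>S + (\<Sum>t\<in>{1..<M}. card (S Int {..<t})) = (M - 1) * card S" using insert by simp
	ultimately show ?case unfolding A by (simp only: mult_Suc_right)
qed simp

text \<open>By \<open>sum_eq_counts\<close> the sum of a set and the sum of its counts add up to a
  constant, so larger counts mean a smaller sum. Equal sums force all counts to agree, and
  membership is read off from consecutive counts.\<close>

lemma sum_le_of_counts:
	assumes "finite S" "finite T" "card S = card T" "!!t. card (T Int {..<t}) <= card (S Int {..<t})"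
	shows "\<Sum>S <= (\<Sum>T :: nat)" and "\<Sum>S = \<Sum>T ==> S = T"
proof -
	obtain M where M: "S Un T <= {..<M}" using assms(1,2) finite_nat_set_iff_bounded[of "S Un T"] by blast
	have S: "\<Sum>S + (\<Sum>t\<in>{1..<M}. card (S Int {..<t})) = (M - 1) * card S" using sum_eq_counts[of S M] assms(1) M by simp
	have T: "\<Sum>T + (\<Sum>t\<in>{1..<M}. card (T Int {..<t})) = (M - 1) * card S" using sum_eq_counts[of T M] assms M by simp
	have le: "(\<Sum>t\<in>{1..<M}. card (T Int {..<t})) <= (\<Sum>t\<in>{1..<M}. card (S Int {..<t}))"
		by (rule sum_mono) (rule assms(4))
	then show "\<Sum>S <= \<Sum>T" using S T by linarith
	assume "\<Sum>S = \<Sum>T"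
	then have "(\<Sum>t\<in>{1..<M}. card (T Int {..<t})) = (\<Sum>t\<in>{1..<M}. card (S Int {..<t}))" using S T by linarith
	then have eq: "card (T Int {..<t}) = card (S Int {..<t})" if "t \<in> {1..<M}" for t
		by (rule sum_mono_inv[of "%t. card (T Int {..<t})" "{1..<M}" "%t. card (S Int {..<t})" t]) (use that assms(4) in simp_all)
	have eq': "card (T Int {..<t}) = card (S Int {..<t})" for t
	proof (cases "t = 0 \<or> t \<ge> M")
		case True
		then show ?thesis
		proof
			assume "M <= t"
			then have "T Int {..<t} = T" "S Int {..<t} = S" using M by auto
			then show ?thesis using assms(3) by simp
		qed simp
	qed (use eq in auto)
	have mem: "r \<in> A \<longleftrightarrow> card (A Int {..<Suc r}) = Suc (card (A Int {..<r}))" if "finite A" for A :: "nat set" and r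
	proof -
		have "A Int {..<Suc r} = (if r \<in> A then insert r (A Int {..<r}) else A Int {..<r})"
			by (auto simp: less_Suc_eq)
		then show ?thesis by simp
	qed
	have "r \<in> S \<longleftrightarrow> r \<in> T" for r
		using mem[OF assms(1), of r] mem[OF assms(2), of r] eq' by simp
	then show "S = T" by blast
qed

definition uvec :: "nat => bseq" where
	"uvec r = Bcontfun (%s. of_bool (s = r))"

lemma apply_uvec [simp]: "ap (uvec r) s = of_bool (s = r)"
proof -
	have "(%s. of_bool (s = r) :: complex) \<in> bcontfun"
		unfolding bcontfun_nat_iff by (rule finite_imp_bounded, rule finite_subset[of _ "{0,1}"]) auto
	then show ?thesis by (simp add: uvec_def Bcontfun_inverse)
qed

text \<open>The size of the partition whose beta-set is \<open>S\<close>: each element counts the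
  gaps below it. A gap below a pivot is a free entry in front of that pivot, and these entries
  vanish on the cell.\<close>

definition codim :: "nat set => nat" where
	"codim S = card {(s, r). s \<in> S & r ~: S & r < s}"

section \<open>Charts and cells of a representation stack\<close>

locale schubert =
	fixes Q :: "('v, 'a) pre_digraph" and dm :: "'v => nat"
	assumes Q: "fin_digraph Q"
begin

lemma finite_verts: "finite (verts Q)"
	using Q by (simp add: fin_digraph_def fin_digraph_axioms_def)

definition indices :: "('v => nat set) set" where
	"indices = (\<Pi>\<^sub>E i\<in>verts Q. {S. finite S & card S = dm i})"

definition weight :: "('v => nat set) => nat" where "weight J = (\<Sum>i\<in>verts Q. \<Sum>(J i))"

definition cd :: "('v => nat set) => nat" where "cd J = (\<Sum>i\<in>verts Q. codim (J i))"

lemma indicesD: "J \<in> indices ==> i \<in> verts Q ==> finite (J i) & card (J i) = dm i"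
	by (auto simp: indices_def)

abbreviation Y where "Y \<equiv> stk_top Q dm"
abbreviation act where "act \<equiv> stk_act Q dm"
abbreviation proj where "proj \<equiv> stk_proj Q dm"
abbreviation G where "G \<equiv> GL_dim Q dm"

definition mnr :: "('v => nat set) => ('v => nat => bseq) \<times> ('a => complex mat) => 'v => complex mat" where
	"mnr J x = (\<lambda>i\<in>verts Q. minor (dm i) (J i) (fst x i))"

definition chart :: "('v => nat set) => ('v, 'a) frep set" where
	"chart J = {x \<in> topspace Y. mnr J x \<in> carrier G}"

text \<open>Acting by \<open>g\<close> multiplies a minor by the inverse of \<open>g\<close> from
  the right, so acting by the minor itself turns it into the identity.\<close>

definition nrm where "nrm J x = act (mnr J x) x"

definition slice :: "('v => nat set) => ('v, 'a) frep set" where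
	"slice J = {x \<in> topspace Y. ALL i:verts Q. pivot_form (dm i) (J i) (fst x i)}"

text \<open>Rows without a pivot that lie before the pivot of the vector. The vanishing of these
  entries cuts the cell out of the slice, so they serve as normal coordinates.\<close>

definition D :: "('v => nat set) => ('v \<times> nat \<times> nat) set" where
	"D J = {(i, c, r). i \<in> verts Q & c < dm i & r ~: J i & r < nm (J i) c}"

definition coord :: "'v \<times> nat \<times> nat => ('v => nat => bseq) \<times> ('a => complex mat) => complex" where
	"coord d x = ap (fst x (fst d) (fst (snd d))) (snd (snd d))"

definition celle where "celle J = {x \<in> chart J. ALL d:D J. coord d (nrm J x) = 0}"

lemma tops_Y: "x \<in> topspace Y \<longleftrightarrow> fst x \<in> (\<Pi>\<^sub>E i\<in>verts Q. frames (dm i))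
		& snd x \<in> (\<Pi>\<^sub>E a\<in>arcs Q. carrier_mat (dm (head Q a)) (dm (tail Q a)))"
	by (auto simp: stk_top_def tops_EGL tops_rep mem_Times_iff)

lemma acts: "acts_on G act (topspace Y)" by (rule acts_on_stk[OF Q])

lemma act_closed: "g \<in> carrier G ==> x \<in> topspace Y ==> act g x \<in> topspace Y"
	using acts by (simp add: acts_on_def)

lemma act_act: "g \<in> carrier G ==> h \<in> carrier G ==> x \<in> topspace Y ==> act g (act h x) = act (g \<otimes>\<^bsub>G\<^esub> h) x"
	using acts by (simp add: acts_on_def)

lemma act_one: "x \<in> topspace Y ==> act \<one>\<^bsub>G\<^esub> x = x"
	using acts by (simp add: acts_on_def)

lemma mnr_act:
	assumes g: "g \<in> carrier G"
	shows "mnr J (act g x) = (\<lambda>i\<in>verts Q. mnr J x i * ginv[dm i] g i)"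
	using g by (auto simp: mnr_def stk_act_def EGL_action_def case_prod_unfold minor_frame_action GL_dim_iff)

lemma mnr_act_G:
	assumes g: "g \<in> carrier G"
	shows "mnr J (act g x) = mnr J x \<otimes>\<^bsub>G\<^esub> inv\<^bsub>G\<^esub> g"
proof -
	have "inv\<^bsub>G\<^esub> g = (\<lambda>i\<in>verts Q. ginv[dm i] g i)"
		using g unfolding GL_dim_def by (simp add: group_GL)
	then show ?thesis by (auto simp: mnr_act[OF g] fun_eq_iff)
qed

interpretation G: group G by (rule group_GL_dim)

lemma mnr_c_iff:
	assumes "J \<in> indices"
	shows "mnr J x \<in> carrier G \<longleftrightarrow> (ALL i:verts Q. rows_indep (dm i) (J i) (fst x i))"
	using indicesD[OF assms] by (auto simp: GL_dim_iff mnr_def minor_GL_iff)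

lemma chart_act:
	assumes g: "g \<in> carrier G" and x: "x \<in> topspace Y"
	shows "act g x \<in> chart J \<longleftrightarrow> x \<in> chart J"
proof -
	have cl: "mnr J (act g x) \<in> carrier G" if "mnr J x \<in> carrier G" "g \<in> carrier G" for g x
		using that by (simp add: mnr_act_G del: GL_dim_simps)
	have "act (inv\<^bsub>G\<^esub> g) (act g x) = x" using act_act[of "inv\<^bsub>G\<^esub> g" g x] act_one x g by (simp del: GL_dim_simps)
	then show ?thesis
		using cl[of "act g x" "inv\<^bsub>G\<^esub> g"] cl[of x g] g act_closed[OF g x] x
		unfolding chart_def by auto
qed

lemma proj_eqD: "x \<in> topspace Y ==> y \<in> topspace Y ==> proj x = proj y ==> EX g:carrier G. y = act g x"
	using orbit_eq_iff[OF acts] unfolding stk_proj_def by blast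

lemma proj_act: "g \<in> carrier G ==> x \<in> topspace Y ==> proj (act g x) = proj x"
	using orbit_act[OF acts] unfolding stk_proj_def by blast

text \<open>Together with \<open>nrm_slice\<close> and \<open>nrm_id\<close> this makes the slice a
  global section: every orbit in the chart meets it in exactly one point.\<close>

lemma nrm_act:
	assumes g: "g \<in> carrier G" and x: "x \<in> chart J"
	shows "nrm J (act g x) = nrm J x"
proof -
	have m: "mnr J x \<in> carrier G" "x \<in> topspace Y" using x by (auto simp: chart_def)
	have "nrm J (act g x) = act (mnr J x \<otimes>\<^bsub>G\<^esub> inv\<^bsub>G\<^esub> g \<otimes>\<^bsub>G\<^esub> g) x"
		unfolding nrm_def mnr_act_G[OF g] using act_act g m by (simp del: GL_dim_simps)
	also have "mnr J x \<otimes>\<^bsub>G\<^esub> inv\<^bsub>G\<^esub> g \<otimes>\<^bsub>G\<^esub> g = mnr J x" using m g by (simp add: G.m_assoc del: GL_dim_simps)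
	finally show ?thesis by (simp add: nrm_def)
qed

lemma slice_iff: "x \<in> slice J \<longleftrightarrow> x \<in> topspace Y & mnr J x = \<one>\<^bsub>G\<^esub>"
	unfolding slice_def mnr_def pivot_form_minor by (auto simp: fun_eq_iff restrict_def)

lemma slice_subset_chart: "slice J <= chart J"
	unfolding chart_def using G.one_closed by (auto simp: slice_iff simp del: GL_dim_simps)

lemma nrm_slice:
	assumes "x \<in> chart J"
	shows "nrm J x \<in> slice J" "proj (nrm J x) = proj x"
proof -
	have m: "mnr J x \<in> carrier G" "x \<in> topspace Y" using assms by (auto simp: chart_def)
	have "mnr J (nrm J x) = \<one>\<^bsub>G\<^esub>" using m by (simp add: nrm_def mnr_act_G del: GL_dim_simps)
	then show "nrm J x \<in> slice J" using act_closed m by (simp add: slice_iff nrm_def)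
	show "proj (nrm J x) = proj x" unfolding nrm_def by (rule proj_act[OF m])
qed

lemma nrm_id: "x \<in> slice J ==> nrm J x = x"
	using act_one by (simp add: slice_iff nrm_def del: GL_dim_simps)

lemma celle_act: "g \<in> carrier G ==> x \<in> celle J ==> act g x \<in> celle J"
	unfolding celle_def using nrm_act chart_act by (auto simp: chart_def)

lemma proj_chart_iff: "x \<in> topspace Y ==> proj x \<in> proj ` chart J \<longleftrightarrow> x \<in> chart J"
	using proj_eqD chart_act unfolding chart_def by (smt (verit) image_iff mem_Collect_eq)

lemma proj_celle_iff: "x \<in> topspace Y ==> proj x \<in> proj ` celle J \<longleftrightarrow> x \<in> celle J"
	using proj_eqD celle_act unfolding celle_def chart_def by (smt (verit) image_iff mem_Collect_eq)

lemma cts_fst_Y: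
	"continuous_map Y (EGL_topology Q dm) fst" "continuous_map Y (rep_topology Q dm) snd"
	by (simp_all add: stk_top_def continuous_map_fst continuous_map_snd)

lemma cts_entry:
	assumes "i \<in> verts Q" "c < dm i"
	shows "cfun Y (%x. ap (fst x i c) r)"
	using cts_fst_Y(1) assms
	by (intro cts_apply_bcontfun) (auto simp: cts_EGL cts_frame)

lemma cts_mnr:
	assumes "i \<in> verts Q"
	shows "continuous_map Y (mat_topology (dm i) (dm i)) (%x. mnr J x i)"
	using assms cts_entry[OF assms] by (auto simp: cts_mat mnr_def minor_def)

lemma openin_chart: "openin Y (chart J)"
proof -
	have "chart J = {x\<in>topspace Y. ALL i:verts Q. det (mnr J x i) \<in> - {0}}"
		by (auto simp: chart_def GL_dim_iff GL_iff mnr_def minor_c)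
	also have "\<dots> = (\<Inter>i\<in>verts Q. {x\<in>topspace Y. det (mnr J x i) \<in> - {0}}) Int topspace Y" by auto
	also have "openin Y \<dots>"
	proof (rule openin_INT[OF finite_verts])
		fix i assume i: "i \<in> verts Q"
		have "cfun Y (%x. det (mnr J x i))"
			by (rule cts_det[OF cts_mnr[OF i]])
		then show "openin Y {x\<in>topspace Y. det (mnr J x i) \<in> - {0}}"
			by (rule openin_continuous_map_preimage) (simp add: open_Compl)
	qed
	finally show ?thesis .
qed

lemma quotient: "quotient_map Y (rep_stack Q dm) proj" by (rule quot_map_stk)

text \<open>A chart is a union of orbits, which gives openness of its image and lets the quotient
  map restrict to it.\<close>

lemma chart_image: "openin (rep_stack Q dm) (proj ` chart J)"
	"quotient_map (subtopology Y (chart J)) (subtopology (rep_stack Q dm) (proj ` chart J)) proj"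
proof -
	have sub: "chart J <= topspace Y" by (auto simp: chart_def)
	have pre: "{x \<in> topspace Y. proj x \<in> proj ` chart J} = chart J"
		using proj_chart_iff sub by blast
	show o: "openin (rep_stack Q dm) (proj ` chart J)"
	proof -
		have "proj ` chart J <= topspace (rep_stack Q dm)"
			using quotient sub unfolding quotient_map_def by blast
		then have "openin Y {x \<in> topspace Y. proj x \<in> proj ` chart J} = openin (rep_stack Q dm) (proj ` chart J)"
			using quotient unfolding quotient_map_def by blast
		then show ?thesis unfolding pre using openin_chart by blast
	qed
	show "quotient_map (subtopology Y (chart J)) (subtopology (rep_stack Q dm) (proj ` chart J)) proj"
		by (rule quotient_map_restriction[OF quotient pre]) (use o in blast)
qed

lemma cts_nrm: "continuous_map (subtopology Y (chart J)) Y (nrm J)"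
	unfolding nrm_def
proof (rule cts_stk_act[OF Q])
	show "continuous_map (subtopology Y (chart J)) (mat_topology (dm i) (dm i)) (%x. mnr J x i)" if "i \<in> verts Q" for i
		by (rule continuous_map_from_subtopology[OF cts_mnr[OF that]])
	show "mnr J x \<in> carrier G" if "x \<in> topspace (subtopology Y (chart J))" for x
		using that by (simp add: chart_def)
	show "continuous_map (subtopology Y (chart J)) Y (%x. x)"
		by (rule continuous_map_from_subtopology) simp
qed

lemma D_eq: "J \<in> indices ==> D J = (SIGMA i:verts Q. {(c, r). c < dm i & r ~: J i & r < nm (J i) c})"
	by (auto simp: D_def)

lemma card_codim:
	assumes S: "finite S" "card S = n"
	shows "finite {(c, r). c < n & r ~: S & r < nm S c}" "card {(c, r). c < n & r ~: S & r < nm S c} = codim S"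
proof -
	have b: "bij_betw (nm S) {..<n} S" using bij_betw_nm S by blast
	have 1: "{(c, r). c < n & r ~: S & r < nm S c} = (SIGMA c:{..<n}. {r. r ~: S & r < nm S c})" by auto
	have 2: "{(s, r). s \<in> S & r ~: S & r < s} = (SIGMA s:S. {r. r ~: S & r < s})" by auto
	show "finite {(c, r). c < n & r ~: S & r < nm S c}" unfolding 1 by simp
	have "(\<Sum>c<n. card {r. r ~: S & r < nm S c}) = (\<Sum>s\<in>S. card {r. r ~: S & r < s})"
		by (rule sum.reindex_bij_betw[OF b, of "%s. card {r. r ~: S & r < s}"])
	then show "card {(c, r). c < n & r ~: S & r < nm S c} = codim S"
		unfolding codim_def 1 2 using S(1) by (simp add: card_SigmaI)
qed

lemma card_D:
	assumes J: "J \<in> indices"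
	shows "finite (D J)" "card (D J) = cd J"
proof -
	have f: "finite {(c, r). c < dm i & r ~: J i & r < nm (J i) c}" if "i \<in> verts Q" for i
		using card_codim(1)[of "J i" "dm i"] indicesD[OF J that] by blast
	then show "finite (D J)" unfolding D_eq[OF J] using finite_verts by blast
	have "card (D J) = (\<Sum>i\<in>verts Q. card {(c, r). c < dm i & r ~: J i & r < nm (J i) c})"
		unfolding D_eq[OF J] using finite_verts f by (intro card_SigmaI) auto
	also have "\<dots> = cd J"
		unfolding cd_def using card_codim(2) indicesD[OF J] by (intro sum.cong) auto
	finally show "card (D J) = cd J" .
qed

text \<open>A section of the normal coordinates. All other free data are zero, so that the slice
  contracts linearly onto the image of the section.\<close>

definition std :: "('v => nat set) => ('v \<times> nat \<times> nat => complex) => ('v => nat => bseq) \<times> ('a => complex mat)" where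
	"std J z = ((\<lambda>i\<in>verts Q. \<lambda>c\<in>{..<dm i}. uvec (nm (J i) c) + (\<Sum>r | (i, c, r) \<in> D J. cmul (z (i, c, r)) (uvec r))),
		(\<lambda>a\<in>arcs Q. 0\<^sub>m (dm (head Q a)) (dm (tail Q a))))"

lemma finite_D': "J \<in> indices ==> finite {r. (i, c, r) \<in> D J}"
	using finite_vimageI[OF card_D(1), of J "%r. (i, c, r)"] by (simp add: vimage_def inj_def)

lemma std_entry:
	assumes J: "J \<in> indices" and "i \<in> verts Q" "c < dm i"
	shows "ap (fst (std J z) i c) r = of_bool (r = nm (J i) c) + (if (i, c, r) \<in> D J then z (i, c, r) else 0)"
	using finite_D'[OF J, of i c] assms
	by (simp add: std_def apply_sum_bcontfun of_bool_def if_distrib[of "%x. _ * x"] cong: if_cong)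

text \<open>Pivot conditions are affine in the frame, so segments remain in the slice. The arrow
  matrices are scaled to zero, the value that they have at \<open>std\<close>.\<close>

definition mix :: "real => ('v => nat => bseq) \<times> ('a => complex mat)
		=> ('v => nat => bseq) \<times> ('a => complex mat) => ('v => nat => bseq) \<times> ('a => complex mat)" where
	"mix t x y = ((\<lambda>i\<in>verts Q. \<lambda>c\<in>{..<dm i}. cmul (1 - of_real t) (fst x i c) + cmul (of_real t) (fst y i c)),
		(\<lambda>a\<in>arcs Q. (1 - of_real t) \<cdot>\<^sub>m snd x a))"

text \<open>An identity minor already makes the vectors independent, so membership in
  \<open>frames\<close> follows from the pivot form.\<close>

lemma pivot_slice:
	assumes J: "J \<in> indices" and e: "fst x \<in> extensional (verts Q)"
		"!!i. i \<in> verts Q ==> fst x i \<in> extensional {..<dm i} & pivot_form (dm i) (J i) (fst x i)"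
		and r: "snd x \<in> (\<Pi>\<^sub>E a\<in>arcs Q. carrier_mat (dm (head Q a)) (dm (tail Q a)))"
	shows "x \<in> slice J"
proof -
	have "fst x i \<in> frames (dm i)" if i: "i \<in> verts Q" for i
	proof (rule rows_indep_frame)
		have "minor (dm i) (J i) (fst x i) = 1\<^sub>m (dm i)" using e(2)[OF i] pivot_form_minor by blast
		then have "minor (dm i) (J i) (fst x i) \<in> carrier (GL (dm i))" by (simp add: GL_iff)
		then show "rows_indep (dm i) (J i) (fst x i)" using minor_GL_iff indicesD[OF J i] by blast
	qed (use e(2)[OF i] in blast)
	then show ?thesis using e r by (auto simp: slice_def tops_Y PiE_def)
qed

lemma std_slice: "J \<in> indices ==> std J z \<in> slice J"
proof (rule pivot_slice)
	assume J: "J \<in> indices"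
	show "fst (std J z) \<in> extensional (verts Q)" by (simp add: std_def)
	show "snd (std J z) \<in> (\<Pi>\<^sub>E a\<in>arcs Q. carrier_mat (dm (head Q a)) (dm (tail Q a)))" by (simp add: std_def)
	fix i assume i: "i \<in> verts Q"
	have "ap (fst (std J z) i c) (nm (J i) r) = of_bool (r = c)" if "c < dm i" "r < dm i" for c r
	proof -
		have b: "bij_betw (nm (J i)) {..<dm i} (J i)" using bij_betw_nm indicesD[OF J i] by metis
		then have "nm (J i) r \<in> J i" using that by (auto simp: bij_betw_def)
		then have "(i, c, nm (J i) r) ~: D J" by (simp add: D_def)
		moreover have "nm (J i) r = nm (J i) c \<longleftrightarrow> r = c" using b that by (auto simp: bij_betw_def inj_on_def)
		ultimately show ?thesis using std_entry[OF J i that(1)] by simp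
	qed
	then show "fst (std J z) i \<in> extensional {..<dm i} & pivot_form (dm i) (J i) (fst (std J z) i)"
		using i by (simp add: std_def pivot_form_def)
qed

lemma coord_std: "J \<in> indices ==> d \<in> D J ==> coord d (std J z) = z d"
proof -
	assume J: "J \<in> indices" and d: "d \<in> D J"
	then obtain i c r where d': "d = (i, c, r)" "i \<in> verts Q" "c < dm i" "r ~: J i" by (auto simp: D_def)
	have "bij_betw (nm (J i)) {..<dm i} (J i)" using bij_betw_nm indicesD[OF J d'(2)] by metis
	then have "r ~= nm (J i) c" using d' by (auto simp: bij_betw_def)
	then show ?thesis using std_entry[OF J d'(2,3)] d d' by (simp add: coord_def)
qed

lemma mix_slice:
	assumes J: "J \<in> indices" and x: "x \<in> slice J" and y: "y \<in> slice J"
	shows "mix t x y \<in> slice J"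
proof (rule pivot_slice[OF J])
	show "fst (mix t x y) \<in> extensional (verts Q)" by (simp add: mix_def)
	show "snd (mix t x y) \<in> (\<Pi>\<^sub>E a\<in>arcs Q. carrier_mat (dm (head Q a)) (dm (tail Q a)))"
	proof -
		have "snd x a \<in> carrier_mat (dm (head Q a)) (dm (tail Q a))" if "a \<in> arcs Q" for a
			using x that by (auto simp: slice_def tops_Y)
		then show ?thesis unfolding mix_def by simp
	qed
	fix i assume i: "i \<in> verts Q"
	then show "fst (mix t x y) i \<in> extensional {..<dm i} & pivot_form (dm i) (J i) (fst (mix t x y) i)"
		using x y by (auto simp: mix_def slice_def pivot_form_def)
qed

lemma coord_mix: "d \<in> D J ==> coord d (mix t x y) = (1 - of_real t) * coord d x + of_real t * coord d y"
	by (auto simp: coord_def mix_def D_def)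

lemma mix_0: "x \<in> topspace Y ==> mix 0 x y = x"
proof -
	assume x: "x \<in> topspace Y"
	have "fst (mix 0 x y) i c = fst x i c" for i c
	proof (cases "i \<in> verts Q & c < dm i")
		case True then show ?thesis by (auto simp: mix_def intro: bcontfun_eqI)
	next
		case False
		then show ?thesis using x frames_extensional[of "fst x i" "dm i"]
			by (cases "i \<in> verts Q") (auto simp: mix_def tops_Y PiE_iff extensional_def)
	qed
	moreover have "fst (mix 0 x y) i = fst x i" if "i ~: verts Q" for i
		using x that by (auto simp: mix_def tops_Y PiE_def extensional_def)
	moreover have "snd (mix 0 x y) a = snd x a" for a
		using x by (cases "a \<in> arcs Q") (auto simp: mix_def tops_Y PiE_def extensional_def)
	ultimately show ?thesis by (intro prod_eqI ext) auto
qed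

lemma mix_1: "J \<in> indices ==> x \<in> topspace Y ==> mix 1 x (std J z) = std J z"
proof -
	assume J: "J \<in> indices" and x: "x \<in> topspace Y"
	have "(0::complex) \<cdot>\<^sub>m snd x a = 0\<^sub>m (dm (head Q a)) (dm (tail Q a))" if "a \<in> arcs Q" for a
	proof -
		have "snd x a \<in> carrier_mat (dm (head Q a)) (dm (tail Q a))" using x that by (auto simp: tops_Y)
		then show ?thesis by (intro eq_matI) auto
	qed
	moreover have "fst (mix 1 x (std J z)) = fst (std J z)"
		by (auto simp: mix_def std_def fun_eq_iff intro!: bcontfun_eqI)
	ultimately show ?thesis by (intro prod_eqI) (auto simp: mix_def std_def fun_eq_iff)
qed

end

context schubert begin

lemma cts_Y:
	"continuous_map X Y F \<longleftrightarrow> (ALL x:topspace X. F x \<in> topspace Y)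
		& (ALL i:verts Q. ALL c<dm i. cfun X (%x. fst (F x) i c))
		& (ALL a:arcs Q. ALL p<dm (head Q a). ALL q<dm (tail Q a). cfun X (%x. snd (F x) a $$ (p,q)))"
	(is "?L \<longleftrightarrow> ?R")
proof
	assume L: ?L
	then show ?R
		using continuous_map_funspace[OF L]
		by (auto simp: stk_top_def continuous_map_pairwise o_def cts_EGL cts_rep
				cts_frame cts_mat)
next
	assume R: ?R
	then have F: "fst (F x) \<in> (\<Pi>\<^sub>E i\<in>verts Q. frames (dm i))"
		"snd (F x) \<in> (\<Pi>\<^sub>E a\<in>arcs Q. carrier_mat (dm (head Q a)) (dm (tail Q a)))" if "x \<in> topspace X" for x
		using that tops_Y by blast+
	show ?L
		unfolding stk_top_def continuous_map_pairwise o_def cts_EGL cts_rep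
				cts_frame cts_mat
		using R F by (auto simp: PiE_iff)
qed

lemma cts_std:
	assumes J: "J \<in> indices" and z: "!!d. d \<in> D J ==> cfun X (%x. z x d)"
	shows "continuous_map X Y (%x. std J (z x))"
	unfolding cts_Y
proof (intro conjI ballI allI impI)
	show "std J (z x) \<in> topspace Y" for x using std_slice[OF J] by (simp add: slice_def)
	fix i c assume "i \<in> verts Q" "c < dm i"
	then show "cfun X (%x. fst (std J (z x)) i c)"
		by (simp add: std_def) (intro cts_add' cts_sum'
				cts_bilinear[OF bounded_bilinear_cmul] z, auto)
next
	fix a p q assume "a \<in> arcs Q" "p < dm (head Q a)" "q < dm (tail Q a)"
	then show "cfun X (%x. snd (std J (z x)) a $$ (p,q))" by (simp add: std_def)
qed

lemma cts_mix:
	assumes t: "continuous_map X euclideanreal t" and a: "continuous_map X Y a" and b: "continuous_map X Y b"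
		and m: "!!x. x \<in> topspace X ==> mix (t x) (a x) (b x) \<in> topspace Y"
	shows "continuous_map X Y (%x. mix (t x) (a x) (b x))"
	unfolding cts_Y
proof (intro conjI ballI allI impI)
	show "mix (t x) (a x) (b x) \<in> topspace Y" if "x \<in> topspace X" for x using m that .
	have ct: "cfun X (%x. cor (t x))"
		"cfun X (%x. 1 - cor (t x))"
		by (rule cts_compose_UNIV[OF t], intro continuous_intros)+
	fix i c assume ic: "i \<in> verts Q" "c < dm i"
	then show "cfun X (%x. fst (mix (t x) (a x) (b x)) i c)"
		using a b ct by (simp add: mix_def)
			(intro cts_add' cts_bilinear[OF bounded_bilinear_cmul], auto simp: cts_Y)
next
	have ct: "cfun X (%x. 1 - cor (t x))"
		by (rule cts_compose_UNIV[OF t], intro continuous_intros)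
	fix e p q assume e: "e \<in> arcs Q" "p < dm (head Q e)" "q < dm (tail Q e)"
	have "cfun X (%x. (1 - cor (t x)) * snd (a x) e $$ (p,q))"
		using a ct e by (intro cts_mult') (auto simp: cts_Y)
	then show "cfun X (%x. snd (mix (t x) (a x) (b x)) e $$ (p,q))"
	proof (rule cts_eq')
		fix x assume "x \<in> topspace X"
		then have "snd (a x) e \<in> carrier_mat (dm (head Q e)) (dm (tail Q e))"
			using continuous_map_funspace[OF a] e(1) by (auto simp: Pi_iff tops_Y)
		then show "(1 - cor (t x)) * snd (a x) e $$ (p,q) = snd (mix (t x) (a x) (b x)) e $$ (p,q)"
			using e by (simp add: mix_def)
	qed
qed

lemma cts_coord:
	assumes "d \<in> D J"
	shows "cfun Y (coord d)"
	unfolding coord_def using assms by (intro cts_entry) (auto simp: D_def)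

text \<open>The chart modulo the group is the slice, which contracts linearly along all coordinates
  but those in \<open>D J\<close>. What remains is \<complex>^d, d being \<open>cd J\<close>, with
  the cell over the origin.\<close>

lemma cell_pair_chart:
	assumes J: "J \<in> indices"
	shows "cell_pair (subtopology (rep_stack Q dm) (proj ` chart J)) (proj ` chart J - proj ` celle J) (cd J)"
proof -
	let ?d = "cd J" and ?B = "subtopology (rep_stack Q dm) (proj ` chart J)" and ?Y = "subtopology Y (chart J)"
	let ?S = "proj ` chart J - proj ` celle J"
	let ?E = "Euclidean_space (2 * ?d)"
	obtain \<kappa> where \<kappa>: "bij_betw \<kappa> {..<?d} (D J)"
		using card_D[OF J] by (metis bij_betw_from_nat_into_finite)
	define ix where "ix = inv_into {..<?d} \<kappa>"
	have ix: "ix d < ?d" "\<kappa> (ix d) = d" if "d \<in> D J" for d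
		using \<kappa> that by (auto simp: ix_def bij_betw_def f_inv_into_f inv_into_into[of d \<kappa> "{..<?d}", simplified])
	have ix\<kappa>: "ix (\<kappa> k) = k" "\<kappa> k \<in> D J" if "k < ?d" for k
		using \<kappa> that by (auto simp: ix_def bij_betw_def)
	\<comment> \<open>Real and imaginary parts of the normal coordinates occupy the even and odd places
	  of a point of real Euclidean space; \<open>zv\<close> undoes this.\<close>
	define Fc where "Fc x = (%k. if k < 2 * ?d then (if even k then Re (coord (\<kappa> (k div 2)) x) else Im (coord (\<kappa> (k div 2)) x)) else 0)" for x
	define zv where "zv v d = Complex (v (2 * ix d)) (v (2 * ix d + 1))" for v :: "nat => real" and d
	have zvF: "zv (Fc x) d = coord d x" if "d \<in> D J" for x d
		using ix[OF that] by (simp add: zv_def Fc_def)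
	have FcE: "Fc x \<in> topspace ?E" for x by (simp add: Fc_def topspace_Euclidean_space)
	have Fc0: "Fc x = (%_. 0) \<longleftrightarrow> (ALL d:D J. coord d x = 0)" for x
	proof
		assume "Fc x = (%_. 0)"
		then show "ALL d:D J. coord d x = 0" using zvF[of _ x] by (auto simp: zv_def complex_eq_iff)
	next
		assume *: "ALL d:D J. coord d x = 0"
		have "\<kappa> (k div 2) \<in> D J" if "k < 2 * ?d" for k using ix\<kappa>(2) that by simp
		then show "Fc x = (%_. 0)" using * by (auto simp: Fc_def fun_eq_iff)
	qed
	have Fstd: "Fc (std J (zv v)) = v" if v: "v \<in> topspace ?E" for v
	proof
		fix k
		show "Fc (std J (zv v)) k = v k"
		proof (cases "k < 2 * ?d")
			case True
			then have k: "k div 2 < ?d" by simp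
			have "coord (\<kappa> (k div 2)) (std J (zv v)) = Complex (v (2 * (k div 2))) (v (2 * (k div 2) + 1))"
				using coord_std[OF J ix\<kappa>(2)[OF k]] ix\<kappa>(1)[OF k] by (simp add: zv_def)
			then show ?thesis using True by (cases "even k") (auto simp: Fc_def odd_two_times_div_two_succ)
		qed (use v in \<open>simp add: Fc_def topspace_Euclidean_space\<close>)
	qed
	have nY: "continuous_map ?Y Y (nrm J)" by (rule cts_nrm)
	have cF: "continuous_map ?Y ?E (%x. Fc (nrm J x))"
		unfolding Fc_def continuous_map_componentwise_Euclidean_space
	proof (intro allI impI)
		fix k assume "k < 2 * ?d"
		then have "cfun Y (coord (\<kappa> (k div 2)))" by (intro cts_coord[OF ix\<kappa>(2)]) simp
		from continuous_map_compose[OF nY this]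
		have c: "continuous_map ?Y euclidean (%x. coord (\<kappa> (k div 2)) (nrm J x))" by (simp add: o_def)
		have "continuous_map ?Y euclideanreal (%x. Re (coord (\<kappa> (k div 2)) (nrm J x)))"
			"continuous_map ?Y euclideanreal (%x. Im (coord (\<kappa> (k div 2)) (nrm J x)))"
			by (rule cts_compose_UNIV[OF c], intro continuous_intros)+
		then show "continuous_map ?Y euclideanreal (%x. if even k then Re (coord (\<kappa> (k div 2)) (nrm J x)) else Im (coord (\<kappa> (k div 2)) (nrm J x)))"
			by (cases "even k") auto
	qed
	have qm: "quotient_map ?Y ?B proj" by (rule chart_image(2))
	have topY: "topspace ?Y = chart J" by (auto simp: chart_def)
	have topB: "topspace ?B = proj ` chart J" using qm topY by (simp add: quotient_map_def)
	have nrm_eq: "nrm J x = nrm J y" if "x \<in> chart J" "y \<in> chart J" "proj x = proj y" for x y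
		using proj_eqD[of x y] that nrm_act[of _ x J] by (auto simp: chart_def)
	obtain f where f: "continuous_map ?B ?E f" "!!x. x \<in> chart J ==> f (proj x) = Fc (nrm J x)"
		using cts_descend[OF qm cF] nrm_eq unfolding topY by metis
	define g where "g v = proj (std J (zv v))" for v
	have stdc: "std J z \<in> chart J" for z using std_slice[OF J] slice_subset_chart by blast
	have proj_c: "continuous_map Y (rep_stack Q dm) proj" by (rule quotient_imp_continuous_map[OF quotient])
	have zvc: "cfun X (%x. zv (w x) d)" if "continuous_map X ?E w" for w and X :: "'z topology" and d
	proof -
		have "continuous_map X euclideanreal (%x. w x k)" for k
			using that by (auto simp: Euclidean_space_def continuous_map_in_subtopology continuous_map_componentwise_UNIV)
		then have "cfun X (%x. cor (w x (2 * ix d)))"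
			"cfun X (%x. \<i> * cor (w x (2 * ix d + 1)))"
			by (auto intro!: cts_compose_UNIV[where h = "%x. cor x"]
					cts_compose_UNIV[where h = "%x. \<i> * cor x"] continuous_intros)
		then show ?thesis unfolding zv_def Complex_eq by (intro cts_add')
	qed
	have gE: "continuous_map ?E Y (%v. std J (zv v))"
		by (rule cts_std[OF J]) (rule zvc, simp add: continuous_map_id[unfolded id_def])
	have gc: "continuous_map ?E ?B g"
		unfolding g_def continuous_map_in_subtopology
		using continuous_map_compose[OF gE proj_c] stdc by (auto simp: o_def)
	have celle_slice: "x \<in> celle J \<longleftrightarrow> (ALL d:D J. coord d x = 0)" if "x \<in> slice J" for x
		using that slice_subset_chart nrm_id by (auto simp: celle_def)
	have notcell: "proj x \<in> ?S \<longleftrightarrow> x \<in> chart J & Fc (nrm J x) ~= (%_. 0)" if "x \<in> topspace Y" for x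
		using proj_chart_iff[OF that] proj_celle_iff[OF that] Fc0 by (auto simp: celle_def)
	show ?thesis
	proof (rule cell_pair_homotopy[OF cell_pair_Euclidean, of ?B ?d f ?S g])
		show "f \<in> ?S \<rightarrow> topspace ?E - {%_. 0}"
		proof
			fix p assume "p \<in> ?S"
			then obtain x where x: "x \<in> chart J" "p = proj x" "proj x \<in> ?S" by blast
			then have "x \<in> topspace Y" by (simp add: chart_def)
			then have "Fc (nrm J x) ~= (%_. 0)" using notcell[of x] x(3) by blast
			then show "f p \<in> topspace ?E - {%_. 0}" using f(2)[OF x(1)] FcE[of "nrm J x"] x(2) by simp
		qed
		show "g \<in> topspace ?E - {%_. 0} \<rightarrow> ?S"
		proof
			fix v assume v: "v \<in> topspace ?E - {%_. 0}"
			have "std J (zv v) \<in> topspace Y" using stdc by (auto simp: chart_def)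
			then show "g v \<in> ?S"
				unfolding g_def using notcell[of "std J (zv v)"] stdc[of "zv v"] nrm_id[OF std_slice[OF J], of "zv v"] Fstd[of v] v
				by (metis DiffD1 DiffD2 singletonI)
		qed
		define H where "H = (%(t, x). proj (mix t (nrm J x) (std J (zv (Fc (nrm J x))))))"
		have mixs: "mix t (nrm J x) (std J (zv (Fc (nrm J x)))) \<in> slice J" if "x \<in> chart J" for t x
			by (rule mix_slice[OF J]) (use that nrm_slice std_slice[OF J] in auto)
		have "homotopic_with (%h. h \<in> ?S \<rightarrow> ?S) ?B ?B id (g \<circ> f)"
		proof (rule homotopic_with_descend[OF qm, where H = H])
			let ?P = "cyl ?Y"
			have n: "continuous_map ?P Y (%p. nrm J (snd p))"
				using continuous_map_compose[OF continuous_map_snd nY, of "top_of_set {0..1::real}"] by (simp add: o_def)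
			have F: "continuous_map ?P ?E (%p. Fc (nrm J (snd p)))"
				using continuous_map_compose[OF continuous_map_snd cF, of "top_of_set {0..1::real}"] by (simp add: o_def)
			have t: "continuous_map ?P euclideanreal fst"
				using continuous_map_fst[of "top_of_set {0..1::real}" ?Y] by (simp add: continuous_map_in_subtopology)
			have "continuous_map ?P Y (%p. mix (fst p) (nrm J (snd p)) (std J (zv (Fc (nrm J (snd p))))))"
				by (intro cts_mix t n cts_std[OF J] zvc F)
					(use mixs in \<open>auto simp: slice_def chart_def\<close>)
			from continuous_map_compose[OF this proj_c]
			have "continuous_map ?P (rep_stack Q dm) H" by (simp add: o_def H_def case_prod_unfold)
			moreover have "H p \<in> proj ` chart J" if "p \<in> topspace ?P" for p
			proof -
				have "snd p \<in> topspace ?Y" using that by (simp only: topspace_prod_topology mem_Times_iff)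
				then have "snd p \<in> chart J" by (simp only: topY)
				from mixs[OF this, of "fst p"] slice_subset_chart[of J]
				show ?thesis unfolding H_def case_prod_unfold by blast
			qed
			ultimately show "continuous_map ?P ?B H" by (auto simp: continuous_map_in_subtopology image_subset_iff)
		next
			fix t :: real and y z assume "y \<in> topspace ?Y" "z \<in> topspace ?Y" "proj y = proj z"
			then have "nrm J y = nrm J z" by (intro nrm_eq) (simp_all only: topY)
			then show "H (t, y) = H (t, z)" by (simp add: H_def)
		next
			fix y assume y: "y \<in> topspace ?Y"
			then have n: "nrm J y \<in> topspace Y" using nrm_slice(1)[of y J] topY by (auto simp: slice_def)
			show "H (0, y) = id (proj y)"
				using y nrm_slice(2)[of y J] mix_0[OF n] topY by (simp add: H_def)
			show "H (1, y) = (g \<circ> f) (proj y)"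
				using y f(2) mix_1[OF J n] topY by (simp add: H_def g_def)
		next
			fix h k :: "('v, 'a) frep set => ('v, 'a) frep set"
			assume "!!x. x \<in> topspace ?B ==> h x = k x"
			then show "h \<in> ?S \<rightarrow> ?S \<longleftrightarrow> k \<in> ?S \<rightarrow> ?S" unfolding topB by (auto simp: Pi_iff)
		next
			fix k :: "('v, 'a) frep set => ('v, 'a) frep set" and t :: real
			assume k: "!!y. y \<in> topspace ?Y ==> k (proj y) = H (t, y)"
			show "k \<in> ?S \<rightarrow> ?S"
			proof
				fix p assume "p \<in> ?S"
				then obtain x where x: "x \<in> chart J" "p = proj x" "proj x \<in> ?S" by blast
				let ?m = "mix t (nrm J x) (std J (zv (Fc (nrm J x))))"
				have m: "?m \<in> slice J" by (rule mixs[OF x(1)])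
				\<comment> \<open>Both ends of the segment have the same normal coordinates, so these are
				  constant along it and the complement of the cell is preserved.\<close>
				have "coord d ?m = coord d (nrm J x)" if "d \<in> D J" for d
					unfolding coord_mix[OF that] coord_std[OF J that] zvF[OF that] by (simp add: algebra_simps)
				then have "Fc ?m = (%_. 0) \<longleftrightarrow> Fc (nrm J x) = (%_. 0)" unfolding Fc0 by simp
				moreover have "Fc (nrm J x) ~= (%_. 0)" using notcell[of x] x by (auto simp: chart_def)
				ultimately have "proj ?m \<in> ?S"
					using notcell[of ?m] m slice_subset_chart nrm_id[OF m] by (auto simp: slice_def)
				then show "k p \<in> ?S" using k[of x, unfolded topY, OF x(1)] x(2) by (simp add: H_def)
			qed
		qed
		then show "homotopic_with (%h. h \<in> ?S \<rightarrow> ?S) ?B ?B (g \<circ> f) id" by (simp add: homotopic_with_sym)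
		have fg: "(f \<circ> g) v = id v" if "v \<in> topspace ?E" for v
			using f(2)[OF stdc] nrm_id[OF std_slice[OF J]] Fstd[OF that] by (simp add: g_def)
		show "homotopic_with (%k. k \<in> topspace ?E - {%_. 0} \<rightarrow> topspace ?E - {%_. 0}) ?E ?E (f \<circ> g) id"
			by (rule homotopic_with_equal) (use fg continuous_map_compose[OF gc f(1)] in auto)
	qed (rule f(1), rule gc)
qed

end

text \<open>Each of the \<open>s\<close> numbers below \<open>s\<close> is in \<open>S\<close> or is
  counted by \<open>codim\<close>. Sets of given size and codimension are therefore bounded, hence
  finite in number.\<close>

lemma codim_bound:
	assumes S: "finite S" and s: "s \<in> S"
	shows "s <= codim S + card S"
proof -
	have "{..<s} <= {r. r ~: S & r < s} Un S" by auto
	then have "card {..<s} <= card ({r. r ~: S & r < s} Un S)"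
		using S by (intro card_mono) auto
	also have "\<dots> <= card {r. r ~: S & r < s} + card S" by (rule card_Un_le)
	also have "card {r. r ~: S & r < s} = card (Pair s ` {r. r ~: S & r < s})"
		by (rule card_image[symmetric]) (auto simp: inj_on_def)
	also have "\<dots> <= codim S"
		unfolding codim_def
	proof (rule card_mono)
		have "{(s, r). s \<in> S & r ~: S & r < s} <= (SIGMA s:S. {..<s})" by auto
		then show "finite {(s, r). s \<in> S & r ~: S & r < s}" using S by (meson finite_SigmaI finite_lessThan finite_subset)
	qed (use s in auto)
	finally show ?thesis by simp
qed

lemma finite_codim: "finite {S. finite S & card S = n & codim S = c}"
proof (rule finite_subset)
	show "{S. finite S & card S = n & codim S = c} <= Pow {..c + n}"
		using codim_bound by force
qed simp

context schubert begin

lemma indices_finite_subset: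
	assumes "!!J i. J \<in> A ==> i \<in> verts Q ==> J i <= {..M i}" "A <= indices"
	shows "finite A"
proof (rule finite_subset)
	show "A <= (\<Pi>\<^sub>E i\<in>verts Q. Pow {..M i})"
	proof
		fix J assume J: "J \<in> A"
		then have "J \<in> (\<Pi>\<^sub>E i\<in>verts Q. {S. finite S & card S = dm i})" using assms(2) by (auto simp: indices_def)
		then show "J \<in> (\<Pi>\<^sub>E i\<in>verts Q. Pow {..M i})" using assms(1)[OF J] by (intro PiE_I) (auto dest: PiE_arb)
	qed
	show "finite (\<Pi>\<^sub>E i\<in>verts Q. Pow {..M i})" using finite_verts by (intro finite_PiE) auto
qed

text \<open>The cell of a point belongs to the chart of least weight among those containing the
  point, the weight being the sum of the pivot positions.\<close>

lemma schubert_cells: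
	"cell_decomposition (rep_stack Q dm) indices (%J. proj ` chart J) (%J. proj ` celle J) weight cd"
proof
	fix w
	show "finite {J \<in> indices. weight J <= w}"
	proof (rule indices_finite_subset[of _ "%_. w"])
		fix J i assume J: "J \<in> {J \<in> indices. weight J <= w}" and i: "i \<in> verts Q"
		have "\<Sum>(J i) <= weight J" unfolding weight_def by (rule member_le_sum[OF i]) (auto simp: finite_verts)
		moreover have "s <= \<Sum>(J i)" if "s \<in> J i" for s
			using that J i indicesD by (intro member_le_sum[of s "J i" "%x. x", simplified]) auto
		ultimately show "J i <= {..w}" using J by force
	qed auto
next
	fix c
	show "finite {J \<in> indices. cd J = c}"
	proof (rule indices_finite_subset[of _ "%i. c + dm i"])
		fix J i assume J: "J \<in> {J \<in> indices. cd J = c}" and i: "i \<in> verts Q"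
		have "codim (J i) <= cd J" unfolding cd_def by (rule member_le_sum[OF i]) (auto simp: finite_verts)
		then show "J i <= {..c + dm i}" using codim_bound[of "J i"] indicesD[of J i] J i by fastforce
	qed auto
next
	fix J show "openin (rep_stack Q dm) (proj ` chart J)" by (rule chart_image)
next
	show "topspace (rep_stack Q dm) = (\<Union>J\<in>indices. proj ` chart J)"
	proof -
		have "EX J:indices. x \<in> chart J" if x: "x \<in> topspace Y" for x
		proof -
			have "ALL i:verts Q. EX S. finite S & card S = dm i & rows_indep (dm i) S (fst x i)"
				using x exists_rows_indep by (auto simp: tops_Y)
			from bchoice[OF this] obtain J where
				J: "ALL i:verts Q. finite (J i) & card (J i) = dm i & rows_indep (dm i) (J i) (fst x i)"
				by (rule exE)
			then have I: "restrict J (verts Q) \<in> indices" by (auto simp: indices_def)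
			moreover have "x \<in> chart (restrict J (verts Q))"
				using J x unfolding chart_def mem_Collect_eq mnr_c_iff[OF I] by simp
			ultimately show ?thesis by blast
		qed
		then have "topspace Y = (\<Union>J\<in>indices. chart J)" by (auto simp: chart_def)
		moreover have "topspace (rep_stack Q dm) = proj ` topspace Y" using quotient by (simp add: quotient_map_def)
		ultimately show ?thesis by (simp only: image_UN)
	qed
next
	fix J assume "J \<in> indices"
	then show "cell_pair (subtopology (rep_stack Q dm) (proj ` chart J)) (proj ` chart J - proj ` celle J) (cd J)"
		by (rule cell_pair_chart)
next
	fix J J' assume J: "J \<in> indices" and J': "J' \<in> indices" and ne: "J' ~= J" and wt: "weight J' <= weight J"
	show "proj ` chart J' Int proj ` chart J Int proj ` celle J = {}"
	proof (rule ccontr)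
		assume "proj ` chart J' Int proj ` chart J Int proj ` celle J ~= {}"
		then obtain x where x: "x \<in> celle J" "proj x \<in> proj ` chart J'" by blast
		then have xc: "x \<in> chart J" "x \<in> topspace Y" by (auto simp: celle_def chart_def)
		\<comment> \<open>In normal form for \<open>J\<close> the minor at \<open>J'\<close> is still
		  invertible, so \<open>cell_rows_count\<close> compares the pivot sets vertex by vertex and
		  forces \<open>J = J'\<close>.\<close>
		define y where "y = nrm J x"
		have y: "y \<in> slice J" "proj y = proj x" using nrm_slice[OF xc(1)] by (auto simp: y_def)
		then have yt: "y \<in> topspace Y" by (simp add: slice_def)
		then have "y \<in> chart J'" using proj_chart_iff[of y J'] x(2) y(2) by simp
		then have ri: "rows_indep (dm i) (J' i) (fst y i)" if "i \<in> verts Q" for i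
			using mnr_c_iff[OF J'] that by (simp add: chart_def)
		have le: "card (J' i Int {..<t}) <= card (J i Int {..<t})" if i: "i \<in> verts Q" for i t
		proof (rule cell_rows_count)
			show "pivot_form (dm i) (J i) (fst y i)" using y(1) i by (simp add: slice_def)
			fix c r assume "c < dm i" "r ~: J i" "r < nm (J i) c"
			then have "(i, c, r) \<in> D J" using i by (simp add: D_def)
			then show "ap (fst y i c) r = 0"
				using x(1) by (force simp: celle_def coord_def y_def)
		qed (use indicesD[OF J i] indicesD[OF J' i] ri[OF i] in auto)
		have sle: "\<Sum>(J i) <= \<Sum>(J' i)" and seq: "\<Sum>(J i) = \<Sum>(J' i) ==> J i = J' i" if i: "i \<in> verts Q" for i
			using sum_le_of_counts[of "J i" "J' i"] indicesD[OF J i] indicesD[OF J' i] le[OF i] by auto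
		have "weight J <= weight J'" unfolding weight_def by (rule sum_mono) (rule sle)
		then have eq: "(\<Sum>i\<in>verts Q. \<Sum>(J i)) = (\<Sum>i\<in>verts Q. \<Sum>(J' i))" using wt by (simp add: weight_def)
		have "J i = J' i" if "i \<in> verts Q" for i
			by (rule seq[OF that], rule sum_mono_inv[OF eq]) (use that sle finite_verts in auto)
		then have "J = J'" using J J' by (intro PiE_ext[of J "verts Q" _ J']) (auto simp: indices_def)
		then show False using ne by simp
	qed
next
	fix J p assume J: "J \<in> indices" and p: "p \<in> proj ` chart J" "p ~: proj ` celle J"
	then obtain x where x: "x \<in> chart J" "p = proj x" "x ~: celle J" by blast
	define y where "y = nrm J x"
	have y: "y \<in> slice J" "proj y = proj x" using nrm_slice[OF x(1)] by (auto simp: y_def)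
	then have yt: "y \<in> topspace Y" by (simp add: slice_def)
	\<comment> \<open>Off the cell some normal coordinate is nonzero. Trading the pivot of its vector
	  for the earlier row \<open>r\<close> gives a chart of smaller weight around the same
	  point.\<close>
	obtain d where d: "d \<in> D J" "coord d y ~= 0" using x by (auto simp: celle_def y_def)
	then obtain i c r where icr: "d = (i, c, r)" "i \<in> verts Q" "c < dm i" "r ~: J i" "r < nm (J i) c"
		by (auto simp: D_def)
	have Ji: "finite (J i)" "card (J i) = dm i" using indicesD[OF J icr(2)] by auto
	have s: "nm (J i) c \<in> J i" using bij_betw_nm[OF Ji(1)] Ji(2) icr(3) by (auto simp: bij_betw_def)
	define S where "S = insert r (J i - {nm (J i) c})"
	have S: "finite S" "card S = dm i" using Ji icr(4) card.remove[OF Ji(1) s] by (simp_all add: S_def)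
	have "\<Sum>S = r + \<Sum>(J i - {nm (J i) c})" using Ji icr(4) by (simp add: S_def)
	moreover have "\<Sum>(J i) = nm (J i) c + \<Sum>(J i - {nm (J i) c})" by (rule sum.remove[OF Ji(1) s])
	ultimately have sum: "\<Sum>S < \<Sum>(J i)" using icr(5) by simp
	define J' where "J' = J(i := S)"
	have J': "J' \<in> indices" using J S icr(2) unfolding J'_def indices_def by (auto simp: PiE_iff extensional_def)
	have "weight J' < weight J"
		unfolding weight_def J'_def by (rule sum_strict_mono_ex1) (use finite_verts sum icr(2) in \<open>auto intro!: bexI[of _ i]\<close>)
	moreover have "y \<in> chart J'"
		unfolding chart_def mem_Collect_eq mnr_c_iff[OF J']
	proof (intro conjI ballI)
		fix j assume j: "j \<in> verts Q"
		show "rows_indep (dm j) (J' j) (fst y j)"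
		proof (cases "j = i")
			case True
			have "rows_indep (dm i) S (fst y i)" unfolding S_def
				by (rule exchange_pivot[OF Ji _ icr(3,4)]) (use y(1) icr(2) d(2) in \<open>auto simp: slice_def coord_def icr(1)\<close>)
			then show ?thesis by (simp add: True J'_def)
		next
			case False
			have "y \<in> chart J" using y(1) slice_subset_chart by blast
			then show ?thesis using False j mnr_c_iff[OF J] by (simp add: J'_def chart_def)
		qed
	qed (rule yt)
	ultimately show "EX J':indices. weight J' < weight J & p \<in> proj ` chart J'"
		using J' y(2) x(2) by (metis imageI)
qed

lemma has_dim_even: "has_dim (singular_cohomology (rep_stack Q dm) (2 * int c)) (card {J\<in>indices. cd J = c})"
	using has_dim_cohomology[OF cell_decomposition.rank_homology(1)[OF schubert_cells]] by simp

lemma has_dim_odd: "odd n ==> has_dim (singular_cohomology (rep_stack Q dm) n) 0"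
proof (cases "n < 0")
	case False
	assume n: "odd n"
	then obtain p where p: "n = int p" "odd p" using False by (metis even_of_nat nonneg_int_cases not_less)
	show ?thesis unfolding p(1)
		by (rule has_dim_cohomology[OF cell_decomposition.rank_homology(2)[OF schubert_cells p(2)]])
qed (rule has_dim_cohomology_neg)

end

section \<open>Generating series of the cells\<close>

definition W :: "nat => nat fps" where
	"W n = Abs_fps (%c. card {S. finite S & card S = n & codim S = c})"

text \<open>Choices at different indices are independent, so the series multiply. Finiteness of the
  level sets is proved in the same induction, because the cardinalities of the pieces are added
  up.\<close>

lemma fps_card_PiE:
	assumes "finite I" and fin: "!!i c. i \<in> I ==> finite {x\<in>A i. w i x = (c::nat)}"
	shows "Abs_fps (%c. card {f\<in>Pi\<^sub>E I A. (\<Sum>i\<in>I. w i (f i)) = c}) = (\<Prod>i\<in>I. Abs_fps (%c. card {x\<in>A i. w i x = c}))"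
		and "finite {f\<in>Pi\<^sub>E I A. (\<Sum>i\<in>I. w i (f i)) = c}"
proof -
	have "Abs_fps (%c. card {f\<in>Pi\<^sub>E I A. (\<Sum>i\<in>I. w i (f i)) = c}) = (\<Prod>i\<in>I. Abs_fps (%c. card {x\<in>A i. w i x = c}))
		& (ALL c. finite {f\<in>Pi\<^sub>E I A. (\<Sum>i\<in>I. w i (f i)) = c})"
		using assms
	proof (induction I rule: finite_induct)
		case empty
		have "{f \<in> {%x. undefined}. 0 = c} = (if c = 0 then {%x. undefined} else {})" for c :: nat by auto
		then show ?case by (auto simp: fps_eq_iff)
	next
		case (insert i I)
		let ?F = "%c. {f\<in>Pi\<^sub>E I A. (\<Sum>i\<in>I. w i (f i)) = c}" and ?G = "%c. {x\<in>A i. w i x = c}"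
		have IH: "Abs_fps (%c. card (?F c)) = (\<Prod>i\<in>I. Abs_fps (%c. card {x\<in>A i. w i x = c}))" "!!c. finite (?F c)"
			using insert by auto
		have finG: "finite (?G c)" for c using insert.prems by simp
		have eq: "{f\<in>Pi\<^sub>E (insert i I) A. (\<Sum>i\<in>insert i I. w i (f i)) = c}
				= (%(x, f). f(i := x)) ` (\<Union>k\<in>{0..c}. ?G k \<times> ?F (c - k))" (is "?L = ?R") for c
		proof (intro equalityI subsetI)
			fix f assume f: "f \<in> ?L"
			have "(\<Sum>j\<in>I. w j ((f(i := undefined)) j)) = (\<Sum>j\<in>I. w j (f j))"
				by (rule sum.cong) (use insert.hyps in auto)
			then have "(f i, f(i := undefined)) \<in> ?G (w i (f i)) \<times> ?F (c - w i (f i))" "w i (f i) \<in> {0..c}"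
				using f insert.hyps by (auto simp: PiE_iff extensional_def)
			then show "f \<in> ?R" by (intro image_eqI[of _ _ "(f i, f(i := undefined))"]) auto
		next
			fix f assume "f \<in> ?R"
			then obtain k x h where h: "k <= c" "x \<in> ?G k" "h \<in> ?F (c - k)" "f = h(i := x)" by auto
			have "(\<Sum>j\<in>I. w j (f j)) = (\<Sum>j\<in>I. w j (h j))"
				by (rule sum.cong) (use insert.hyps h(4) in auto)
			then show "f \<in> ?L" using h insert.hyps by (auto simp: PiE_iff extensional_def)
		qed
		have inj: "inj_on (%(x, f). f(i := x)) (\<Union>k\<in>{0..c}. ?G k \<times> ?F (c - k))" for c
		proof (rule inj_onI, clarify)
			fix x f x' f' assume *: "f(i := x) = f'(i := x')" and "f \<in> Pi\<^sub>E I A" "f' \<in> Pi\<^sub>E I A"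
			then have "f j = f' j" for j using insert.hyps
				by (cases "j = i") (auto simp: PiE_iff extensional_def dest: fun_cong[of _ _ j])
			then show "x = x' & f = f'" using fun_cong[OF *, of i] by auto
		qed
		have "card {f\<in>Pi\<^sub>E (insert i I) A. (\<Sum>i\<in>insert i I. w i (f i)) = c} = (\<Sum>k=0..c. card (?G k) * card (?F (c - k)))" for c
		proof -
			have "card (\<Union>k\<in>{0..c}. ?G k \<times> ?F (c - k)) = (\<Sum>k=0..c. card (?G k \<times> ?F (c - k)))"
				by (rule card_UN_disjoint) (use finG IH(2) in auto)
			then show ?thesis unfolding eq by (simp add: card_image[OF inj] card_cartesian_product)
		qed
		moreover have "finite {f\<in>Pi\<^sub>E (insert i I) A. (\<Sum>i\<in>insert i I. w i (f i)) = c}" for c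
			unfolding eq using finG IH(2) by (intro finite_imageI finite_UN_I finite_cartesian_product) auto
		ultimately show ?case
			using insert.hyps IH(1) by (auto simp: fps_eq_iff fps_mult_nth simp flip: IH(1))
	qed
	then show "Abs_fps (%c. card {f\<in>Pi\<^sub>E I A. (\<Sum>i\<in>I. w i (f i)) = c}) = (\<Prod>i\<in>I. Abs_fps (%c. card {x\<in>A i. w i x = c}))"
		"finite {f\<in>Pi\<^sub>E I A. (\<Sum>i\<in>I. w i (f i)) = c}" by auto
qed

lemma (in schubert) card_indices: "card {J\<in>indices. cd J = c} = fps_nth (\<Prod>i\<in>verts Q. W (dm i)) c"
proof -
	have s: "{S \<in> {S. finite S & card S = n}. codim S = c} = {S. finite S & card S = n & codim S = c}" for n c by auto
	have "Abs_fps (%c. card {J\<in>indices. cd J = c})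
			= (\<Prod>i\<in>verts Q. Abs_fps (%c. card {S\<in>{S. finite S & card S = dm i}. codim S = c}))"
		unfolding indices_def cd_def
		by (rule fps_card_PiE(1)[OF finite_verts]) (simp only: s finite_codim)
	then have "Abs_fps (%c. card {J\<in>indices. cd J = c}) = (\<Prod>i\<in>verts Q. W (dm i))"
		by (simp only: s W_def)
	from arg_cong[OF this, of "%f. fps_nth f c"] show ?thesis by (simp only: fps_nth_Abs_fps)
qed

lemma W_0: "W 0 = 1"
proof -
	have "{S. finite S & card S = 0 & codim S = c} = (if c = 0 then {{}} else {})" for c
		by (auto simp: codim_def)
	then show ?thesis by (auto simp: W_def fps_eq_iff)
qed

lemma codim_shift: "codim (Suc ` S) = codim S + card S" if "finite S"
proof -
	have "{(s, r). s \<in> Suc ` S & r ~: Suc ` S & r < s}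
			= (%(s, r). (Suc s, Suc r)) ` {(s, r). s \<in> S & r ~: S & r < s} Un (%s. (Suc s, 0)) ` S" (is "?L = ?A Un ?B")
	proof (intro equalityI subsetI)
		fix p assume "p \<in> ?L"
		then obtain s r where p: "p = (Suc s, r)" "s \<in> S" "r ~: Suc ` S" "r < Suc s" by auto
		then show "p \<in> ?A Un ?B" by (cases r) auto
	qed auto
	moreover have "finite {(s, r). s \<in> S & r ~: S & r < s}"
		by (rule finite_subset[of _ "SIGMA s:S. {..<s}"]) (use that in auto)
	then have "card (?A Un ?B) = card ?A + card ?B" by (intro card_Un_disjoint) (use that in auto)
	moreover have "card ?A = codim S" unfolding codim_def by (rule card_image) (auto simp: inj_on_def)
	moreover have "card ?B = card S" by (rule card_image) (auto simp: inj_on_def)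
	ultimately show ?thesis by (simp add: codim_def)
qed

lemma codim_insert_0: "codim (insert 0 (Suc ` S)) = codim S"
proof -
	have "{(s, r). s \<in> insert 0 (Suc ` S) & r ~: insert 0 (Suc ` S) & r < s}
			= (%(s, r). (Suc s, Suc r)) ` {(s, r). s \<in> S & r ~: S & r < s}" (is "?L = ?A")
	proof (intro equalityI subsetI)
		fix p assume "p \<in> ?L"
		then obtain s r where p: "p = (Suc s, r)" "s \<in> S" "r ~= 0" "r ~: Suc ` S" "r < Suc s" by auto
		moreover from p(3) obtain r' where "r = Suc r'" by (rule not0_implies_Suc[THEN exE])
		ultimately have "p = (Suc s, Suc r')" "s \<in> S" "r' ~: S" "r' < s" by auto
		then show "p \<in> ?A" by auto
	qed auto
	moreover have "card ?A = codim S" unfolding codim_def by (rule card_image) (auto simp: inj_on_def)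
	ultimately show ?thesis by (simp add: codim_def)
qed

text \<open>The subtraction-free form of the factor 1/(1 - X^(n+1)). A set containing 0 loses it and
  is shifted down, with \<open>codim\<close> unchanged; any other set is shifted down, which lowers
  \<open>codim\<close> by its size n + 1.\<close>

lemma W_Suc: "W (Suc n) = W n + fps_X ^ Suc n * W (Suc n)"
proof (rule fps_ext)
	fix c
	let ?A = "%n c. {S. finite S & card S = n & codim S = c}"
	have "?A (Suc n) c = (%S. insert 0 (Suc ` S)) ` ?A n c Un (if c < Suc n then {} else (`) Suc ` ?A (Suc n) (c - Suc n))"
		(is "_ = ?B Un ?C")
	proof (intro equalityI subsetI)
		fix S assume S: "S \<in> ?A (Suc n) c"
		define T where "T = {s. Suc s \<in> S}"
		have T: "finite T" using S finite_vimageI[of S Suc] by (auto simp: T_def vimage_def)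
		show "S \<in> ?B Un ?C"
		proof (cases "0 \<in> S")
			case True
			have "x \<in> S \<longleftrightarrow> x \<in> insert 0 (Suc ` T)" for x using True by (cases x) (auto simp: T_def)
			then have eq: "S = insert 0 (Suc ` T)" by blast
			then have "card S = Suc (card T)" using T by (simp add: card_image)
			then have "T \<in> ?A n c" using S T codim_insert_0[of T] eq by auto
			then show ?thesis using eq by blast
		next
			case False
			have "x \<in> S \<longleftrightarrow> x \<in> Suc ` T" for x using False by (cases x) (auto simp: T_def)
			then have eq: "S = Suc ` T" by blast
			then have "card S = card T" by (simp add: card_image)
			then have "codim T + Suc n = c" "card T = Suc n" using S T codim_shift[OF T] eq by auto
			then show ?thesis using T eq by auto
		qed
	next
		fix S assume "S \<in> ?B Un ?C"
		then consider (1) T where "T \<in> ?A n c" "S = insert 0 (Suc ` T)" | (2) T where "Suc n <= c" "T \<in> ?A (Suc n) (c - Suc n)" "S = Suc ` T"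
			by (auto split: if_splits)
		then show "S \<in> ?A (Suc n) c"
		proof cases
			case 1
			then have "card S = Suc (card T)" by (simp add: card_image)
			then show ?thesis using 1 codim_insert_0[of T] by auto
		next
			case 2
			then show ?thesis using codim_shift[of T] by (auto simp: card_image)
		qed
	qed
	moreover have "card (?B Un ?C) = card ?B + card ?C"
	proof (rule card_Un_disjoint)
		show "finite ?B" "finite ?C" using finite_codim by simp_all
		show "?B Int ?C = {}" by auto
	qed
	ultimately have "card (?A (Suc n) c) = card ?B + card ?C" by (simp only:)
	moreover have "card ?B = card (?A n c)"
	proof (rule card_image, rule inj_onI)
		fix S T assume "insert 0 (Suc ` S) = insert 0 (Suc ` T)"
		then have "Suc ` S = Suc ` T" by (metis Diff_insert_absorb imageE nat.distinct(1))
		then show "S = T" by (simp add: inj_image_eq_iff)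
	qed
	moreover have "card ((`) Suc ` ?A (Suc n) k) = card (?A (Suc n) k)" for k
		by (rule card_image) (auto simp: inj_on_def inj_image_eq_iff)
	ultimately have "card (?A (Suc n) c) = card (?A n c) + (if c < Suc n then 0 else card (?A (Suc n) (c - Suc n)))" by simp
	then show "fps_nth (W (Suc n)) c = fps_nth (W n + fps_X ^ Suc n * W (Suc n)) c"
		by (simp only: W_def fps_X_power_mult_nth fps_add_nth fps_nth_Abs_fps)
qed

section \<open>A partition identity\<close>

abbreviation XX :: "nat fps" where "XX \<equiv> fps_X"

text \<open>Stands in for division by 1 - X^(n+1): the equation determines the coefficients one
  after the other.\<close>

lemma fps_fixpoint_unique:
	assumes "A = C + XX ^ Suc n * A" "B = C + XX ^ Suc n * B"
	shows "A = B"
proof (rule fps_ext)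
	fix c show "fps_nth A c = fps_nth B c"
	proof (induction c rule: less_induct)
		case (less c)
		have "fps_nth A c = fps_nth C c + (if c < Suc n then 0 else fps_nth A (c - Suc n))"
			by (subst assms(1)) (simp only: fps_add_nth fps_X_power_mult_nth)
		moreover have "fps_nth B c = fps_nth C c + (if c < Suc n then 0 else fps_nth B (c - Suc n))"
			by (subst assms(2)) (simp only: fps_add_nth fps_X_power_mult_nth)
		ultimately show ?case using less.IH[of "c - Suc n"] by simp
	qed
qed

text \<open>The powers of X in the last clause arise because the variables X, ..., X^r are X times
  the variables 1, ..., X^(r-1).\<close>

fun ee :: "nat => nat => nat fps" where
	"ee r 0 = 1"
| "ee 0 (Suc k) = 0"
| "ee (Suc r) (Suc k) = XX ^ k * ee r k + XX ^ Suc k * ee r (Suc k)"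

lemma ee_zero: "r < k ==> ee r k = 0"
	by (induction r k rule: ee.induct) auto

lemma mult_W_Suc: "m * W (Suc r) = m * W r + XX ^ Suc r * (m * W (Suc r))"
proof -
	have "m * W (Suc r) = m * (W r + XX ^ Suc r * W (Suc r))" by (rule arg_cong[OF W_Suc])
	also have "\<dots> = m * W r + XX ^ Suc r * (m * W (Suc r))" by (simp only: distrib_left mult_ac)
	finally show ?thesis .
qed

text \<open>The recursion is applied to one factor and then, in the product that carries X^(u+1), to
  the other. This asymmetric expansion is the one whose terms recombine in \<open>ee_W\<close> and
  \<open>durfee\<close>.\<close>

lemma W_Suc_mult:
	"W (Suc u) * W (Suc s) = W u * W (Suc s) + XX ^ Suc u * (W (Suc u) * W s) + XX ^ (Suc u + Suc s) * (W (Suc u) * W (Suc s))"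
proof -
	have 1: "W (Suc s) * W (Suc u) = W (Suc s) * W u + XX ^ Suc u * (W (Suc s) * W (Suc u))"
		by (rule mult_W_Suc)
	have 2: "W (Suc s) * W (Suc u) = W (Suc u) * W s + XX ^ Suc s * (W (Suc u) * W (Suc s))"
		by (subst mult.commute) (rule mult_W_Suc)
	have "W (Suc u) * W (Suc s) = W (Suc s) * W u + XX ^ Suc u * (W (Suc s) * W (Suc u))"
		by (subst mult.commute) (rule 1)
	also have "XX ^ Suc u * (W (Suc s) * W (Suc u)) = XX ^ Suc u * (W (Suc u) * W s + XX ^ Suc s * (W (Suc u) * W (Suc s)))"
		by (rule arg_cong[OF 2])
	also have "W (Suc s) * W u + XX ^ Suc u * (W (Suc u) * W s + XX ^ Suc s * (W (Suc u) * W (Suc s)))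
			= W u * W (Suc s) + XX ^ Suc u * (W (Suc u) * W s) + XX ^ (Suc u + Suc s) * (W (Suc u) * W (Suc s))"
		unfolding power_add by (simp only: distrib_left mult_ac add_ac)
	finally show ?thesis .
qed

lemma choose_two_Suc: "Suc k * k div 2 = k * (k - 1) div 2 + (k::nat)"
	by (cases k) auto

text \<open>The evaluation of elementary symmetric polynomials at 1, X, ..., X^(r-1) as a power of X
  times a Gaussian binomial, cleared of denominators. After multiplication by the series both sides
  solve the same fixed-point equation, whose inhomogeneous parts agree by induction.\<close>

lemma ee_W: "k <= r ==> ee r k * W r = XX ^ (k * (k - 1) div 2) * (W k * W (r - k))"
proof (induction r k rule: ee.induct)
	case (1 r)
	then show ?case by (simp add: W_0)
next
	case (2 k)
	then show ?case by simp
next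
	case (3 r k)
	let ?t = "k * (k - 1) div 2"
	have p: "XX ^ (Suc k * (Suc k - 1) div 2) = XX ^ ?t * XX ^ k"
		using choose_two_Suc[of k] by (simp add: power_add)
	have IH1: "ee r k * W r = XX ^ ?t * (W k * W (r - k))" using 3 by simp
	show ?case
	proof (cases "k = r")
		case True
		have "ee r (Suc k) = 0" by (rule ee_zero) (simp add: True)
		then have A: "ee (Suc r) (Suc k) = XX ^ k * ee r k" by simp
		have I: "ee r k * W r = XX ^ ?t * W k" using IH1 True by (simp add: W_0)
		have "ee (Suc r) (Suc k) * W (Suc r) = XX ^ ?t * XX ^ k * W (Suc r)"
		proof (rule fps_fixpoint_unique)
			have "ee (Suc r) (Suc k) * W r = XX ^ k * (XX ^ ?t * W k)" unfolding A mult.assoc I ..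
			then show "ee (Suc r) (Suc k) * W (Suc r) = XX ^ k * (XX ^ ?t * W k) + XX ^ Suc r * (ee (Suc r) (Suc k) * W (Suc r))"
				by (metis mult_W_Suc)
			have "XX ^ ?t * XX ^ k * W r = XX ^ k * (XX ^ ?t * W k)" unfolding True by (simp only: mult_ac)
			then show "XX ^ ?t * XX ^ k * W (Suc r) = XX ^ k * (XX ^ ?t * W k) + XX ^ Suc r * (XX ^ ?t * XX ^ k * W (Suc r))"
				by (metis mult_W_Suc)
		qed
		then show ?thesis using True p by (simp add: W_0)
	next
		case False
		then have kr: "Suc k <= r" using 3 by simp
		then obtain s where s: "r - k = Suc s" "r - Suc k = s" "r = k + Suc s" by (metis Suc_diff_Suc Suc_le_eq le_add_diff_inverse less_or_eq_imp_le)
		have IH2: "ee r (Suc k) * W r = XX ^ ?t * XX ^ k * (W (Suc k) * W s)" using 3 kr p s by simp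
		let ?C = "XX ^ ?t * XX ^ k * (W k * W (Suc s) + XX ^ Suc k * (W (Suc k) * W s))"
		have C: "(XX ^ k * ee r k + XX ^ Suc k * ee r (Suc k)) * W r = ?C"
		proof -
			have "(XX ^ k * ee r k + XX ^ Suc k * ee r (Suc k)) * W r = XX ^ k * (ee r k * W r) + XX ^ Suc k * (ee r (Suc k) * W r)"
				by (simp only: distrib_right mult.assoc)
			also have "\<dots> = ?C" unfolding IH1 IH2 s(1) by (simp only: distrib_left mult_ac)
			finally show ?thesis .
		qed
		have "ee (Suc r) (Suc k) * W (Suc r) = XX ^ ?t * XX ^ k * (W (Suc k) * W (Suc s))"
		proof (rule fps_fixpoint_unique)
			have "ee (Suc r) (Suc k) * W r = ?C" using C by simp
			then show "ee (Suc r) (Suc k) * W (Suc r) = ?C + XX ^ Suc r * (ee (Suc r) (Suc k) * W (Suc r))"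
				by (metis mult_W_Suc)
			have sr: "Suc k + Suc s = Suc r" using s(3) by simp
			show "XX ^ ?t * XX ^ k * (W (Suc k) * W (Suc s)) = ?C + XX ^ Suc r * (XX ^ ?t * XX ^ k * (W (Suc k) * W (Suc s)))"
				unfolding sr[symmetric] by (subst W_Suc_mult) (simp only: distrib_left mult_ac add_ac)
		qed
		then show ?thesis using p s by simp
	qed
qed

text \<open>Geometrically, the contribution of the rank-\<open>s\<close> matrices to the equivariant
  series of a-by-b matrices: they have codimension (a - s)(b - s), and the stabiliser has reductive
  part GL_s x GL_(a-s) x GL_(b-s).\<close>

definition TT :: "nat => nat => nat => nat fps" where
	"TT a b s = (if s <= a & s <= b then XX ^ ((a - s) * (b - s)) * (W (a - s) * W (b - s) * W s) else 0)"

text \<open>In the induction on \<open>b\<close> both sides are shown to solve S =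
  \<open>W a * W b\<close> + X^(b+1) S.\<close>

lemma durfee: "(\<Sum>s\<le>b. TT a b s) = W a * W b"
proof (induction b)
	case 0
	show ?case by (simp add: TT_def W_0)
next
	case (Suc b)
	\<comment> \<open>\<open>W_Suc_mult\<close> splits a summand for \<open>Suc b\<close> into three.
	  \<open>P\<close> and \<open>R\<close> are the two without the factor X^(b+1) in front of the
	  whole summand; the third one drives the fixed-point equation.\<close>
	define P where "P s = (if s <= a & s <= b then XX ^ ((a - s) * (Suc b - s)) * (W (a - s) * W (b - s) * W s) else 0)" for s
	define R where "R s = (if 1 <= s & s <= a & s <= Suc b
			then XX ^ ((Suc b - s) + (a - s) * (Suc b - s)) * (W (a - s) * W (Suc b - s) * W (s - 1)) else 0)" for s
	have 1: "TT a (Suc b) s = P s + R s + XX ^ Suc b * TT a (Suc b) s" if "s <= Suc b" for s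
	proof (cases "s <= a")
		case True
		consider "s = 0" | "s = Suc b" "s ~= 0" | u t where "s = Suc t" "Suc b - s = Suc u" "b - s = u" "Suc u + Suc t = Suc b"
		proof (cases s)
			case (Suc t)
			show ?thesis
			proof (cases "s = Suc b")
				case False
				then have "Suc b - s = Suc (b - s)" "Suc (b - s) + Suc t = Suc b" using \<open>s <= Suc b\<close> Suc by auto
				then show ?thesis using that(3)[OF Suc] by blast
			qed (use Suc that in auto)
		qed (use that in auto)
		then show ?thesis
		proof cases
			case 1
			then have "TT a (Suc b) s = XX ^ (a * Suc b) * (W a * W (Suc b))" by (simp add: TT_def W_0)
			moreover have "P s = XX ^ (a * Suc b) * (W a * W b)" "R s = 0" using 1 by (simp_all add: P_def R_def W_0)
			ultimately show ?thesis using mult_W_Suc[of "XX ^ (a * Suc b) * W a" b] by (simp only: mult.assoc add_0_right)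
		next
			case 2
			then have "TT a (Suc b) s = W (a - s) * W (Suc b)" using True by (simp add: TT_def W_0)
			moreover have "R s = W (a - s) * W b" "P s = 0" using 2 True by (simp_all add: P_def R_def W_0)
			ultimately show ?thesis using mult_W_Suc[of "W (a - s)" b] by (simp only: add_0_left)
		next
			case 3
			have T: "TT a (Suc b) s = XX ^ ((a - s) * Suc u) * W (a - s) * (W (Suc u) * W (Suc t))"
				using 3 True by (simp add: TT_def mult_ac)
			have PP: "P s = XX ^ ((a - s) * Suc u) * W (a - s) * (W u * W (Suc t))"
				using 3 True by (simp add: P_def mult_ac)
			have RR: "R s = XX ^ ((a - s) * Suc u) * W (a - s) * (XX ^ Suc u * (W (Suc u) * W t))"
			proof -
				have "R s = XX ^ (Suc u + (a - s) * Suc u) * (W (a - s) * W (Suc u) * W t)"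
					unfolding R_def using 3 True that by simp
				then show ?thesis unfolding power_add by (simp only: mult_ac)
			qed
			have "XX ^ ((a - s) * Suc u) * W (a - s) * (W (Suc u) * W (Suc t)) = XX ^ ((a - s) * Suc u) * W (a - s) * (W u * W (Suc t)
				+ XX ^ Suc u * (W (Suc u) * W t) + XX ^ Suc b * (W (Suc u) * W (Suc t)))"
				using W_Suc_mult[of u t] unfolding 3(4) by (rule arg_cong)
			also have "\<dots> = XX ^ ((a - s) * Suc u) * W (a - s) * (W u * W (Suc t))
					+ XX ^ ((a - s) * Suc u) * W (a - s) * (XX ^ Suc u * (W (Suc u) * W t))
					+ XX ^ Suc b * (XX ^ ((a - s) * Suc u) * W (a - s) * (W (Suc u) * W (Suc t)))"
				by (simp only: distrib_left mult_ac add_ac)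
			finally show ?thesis unfolding T PP RR .
		qed
	qed (simp add: TT_def P_def R_def)
	\<comment> \<open>The recursion of \<open>W (a - s)\<close> merges \<open>P s\<close> with the
	  shifted term \<open>R (Suc s)\<close> into a single summand for \<open>b\<close>.\<close>
	have 2: "P s + R (Suc s) = TT a b s" if s: "s <= b" for s
	proof (cases "s < a")
		case True
		define q where "q = a - Suc s"
		have q: "a - s = Suc q" "a - Suc s = q" using True by (auto simp: q_def)
		let ?u = "b - s"
		have u: "Suc b - s = Suc ?u" "Suc b - Suc s = ?u" using s by auto
		have e1: "Suc q * Suc ?u = Suc q * ?u + Suc q" "?u + q * ?u = Suc q * ?u" by simp_all
		have "P s + R (Suc s) = XX ^ (Suc q * ?u) * (XX ^ Suc q * W (Suc q)) * (W ?u * W s) + XX ^ (Suc q * ?u) * W q * (W ?u * W s)"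
		proof -
			have "P s = XX ^ (Suc q * Suc ?u) * (W (Suc q) * W ?u * W s)"
				unfolding P_def using s True q(1) u(1) by simp
			moreover have "R (Suc s) = XX ^ (?u + q * ?u) * (W q * W ?u * W s)"
				unfolding R_def q(2) u(2) using s True by simp
			ultimately show ?thesis unfolding e1 power_add by (simp only: mult_ac)
		qed
		also have "\<dots> = XX ^ (Suc q * ?u) * (W q + XX ^ Suc q * W (Suc q)) * (W ?u * W s)"
			by (simp only: distrib_left distrib_right add_ac)
		also have "\<dots> = TT a b s" using W_Suc[of q] s True q by (simp add: TT_def mult_ac)
		finally show ?thesis .
	next
		case False
		then show ?thesis using s by (cases "s = a") (auto simp: P_def R_def TT_def)
	qed
	have "(\<Sum>s\<le>Suc b. TT a (Suc b) s) = (\<Sum>s\<le>Suc b. P s + R s + XX ^ Suc b * TT a (Suc b) s)"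
		by (rule sum.cong) (use 1 in auto)
	also have "\<dots> = (\<Sum>s\<le>Suc b. P s) + (\<Sum>s\<le>Suc b. R s) + XX ^ Suc b * (\<Sum>s\<le>Suc b. TT a (Suc b) s)"
		by (simp only: sum.distrib sum_distrib_left)
	also have "(\<Sum>s\<le>Suc b. P s) = (\<Sum>s\<le>b. P s)" by (simp add: P_def)
	also have "(\<Sum>s\<le>Suc b. R s) = (\<Sum>s\<le>b. R (Suc s))"
		by (subst sum.atMost_Suc_shift) (simp add: R_def)
	also have "(\<Sum>s\<le>b. P s) + (\<Sum>s\<le>b. R (Suc s)) = (\<Sum>s\<le>b. TT a b s)"
		unfolding sum.distrib[symmetric] by (rule sum.cong) (use 2 in auto)
	finally have "(\<Sum>s\<le>Suc b. TT a (Suc b) s) = W a * W b + XX ^ Suc b * (\<Sum>s\<le>Suc b. TT a (Suc b) s)"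
		unfolding Suc.IH .
	moreover have "W a * W (Suc b) = W a * W b + XX ^ Suc b * (W a * W (Suc b))"
		by (rule mult_W_Suc)
	ultimately show ?case by (rule fps_fixpoint_unique)
qed

text \<open>The factor of the vertices 0 and 1 in the series of the \<open>k\<close>-th term. The
  exponent is half of k^2 - k: the shift by k^2, less the displacement by k that the
  \<open>k\<close>-th term has along the complex.\<close>

definition VV :: "nat => nat => nat => nat fps" where
	"VV a b k = (if k <= a & k <= b then XX ^ (k * (k - 1) div 2) * (W k * (W (a - k) * W (b - k))) else 0)"

text \<open>The factor \<open>XX ^ k * ee (r - 1) k\<close> collects the monomials of degree k + 1
  containing the variable 1. For \<open>r = 0\<close> there are no variables, and this summand alone
  forms \<open>RR a b 0\<close>.\<close>

fun RR :: "nat => nat => nat => nat fps" where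
	"RR a b 0 = TT a b 0"
| "RR a b (Suc k) = (\<Sum>r\<in>{1..b}. XX ^ k * ee (r - 1) k * TT a b r)"

text \<open>\<open>ee_W\<close> replaces \<open>ee r k * W r\<close> by
  \<open>W k * W (r - k)\<close> up to a power of X; the sum over \<open>r\<close> is then
  \<open>durfee\<close> for \<open>a - k\<close> and \<open>b - k\<close>.\<close>

lemma VV_sum: "VV a b k = (\<Sum>r\<le>b. ee r k * TT a b r)"
proof (cases "k <= a & k <= b")
	case True
	have "(\<Sum>r\<le>b. ee r k * TT a b r) = (\<Sum>r\<in>{k..b}. ee r k * TT a b r)"
		by (rule sum.mono_neutral_right) (auto simp: ee_zero)
	also have "\<dots> = (\<Sum>s\<in>{0..b-k}. ee (s + k) k * TT a b (s + k))"
		using sum.shift_bounds_cl_nat_ivl[of "%r. ee r k * TT a b r" 0 k "b - k"] True by simp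
	also have "\<dots> = (\<Sum>s\<in>{0..b-k}. XX ^ (k * (k - 1) div 2) * W k * TT (a - k) (b - k) s)"
	proof (rule sum.cong[OF refl])
		fix s assume "s \<in> {0..b-k}"
		show "ee (s + k) k * TT a b (s + k) = XX ^ (k * (k - 1) div 2) * W k * TT (a - k) (b - k) s"
		proof (cases "s + k <= a & s + k <= b")
			case True
			then have d: "a - (s + k) = a - k - s" "b - (s + k) = b - k - s" "s <= a - k" "s <= b - k" by auto
			have "ee (s + k) k * TT a b (s + k)
					= (ee (s + k) k * W (s + k)) * (XX ^ ((a - k - s) * (b - k - s)) * (W (a - k - s) * W (b - k - s)))"
				using True unfolding TT_def d by (simp add: mult_ac)
			also have "\<dots> = XX ^ (k * (k - 1) div 2) * W k * TT (a - k) (b - k) s"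
				using ee_W[of k "s + k"] d by (simp add: TT_def mult_ac)
			finally show ?thesis .
		next
			case False
			then have "TT a b (s + k) = 0" "TT (a - k) (b - k) s = 0"
				using \<open>k <= a & k <= b\<close> by (auto simp: TT_def)
			then show ?thesis by simp
		qed
	qed
	also have "\<dots> = XX ^ (k * (k - 1) div 2) * W k * (W (a - k) * W (b - k))"
		unfolding sum_distrib_left[symmetric] using durfee[of "a - k" "b - k"] by (simp add: atLeast0AtMost)
	finally show ?thesis using True by (simp add: VV_def mult_ac)
next
	case False
	have "ee r k * TT a b r = 0" for r
		using False ee_zero[of r k] by (cases "r < k") (auto simp: TT_def)
	then show ?thesis unfolding VV_def if_not_P[OF False] by (simp only: sum.neutral_const)
qed

lemma VV_RR: "VV a b k = RR a b k + RR a b (Suc k)"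
proof (cases k)
	case 0
	\<comment> \<open>The summand \<open>r = 0\<close> is split off, since it is
	  \<open>RR a b 0\<close>, while the others make up \<open>RR a b 1\<close>.\<close>
	have "{..b} = insert 0 {1..b}" by auto
	then show ?thesis by (simp add: VV_sum 0)
next
	case (Suc j)
	have "{..b} = insert 0 {1..b}" by auto
	then have "VV a b k = (\<Sum>r\<in>{1..b}. ee r (Suc j) * TT a b r)" by (simp add: VV_sum Suc)
	also have "\<dots> = (\<Sum>r\<in>{1..b}. XX ^ j * ee (r - 1) j * TT a b r + XX ^ Suc j * ee (r - 1) (Suc j) * TT a b r)"
	proof (rule sum.cong[OF refl])
		fix r assume "r \<in> {1..b}"
		then obtain q where "r = Suc q" by (cases r) auto
		then show "ee r (Suc j) * TT a b r = XX ^ j * ee (r - 1) j * TT a b r + XX ^ Suc j * ee (r - 1) (Suc j) * TT a b r"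
			by (simp add: distrib_right)
	qed
	finally show ?thesis unfolding Suc RR.simps by (simp only: sum.distrib)
qed

text \<open>The exponent is half of 2ab, the amount by which the two added arrows lower the Euler
  form.\<close>

lemma RR_0: "RR a b 0 = XX ^ (a * b) * (W a * W b)"
	by (simp add: TT_def W_0)

section \<open>Frames and complex matrices\<close>

text \<open>Side conditions are equations between dimensions instead of carrier memberships, so that
  simplification discharges them in long products.\<close>

lemma mat_assoc: "dim_col A = dim_row B ==> dim_col B = dim_row C ==> A * B * C = A * (B * (C :: complex mat))"
	by (rule assoc_mult_mat[of A "dim_row A" "dim_row B" B "dim_col B" C "dim_col C"]) (auto intro: carrier_matI)

lemma mat_distr_left:
	"dim_col A = dim_row B ==> dim_row B = dim_row C ==> dim_col B = dim_col C ==> A * (B + C) = A * B + A * (C :: complex mat)"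
	by (rule mult_add_distrib_mat[of A "dim_row A" "dim_row B" B "dim_col B" C]) (auto intro: carrier_matI)

lemma mat_distr_right:
	"dim_col A = dim_row C ==> dim_row A = dim_row B ==> dim_col A = dim_col B ==> (A + B) * C = A * C + B * (C :: complex mat)"
	by (rule add_mult_distrib_mat[of A "dim_row A" "dim_col A" B C "dim_col C"]) (auto intro: carrier_matI)

lemma mat_mdistr_left:
	"dim_col A = dim_row B ==> dim_row B = dim_row C ==> dim_col B = dim_col C ==> A * (B - C) = A * B - A * (C :: complex mat)"
	by (rule mult_minus_distrib_mat[of A "dim_row A" "dim_row B" B "dim_col B" C]) (auto intro: carrier_matI)

lemma mat_mdistr_right:
	"dim_col A = dim_row C ==> dim_row A = dim_row B ==> dim_col A = dim_col B ==> (A - B) * C = A * C - B * (C :: complex mat)"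
	by (rule minus_mult_distrib_mat[of A "dim_row A" "dim_col A" B C "dim_col C"]) (auto intro: carrier_matI)

lemma mat_one_left: "dim_row A = n ==> 1\<^sub>m n * A = (A :: complex mat)"
	by (rule left_mult_one_mat) (auto intro: carrier_matI)

lemma mat_one_right: "dim_col A = n ==> A * 1\<^sub>m n = (A :: complex mat)"
	by (rule right_mult_one_mat) (auto intro: carrier_matI)

lemma mat_zero_left: "dim_row A = n ==> 0\<^sub>m m n * A = 0\<^sub>m m (dim_col (A :: complex mat))"
	by (rule left_mult_zero_mat) (auto intro: carrier_matI)

lemma mat_zero_right: "dim_col A = n ==> A * 0\<^sub>m n m = 0\<^sub>m (dim_row (A :: complex mat)) m"
	by (rule right_mult_zero_mat) (auto intro: carrier_matI)

lemma mat_add_zero: "dim_row A = n ==> dim_col A = m ==> A + 0\<^sub>m n m = (A :: complex mat)"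
	"dim_row A = n ==> dim_col A = m ==> 0\<^sub>m n m + A = (A :: complex mat)"
	"dim_row A = n ==> dim_col A = m ==> A - 0\<^sub>m n m = (A :: complex mat)"
	by (auto intro!: eq_matI)

lemma mat_diff_self: "A - A = 0\<^sub>m (dim_row A) (dim_col (A :: complex mat))"
	by (auto intro!: eq_matI)

lemmas mat_dim_simps = mat_distr_left mat_distr_right mat_mdistr_left
	mat_mdistr_right mat_assoc mat_one_left mat_one_right mat_zero_left mat_zero_right
	mat_add_zero mat_diff_self

text \<open>With products kept associated to the right, a known product A B = C occurs only as A (B
  D); this form lets it be used as a rewrite rule there.\<close>

lemma mat_cancel:
	assumes "A * B = C" "dim_col A = dim_row B" "dim_col B = dim_row D"
	shows "A * (B * D) = C * (D :: complex mat)"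
	using mat_assoc[OF assms(2,3)] assms(1) by simp

definition mat_surj :: "nat => nat => complex mat => bool" where
	"mat_surj m n f \<longleftrightarrow> f \<in> carrier_mat m n & (EX s:carrier_mat n m. f * s = 1\<^sub>m m)"

lemma mult_select:
	assumes "A \<in> carrier_mat m n" "i < m" "q < l" "c q < n"
	shows "(A * mat n l (%(i,j). of_bool (i = c j))) $$ (i, q) = (A $$ (i, c q) :: complex)"
	by (subst mat_mult_entry[OF assms(1) _ assms(2,3)])
		(use assms in \<open>auto simp: of_bool_def if_distrib[of "%y. _ * y"] cong: if_cong\<close>)

text \<open>A maximal independent set of columns has \<open>k\<close> elements by the rank
  condition, and these columns form the minor.\<close>

lemma mat_surj_minor:
	assumes f: "f \<in> carrier_mat k n" and r: "vec_space.rank k f = k"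
	obtains c where "inj_on c {..<k}" "c ` {..<k} <= {..<n}" "mat k k (%(i,j). f $$ (i, c j)) \<in> carrier (GL k)"
proof -
	interpret vec_space "TYPE(complex)" k .
	obtain U where U: "maximal U (%T. T <= set (cols f) & lin_indpt T)"
		using maximal_exists_superset[of "set (cols f)" "%T. T <= set (cols f) & lin_indpt T" "{}"]
		by (auto simp: lin_dep_def)
	then have U': "U <= set (cols f)" "lin_indpt U" by (auto simp: maximal_def)
	have cU: "card U = k" using rank_card_indpt[OF f U] r by simp
	have finU: "finite U" using U'(1) finite_subset by blast
	obtain g where g: "bij_betw g {..<k} U" using finU cU by (metis bij_betw_from_nat_into_finite)
	have "EX j. j < n & col f j = g i" if "i < k" for i
	proof -
		have "g i \<in> set (cols f)" using g that U'(1) by (auto simp: bij_betw_def)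
		then show ?thesis using f by (auto simp: cols_def)
	qed
	then obtain c where c: "!!i. i < k ==> c i < n & col f (c i) = g i" by metis
	have inj: "inj_on c {..<k}"
	proof (rule inj_onI)
		fix i j assume "i \<in> {..<k}" "j \<in> {..<k}" "c i = c j"
		then have "g i = g j" using c by (metis lessThan_iff)
		then show "i = j" using g \<open>i \<in> {..<k}\<close> \<open>j \<in> {..<k}\<close> by (auto simp: bij_betw_def inj_on_def)
	qed
	let ?M = "mat k k (%(i,j). f $$ (i, c j))"
	have M: "?M \<in> carrier_mat k k" by simp
	have colM: "col ?M j = g j" if "j < k" for j
	proof -
		have "c j < n" using c[OF that] by blast
		then have "col ?M j = col f (c j)" using that f by (intro eq_vecI) auto
		then show ?thesis using c[OF that] by simp
	qed
	have cM: "cols ?M = map g [0..<k]" using colM by (simp add: cols_def)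
	have "distinct (cols ?M)" unfolding cM distinct_map using g by (auto simp: bij_betw_def atLeast0LessThan)
	moreover have "set (cols ?M) = U" unfolding cM using g by (auto simp: bij_betw_def atLeast0LessThan)
	ultimately have "rank ?M = k" using lin_indpt_full_rank[OF M] U'(2) by simp
	then have "?M \<in> carrier (GL k)" using det_rank_iff[OF M] M GL_iff by blast
	then show ?thesis using that[OF inj] c by auto
qed

lemma rank_of_surj:
	assumes "mat_surj k n f"
	shows "vec_space.rank k f = k"
proof -
	interpret vec_space "TYPE(complex)" k .
	obtain s where f: "f \<in> carrier_mat k n" and s: "s \<in> carrier_mat n k" "f * s = 1\<^sub>m k"
		using assms by (auto simp: mat_surj_def)
	have "v \<in> span (set (cols f))" if v: "v \<in> carrier_vec k" for v
	proof -
		have "f *\<^sub>v (s *\<^sub>v v) = v" using s f v assoc_mult_mat_vec[OF f s(1) v] by simp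
		then show ?thesis
			using col_space_eq[OF f] f s v unfolding col_space_def
			by (auto intro!: bexI[of _ "s *\<^sub>v v"])
	qed
	moreover have "set (cols f) <= carrier_vec k" using cols_dim f by blast
	ultimately have "span (set (cols f)) = carrier_vec k"
		using span_is_subset2[of "set (cols f)"] by auto
	then have "span_vs (set (cols f)) = V" by (simp add: module_vec_def)
	then show ?thesis unfolding rank_def by (simp add: dim_is_n)
qed

text \<open>\<open>b\<close> parametrises the kernel of \<open>f\<close> and \<open>s\<close> is a right inverse.\<close>

definition splitting :: "nat => nat => complex mat => complex mat => complex mat => complex mat => bool" where
	"splitting m l f b L s \<longleftrightarrow> f \<in> carrier_mat m (l + m) & b \<in> carrier_mat (l + m) l
		& L \<in> carrier_mat l (l + m) & s \<in> carrier_mat (l + m) m & f * s = 1\<^sub>m m & f * b = 0\<^sub>m m l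
		& L * b = 1\<^sub>m l & L * s = 0\<^sub>m l m & b * L + s * f = 1\<^sub>m (l + m)"

text \<open>\<open>c\<close> marks columns with an invertible minor and \<open>p\<close> enumerates
  the other positions. The right inverse is supported on the rows marked by \<open>c\<close>; the
  unit vectors at \<open>p\<close>, corrected by it, span the kernel, and \<open>L\<close> reads off
  the coordinates at \<open>p\<close>.\<close>

lemma ex_splitting:
	assumes f: "f \<in> carrier_mat m (l + m)" and r: "vec_space.rank m f = m"
	shows "EX b L s. splitting m l f b L s"
proof -
	obtain c where c: "inj_on c {..<m}" "c ` {..<m} <= {..<l + m}"
		and M: "mat m m (%(i,j). f $$ (i, c j)) \<in> carrier (GL m)"
		using mat_surj_minor[OF f r] .
	define F where "F = mat m m (%(i,j). f $$ (i, c j))"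
	define N where "N = ginv[m] F"
	have N: "N \<in> carrier_mat m m" "F * N = 1\<^sub>m m" "N * F = 1\<^sub>m m" "F \<in> carrier_mat m m"
		using GL_inv[OF M] by (auto simp: N_def F_def)
	let ?C = "c ` {..<m}"
	have "card ({..<l + m} - ?C) = l" using c by (subst card_Diff_subset) (auto simp: card_image)
	then obtain p where p: "bij_betw p {..<l} ({..<l + m} - ?C)"
		by (metis bij_betw_from_nat_into_finite finite_Diff finite_lessThan)
	define I where "I = mat (l + m) m (%(i,j). of_bool (i = c j) :: complex)"
	define s where "s = I * N"
	define L where "L = mat l (l + m) (%(i,j). of_bool (j = p i) :: complex)"
	define I2 where "I2 = mat (l + m) l (%(i,j). of_bool (i = p j) :: complex)"
	define b where "b = I2 - s * (f * I2)"
	have IC: "I \<in> carrier_mat (l + m) m" "L \<in> carrier_mat l (l + m)" "I2 \<in> carrier_mat (l + m) l"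
		"s \<in> carrier_mat (l + m) m" "b \<in> carrier_mat (l + m) l"
		using N(1) f by (auto simp: I_def L_def I2_def s_def b_def)
	note d = IC[THEN mdim] N(1,4)[THEN mdim]
		f[THEN mdim]
	have pl: "p i < l + m" "p i ~: ?C" if "i < l" for i using p that by (auto simp: bij_betw_def)
	have cl: "c i < l + m" if "i < m" for i using c(2) that by auto
	have pinj: "p i = p j \<longleftrightarrow> i = j" if "i < l" "j < l" for i j using p that by (auto simp: bij_betw_def inj_on_def)
	have cinj: "c i = c j \<longleftrightarrow> i = j" if "i < m" "j < m" for i j using c(1) that by (auto simp: inj_on_def)
	have fI: "f * I = F"
	proof (rule eq_matI)
		fix i j assume "i < dim_row F" "j < dim_col F"
		then show "(f * I) $$ (i, j) = F $$ (i, j)"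
			unfolding F_def I_def using mult_select[OF f, of i j m c] cl[of j] by simp
	qed (use f IC in \<open>auto simp: F_def\<close>)
	have LI: "L * I = 0\<^sub>m l m"
	proof (rule eq_matI)
		fix i j assume "i < dim_row (0\<^sub>m l m :: complex mat)" "j < dim_col (0\<^sub>m l m :: complex mat)"
		then have "i < l" "j < m" by auto
		then show "(L * I) $$ (i, j) = 0\<^sub>m l m $$ (i,j)"
		proof -
			have "c j ~= p i" using \<open>j < m\<close> pl(2)[OF \<open>i < l\<close>] by (metis imageI lessThan_iff)
			then show ?thesis
				unfolding I_def using \<open>i < l\<close> \<open>j < m\<close> cl[of j] mult_select[OF IC(2), of i j m c] by (simp add: L_def)
		qed
	qed (use IC in auto)
	have LI2: "L * I2 = 1\<^sub>m l"
	proof (rule eq_matI)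
		fix i j assume "i < dim_row (1\<^sub>m l :: complex mat)" "j < dim_col (1\<^sub>m l :: complex mat)"
		then have "i < l" "j < l" by auto
		then show "(L * I2) $$ (i, j) = 1\<^sub>m l $$ (i,j)"
			unfolding I2_def using pl(1)[of j] pinj[of i j] mult_select[OF IC(2), of i j l p] by (auto simp: L_def)
	qed (use IC in auto)
	have fs: "f * s = 1\<^sub>m m" unfolding s_def using N(2) fI d by (simp add: mat_assoc[symmetric])
	have Ls: "L * s = 0\<^sub>m l m" unfolding s_def using LI d by (simp add: mat_assoc[symmetric] mat_zero_left)
	have fb: "f * b = 0\<^sub>m m l" unfolding b_def using d by (simp add: mat_dim_simps mat_cancel[OF fs])
	have Lb: "L * b = 1\<^sub>m l" unfolding b_def using d LI2 by (simp add: mat_dim_simps mat_cancel[OF Ls])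
	\<comment> \<open>\<open>E\<close> fixes the columns of \<open>I\<close> and of \<open>I2\<close>,
	  which together are all the unit vectors.\<close>
	define E where "E = b * L + s * f"
	have E: "E \<in> carrier_mat (l + m) (l + m)" using d by (auto simp: E_def)
	have EI: "E * I = I"
	proof -
		have "E * I = s * F" unfolding E_def using d LI fI by (simp add: mat_dim_simps)
		also have "\<dots> = I" unfolding s_def using d N(3) by (simp add: mat_dim_simps)
		finally show ?thesis .
	qed
	have EI2: "E * I2 = I2"
	proof -
		have "E * I2 = b + s * (f * I2)" unfolding E_def using d LI2 by (simp add: mat_dim_simps)
		also have "\<dots> = I2" unfolding b_def using d by (auto intro!: eq_matI)
		finally show ?thesis .
	qed
	have "E $$ (i, j) = of_bool (i = j)" if i: "i < l + m" and j: "j < l + m" for i j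
	proof (cases "j \<in> ?C")
		case True
		then obtain q where q: "q < m" "j = c q" by auto
		have "(E * I) $$ (i, q) = E $$ (i, j)"
			unfolding I_def using i j q mult_select[OF E, of i q m c] by simp
		moreover have "I $$ (i, q) = of_bool (i = j)" using i j q by (simp add: I_def)
		ultimately show ?thesis using EI by simp
	next
		case False
		then have "j \<in> p ` {..<l}" using p j by (auto simp: bij_betw_def)
		then obtain q where q: "q < l" "j = p q" by auto
		have "(E * I2) $$ (i, q) = E $$ (i, j)"
			unfolding I2_def using i j q mult_select[OF E, of i q l p] by simp
		moreover have "I2 $$ (i, q) = of_bool (i = j)" using i j q by (simp add: I2_def)
		ultimately show ?thesis using EI2 by simp
	qed
	then have "E = 1\<^sub>m (l + m)" using E by (intro eq_matI) auto
	then have "splitting m l f b L s"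
		unfolding splitting_def using f IC fs Ls fb Lb by (simp add: E_def)
	then show ?thesis by blast
qed

lemma surj_iff_rank: "f \<in> carrier_mat m n ==> vec_space.rank m f = m \<longleftrightarrow> mat_surj m n f"
proof
	interpret vec_space "TYPE(complex)" m .
	assume f: "f \<in> carrier_mat m n" and r: "rank f = m"
	then have "n - m + m = n" using rank_le_nc[OF f] by simp
	then show "mat_surj m n f" using ex_splitting[of f m "n - m"] f r by (auto simp: mat_surj_def splitting_def)
qed (rule rank_of_surj)

lemma surj_le: "mat_surj m n f ==> m <= n"
	using vec_space.rank_le_nc[of f m n] rank_of_surj[of m n f] by (auto simp: mat_surj_def)

lemma mat_inj_mult: "mat_inj n m A \<longleftrightarrow> (ALL c:carrier_mat m 1. A * c = 0\<^sub>m n 1 --> c = 0\<^sub>m m 1)"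
	if A: "A \<in> carrier_mat n m"
proof
	assume i: "mat_inj n m A"
	show "ALL c:carrier_mat m 1. A * c = 0\<^sub>m n 1 --> c = 0\<^sub>m m 1"
	proof (intro ballI impI)
		fix c assume c: "c \<in> carrier_mat m 1" and 0: "A * c = 0\<^sub>m n 1"
		have "ALL i<n. (\<Sum>j<m. A $$ (i,j) * c $$ (j,0)) = 0"
		proof (intro allI impI)
			fix i assume "i < n"
			then show "(\<Sum>j<m. A $$ (i,j) * c $$ (j,0)) = 0"
				using mat_mult_entry[OF A c, of i 0] 0 by simp
		qed
		then have "c $$ (j,0) = 0" if "j < m" for j
			using i[unfolded mat_inj_def, rule_format, of "%j. c $$ (j,0)" j] that by blast
		then show "c = 0\<^sub>m m 1" using c by (intro eq_matI) auto
	qed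
next
	assume R: "ALL c:carrier_mat m 1. A * c = 0\<^sub>m n 1 --> c = 0\<^sub>m m 1"
	show "mat_inj n m A"
		unfolding mat_inj_def
	proof (intro allI impI)
		fix c j assume *: "ALL i<n. (\<Sum>j<m. A $$ (i,j) * c j) = 0" and j: "j < m"
		let ?c = "mat m 1 (%(i,_). c i)"
		have c: "?c \<in> carrier_mat m 1" by simp
		have "A * ?c = 0\<^sub>m n 1"
		proof (rule eq_matI)
			fix i q assume "i < dim_row (0\<^sub>m n 1 :: complex mat)" "q < dim_col (0\<^sub>m n 1 :: complex mat)"
			then have "i < n" "q < 1" "q = 0" by auto
			then show "(A * ?c) $$ (i,q) = 0\<^sub>m n 1 $$ (i,q)"
				using mat_mult_entry[OF A c] * by simp
		qed (use A in auto)
		then have "?c = 0\<^sub>m m 1" using R c by blast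
		then have "?c $$ (j,0) = 0\<^sub>m m 1 $$ (j,0)" by simp
		then show "c j = 0" using j by simp
	qed
qed

lemma left_inverse_inj:
	assumes "A \<in> carrier_mat n m" "B \<in> carrier_mat m n" "B * A = 1\<^sub>m m"
	shows "mat_inj n m A"
	unfolding mat_inj_mult[OF assms(1)]
proof (intro ballI impI)
	fix c assume c: "c \<in> carrier_mat m 1" "A * c = 0\<^sub>m n 1"
	have "c = B * A * c" unfolding assms(3) using c(1) by (intro left_mult_one_mat[symmetric])
	also have "\<dots> = B * (A * c)" using assms(1,2) c(1) by (intro mat_assoc) auto
	also have "\<dots> = 0\<^sub>m m 1" using assms unfolding c(2) by (simp add: mat_zero_right del: One_nat_def)
	finally show "c = 0\<^sub>m m 1" .
qed

lemma GL_of_inj: "A \<in> carrier_mat n n ==> mat_inj n n A ==> A \<in> carrier (GL n)"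
	unfolding mat_inj_def by (rule GL_kernel) blast+

text \<open>Two injective parametrisations of the kernel differ by an invertible matrix, and
  \<open>L\<close> computes it because it is inverse to \<open>b\<close> on the kernel.\<close>

lemma kernel_basis_change:
	assumes s: "splitting m l f b L s" and b': "b' \<in> carrier_mat (l + m) l" "mat_inj (l + m) l b'" "f * b' = 0\<^sub>m m l"
	shows "L * b' \<in> carrier (GL l)" "b' = b * (L * b')"
proof -
	have c: "f \<in> carrier_mat m (l + m)" "b \<in> carrier_mat (l + m) l" "L \<in> carrier_mat l (l + m)" "s \<in> carrier_mat (l + m) m"
		and e: "b * L + s * f = 1\<^sub>m (l + m)" using s by (auto simp: splitting_def)
	note d = c[THEN mdim] b'(1)[THEN mdim]
	have "b' = (b * L + s * f) * b'" unfolding e using d by (simp add: mat_dim_simps)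
	also have "\<dots> = b * (L * b')" using d b'(3) by (simp add: mat_dim_simps)
	finally show bb: "b' = b * (L * b')" .
	show "L * b' \<in> carrier (GL l)"
	proof (rule GL_of_inj)
		show Lb: "L * b' \<in> carrier_mat l l" using c b' by auto
		show "mat_inj l l (L * b')"
			unfolding mat_inj_mult[OF Lb]
		proof (intro ballI impI)
			fix x assume x: "x \<in> carrier_mat l 1" "L * b' * x = 0\<^sub>m l 1"
			have "b' * x = b * (L * b' * x)" using d x(1) by (subst bb) (simp add: mat_assoc)
			then have "b' * x = 0\<^sub>m (l + m) 1" using x d by (simp add: mat_dim_simps)
			then show "x = 0\<^sub>m l 1" using b'(2) x(1) unfolding mat_inj_mult[OF b'(1)] by blast
		qed
	qed
qed

section \<open>A Hermitian form on frames and an equivariant right inverse\<close>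

definition ip :: "bseq => bseq => complex" where
	"ip x y = suminf (%r. (1/2) ^ r * (cnj (ap x r) * ap y r))"

lemma norm_ip_term: "norm ((1/2) ^ r * (cnj (ap x r) * ap y r)) <= (norm x * norm y) * (1/2) ^ r"
proof -
	have "norm (ap x r) * norm (ap y r) <= norm x * norm y"
		using norm_bounded[of x r] norm_bounded[of y r] by (intro mult_mono) auto
	then show ?thesis by (simp add: norm_mult norm_power norm_divide divide_right_mono)
qed

text \<open>The geometric weight makes the pairing of bounded sequences converge; being positive, it
  keeps the form definite.\<close>

lemma summable_ip: "summable (%r. (1/2) ^ r * (cnj (ap x r) * ap y r))"
	by (rule summable_comparison_test'[of "%r. (norm x * norm y) * (1/2) ^ r" 0])
		(use norm_ip_term in \<open>auto intro!: summable_mult summable_geometric\<close>)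

lemma norm_ip: "norm (ip x y) <= norm x * norm y * 2"
proof -
	have "norm (ip x y) <= suminf (%r. (norm x * norm y) * (1/2) ^ r)"
		unfolding ip_def by (rule norm_suminf_le) (use norm_ip_term in \<open>auto intro!: summable_mult summable_geometric\<close>)
	also have "\<dots> = norm x * norm y * 2"
		by (simp add: suminf_mult summable_geometric suminf_geometric)
	finally show ?thesis .
qed

lemma ip_add: "ip (x + x') y = ip x y + ip x' y" "ip x (y + y') = ip x y + ip x y'"
proof -
	show "ip (x + x') y = ip x y + ip x' y"
		unfolding ip_def by (subst suminf_add[OF summable_ip summable_ip]) (simp add: distrib_left distrib_right)
	show "ip x (y + y') = ip x y + ip x y'"
		unfolding ip_def by (subst suminf_add[OF summable_ip summable_ip]) (simp add: distrib_left)
qed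

lemma ip_cmul: "ip (cmul c x) y = cnj c * ip x y" "ip x (cmul c y) = c * ip x y"
proof -
	show "ip (cmul c x) y = cnj c * ip x y"
		unfolding ip_def by (subst suminf_mult[OF summable_ip, symmetric]) (simp add: mult.left_commute mult.assoc)
	show "ip x (cmul c y) = c * ip x y"
		unfolding ip_def by (subst suminf_mult[OF summable_ip, symmetric]) (simp add: mult.left_commute mult.assoc)
qed

lemma scaleR_cmul: "r *\<^sub>R x = cmul (of_real r) x"
	by (rule bcontfun_eqI) (simp add: scaleR_conv_of_real)

lemma bounded_bilinear_ip: "bounded_bilinear ip"
proof
	show "EX K. ALL a b. norm (ip a b) <= norm a * norm b * K" using norm_ip by blast
qed (simp_all only: ip_add scaleR_cmul ip_cmul complex_cnj_complex_of_real scaleR_conv_of_real)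

lemma ip_zero: 
	assumes "ip x x = 0"
	shows "ap x r = 0"
proof -
	let ?f = "%r. (1/2) ^ r * (cmod (ap x r))\<^sup>2"
	have eq: "(%r. (1/2) ^ r * (cnj (ap x r) * ap x r)) = (%r. of_real (?f r))"
		by (rule ext) (simp add: complex_norm_square[symmetric] mult.commute[of "cnj _"])
	have s: "summable (%r. of_real (?f r) :: complex)" using summable_ip[of x x] unfolding eq .
	then have s': "summable ?f" by (rule summable_of_real_iff[THEN iffD1])
	have "of_real (suminf ?f) = (0::complex)"
		using assms unfolding ip_def eq by (simp only: suminf_of_real[OF s'])
	then have "suminf ?f = 0" by (simp only: of_real_eq_0_iff)
	then have "?f r = 0" using suminf_eq_zero_iff[OF s'] by simp
	then show ?thesis by simp
qed

definition gram :: "nat => (nat => bseq) => complex mat" where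
	"gram n e = mat n n (%(i,j). ip (e i) (e j))"

definition hadj :: "complex mat => complex mat" where
	"hadj A = mat (dim_col A) (dim_row A) (%(i,j). cnj (A $$ (j,i)))"

lemma dim_hadj [simp]: "dim_row (hadj A) = dim_col A" "dim_col (hadj A) = dim_row A"
	by (simp_all add: hadj_def)

lemma hadj_c: "A \<in> carrier_mat n m ==> hadj A \<in> carrier_mat m n"
	by (auto intro: carrier_matI)

lemma dim_gram [simp]: "dim_row (gram n e) = n" "dim_col (gram n e) = n"
	by (simp_all add: gram_def)

lemma gram_c: "gram n e \<in> carrier_mat n n"
	by (auto intro: carrier_matI)

lemma hadj_mult: "dim_col A = dim_row B ==> hadj (A * B) = hadj B * hadj A"
proof (rule eq_matI)
	assume d: "dim_col A = dim_row B"
	fix i j assume "i < dim_row (hadj B * hadj A)" "j < dim_col (hadj B * hadj A)"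
	then have ij: "i < dim_col B" "j < dim_row A" by auto
	have "(A * B) $$ (j,i) = (\<Sum>k<dim_col A. A $$ (j,k) * B $$ (k,i))"
		by (rule mat_mult_entry) (use ij d in \<open>auto intro: carrier_matI\<close>)
	moreover have "(hadj B * hadj A) $$ (i,j) = (\<Sum>k<dim_col A. hadj B $$ (i,k) * hadj A $$ (k,j))"
		by (rule mat_mult_entry) (use ij d in \<open>auto intro: carrier_matI\<close>)
	ultimately show "hadj (A * B) $$ (i,j) = (hadj B * hadj A) $$ (i,j)"
		using ij d by (simp add: hadj_def mult.commute del: index_mult_mat(1))
qed auto

lemma hadj_one: "hadj (1\<^sub>m n) = 1\<^sub>m n"
	by (auto simp: hadj_def intro!: eq_matI)

lemma hadj_zero: "hadj (0\<^sub>m n m) = 0\<^sub>m m n"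
	by (rule eq_matI) (auto simp: hadj_def)

lemma gram_fmul:
	assumes A: "A \<in> carrier_mat n m"
	shows "gram m (fmul n m e A) = hadj A * gram n e * A"
proof (rule eq_matI)
	interpret ip: bounded_bilinear ip by (rule bounded_bilinear_ip)
	note h = hadj_c[OF A] and g = gram_c[of n e]
	fix i j assume "i < dim_row (hadj A * gram n e * A)" "j < dim_col (hadj A * gram n e * A)"
	then have ij: "i < m" "j < m" using A by auto
	have "(hadj A * gram n e * A) $$ (i,j) = (\<Sum>l<n. (\<Sum>k<n. hadj A $$ (i,k) * gram n e $$ (k,l)) * A $$ (l,j))"
		by (subst mat_mult_entry[OF mult_carrier_mat[OF h g] A ij])
			(intro sum.cong refl arg_cong2[of _ _ _ _ "(*)"] mat_mult_entry[OF h g], use ij in auto)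
	also have "\<dots> = (\<Sum>l<n. (\<Sum>k<n. cnj (A $$ (k,i)) * ip (e k) (e l)) * A $$ (l,j))"
		using ij A by (intro sum.cong refl arg_cong2[of _ _ _ _ "(*)"]) (auto simp: hadj_def gram_def)
	finally have *: "(hadj A * gram n e * A) $$ (i,j) = \<dots>" .
	have "gram m (fmul n m e A) $$ (i,j) = ip (\<Sum>k<n. cmul (A $$ (k,i)) (e k)) (\<Sum>l<n. cmul (A $$ (l,j)) (e l))"
		using ij by (simp add: gram_def fmul_def)
	also have "\<dots> = (\<Sum>k<n. \<Sum>l<n. ip (cmul (A $$ (k,i)) (e k)) (cmul (A $$ (l,j)) (e l)))"
		unfolding ip.sum_left by (intro sum.cong refl ip.sum_right)
	also have "\<dots> = (\<Sum>l<n. \<Sum>k<n. ip (cmul (A $$ (k,i)) (e k)) (cmul (A $$ (l,j)) (e l)))"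
		by (rule sum.swap)
	also have "\<dots> = (\<Sum>l<n. (\<Sum>k<n. cnj (A $$ (k,i)) * ip (e k) (e l)) * A $$ (l,j))"
		unfolding ip_cmul sum_distrib_right by (intro sum.cong refl) (simp only: mult_ac)
	finally show "gram m (fmul n m e A) $$ (i,j) = (hadj A * gram n e * A) $$ (i,j)" using * by simp
qed (use A in auto)

text \<open>A null vector of the Gram matrix gives a combination of the frame vectors with norm
  zero, which must be trivial.\<close>

lemma gram_definite:
	assumes e: "e \<in> frames n" and c: "c \<in> carrier_mat n 1" and 0: "hadj c * gram n e * c = 0\<^sub>m 1 1"
	shows "c = 0\<^sub>m n 1"
proof -
	have "gram 1 (fmul n 1 e c) $$ (0,0) = 0" unfolding gram_fmul[OF c] 0 by simp
	then have "ip (fmul n 1 e c 0) (fmul n 1 e c 0) = 0" by (simp add: gram_def)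
	then have *: "ap (fmul n 1 e c 0) r = 0" for r by (rule ip_zero)
	have "c $$ (i,0) = 0" if "i < n" for i
	proof (rule framesD[OF e _ that, of "%i. c $$ (i,0)"])
		fix r show "(\<Sum>i<n. c $$ (i,0) * ap (e i) r) = 0"
			using *[of r] by (simp add: apply_fmul mult.commute)
	qed
	then show ?thesis using c by (intro eq_matI) auto
qed

lemma gram_GL: 
	assumes e: "e \<in> frames n"
	shows "gram n e \<in> carrier (GL n)"
proof (rule GL_of_inj[OF gram_c])
	show "mat_inj n n (gram n e)"
		unfolding mat_inj_mult[OF gram_c]
	proof (intro ballI impI)
		fix c assume c: "c \<in> carrier_mat n 1" "gram n e * c = 0\<^sub>m n 1"
		have "hadj c * gram n e * c = hadj c * (gram n e * c)" using c(1) by (intro mat_assoc) auto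
		also have "\<dots> = 0\<^sub>m 1 1" unfolding c(2) using c(1) by (subst mat_zero_right) auto
		finally show "c = 0\<^sub>m n 1" by (rule gram_definite[OF e c(1)])
	qed
qed

text \<open>For \<open>H\<close> the Gram matrix, the right inverse of \<open>f\<close> whose image
  is orthogonal to the kernel of \<open>f\<close>, written out by the normal equations.\<close>

definition sigma :: "nat => nat => complex mat => complex mat => complex mat" where
	"sigma n m H f = ginv[n] H * (hadj f * ginv[m] (f * (ginv[n] H * hadj f)))"

lemma sigma_GL:
	assumes e: "e \<in> frames n" and f: "mat_surj m n f"
	shows "f * (ginv[n] (gram n e) * hadj f) \<in> carrier (GL m)"
proof (rule GL_of_inj)
	let ?A = "ginv[n] (gram n e)"
	obtain s where fc: "f \<in> carrier_mat m n" and s: "s \<in> carrier_mat n m" "f * s = 1\<^sub>m m"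
		using f by (auto simp: mat_surj_def)
	have A: "?A \<in> carrier_mat n n" "gram n e * ?A = 1\<^sub>m n" using GL_inv[OF gram_GL[OF e]] by auto
	note d = fc[THEN mdim] s(1)[THEN mdim]
		A(1)[THEN mdim]
	show car: "f * (?A * hadj f) \<in> carrier_mat m m" using d by (intro carrier_matI) auto
	show "mat_inj m m (f * (?A * hadj f))"
		unfolding mat_inj_mult[OF car]
	proof (intro ballI impI)
		fix c assume c: "c \<in> carrier_mat m 1" "f * (?A * hadj f) * c = 0\<^sub>m m 1"
		note dc = c(1)[THEN mdim]
		\<comment> \<open>\<open>y\<close> lies in the kernel of \<open>f\<close>, and the Gram matrix
		  sends it into the image of the adjoint of \<open>f\<close>; hence its norm is zero.\<close>
		define y where "y = ?A * (hadj f * c)"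
		have y: "y \<in> carrier_mat n 1" using d dc by (auto simp: y_def intro: carrier_matI)
		note dy = y[THEN mdim]
		have Hy: "gram n e * y = hadj f * c"
			unfolding y_def using d dc by (simp add: mat_cancel[OF A(2)] mat_one_left)
		have fy: "f * y = 0\<^sub>m m 1" using c(2) d dc by (simp add: mat_assoc y_def)
		have "hadj y * gram n e * y = hadj y * (hadj f * c)" using dy Hy by (simp add: mat_assoc)
		also have "\<dots> = hadj (f * y) * c" using d dy dc by (simp add: mat_assoc hadj_mult)
		also have "\<dots> = 0\<^sub>m 1 1" unfolding fy hadj_zero using dc by (subst mat_zero_left) auto
		finally have y0: "y = 0\<^sub>m n 1" by (rule gram_definite[OF e y])
		then have "hadj f * c = 0\<^sub>m n 1" using Hy by (simp add: mat_zero_right del: One_nat_def)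
		then have "hadj s * (hadj f * c) = 0\<^sub>m m 1" using d by (simp add: mat_zero_right del: One_nat_def)
		moreover have "hadj s * (hadj f * c) = hadj (f * s) * c" using d dc by (simp add: mat_assoc hadj_mult del: s(2))
		ultimately show "c = 0\<^sub>m m 1" unfolding s(2) hadj_one using dc by (simp add: mat_one_left)
	qed
qed

lemma sigma:
	assumes e: "e \<in> frames n" and f: "mat_surj m n f"
	shows "sigma n m (gram n e) f \<in> carrier_mat n m" "f * sigma n m (gram n e) f = 1\<^sub>m m"
		"EX N:carrier_mat m m. gram n e * sigma n m (gram n e) f = hadj f * N"
proof -
	let ?A = "ginv[n] (gram n e)"
	let ?K = "f * (?A * hadj f)"
	have A: "?A \<in> carrier_mat n n" "gram n e * ?A = 1\<^sub>m n" using GL_inv[OF gram_GL[OF e]] by auto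
	have K: "ginv[m] ?K \<in> carrier_mat m m" "?K * ginv[m] ?K = 1\<^sub>m m"
		using GL_inv[OF sigma_GL[OF e f]] by auto
	have fc: "f \<in> carrier_mat m n" using f by (auto simp: mat_surj_def)
	note d = fc[THEN mdim] K(1)[THEN mdim]
		A(1)[THEN mdim]
	show "sigma n m (gram n e) f \<in> carrier_mat n m" unfolding sigma_def using d by (intro carrier_matI) auto
	have "f * sigma n m (gram n e) f = ?K * ginv[m] ?K"
		unfolding sigma_def using d by (simp add: mat_assoc)
	then show "f * sigma n m (gram n e) f = 1\<^sub>m m" using K(2) by simp
	show "EX N:carrier_mat m m. gram n e * sigma n m (gram n e) f = hadj f * N"
		by (rule bexI[of _ "ginv[m] ?K"])
			(use d K(1) in \<open>simp_all add: sigma_def mat_cancel[OF A(2)] mat_one_left\<close>)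
qed

text \<open>The last hypothesis expresses that the image of \<open>t\<close> is orthogonal to the
  kernel of \<open>f\<close>; with f t = 1 this determines \<open>t\<close>. Equivariance is deduced
  from this description rather than from the formula.\<close>

lemma sigma_unique:
	assumes e: "e \<in> frames n" and f: "mat_surj m n f"
		and t: "t \<in> carrier_mat n m" "f * t = 1\<^sub>m m" "N \<in> carrier_mat m m" "gram n e * t = hadj f * N"
	shows "t = sigma n m (gram n e) f"
proof -
	let ?A = "ginv[n] (gram n e)"
	let ?K = "f * (?A * hadj f)"
	have A: "?A \<in> carrier_mat n n" "?A * gram n e = 1\<^sub>m n" using GL_inv[OF gram_GL[OF e]] by auto
	have fc: "f \<in> carrier_mat m n" using f by (auto simp: mat_surj_def)
	note d = fc[THEN mdim] t(1)[THEN mdim]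
		A(1)[THEN mdim] t(3)[THEN mdim]
	have t': "t = ?A * (hadj f * N)"
	proof -
		have "t = ?A * (gram n e * t)" using d by (simp add: mat_cancel[OF A(2)] mat_one_left)
		then show ?thesis unfolding t(4) .
	qed
	have "?K * N = f * t" unfolding t' using d by (simp add: mat_assoc)
	then have "ginv[m] ?K = N" using t(2,3) d by (intro GL_invI(3)) (auto intro: carrier_matI)
	then show ?thesis unfolding sigma_def using t' by simp
qed

text \<open>The transformed right inverse satisfies the characterising equations of
  \<open>sigma_unique\<close> for the transformed data; the adjoint of the inverse of
  \<open>h\<close> is absorbed into the auxiliary matrix \<open>N\<close>.\<close>

lemma sigma_equivariant:
	assumes e: "e \<in> frames n" and f: "mat_surj m n f" and g: "g \<in> carrier (GL n)" and h: "h \<in> carrier (GL m)"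
	shows "sigma n m (gram n (frame_action n g e)) (h * f * ginv[n] g)
		= g * sigma n m (gram n e) f * ginv[m] h"
		and "mat_surj m n (h * f * ginv[n] g)"
proof -
	let ?s = "sigma n m (gram n e) f" and ?g = "ginv[n] g" and ?h = "ginv[m] h"
	have fc: "f \<in> carrier_mat m n" using f by (auto simp: mat_surj_def)
	note s = sigma[OF e f]
	obtain N where N: "N \<in> carrier_mat m m" "gram n e * ?s = hadj f * N" using s(3) by blast
	note gi = GL_inv(2-4)[OF g] GL_c_mat[OF g] and hi = GL_inv(2-4)[OF h] GL_c_mat[OF h]
	note d = fc[THEN mdim] s(1)[THEN mdim]
		gi(1,4)[THEN mdim] hi(1,4)[THEN mdim]
		N(1)[THEN mdim]
	have t: "g * ?s * ?h \<in> carrier_mat n m" using d by (intro carrier_matI) auto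
	have ft: "h * f * ?g * (g * ?s * ?h) = 1\<^sub>m m"
		using d hi(2) by (simp add: mat_dim_simps mat_cancel[OF gi(3)] mat_cancel[OF s(2)])
	show f': "mat_surj m n (h * f * ?g)"
		unfolding mat_surj_def using t ft d by (auto intro: carrier_matI)
	have hh: "hadj h * hadj ?h = 1\<^sub>m m" using d hi(3) hadj_mult[of ?h h] hadj_one by simp
	have "gram n (frame_action n g e) * (g * ?s * ?h) = hadj ?g * gram n e * ?g * (g * ?s * ?h)"
		unfolding frame_action_fmul gram_fmul[OF gi(1)] ..
	also have "\<dots> = hadj ?g * (gram n e * ?s) * ?h"
		using d by (simp add: mat_dim_simps mat_cancel[OF gi(3)])
	also have "\<dots> = hadj (h * f * ?g) * (hadj ?h * N * ?h)"
		unfolding N(2) using d by (simp add: mat_dim_simps hadj_mult mat_cancel[OF hh])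
	finally have "gram n (frame_action n g e) * (g * ?s * ?h) = hadj (h * f * ?g) * (hadj ?h * N * ?h)" .
	then show "sigma n m (gram n (frame_action n g e)) (h * f * ?g) = g * ?s * ?h"
		by (intro sigma_unique[symmetric, OF frame_action_frames[OF g e] f' t ft]) (use d in \<open>auto intro: carrier_matI\<close>)
qed

lemma cts_hadj:
	assumes "continuous_map X (mat_topology n m) F"
	shows "continuous_map X (mat_topology m n) (%x. hadj (F x))"
	unfolding cts_mat
proof (intro conjI ballI allI impI)
	fix x assume "x \<in> topspace X"
	then show "hadj (F x) \<in> carrier_mat m n" using assms by (intro hadj_c cts_mat_c)
next
	fix i j assume ij: "i < m" "j < n"
	have "cfun X (%x. cnj (F x $$ (j,i)))"
		by (rule cts_compose_UNIV[OF cts_mat_entry[OF assms ij(2,1)]]) (intro continuous_intros)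
	then show "cfun X (%x. hadj (F x) $$ (i,j))"
	proof (rule cts_eq')
		fix x assume "x \<in> topspace X"
		then show "cnj (F x $$ (j,i)) = hadj (F x) $$ (i,j)"
			using cts_mat_c[OF assms \<open>x \<in> topspace X\<close>] ij by (auto simp: hadj_def)
	qed
qed

lemma cts_gram:
	assumes "continuous_map X (frame_topology n) e"
	shows "continuous_map X (mat_topology n n) (%x. gram n (e x))"
	unfolding cts_mat
proof (intro conjI ballI allI impI)
	fix i j assume ij: "i < n" "j < n"
	then have "cfun X (%x. ip (e x i) (e x j))"
		using assms by (intro cts_bilinear[OF bounded_bilinear_ip]) (auto simp: cts_frame)
	then show "cfun X (%x. gram n (e x) $$ (i,j))" using ij by (simp add: gram_def)
qed (rule gram_c)

lemma cts_sigma: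
	assumes e: "continuous_map X (frame_topology n) e" and f: "continuous_map X (mat_topology m n) f"
		and s: "!!x. x \<in> topspace X ==> mat_surj m n (f x)"
	shows "continuous_map X (mat_topology n m) (%x. sigma n m (gram n (e x)) (f x))"
proof -
	have fr: "e x \<in> frames n" if "x \<in> topspace X" for x using e that by (auto simp: cts_frame)
	have A: "continuous_map X (mat_topology n n) (%x. ginv[n] (gram n (e x)))"
		by (intro cts_GL_inv cts_gram e gram_GL fr)
	show ?thesis
		unfolding sigma_def
		by (intro cts_mat_mult[of _ n n] cts_mat_mult[of _ n m] cts_mat_mult[of _ m n]
				cts_GL_inv cts_hadj A f sigma_GL fr s)
qed

section \<open>Spreading and joining frames\<close>

definition spread :: "nat => bseq => bseq" where
	"spread q x = Bcontfun (%r. if r mod 2 = q then ap x (r div 2) else 0)"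

lemma apply_spread [simp]: "ap (spread q x) r = (if r mod 2 = q then ap x (r div 2) else 0)"
proof -
	have "(%r. if r mod 2 = q then ap x (r div 2) else 0) \<in> bcontfun"
		unfolding bcontfun_nat_iff bounded_iff
		by (rule exI[of _ "norm x"]) (use norm_bounded[of x] in auto)
	then show ?thesis by (simp add: spread_def Bcontfun_inverse)
qed

lemma bounded_linear_spread: "bounded_linear (spread q)"
proof (rule bounded_linear_intro[of _ 1])
	show "norm (spread q x) <= norm x * 1" for x
		using norm_bounded[of x] by (auto intro: norm_bound)
qed (auto intro!: bcontfun_eqI)

lemma cts_spread:
	"cfun X F ==> cfun X (%x. spread q (F x))"
	by (erule cts_compose_UNIV) (rule bounded_linear.continuous_on[OF bounded_linear_spread continuous_on_id])

text \<open>Even and odd positions make the sequence space a direct sum of two copies of itself; the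
  two families are placed in different summands and added.\<close>

definition join :: "nat => (nat => bseq) => (nat => bseq) => nat => bseq" where
	"join l x y = (\<lambda>j\<in>{..<l}. spread 0 (x j) + spread 1 (y j))"

lemma apply_join: "j < l ==> ap (join l x y j) r =
		(if even r then ap (x j) (r div 2) else ap (y j) (r div 2))"
	by (simp add: join_def even_iff_mod_2_eq_zero)

lemma fmul_join: "fmul l q (join l x y) C = join q (fmul l q x C) (fmul l q y C)"
proof
	fix j show "fmul l q (join l x y) C j = join q (fmul l q x C) (fmul l q y C) j"
	proof (cases "j < q")
		case True
		show ?thesis by (rule bcontfun_eqI) (use True in \<open>auto simp: apply_fmul apply_join\<close>)
	qed (simp add: fmul_def join_def)
qed

lemma fmul_indep:
	assumes e: "e \<in> frames n" and *: "!!r. (\<Sum>j<l. c j * ap (fmul n l e A j) r) = 0" and i: "i < n"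
	shows "(\<Sum>j<l. A $$ (i,j) * c j) = 0"
proof (rule framesD[OF e _ i])
	fix r
	have "(\<Sum>i<n. (\<Sum>j<l. A $$ (i,j) * c j) * ap (e i) r)
			= (\<Sum>j<l. c j * (\<Sum>i<n. ap (e i) r * A $$ (i,j)))"
		by (simp add: sum_distrib_left sum_distrib_right mult_ac) (rule sum.swap)
	also have "\<dots> = (\<Sum>j<l. c j * ap (fmul n l e A j) r)" by (simp add: apply_fmul)
	finally show "(\<Sum>i<n. (\<Sum>j<l. A $$ (i,j) * c j) * ap (e i) r) = 0" using * by simp
qed

lemma subframe: "e \<in> frames k ==> m <= k ==> restrict e {..<m} \<in> frames m"
proof (rule framesI)
	fix c i assume e: "e \<in> frames k" "m <= k" and *: "!!r. (\<Sum>i<m. c i * ap (restrict e {..<m} i) r) = 0" and i: "i < m"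
	let ?c = "%i. if i < m then c i else 0"
	have "?c i = 0"
	proof (rule framesD[OF e(1)])
		show "i < k" using i e by simp
		fix r
		have "(\<Sum>i<k. ?c i * ap (e i) r) = (\<Sum>i<m. c i * ap (e i) r)"
			by (rule sum.mono_neutral_cong_right) (use e in auto)
		then show "(\<Sum>i<k. ?c i * ap (e i) r) = 0" using *[of r] by simp
	qed
	then show "c i = 0" using i by simp
qed simp

lemma fmul_restrict: "fmul m l (restrict e {..<m}) A = fmul m l e A"
	by (simp add: fmul_def)

text \<open>The two families have disjoint supports, so the columns of the join are independent as soon as
	the two matrices have no common kernel.\<close>

lemma join_frames:
	assumes e: "e \<in> frames n" and e': "e' \<in> frames k" "m <= k"
		and AB: "A \<in> carrier_mat n l" "B \<in> carrier_mat m l"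
		"!!c. c \<in> carrier_mat l 1 ==> A * c = 0\<^sub>m n 1 ==> B * c = 0\<^sub>m m 1 ==> c = 0\<^sub>m l 1"
	shows "join l (fmul n l e A) (fmul m l e' B) \<in> frames l"
proof (rule framesI)
	fix c j assume *: "!!r. (\<Sum>j<l. c j * ap (join l (fmul n l e A) (fmul m l e' B) j) r) = 0" and j: "j < l"
	have A0: "(\<Sum>j<l. A $$ (i,j) * c j) = 0" if "i < n" for i
	proof (rule fmul_indep[OF e _ that])
		fix r show "(\<Sum>j<l. c j * ap (fmul n l e A j) r) = 0"
			using *[of "2 * r"] by (simp add: apply_join)
	qed
	have B0: "(\<Sum>j<l. B $$ (i,j) * c j) = 0" if "i < m" for i
	proof (rule fmul_indep[OF subframe[OF e'] _ that])
		fix r show "(\<Sum>j<l. c j * ap (fmul m l (restrict e' {..<m}) B j) r) = 0"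
			using *[of "2 * r + 1"] by (simp add: apply_join fmul_restrict)
	qed
	let ?c = "mat l 1 (%(i,_). c i)"
	have cc: "?c \<in> carrier_mat l 1" by simp
	have "A * ?c = 0\<^sub>m n 1"
	proof (rule eq_matI)
		fix i q assume "i < dim_row (0\<^sub>m n 1 :: complex mat)" "q < dim_col (0\<^sub>m n 1 :: complex mat)"
		then have "i < n" "q < 1" "q = 0" by auto
		then show "(A * ?c) $$ (i,q) = 0\<^sub>m n 1 $$ (i,q)" using mat_mult_entry[OF AB(1) cc] A0 by simp
	qed (use AB in auto)
	moreover have "B * ?c = 0\<^sub>m m 1"
	proof (rule eq_matI)
		fix i q assume "i < dim_row (0\<^sub>m m 1 :: complex mat)" "q < dim_col (0\<^sub>m m 1 :: complex mat)"
		then have "i < m" "q < 1" "q = 0" by auto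
		then show "(B * ?c) $$ (i,q) = 0\<^sub>m m 1 $$ (i,q)" using mat_mult_entry[OF AB(2) cc] B0 by simp
	qed (use AB in auto)
	ultimately have "?c = 0\<^sub>m l 1" using AB(3) cc by blast
	then have "?c $$ (j,0) = 0\<^sub>m l 1 $$ (j,0)" by simp
	then show "c j = 0" using j by simp
qed (simp add: join_def)

definition spread_path :: "nat => real => (nat => bseq) => nat => bseq" where
	"spread_path n t e = (\<lambda>j\<in>{..<n}. (1 - t) *\<^sub>R e j + t *\<^sub>R spread 0 (e j))"

lemma spread_path_0: "e \<in> frames n ==> spread_path n 0 e = e"
	using frames_extensional[of e n] by (auto simp: spread_path_def fun_eq_iff extensional_def)

lemma spread_path_1: "spread_path n 1 e = (\<lambda>j\<in>{..<n}. spread 0 (e j))"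
	by (auto simp: spread_path_def)

lemma join_zero: "join l x (fmul 0 l y B) = spread_path l 1 x"
proof
	fix j
	have "spread 0 (x j) + spread 1 0 = spread 0 (x j)" by (rule bcontfun_eqI) simp
	then show "join l x (fmul 0 l y B) j = spread_path l 1 x j" by (simp add: join_def fmul_def spread_path_1)
qed

lemma fmul_spread_path: "fmul n m (spread_path n t e) A = spread_path m t (fmul n m e A)"
proof
	fix j show "fmul n m (spread_path n t e) A j = spread_path m t (fmul n m e A) j"
	proof (cases "j < m")
		case True
		show ?thesis
			by (rule bcontfun_eqI)
				(use True in \<open>auto simp: apply_fmul spread_path_def sum.distrib distrib_right sum_distrib_left
					scaleR_conv_of_real mult.assoc\<close>)
	qed (simp add: fmul_def spread_path_def)
qed

text \<open>If a combination vanishes along the path, its original values satisfy (1 - t) z(r) + t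
  z(r div 2) = 0 for even r, and (1 - t) z(r) = 0 for odd r. For t other than 1 induction on r gives
  z = 0, the coefficient at r = 0 being 1; for t = 1 the even rows already show it.\<close>

lemma spread_path_frames:
	assumes e: "e \<in> frames n"
	shows "spread_path n t e \<in> frames n"
proof (rule framesI)
	fix c i assume *: "!!r. (\<Sum>i<n. c i * ap (spread_path n t e i) r) = 0" and i: "i < n"
	define z where "z r = (\<Sum>i<n. c i * ap (e i) r)" for r
	have zr: "of_real (1 - t) * z r + (if even r then of_real t * z (r div 2) else 0) = 0" for r
	proof -
		have "(\<Sum>i<n. c i * ap (spread_path n t e i) r)
				= (\<Sum>i<n. of_real (1 - t) * (c i * ap (e i) r)
					+ (if even r then of_real t * (c i * ap (e i) (r div 2)) else 0))"
			by (rule sum.cong) (auto simp: spread_path_def scaleR_conv_of_real algebra_simps even_iff_mod_2_eq_zero)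
		then show ?thesis using *[of r] by (simp only: sum.distrib z_def sum_distrib_left if_distrib sum.neutral_const split: if_splits) auto
	qed
	have "z r = 0" for r
	proof (cases "t = 1")
		case True
		then show ?thesis using zr[of "2 * r"] by simp
	next
		case False
		show ?thesis
		proof (induction r rule: less_induct)
			case (less r)
			show ?case
			proof (cases "even r & r > 0")
				case True
				then have "z (r div 2) = 0" by (intro less.IH) auto
				then show ?thesis using zr[of r] False True by simp
			next
				case F: False
				show ?thesis
				proof (cases "r = 0")
					case True
					then have "(of_real (1 - t) + of_real t) * z 0 = 0" using zr[of 0] by (simp only: distrib_right) simp
					then show ?thesis using True by simp
				next
					case r: False
					then show ?thesis using zr[of r] F False by simp
				qed
			qed
		qed
	qed
	then show "c i = 0" using framesD[OF e _ i, of c] by (simp add: z_def)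
qed (simp add: spread_path_def)

lemma cts_spread_path:
	assumes e: "continuous_map X (frame_topology n) e" and t: "cfun X t"
	shows "continuous_map X (frame_topology n) (%x. spread_path n (t x) (e x))"
	unfolding cts_frame
proof (intro conjI ballI allI impI)
	fix x assume "x \<in> topspace X"
	then show "spread_path n (t x) (e x) \<in> frames n"
		using e by (intro spread_path_frames) (auto simp: cts_frame)
next
	fix i assume i: "i < n"
	then have ei: "cfun X (%x. e x i)" using e by (auto simp: cts_frame)
	have t1: "cfun X (%x. 1 - t x)"
		by (rule cts_compose_UNIV[OF t]) (intro continuous_intros)
	have "cfun X (%x. (1 - t x) *\<^sub>R e x i + t x *\<^sub>R spread 0 (e x i))"
		by (intro cts_add' cts_bilinear[OF bounded_bilinear_scaleR] ei t t1 cts_spread)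
	then show "cfun X (%x. spread_path n (t x) (e x) i)" using i by (simp add: spread_path_def)
qed

lemma cts_join:
	assumes "!!j. j < l ==> cfun X (%x. F x j)" "!!j. j < l ==> cfun X (%x. G x j)"
		and "!!x. x \<in> topspace X ==> join l (F x) (G x) \<in> frames l"
	shows "continuous_map X (frame_topology l) (%x. join l (F x) (G x))"
	unfolding cts_frame
proof (intro conjI ballI allI impI)
	fix j assume j: "j < l"
	have "cfun X (%x. spread 0 (F x j) + spread 1 (G x j))"
		using assms j by (intro cts_add' cts_spread)
	then show "cfun X (%x. join l (F x) (G x) j)" using j by (simp add: join_def)
qed (use assms in auto)

lemma cts_mat_add:
	assumes "continuous_map X (mat_topology m n) F" "continuous_map X (mat_topology m n) H"
	shows "continuous_map X (mat_topology m n) (%x. F x + H x)"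
	unfolding cts_mat
proof (intro conjI ballI allI impI)
	fix i j assume ij: "i < m" "j < n"
	have "cfun X (%x. F x $$ (i,j) + H x $$ (i,j))"
		using assms ij by (intro cts_add' cts_mat_entry)
	then show "cfun X (%x. (F x + H x) $$ (i,j))"
	proof (rule cts_eq')
		fix x assume "x \<in> topspace X"
		from cts_mat_c[OF assms(2) this]
		show "F x $$ (i,j) + H x $$ (i,j) = (F x + H x) $$ (i,j)" using ij by auto
	qed
next
	fix x assume "x \<in> topspace X"
	then show "F x + H x \<in> carrier_mat m n" by (intro add_carrier_mat cts_mat_c[OF assms(2)])
qed

lemma cts_mat_smult:
	assumes "continuous_map X (mat_topology m n) F" "cfun X c"
	shows "continuous_map X (mat_topology m n) (%x. c x \<cdot>\<^sub>m F x)"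
	unfolding cts_mat
proof (intro conjI ballI allI impI)
	fix i j assume ij: "i < m" "j < n"
	have "cfun X (%x. c x * F x $$ (i,j))"
		using assms ij by (intro cts_mult' cts_mat_entry)
	then show "cfun X (%x. (c x \<cdot>\<^sub>m F x) $$ (i,j))"
	proof (rule cts_eq')
		fix x assume "x \<in> topspace X"
		from cts_mat_c[OF assms(1) this]
		show "c x * F x $$ (i,j) = (c x \<cdot>\<^sub>m F x) $$ (i,j)" using ij by auto
	qed
next
	fix x assume "x \<in> topspace X"
	then show "c x \<cdot>\<^sub>m F x \<in> carrier_mat m n" by (intro smult_carrier_mat cts_mat_c[OF assms(1)])
qed

lemma cts_mat_const: "A \<in> carrier_mat m n ==> continuous_map X (mat_topology m n) (%_. A)"
	by (simp add: cts_mat)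

section \<open>Framed representations and two equivariant homotopies\<close>

locale framed = fin_digraph Q for Q :: "('v, 'a) pre_digraph" +
	fixes v0 v1 :: 'v and k :: nat and dl :: "'v => nat"
	assumes v: "v0 \<in> verts Q" "v1 \<in> verts Q" "v0 ~= v1"
begin

abbreviation "QT \<equiv> add_two_cycle v0 v1 Q"

lemma QT_simps [simp]: "verts QT = verts Q" "head QT (Orig a) = head Q a" "tail QT (Orig a) = tail Q a"
	"head QT Arrow_d = v0" "tail QT Arrow_d = v1" "head QT Arrow_c = v1" "tail QT Arrow_c = v0"
	"Orig a \<in> arcs QT \<longleftrightarrow> a \<in> arcs Q" "Arrow_c \<in> arcs QT" "Arrow_d \<in> arcs QT"
	by (auto simp: add_two_cycle_def)

lemma fin_digraph_QT: "fin_digraph QT"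
proof
	show "finite (verts QT)" by simp
	show "finite (arcs QT)" by (simp add: add_two_cycle_def)
	fix a assume "a \<in> arcs QT"
	then show "tail QT a \<in> verts QT" "head QT a \<in> verts QT" using v by (cases a; auto)+
qed

lemma QT_wf: "a \<in> arcs QT ==> head QT a \<in> verts Q" "a \<in> arcs QT ==> tail QT a \<in> verts Q"
	using wf_digraph.head_in_verts[of QT a] wf_digraph.tail_in_verts[of QT a] fin_digraph_QT
	by (auto simp: fin_digraph_def)

text \<open>The part of the dimension vector that the framing takes up, which allows uniform
  statements over all vertices.\<close>

definition kk :: "'v => nat" where "kk i = (if i = v0 \<or> i = v1 then k else 0)"

lemma kk_simps [simp]: "kk v0 = k" "kk v1 = k"
	by (simp_all add: kk_def)

definition fr where "fr x = fst (fst x)"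
definition fk where "fk x = snd (fst x)"
definition rp where "rp x = fst (snd x)"
definition ff where "ff x = snd (snd x)"

lemma proj_simps [simp]: "fr ((e,e'),(r,f)) = e" "fk ((e,e'),(r,f)) = e'" "rp ((e,e'),(r,f)) = r" "ff ((e,e'),(r,f)) = f"
	by (simp_all add: fr_def fk_def rp_def ff_def)

lemma quad_eqI: "fr x = fr y ==> fk x = fk y ==> rp x = rp y ==> ff x = ff y ==> x = y"
	by (cases x; cases y) (auto simp: fr_def fk_def rp_def ff_def prod_eq_iff)

definition fact where
	"fact = (%(g, h) ((e, e'), (r, f)). ((EGL_action Q dl g e, frame_action k h e'), framed_base_change Q v0 v1 dl (g, h) (r, f)))"

lemma fact_simps [simp]:
	"fr (fact (g, h) x) = EGL_action Q dl g (fr x)" "fk (fact (g, h) x) = frame_action k h (fk x)"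
	"rp (fact (g, h) x) = base_change QT dl g (rp x)" "ff (fact (g, h) x) = h * ff x * ginv[dl v0] (g v0)"
	by (cases x; auto simp: fact_def framed_base_change_def fr_def fk_def rp_def ff_def)+

definition Y where "Y = prod_topology (prod_topology (EGL_topology Q dl) (frame_topology k)) (framed_topology Q v0 v1 k dl)"

definition fproj where "fproj = orbit (GL_dim Q dl \<times>\<times> GL k) fact"

lemma quot_map_framed: "quotient_map Y (framed_stack Q v0 v1 k dl) fproj"
proof -
	have "fact = (%g (e, x). ((%(g, h) (e, e'). (EGL_action Q dl g e, frame_action k h e')) g e, framed_base_change Q v0 v1 dl g x))"
		by (auto simp: fact_def fun_eq_iff)
	then show ?thesis
		unfolding framed_stack_def borel_construction_def Y_def fproj_def
		by (simp add: quotient_map_quotient_topology)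
qed

lemma tops_Y: "x \<in> topspace Y \<longleftrightarrow> fr x \<in> (\<Pi>\<^sub>E i\<in>verts Q. frames (dl i)) & fk x \<in> frames k
		& rp x \<in> topspace (rep_topology QT dl) & mat_surj k (dl v0) (ff x) & mat_surj k (dl v1) (ff x * rp x Arrow_d)"
proof -
	have 1: "ff x * rp x Arrow_d \<in> carrier_mat k (dl v1)"
		if "ff x \<in> carrier_mat k (dl v0)" "rp x \<in> topspace (rep_topology QT dl)"
		using that by (auto simp: tops_rep PiE_iff dest!: bspec[of _ _ Arrow_d])
	show ?thesis
		using 1 surj_iff_rank[of "ff x" k "dl v0"] surj_iff_rank[of "ff x * rp x Arrow_d" k "dl v1"]
		by (cases x) (auto simp: Y_def framed_topology_def framed_reps_def tops_EGL fr_def fk_def rp_def ff_def mat_surj_def)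
qed

lemma tops_YD:
	assumes "x \<in> topspace Y"
	shows "i \<in> verts Q ==> fr x i \<in> frames (dl i)" "fr x \<in> extensional (verts Q)" "fk x \<in> frames k"
		"a \<in> arcs QT ==> rp x a \<in> carrier_mat (dl (head QT a)) (dl (tail QT a))" "rp x \<in> extensional (arcs QT)"
		"rp x Arrow_d \<in> carrier_mat (dl v0) (dl v1)"
		"ff x \<in> carrier_mat k (dl v0)" "mat_surj k (dl v0) (ff x)" "mat_surj k (dl v1) (ff x * rp x Arrow_d)"
	using assms by (auto simp: tops_Y tops_rep PiE_iff mat_surj_def dest!: bspec[of _ _ Arrow_d])

lemma cts_Y:
	"continuous_map X Y F \<longleftrightarrow> (ALL x:topspace X. F x \<in> topspace Y)
		& (ALL i:verts Q. continuous_map X (frame_topology (dl i)) (%x. fr (F x) i))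
		& continuous_map X (frame_topology k) (%x. fk (F x))
		& (ALL a:arcs QT. continuous_map X (mat_topology (dl (head QT a)) (dl (tail QT a))) (%x. rp (F x) a))
		& continuous_map X (mat_topology k (dl v0)) (%x. ff (F x))" (is "?L \<longleftrightarrow> ?R")
proof -
	have "?L \<longleftrightarrow> continuous_map X (EGL_topology Q dl) (%x. fr (F x)) & continuous_map X (frame_topology k) (%x. fk (F x))
		& continuous_map X (rep_topology QT dl) (%x. rp (F x)) & continuous_map X (mat_topology k (dl v0)) (%x. ff (F x))
		& (ALL x:topspace X. snd (F x) \<in> framed_reps Q v0 v1 k dl)"
		unfolding Y_def framed_topology_def continuous_map_pairwise continuous_map_in_subtopology o_def
		by (auto simp: fr_def fk_def rp_def ff_def)
	also have "\<dots> \<longleftrightarrow> ?R"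
	proof (intro iffI conjI; (elim conjE)?)
		assume a: "continuous_map X (EGL_topology Q dl) (%x. fr (F x))" "continuous_map X (frame_topology k) (%x. fk (F x))"
		"continuous_map X (rep_topology QT dl) (%x. rp (F x))" "continuous_map X (mat_topology k (dl v0)) (%x. ff (F x))"
		"ALL x:topspace X. snd (F x) \<in> framed_reps Q v0 v1 k dl"
		have "F x \<in> topspace Y" if x: "x \<in> topspace X" for x
		proof -
			have "fst (fst (F x)) \<in> topspace (EGL_topology Q dl)" "snd (fst (F x)) \<in> topspace (frame_topology k)"
				"fst (snd (F x)) \<in> topspace (rep_topology QT dl)" "snd (snd (F x)) \<in> topspace (mat_topology k (dl v0))"
				using a(1-4)[THEN continuous_map_funspace] x by (auto simp: fr_def fk_def rp_def ff_def)
			then show ?thesis using a(5) x by (simp add: Y_def framed_topology_def mem_Times_iff)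
		qed
		then show "ALL x:topspace X. F x \<in> topspace Y" by blast
	next
		assume "ALL x:topspace X. F x \<in> topspace Y"
		then show "ALL x:topspace X. snd (F x) \<in> framed_reps Q v0 v1 k dl"
			by (auto simp: Y_def framed_topology_def mem_Times_iff)
	next
		assume "ALL x:topspace X. F x \<in> topspace Y" "ALL i:verts Q. continuous_map X (frame_topology (dl i)) (%x. fr (F x) i)"
		then show "continuous_map X (EGL_topology Q dl) (%x. fr (F x))"
			using tops_YD(2) by (auto simp: cts_EGL)
	next
		assume "ALL x:topspace X. F x \<in> topspace Y"
			"ALL a:arcs QT. continuous_map X (mat_topology (dl (head QT a)) (dl (tail QT a))) (%x. rp (F x) a)"
		then show "continuous_map X (rep_topology QT dl) (%x. rp (F x))"
			using tops_YD(5) by (auto simp: cts_rep)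
	qed (auto simp: cts_EGL cts_rep)
	finally show ?thesis .
qed

lemma cts_YD:
	assumes "continuous_map X Y F"
	shows "i \<in> verts Q ==> continuous_map X (frame_topology (dl i)) (%x. fr (F x) i)"
		"continuous_map X (frame_topology k) (%x. fk (F x))"
		"a \<in> arcs QT ==> continuous_map X (mat_topology (dl (head QT a)) (dl (tail QT a))) (%x. rp (F x) a)"
		"continuous_map X (mat_topology (dl v0) (dl v1)) (%x. rp (F x) Arrow_d)"
		"continuous_map X (mat_topology k (dl v0)) (%x. ff (F x))"
		"x \<in> topspace X ==> F x \<in> topspace Y"
	using assms[unfolded cts_Y] QT_simps(4,5,10) by (simp_all, metis)

text \<open>The maps f and f d onto \<complex>^k at the vertices 0 and 1, completed by maps to the
  zero space. Every vertex then carries a surjection, whose kernel is the space of the linked quiver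
  at that vertex.\<close>

definition phi :: "(('v => nat => bseq) \<times> (nat => bseq))
		\<times> (('a cycle_arrow => complex mat) \<times> complex mat) => 'v => complex mat" where
	"phi x i = (if i = v0 then ff x else if i = v1 then ff x * rp x Arrow_d else 0\<^sub>m 0 (dl i))"

lemma mat_surj_0: "mat_surj 0 n (0\<^sub>m 0 n)"
	unfolding mat_surj_def by (auto intro!: bexI[of _ "0\<^sub>m n 0"])

lemma phi_surj: "x \<in> topspace Y ==> mat_surj (kk i) (dl i) (phi x i)"
	using tops_YD(8,9)[of x] mat_surj_0[of "dl i"] by (auto simp: phi_def kk_def)

lemma phi_c: "x \<in> topspace Y ==> phi x i \<in> carrier_mat (kk i) (dl i)"
	using phi_surj by (auto simp: mat_surj_def)

definition hh :: "complex mat => 'v => complex mat" where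
	"hh h i = (if i = v0 \<or> i = v1 then h else 1\<^sub>m 0)"

lemma hh_GL: "h \<in> carrier (GL k) ==> hh h i \<in> carrier (GL (kk i))"
	by (simp add: hh_def kk_def GL_iff)

lemma phi_fact:
	assumes x: "x \<in> topspace Y" and g: "g \<in> carrier (GL_dim Q dl)" and h: "h \<in> carrier (GL k)" and i: "i \<in> verts Q"
	shows "phi (fact (g, h) x) i = hh h i * phi x i * ginv[dl i] (g i)"
proof -
	note D = tops_YD[OF x]
	have gi: "g j \<in> carrier (GL (dl j))" if "j \<in> verts Q" for j using g that by (simp add: GL_dim_iff)
	note G0 = GL_inv(2-4)[OF gi[OF v(1)]] GL_c_mat[OF gi[OF v(1)]]
	note G1 = GL_inv(2-4)[OF gi[OF v(2)]] GL_c_mat[OF gi[OF v(2)]]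
	note d = G0(1,4)[THEN mdim] G1(1,4)[THEN mdim]
		D(6,7)[THEN mdim]
		GL_c_mat[OF h, THEN mdim]
	consider "i = v0" | "i = v1" | "i ~= v0" "i ~= v1" by blast
	then show ?thesis
	proof cases
		case 2
		then show ?thesis using v d
			by (simp add: phi_def hh_def base_change_def mat_dim_simps mat_cancel[OF G0(3)])
	next
		case 3
		have "dim_col (ginv[dl i] (g i)) = dl i" "dim_row (ginv[dl i] (g i)) = dl i"
			using GL_inv(2)[OF gi[OF i]] by auto
		then show ?thesis using 3 by (auto simp: phi_def hh_def intro!: eq_matI)
	qed (simp add: phi_def hh_def)
qed

text \<open>The frame at the vertex supplies the Hermitian form, and it moves along with the group.
  Hence \<open>sig_fact\<close> holds for the full general linear groups and not just for unitary
  ones.\<close>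

definition sig where "sig x i = sigma (dl i) (kk i) (gram (dl i) (fr x i)) (phi x i)"

lemma sig:
	assumes x: "x \<in> topspace Y" and i: "i \<in> verts Q"
	shows "sig x i \<in> carrier_mat (dl i) (kk i)" "phi x i * sig x i = 1\<^sub>m (kk i)"
	using sigma(1,2)[OF tops_YD(1)[OF x i] phi_surj[OF x, of i]] by (auto simp: sig_def)

lemma sig_fact:
	assumes x: "x \<in> topspace Y" and g: "g \<in> carrier (GL_dim Q dl)" and h: "h \<in> carrier (GL k)" and i: "i \<in> verts Q"
	shows "sig (fact (g, h) x) i = g i * sig x i * ginv[kk i] (hh h i)"
proof -
	have gi: "g i \<in> carrier (GL (dl i))" using g i by (simp add: GL_dim_iff)
	have "fr (fact (g, h) x) i = frame_action (dl i) (g i) (fr x i)" using i by (simp add: EGL_action_def)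
	then show ?thesis
		unfolding sig_def phi_fact[OF assms]
		using sigma_equivariant(1)[OF tops_YD(1)[OF x i] phi_surj[OF x, of i] gi hh_GL[OF h, of i]] by simp
qed

lemma cts_phi:
	assumes F: "continuous_map X Y F" and i: "i \<in> verts Q"
	shows "continuous_map X (mat_topology (kk i) (dl i)) (%x. phi (F x) i)"
proof -
	note c = cts_YD[OF F]
	consider "i = v0" | "i = v1" | "i ~= v0" "i ~= v1" by blast
	then show ?thesis
	proof cases
		case 1 then show ?thesis using c(5) by (simp add: phi_def)
	next
		case 2 then show ?thesis using v cts_mat_mult[OF c(5,4)] by (simp add: phi_def)
	next
		case 3 then show ?thesis by (simp add: phi_def kk_def cts_mat)
	qed
qed

lemma cts_sig:
	assumes F: "continuous_map X Y F" and i: "i \<in> verts Q"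
	shows "continuous_map X (mat_topology (dl i) (kk i)) (%x. sig (F x) i)"
	unfolding sig_def
	by (intro cts_sigma cts_phi cts_YD(1)[OF F] F i phi_surj cts_YD(6)[OF F])

lemma acts_on_fact: "acts_on (GL_dim Q dl \<times>\<times> GL k) fact (topspace Y)"
proof -
	have E: "acts_on (GL_dim Q dl) (EGL_action Q dl) (topspace (EGL_topology Q dl))" by (rule acts_on_EGL)
	have R: "acts_on (GL_dim QT dl) (base_change QT dl) (topspace (rep_topology QT dl))"
		by (rule acts_on_rep[OF fin_digraph_QT])
	have GQ: "GL_dim QT dl = GL_dim Q dl" by (simp add: GL_dim_def)
	have ext: "fr x \<in> topspace (EGL_topology Q dl)" "rp x \<in> topspace (rep_topology QT dl)" if "x \<in> topspace Y" for x
		using that by (auto simp: tops_Y tops_EGL)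
	show ?thesis
		unfolding acts_on_def
	proof (intro conjI ballI)
		show "group (GL_dim Q dl \<times>\<times> GL k)" by (intro DirProd_group group_GL_dim group_GL)
	next
		fix gh x assume "gh \<in> carrier (GL_dim Q dl \<times>\<times> GL k)" and x: "x \<in> topspace Y"
		then obtain g h where gh: "gh = (g, h)" "g \<in> carrier (GL_dim Q dl)" "h \<in> carrier (GL k)" by auto
		have "EGL_action Q dl g (fr x) \<in> topspace (EGL_topology Q dl)" using E gh(2) ext(1)[OF x] by (auto simp: acts_on_def)
		moreover have "base_change QT dl g (rp x) \<in> topspace (rep_topology QT dl)"
			using R gh(2) ext(2)[OF x] by (auto simp: acts_on_def GQ)
		moreover have "frame_action k h (fk x) \<in> frames k" using gh(3) tops_YD(3)[OF x] by (intro frame_action_frames)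
		moreover have "mat_surj k (dl i) (phi (fact gh x) i)" if "i = v0 \<or> i = v1" for i
		proof -
			have i: "i \<in> verts Q" "kk i = k" "hh h i = h" using that v by (auto simp: hh_def kk_def)
			have "g i \<in> carrier (GL (dl i))" using gh(2) i by (simp add: GL_dim_iff)
			then show ?thesis
				unfolding gh(1) phi_fact[OF x gh(2,3) i(1)]
				using sigma_equivariant(2)[OF tops_YD(1)[OF x i(1)] phi_surj[OF x, of i] _ hh_GL[OF gh(3), of i]] i by simp
		qed
		from this[of v0] this[of v1]
		have "mat_surj k (dl v0) (ff (fact gh x))" "mat_surj k (dl v1) (ff (fact gh x) * rp (fact gh x) Arrow_d)"
			using v by (simp_all add: phi_def del: fact_simps)
		ultimately show "fact gh x \<in> topspace Y" by (simp add: tops_Y gh(1) tops_EGL)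
	next
		fix x assume x: "x \<in> topspace Y"
		have o: "\<one>\<^bsub>GL_dim Q dl \<times>\<times> GL k\<^esub> = (\<one>\<^bsub>GL_dim Q dl\<^esub>, 1\<^sub>m k)" by (simp add: DirProd_def)
		have i1: "ginv[n] (1\<^sub>m n) = 1\<^sub>m n" for n by (rule GL_invI(3)) auto
		show "fact \<one>\<^bsub>GL_dim Q dl \<times>\<times> GL k\<^esub> x = x"
			unfolding o
		proof (rule quad_eqI)
			show "fr (fact (\<one>\<^bsub>GL_dim Q dl\<^esub>, 1\<^sub>m k) x) = fr x" using E ext(1)[OF x] by (simp add: acts_on_def del: GL_dim_simps)
			show "rp (fact (\<one>\<^bsub>GL_dim Q dl\<^esub>, 1\<^sub>m k) x) = rp x" using R ext(2)[OF x] by (simp add: acts_on_def GQ del: GL_dim_simps)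
			show "fk (fact (\<one>\<^bsub>GL_dim Q dl\<^esub>, 1\<^sub>m k) x) = fk x" using tops_YD(3)[OF x] by (simp add: frame_action_one)
			show "ff (fact (\<one>\<^bsub>GL_dim Q dl\<^esub>, 1\<^sub>m k) x) = ff x" using tops_YD(7)[OF x] v by (simp add: i1)
		qed
	next
		fix gh gh' x assume "gh \<in> carrier (GL_dim Q dl \<times>\<times> GL k)" "gh' \<in> carrier (GL_dim Q dl \<times>\<times> GL k)" and x: "x \<in> topspace Y"
		then obtain g h g' h' where gh: "gh = (g, h)" "g \<in> carrier (GL_dim Q dl)" "h \<in> carrier (GL k)"
			and gh': "gh' = (g', h')" "g' \<in> carrier (GL_dim Q dl)" "h' \<in> carrier (GL k)" by auto
		have m: "gh \<otimes>\<^bsub>GL_dim Q dl \<times>\<times> GL k\<^esub> gh' = (g \<otimes>\<^bsub>GL_dim Q dl\<^esub> g', h * h')" by (simp add: gh gh' DirProd_def)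
		show "fact (gh \<otimes>\<^bsub>GL_dim Q dl \<times>\<times> GL k\<^esub> gh') x = fact gh (fact gh' x)"
			unfolding m
		proof (rule quad_eqI)
			show "fr (fact (g \<otimes>\<^bsub>GL_dim Q dl\<^esub> g', h * h') x) = fr (fact gh (fact gh' x))"
				using E ext(1)[OF x] gh gh' by (simp add: acts_on_def del: GL_dim_simps)
			show "rp (fact (g \<otimes>\<^bsub>GL_dim Q dl\<^esub> g', h * h') x) = rp (fact gh (fact gh' x))"
				using R ext(2)[OF x] gh gh' by (simp add: acts_on_def GQ del: GL_dim_simps)
			show "fk (fact (g \<otimes>\<^bsub>GL_dim Q dl\<^esub> g', h * h') x) = fk (fact gh (fact gh' x))"
				using gh gh' by (simp add: frame_action_mult)
			have G: "g v0 \<in> carrier (GL (dl v0))" "g' v0 \<in> carrier (GL (dl v0))" using gh(2) gh'(2) v by (auto simp: GL_dim_iff)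
			show "ff (fact (g \<otimes>\<^bsub>GL_dim Q dl\<^esub> g', h * h') x) = ff (fact gh (fact gh' x))"
				using gh gh' v tops_YD(7)[OF x] GL_inv(2)[OF G(1)] GL_inv(2)[OF G(2)] GL_c_mat[OF gh(3)] GL_c_mat[OF gh'(3)]
				by (auto simp: GL_inv_mult[OF G] mat_assoc)
		qed
	qed
qed

end

context framed
begin

lemma hh_inv: "ginv[kk i] (hh h i) = (if i = v0 \<or> i = v1 then ginv[k] h else 1\<^sub>m 0)"
proof -
	have "ginv[0] (1\<^sub>m 0) = 1\<^sub>m 0" by (rule GL_invI(3)) auto
	then show ?thesis by (simp add: hh_def kk_def)
qed

lemma fmul_frame_action_kk:
	assumes h: "h \<in> carrier (GL k)" and B: "B \<in> carrier_mat (kk i) l"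
	shows "fmul (kk i) l (frame_action k h e) B = fmul (kk i) l e (ginv[kk i] (hh h i) * B)"
proof (cases "i = v0 \<or> i = v1")
	case True
	then show ?thesis using B GL_inv(2)[OF h] by (auto simp: hh_def kk_def frame_action_fmul fmul_fmul)
next
	case False
	then show ?thesis by (simp add: kk_def fmul_def)
qed

text \<open>At \<open>t = 1\<close> this is the projection onto the kernel of \<open>phi x i\<close>
  along the image of \<open>sig x i\<close>.\<close>

definition mixm where "mixm t x i = 1\<^sub>m (dl i) - cor t \<cdot>\<^sub>m (sig x i * phi x i)"

lemma mixm_c: "x \<in> topspace Y ==> i \<in> verts Q ==> mixm t x i \<in> carrier_mat (dl i) (dl i)"
	using sig(1)[of x i] phi_c[of x i] by (auto simp: mixm_def)

text \<open>Empties the odd positions of the frames, so that \<open>st2\<close> can fill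
  them.\<close>

definition st1 where
	"st1 t x = ((\<lambda>i\<in>verts Q. spread_path (dl i) t (fr x i), fk x), (rp x, ff x))"

text \<open>At the end the frame is split: projected to the kernel of \<open>phi\<close> on the even
  positions, and on the odd ones the frame of \<complex>^k pulled back by \<open>phi\<close>. All
  arrows are contracted to zero except \<open>Arrow_d\<close>, for which f d has to stay surjective;
  it is moved to the section of f composed with f d.\<close>

definition st2 where
	"st2 t x = ((\<lambda>i\<in>verts Q. join (dl i) (fmul (dl i) (dl i) (fr x i) (mixm t x i))
				(fmul (kk i) (dl i) (fk x) (cor t \<cdot>\<^sub>m phi x i)), fk x),
		(\<lambda>a\<in>arcs QT. cor (1 - t) \<cdot>\<^sub>m rp x a
				+ (if a = Arrow_d then cor t \<cdot>\<^sub>m (sig x v0 * phi x v1) else 0\<^sub>m (dl (head QT a)) (dl (tail QT a))), ff x))"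

lemma st1_simps [simp]: "fr (st1 t x) = (\<lambda>i\<in>verts Q. spread_path (dl i) t (fr x i))" "fk (st1 t x) = fk x"
	"rp (st1 t x) = rp x" "ff (st1 t x) = ff x"
	by (simp_all add: st1_def)

lemma st2_simps [simp]:
	"fr (st2 t x) = (\<lambda>i\<in>verts Q. join (dl i) (fmul (dl i) (dl i) (fr x i) (mixm t x i))
				(fmul (kk i) (dl i) (fk x) (cor t \<cdot>\<^sub>m phi x i)))" "fk (st2 t x) = fk x"
	"rp (st2 t x) = (\<lambda>a\<in>arcs QT. cor (1 - t) \<cdot>\<^sub>m rp x a
				+ (if a = Arrow_d then cor t \<cdot>\<^sub>m (sig x v0 * phi x v1) else 0\<^sub>m (dl (head QT a)) (dl (tail QT a))))"
	"ff (st2 t x) = ff x"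
	by (simp_all add: st2_def)

lemma st1_tops: "x \<in> topspace Y ==> st1 t x \<in> topspace Y"
	by (auto simp: tops_Y intro: spread_path_frames)

lemma st1_fact: "fact (g, h) (st1 t x) = st1 t (fact (g, h) x)"
	by (rule quad_eqI) (auto simp: EGL_action_def fun_eq_iff frame_action_fmul fmul_spread_path)

lemma kk_le: "kk i <= k" by (simp add: kk_def)

lemma smult_dim_simps: "dim_row A = dim_row B ==> dim_col A = dim_col B ==> c \<cdot>\<^sub>m (A + B) = c \<cdot>\<^sub>m A + c \<cdot>\<^sub>m (B :: complex mat)"
	"dim_col A = dim_row B ==> (c \<cdot>\<^sub>m A) * B = c \<cdot>\<^sub>m (A * B)"
	"dim_col A = dim_row B ==> A * (c \<cdot>\<^sub>m B) = c \<cdot>\<^sub>m (A * B)"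
	by (auto intro!: eq_matI simp: algebra_simps)

text \<open>For a common null vector c of the two matrices, the second condition kills the
  correction term in \<open>mixm t x i * c\<close>, which leaves c = 0. The rank conditions persist
  because f d is constant along the path.\<close>

lemma st2_tops:
	assumes x: "x \<in> topspace Y"
	shows "st2 t x \<in> topspace Y"
	unfolding tops_Y
proof (intro conjI)
	note D = tops_YD[OF x]
	show "fr (st2 t x) \<in> (\<Pi>\<^sub>E i\<in>verts Q. frames (dl i))"
		unfolding st2_simps restrict_PiE_iff
	proof
		fix i assume i: "i \<in> verts Q"
		note s = sig[OF x i] and p = phi_c[OF x, of i]
		note d = s(1)[THEN mdim] p[THEN mdim]
		show "join (dl i) (fmul (dl i) (dl i) (fr x i) (mixm t x i)) (fmul (kk i) (dl i) (fk x) (cor t \<cdot>\<^sub>m phi x i)) \<in> frames (dl i)"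
		proof (rule join_frames[OF D(1)[OF i] D(3) kk_le mixm_c[OF x i]])
			show "cor t \<cdot>\<^sub>m phi x i \<in> carrier_mat (kk i) (dl i)" using p by simp
			fix c assume c: "c \<in> carrier_mat (dl i) 1" "mixm t x i * c = 0\<^sub>m (dl i) 1" "cor t \<cdot>\<^sub>m phi x i * c = 0\<^sub>m (kk i) 1"
			have m: "mixm t x i * c = c - cor t \<cdot>\<^sub>m (sig x i * (phi x i * c))"
				using c(1) d unfolding mixm_def by (auto simp: mat_dim_simps smult_dim_simps simp del: One_nat_def)
			have "cor t \<cdot>\<^sub>m (sig x i * (phi x i * c)) = sig x i * (cor t \<cdot>\<^sub>m phi x i * c)"
				using c(1) d by (auto simp: smult_dim_simps)
			also have "\<dots> = 0\<^sub>m (dl i) 1" unfolding c(3) using d by (simp add: mat_zero_right del: One_nat_def)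
			finally have "mixm t x i * c = c" unfolding m using c(1) by (auto simp: mat_add_zero simp del: One_nat_def)
			then show "c = 0\<^sub>m (dl i) 1" using c(2) by simp
		qed
	qed
	show "fk (st2 t x) \<in> frames k" using D by simp
	note s = sig[OF x v(1)] and p = phi_c[OF x, of v1]
	note d = s(1)[THEN mdim] p[THEN mdim]
		D(6,7)[THEN mdim]
	show "rp (st2 t x) \<in> topspace (rep_topology QT dl)"
		using D(4) d by (auto simp: tops_rep intro!: carrier_matI)
	show "mat_surj k (dl v0) (ff (st2 t x))" using D by simp
	have f: "phi x v0 = ff x" "phi x v1 = ff x * rp x Arrow_d" using v by (simp_all add: phi_def)
	have fs: "ff x * sig x v0 = 1\<^sub>m k" using s(2) unfolding f by simp
	have "ff (st2 t x) * rp (st2 t x) Arrow_d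
		= cor (1 - t) \<cdot>\<^sub>m (ff x * rp x Arrow_d) + cor t \<cdot>\<^sub>m (ff x * rp x Arrow_d)"
		using d by (simp add: mat_dim_simps smult_dim_simps mat_cancel[OF fs] f)
	also have "\<dots> = ff x * rp x Arrow_d" by (auto intro!: eq_matI simp: algebra_simps simp del: index_mult_mat(1))
	finally show "mat_surj k (dl v1) (ff (st2 t x) * rp (st2 t x) Arrow_d)" using D by simp
qed

text \<open>\<open>mixm\<close> and \<open>phi\<close> intertwine the actions because
  \<open>sig\<close> does; this is what lets the homotopy descend to orbits.\<close>

lemma st2_fact:
	assumes x: "x \<in> topspace Y" and g: "g \<in> carrier (GL_dim Q dl)" and h: "h \<in> carrier (GL k)"
	shows "fact (g, h) (st2 t x) = st2 t (fact (g, h) x)"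
proof (rule quad_eqI)
	note D = tops_YD[OF x]
	have gi: "g j \<in> carrier (GL (dl j))" if "j \<in> verts Q" for j using g that by (simp add: GL_dim_iff)
	show "fk (fact (g, h) (st2 t x)) = fk (st2 t (fact (g, h) x))" "ff (fact (g, h) (st2 t x)) = ff (st2 t (fact (g, h) x))"
		by simp_all
	show "fr (fact (g, h) (st2 t x)) = fr (st2 t (fact (g, h) x))"
	proof
		fix i show "fr (fact (g, h) (st2 t x)) i = fr (st2 t (fact (g, h) x)) i"
		proof (cases "i \<in> verts Q")
			case i: True
			note s = sig[OF x i] and p = phi_c[OF x, of i]
			note G = GL_inv(2-4)[OF gi[OF i]] GL_c_mat[OF gi[OF i]]
			note H = GL_inv(2-4)[OF hh_GL[OF h, of i]] GL_c_mat[OF hh_GL[OF h, of i]]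
			note d = s(1)[THEN mdim] p[THEN mdim]
				G(1,4)[THEN mdim] H(1,4)[THEN mdim]
			let ?gi = "ginv[dl i] (g i)" and ?hi = "ginv[kk i] (hh h i)"
			have m: "?gi * mixm t (fact (g, h) x) i = mixm t x i * ?gi"
				unfolding mixm_def sig_fact[OF x g h i] phi_fact[OF x g h i] using d
				by (simp add: mat_dim_simps smult_dim_simps mat_cancel[OF H(3)]
mat_cancel[OF G(3)])
			have p': "?hi * (cor t \<cdot>\<^sub>m phi (fact (g, h) x) i) = (cor t \<cdot>\<^sub>m phi x i) * ?gi"
				unfolding phi_fact[OF x g h i] using d
				by (simp add: smult_dim_simps mat_dim_simps mat_cancel[OF H(3)])
			have pc: "cor t \<cdot>\<^sub>m phi x i \<in> carrier_mat (kk i) (dl i)"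
				"cor t \<cdot>\<^sub>m phi (fact (g, h) x) i \<in> carrier_mat (kk i) (dl i)"
				unfolding phi_fact[OF x g h i] using d by (auto intro: carrier_matI)
			have mc: "mixm t x i \<in> carrier_mat (dl i) (dl i)" "mixm t (fact (g, h) x) i \<in> carrier_mat (dl i) (dl i)"
				unfolding mixm_def sig_fact[OF x g h i] phi_fact[OF x g h i] using d by (auto intro: carrier_matI)
			have "fr (fact (g, h) (st2 t x)) i
				= join (dl i) (fmul (dl i) (dl i) (fr x i) (mixm t x i * ?gi)) (fmul (kk i) (dl i) (fk x) ((cor t \<cdot>\<^sub>m phi x i) * ?gi))"
				using i by (simp add: EGL_action_def frame_action_fmul fmul_join fmul_fmul[OF mc(1) G(1)] fmul_fmul[OF pc(1) G(1)])
			also have "\<dots> = fr (st2 t (fact (g, h) x)) i"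
				using i unfolding m[symmetric] p'[symmetric] st2_simps fact_simps
				by (simp add: EGL_action_def fmul_frame_action_kk[OF h pc(2)] frame_action_fmul[of "dl i"] fmul_fmul[OF G(1) mc(2)])
			finally show ?thesis .
		qed (simp add: EGL_action_def)
	qed
	show "rp (fact (g, h) (st2 t x)) = rp (st2 t (fact (g, h) x))"
	proof
		fix a show "rp (fact (g, h) (st2 t x)) a = rp (st2 t (fact (g, h) x)) a"
		proof (cases "a \<in> arcs QT")
			case a: True
			let ?i = "head QT a" and ?j = "tail QT a"
			note w = QT_wf[OF a]
			note G = GL_c_mat[OF gi[OF w(1)]] GL_inv(2-4)[OF gi[OF w(2)]]
			note d = G(1,2)[THEN mdim] D(4)[OF a, THEN mdim]
			show ?thesis
			proof (cases "a = Arrow_d")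
				case False
				then show ?thesis using a d
					by (simp add: base_change_def mat_dim_simps smult_dim_simps)
			next
				case True
				note s = sig[OF x v(1)] and p = phi_c[OF x, of v1]
				note H = GL_inv(2-4)[OF h] GL_c_mat[OF h]
				note d' = s(1)[THEN mdim] p[THEN mdim]
					H(1,4)[THEN mdim]
				have "sig (fact (g, h) x) v0 * phi (fact (g, h) x) v1 = g v0 * (sig x v0 * phi x v1) * ginv[dl v1] (g v1)"
					unfolding sig_fact[OF x g h v(1)] phi_fact[OF x g h v(2)] hh_inv using d d' True
					by (simp add: hh_def mat_dim_simps mat_cancel[OF H(3)])
				then show ?thesis using a d d' True
					by (simp add: base_change_def mat_dim_simps smult_dim_simps)
			qed
		qed (simp add: base_change_def)
	qed
qed

lemma cts_st1:
	assumes "continuous_map X Y F" "continuous_map X euclideanreal t"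
	shows "continuous_map X Y (%x. st1 (t x) (F x))"
proof -
	note c = cts_YD[OF assms(1)]
	show ?thesis
		unfolding cts_Y using c st1_tops by (auto intro!: cts_spread_path assms(2))
qed

lemma cts_st2:
	assumes F: "continuous_map X Y F" and t: "continuous_map X euclideanreal t"
	shows "continuous_map X Y (%x. st2 (t x) (F x))"
proof -
	note c = cts_YD[OF F]
	have t': "cfun X (%x. cor (t x))"
		by (rule cts_compose_UNIV[OF t]) (intro continuous_intros)
	have t1: "cfun X (%x. cor (1 - t x))"
		by (rule cts_compose_UNIV[OF t]) (intro continuous_intros)
	have tm: "cfun X (%x. - cor (t x))"
		by (rule cts_compose_UNIV[OF t]) (intro continuous_intros)
	have top: "st2 (t x) (F x) \<in> topspace Y" if "x \<in> topspace X" for x using c(6)[OF that] by (rule st2_tops)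
	show ?thesis
		unfolding cts_Y
	proof (intro conjI ballI)
		fix i assume i: "i \<in> verts Q"
		have mc: "continuous_map X (mat_topology (dl i) (dl i)) (%x. mixm (t x) (F x) i)"
		proof (rule cts_eq')
			show "continuous_map X (mat_topology (dl i) (dl i)) (%x. 1\<^sub>m (dl i) + (- cor (t x)) \<cdot>\<^sub>m (sig (F x) i * phi (F x) i))"
				by (intro cts_mat_add cts_mat_smult tm cts_mat_const one_carrier_mat
						cts_mat_mult[OF cts_sig[OF F i] cts_phi[OF F i]])
			fix x assume x: "x \<in> topspace X"
			have "sig (F x) i * phi (F x) i \<in> carrier_mat (dl i) (dl i)"
				using sig(1)[OF c(6)[OF x] i] phi_c[OF c(6)[OF x], of i] by (rule mult_carrier_mat)
			then show "1\<^sub>m (dl i) + (- cor (t x)) \<cdot>\<^sub>m (sig (F x) i * phi (F x) i) = mixm (t x) (F x) i"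
				unfolding mixm_def by (intro eq_matI) (auto simp del: index_mult_mat(1))
		qed
		have fr: "fr (st2 (t x) (F x)) i \<in> frames (dl i)" if "x \<in> topspace X" for x using tops_YD(1)[OF top[OF that] i] .
		have e: "cfun X (%x. fr (F x) i j)" if "j < dl i" for j
			using c(1)[OF i] that by (simp add: cts_frame)
		have e': "cfun X (%x. fk (F x) j)" if "j < kk i" for j
			using c(2) that kk_le[of i] by (simp add: cts_frame)
		have "continuous_map X (frame_topology (dl i)) (%x. join (dl i) (fmul (dl i) (dl i) (fr (F x) i) (mixm (t x) (F x) i))
				(fmul (kk i) (dl i) (fk (F x)) (cor (t x) \<cdot>\<^sub>m phi (F x) i)))"
			by (intro cts_join cts_fmul[OF e mc] cts_fmul[OF e'] cts_mat_smult t' cts_phi F i)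
				(use fr i in auto)
		then show "continuous_map X (frame_topology (dl i)) (%x. fr (st2 (t x) (F x)) i)" using i by simp
	next
		fix a assume a: "a \<in> arcs QT"
		have "continuous_map X (mat_topology (dl v0) (dl v1)) (%x. sig (F x) v0 * phi (F x) v1)"
			using cts_mat_mult[OF cts_sig[OF F v(1)], of "dl v1" "%x. phi (F x) v1"] cts_phi[OF F v(2)] by simp
		then have "continuous_map X (mat_topology (dl (head QT a)) (dl (tail QT a))) (%x. cor (1 - t x) \<cdot>\<^sub>m rp (F x) a
				+ (if a = Arrow_d then cor (t x) \<cdot>\<^sub>m (sig (F x) v0 * phi (F x) v1) else 0\<^sub>m (dl (head QT a)) (dl (tail QT a))))"
			by (intro cts_mat_add cts_mat_smult t1 c(3)[OF a])
				(auto intro: cts_mat_smult t' cts_mat_const)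
		then show "continuous_map X (mat_topology (dl (head QT a)) (dl (tail QT a))) (%x. rp (st2 (t x) (F x)) a)"
			using a by simp
	qed (use c top in auto)
qed

end

lemma cts_locally:
	assumes "!!x. x \<in> topspace X ==> EX U. openin X U & x \<in> U & continuous_map (subtopology X U) Z f"
	shows "continuous_map X Z f"
proof -
	obtain U where U: "!!x. x \<in> topspace X ==> openin X (U x) & x \<in> U x & continuous_map (subtopology X (U x)) Z f"
		using assms by metis
	show ?thesis
		unfolding continuous_map_def
	proof (intro conjI allI impI)
		show "f \<in> topspace X \<rightarrow> topspace Z"
		proof
			fix x assume x: "x \<in> topspace X"
			then show "f x \<in> topspace Z"
				using continuous_map_funspace[of "subtopology X (U x)" Z f] U[OF x] by auto
		qed
		fix V assume V: "openin Z V"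
		show "openin X {x \<in> topspace X. f x \<in> V}"
			unfolding openin_subopen[of X "{x \<in> topspace X. f x \<in> V}"]
		proof
			fix x assume x: "x \<in> {x \<in> topspace X. f x \<in> V}"
			then have u: "openin X (U x)" "x \<in> U x" "continuous_map (subtopology X (U x)) Z f" using U by auto
			have "openin (subtopology X (U x)) {y \<in> topspace (subtopology X (U x)). f y \<in> V}"
				using u(3) V by (rule openin_continuous_map_preimage)
			then have "openin X {y \<in> topspace (subtopology X (U x)). f y \<in> V}"
				using u(1) openin_trans_full by blast
			then show "EX T. openin X T & x \<in> T & T <= {x \<in> topspace X. f x \<in> V}"
				using x u by (intro exI[of _ "{y \<in> topspace (subtopology X (U x)). f y \<in> V}"]) auto
		qed
	qed
qed

section \<open>Block matrices by coordinate projections\<close>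

definition J1 :: "nat => nat => complex mat" where
	"J1 n m = mat n (n + m) (%(i,j). if i = j then 1 else 0)"

definition J2 :: "nat => nat => complex mat" where
	"J2 n m = mat m (n + m) (%(i,j). if n + i = j then 1 else 0)"

lemma J_dim [simp]: "dim_row (J1 n m) = n" "dim_col (J1 n m) = n + m" "dim_row (J2 n m) = m" "dim_col (J2 n m) = n + m"
	by (simp_all add: J1_def J2_def)

lemma J_mult: "J1 n m * (J1 n m)\<^sup>T = 1\<^sub>m n" "J2 n m * (J2 n m)\<^sup>T = 1\<^sub>m m" "J1 n m * (J2 n m)\<^sup>T = 0\<^sub>m n m"
	"J2 n m * (J1 n m)\<^sup>T = 0\<^sub>m m n" "(J1 n m)\<^sup>T * J1 n m + (J2 n m)\<^sup>T * J2 n m = 1\<^sub>m (n + m)"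
proof -
	have s: "(\<Sum>ia = 0..<N. (if x = ia then 1 else 0) * (if y = ia then 1 else 0)) = (if x = y & x < N then 1 else (0::complex))" for x y N :: nat
		by (simp add: if_distrib[of "%z. z * _"] cong: if_cong)
	have s2: "(\<Sum>ia = 0..<N. (if d + ia = x then 1 else 0) * (if d + ia = y then 1 else 0)) = (if x = y & d <= x & x < d + N then 1 else (0::complex))" for x y N d :: nat
	proof (cases "d <= x & x < d + N")
		case True
		then have "(\<Sum>ia = 0..<N. (if d + ia = x then 1 else 0) * (if d + ia = y then 1 else (0::complex)))
			= (\<Sum>ia\<in>{0..<N}. (if ia = x - d then (if x = y then 1 else 0) else 0))"
			by (intro sum.cong) auto
		also have "\<dots> = (if x = y then 1 else 0)" using True by (subst sum.delta) auto
		finally show ?thesis using True by simp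
	next
		case False
		then show ?thesis by (auto intro!: sum.neutral)
	qed
	have s0: "(\<Sum>ia = 0..<N. (if ia = x then 1 else 0) * (if ia = y then 1 else 0)) = (if x = y & x < N then 1 else (0::complex))" for x y N :: nat
		using s2[of 0] by simp
	show "J1 n m * (J1 n m)\<^sup>T = 1\<^sub>m n"
		by (rule eq_matI) (simp_all add: J1_def scalar_prod_def s)
	show "J2 n m * (J2 n m)\<^sup>T = 1\<^sub>m m"
		by (rule eq_matI) (simp_all add: J2_def scalar_prod_def s)
	show "J1 n m * (J2 n m)\<^sup>T = 0\<^sub>m n m"
		by (rule eq_matI) (simp_all add: J1_def J2_def scalar_prod_def s)
	show "J2 n m * (J1 n m)\<^sup>T = 0\<^sub>m m n"
		by (rule eq_matI) (simp_all add: J1_def J2_def scalar_prod_def s)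
	show "(J1 n m)\<^sup>T * J1 n m + (J2 n m)\<^sup>T * J2 n m = 1\<^sub>m (n + m)"
		by (rule eq_matI)
			(auto simp add: J1_def J2_def scalar_prod_def s2 s0)
qed

definition block where
	"block n m A B = (J1 n m)\<^sup>T * (A * J1 n m) + (J2 n m)\<^sup>T * (B * J2 n m)"

lemma block_c: "A \<in> carrier_mat n n ==> B \<in> carrier_mat m m ==> block n m A B \<in> carrier_mat (n + m) (n + m)"
	by (auto simp: block_def intro!: carrier_matI)

lemma block_mult:
	assumes "A \<in> carrier_mat n n" "A' \<in> carrier_mat n n" "B \<in> carrier_mat m m" "B' \<in> carrier_mat m m"
	shows "block n m A B * block n m A' B' = block n m (A * A') (B * B')"
proof -
	note d = assms[THEN mdim]
	show ?thesis unfolding block_def using d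
		by (simp add: mat_dim_simps J_mult(1-4)[THEN mat_cancel])
qed

lemma block_GL:
	assumes A: "A \<in> carrier (GL n)" and B: "B \<in> carrier (GL m)"
	shows "block n m A B \<in> carrier (GL (n + m))" "ginv[n + m] (block n m A B) = block n m (ginv[n] A) (ginv[m] B)"
proof -
	have "block n m A B * block n m (ginv[n] A) (ginv[m] B) = block n m (1\<^sub>m n) (1\<^sub>m m)"
		using GL_inv(2,3)[OF A] GL_inv(2,3)[OF B] GL_c_mat[OF A] GL_c_mat[OF B] by (simp add: block_mult)
	also have "\<dots> = 1\<^sub>m (n + m)" using J_mult(5) by (simp add: block_def mat_one_left)
	finally have e: "block n m A B * block n m (ginv[n] A) (ginv[m] B) = 1\<^sub>m (n + m)" .
	note c = block_c[OF GL_c_mat[OF A] GL_c_mat[OF B]] block_c[OF GL_inv(2)[OF A] GL_inv(2)[OF B]]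
	show "block n m A B \<in> carrier (GL (n + m))" "ginv[n + m] (block n m A B) = block n m (ginv[n] A) (ginv[m] B)"
		by (rule GL_invI[OF c e])+
qed

lemma J_block:
	assumes "A \<in> carrier_mat n n" "B \<in> carrier_mat m m"
	shows "J1 n m * block n m A B = A * J1 n m" "J2 n m * block n m A B = B * J2 n m"
		"block n m A B * (J2 n m)\<^sup>T = (J2 n m)\<^sup>T * B"
proof -
	note d = assms[THEN mdim]
	show "J1 n m * block n m A B = A * J1 n m" "J2 n m * block n m A B = B * J2 n m" 
		unfolding block_def using d by (simp_all add: mat_distr_left mat_one_left mat_zero_left mat_add_zero J_mult(1-4)[THEN mat_cancel])
	show "block n m A B * (J2 n m)\<^sup>T = (J2 n m)\<^sup>T * B"
		unfolding block_def using d by (simp add: mat_dim_simps J_mult(1-4))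
qed

lemma J_surj: "mat_surj m (n + m) (J2 n m)"
	unfolding mat_surj_def by (auto intro!: carrier_matI bexI[of _ "(J2 n m)\<^sup>T"] simp: J_mult)

section \<open>The homotopy equivalence with the linked quiver\<close>

locale framed_shift = framed Q v0 v1 k "shift_dim v0 v1 k dm"
	for Q :: "('v, 'a) pre_digraph" and v0 v1 :: 'v and k :: nat and dm :: "'v => nat"
begin

abbreviation "dl \<equiv> shift_dim v0 v1 k dm"

lemma dl: "dl i = dm i + kk i"
	using v by (simp add: shift_dim_def kk_def)

abbreviation "QL \<equiv> linked_quiver v0 v1 Q"
abbreviation "ldim \<equiv> linked_dim dm k"
abbreviation "TL \<equiv> stk_top QL ldim"
abbreviation "SL \<equiv> rep_stack QL ldim"
abbreviation "FS \<equiv> framed_stack Q v0 v1 k dl"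
abbreviation "projL \<equiv> stk_proj QL ldim"
abbreviation "actL \<equiv> stk_act QL ldim"
abbreviation "GL_L \<equiv> GL_dim QL ldim"
abbreviation "I1 i \<equiv> J1 (dm i) (kk i)"
abbreviation "I2 i \<equiv> J2 (dm i) (kk i)"
abbreviation "K0 \<equiv> J2 (dm v0) k"
abbreviation "K1 \<equiv> J2 (dm v1) k"

lemma ldim_simps [simp]: "ldim None = k" "ldim (Some i) = dm i"
	by (simp_all add: linked_dim_def)

lemma verts_QL [simp]: "verts QL = insert None (Some ` verts Q)"
	by (simp add: linked_quiver_def)

lemma fin_digraph_QL: "fin_digraph QL"
proof
	show "finite (verts QL)" by simp
	show "finite (arcs QL)" by (simp add: linked_quiver_def)
	fix a assume "a \<in> arcs QL"
	then show "tail QL a \<in> verts QL" "head QL a \<in> verts QL"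
		using v head_in_verts tail_in_verts by (auto simp: linked_quiver_def)
qed

definition zrep :: "'a linked_arrow => complex mat" where "zrep = (\<lambda>a\<in>arcs QL. 0\<^sub>m (ldim (head QL a)) (ldim (tail QL a)))"

lemma tops_stk_QL: "(E, R) \<in> topspace TL \<longleftrightarrow> E \<in> extensional (verts QL) & E None \<in> frames k
	& (ALL i:verts Q. E (Some i) \<in> frames (dm i)) & R \<in> topspace (rep_topology QL ldim)"
	by (auto simp: stk_top_def tops_EGL PiE_iff)

lemma zrep_tops: "zrep \<in> topspace (rep_topology QL ldim)"
	by (simp add: zrep_def tops_rep)

text \<open>The standard framing built from a frame of the linked quiver: the vertices 0 and 1 each
  receive a copy of \<complex>^k, f projects onto the first copy and d identifies the second with
  the first. All other arrows are zero, which is harmless up to homotopy because representation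
  spaces are contractible.\<close>

definition uu where
	"uu y = ((\<lambda>i\<in>verts Q. join (dl i) (fmul (dm i) (dl i) (fst y (Some i)) (I1 i))
				(fmul (kk i) (dl i) (fst y None) (I2 i)), fst y None),
		(\<lambda>a\<in>arcs QT. if a = Arrow_d then K0\<^sup>T * K1 else 0\<^sub>m (dl (head QT a)) (dl (tail QT a)), K0))"

lemma uu_simps [simp]:
	"fr (uu y) = (\<lambda>i\<in>verts Q. join (dl i) (fmul (dm i) (dl i) (fst y (Some i)) (I1 i))
				(fmul (kk i) (dl i) (fst y None) (I2 i)))"
	"fk (uu y) = fst y None"
	"rp (uu y) = (\<lambda>a\<in>arcs QT. if a = Arrow_d then K0\<^sup>T * K1 else 0\<^sub>m (dl (head QT a)) (dl (tail QT a)))"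
	"ff (uu y) = K0"
	by (simp_all add: uu_def)

lemma J_c: "I1 i \<in> carrier_mat (dm i) (dl i)" "I2 i \<in> carrier_mat (kk i) (dl i)"
	by (auto simp: dl intro: carrier_matI)

lemma J2_Arrow_d: "K0 * (K0\<^sup>T * K1) = K1"
	by (simp add: mat_cancel[OF J_mult(2)] mat_one_left)

lemma uu_tops:
	assumes y: "y \<in> topspace TL"
	shows "uu y \<in> topspace Y"
	unfolding tops_Y
proof (intro conjI)
	obtain E R where yy: "y = (E, R)" by (cases y)
	note E = y[unfolded yy tops_stk_QL]
	show "fr (uu y) \<in> (\<Pi>\<^sub>E i\<in>verts Q. frames (dl i))"
		unfolding uu_simps restrict_PiE_iff
	proof
		fix i assume i: "i \<in> verts Q"
		show "join (dl i) (fmul (dm i) (dl i) (fst y (Some i)) (I1 i)) (fmul (kk i) (dl i) (fst y None) (I2 i)) \<in> frames (dl i)"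
		proof (rule join_frames[OF _ _ kk_le J_c])
			show "fst y (Some i) \<in> frames (dm i)" "fst y None \<in> frames k" using E i by (auto simp: yy)
			fix c assume c: "c \<in> carrier_mat (dl i) 1" "I1 i * c = 0\<^sub>m (dm i) 1" "I2 i * c = 0\<^sub>m (kk i) 1"
			have dc: "dim_row c = dm i + kk i" "dim_col c = 1" using c(1) by (auto simp: dl)
			have "c = ((I1 i)\<^sup>T * I1 i + (I2 i)\<^sup>T * I2 i) * c"
				unfolding J_mult(5) using dc by (simp add: mat_one_left)
			also have "\<dots> = (I1 i)\<^sup>T * (I1 i * c) + (I2 i)\<^sup>T * (I2 i * c)"
				using dc by (simp add: mat_dim_simps)
			also have "\<dots> = 0\<^sub>m (dl i) 1"
				unfolding c(2,3) by (simp add: mat_dim_simps dl del: One_nat_def)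
			finally show "c = 0\<^sub>m (dl i) 1" .
		qed
	qed
	show "fk (uu y) \<in> frames k" using E by (simp add: yy)
	show "rp (uu y) \<in> topspace (rep_topology QT dl)"
		by (auto simp: tops_rep dl intro!: carrier_matI)
	show "mat_surj k (dl v0) (ff (uu y))" using J_surj[of k "dm v0"] by (simp add: dl)
	show "mat_surj k (dl v1) (ff (uu y) * rp (uu y) Arrow_d)"
		using J_surj[of k "dm v1"] by (simp add: dl J2_Arrow_d)
qed

lemma phi_uu: "i \<in> verts Q ==> phi (uu y) i = I2 i"
	using v by (auto simp: phi_def J2_Arrow_d kk_def dl intro!: eq_matI)

text \<open>Equivariance along the block embedding of groups: the factor at the new vertex acts on
  both copies of \<complex>^k and on the framing at once, hence fixes the standard f and d.\<close>

lemma uu_act: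
	assumes y: "y \<in> topspace TL" and g: "g \<in> carrier (GL_L)"
	shows "EX gh:carrier (GL_dim Q dl \<times>\<times> GL k). uu (actL g y) = fact gh (uu y)"
proof -
	let ?h = "g None"
	define G where "G = (\<lambda>i\<in>verts Q. block (dm i) (kk i) (g (Some i)) (hh ?h i))"
	have h: "?h \<in> carrier (GL k)" using g by (simp add: GL_dim_iff)
	have gi: "g (Some i) \<in> carrier (GL (dm i))" if "i \<in> verts Q" for i using g that by (simp add: GL_dim_iff)
	have Gi: "G i \<in> carrier (GL (dl i))" "ginv[dl i] (G i) = block (dm i) (kk i) (ginv[dm i] (g (Some i))) (ginv[kk i] (hh ?h i))"
		if "i \<in> verts Q" for i
		using block_GL[OF gi[OF that] hh_GL[OF h, of i]] that by (simp_all add: G_def dl)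
	have G: "G \<in> carrier (GL_dim Q dl)" using Gi by (simp add: GL_dim_iff) (simp add: G_def)
	obtain E R where yy: "y = (E, R)" by (cases y)
	have "uu (actL g y) = fact (G, ?h) (uu y)"
	proof (rule quad_eqI)
		show "fk (uu (actL g y)) = fk (fact (G, ?h) (uu y))" by (simp add: yy stk_act_def EGL_action_def)
		show "fr (uu (actL g y)) = fr (fact (G, ?h) (uu y))"
		proof
			fix i show "fr (uu (actL g y)) i = fr (fact (G, ?h) (uu y)) i"
			proof (cases "i \<in> verts Q")
				case i: True
				note A = GL_inv(2)[OF gi[OF i]] and B = GL_inv(2)[OF hh_GL[OF h, of i]]
				note Jc = J_c[of i]
				have bc: "block (dm i) (kk i) (ginv[dm i] (g (Some i))) (ginv[kk i] (hh ?h i)) \<in> carrier_mat (dl i) (dl i)"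
					using block_c[OF A B] by (simp add: dl)
				have "fr (uu (actL g y)) i = join (dl i) (fmul (dm i) (dl i) (frame_action (dm i) (g (Some i)) (E (Some i))) (I1 i))
						(fmul (kk i) (dl i) (frame_action k ?h (E None)) (I2 i))"
					using i by (simp add: yy stk_act_def EGL_action_def)
				also have "\<dots> = join (dl i) (fmul (dm i) (dl i) (E (Some i)) (ginv[dm i] (g (Some i)) * I1 i))
						(fmul (kk i) (dl i) (E None) (ginv[kk i] (hh ?h i) * I2 i))"
					unfolding fmul_frame_action_kk[OF h Jc(2)] frame_action_fmul[of "dm i"] fmul_fmul[OF A Jc(1)] ..
				also have "\<dots> = fr (fact (G, ?h) (uu y)) i"
					using i by (simp add: yy EGL_action_def frame_action_fmul[of "dl i"] Gi(2) fmul_join fmul_fmul[OF Jc(1) bc] fmul_fmul[OF Jc(2) bc] J_block(1,2)[OF A B])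
				finally show ?thesis .
			qed (simp add: EGL_action_def)
		qed
		note A0 = GL_c_mat[OF gi[OF v(1)]] GL_inv(2)[OF gi[OF v(1)]] and A1 = GL_inv(2)[OF gi[OF v(2)]]
		have hv: "hh ?h v0 = ?h" "hh ?h v1 = ?h" by (simp_all add: hh_def)
		note H = GL_inv(2-4)[OF h] GL_c_mat[OF h]
		have G0: "G v0 = block (dm v0) k (g (Some v0)) ?h" using v by (simp add: G_def hv)
		have Gi0: "ginv[dl v0] (G v0) = block (dm v0) k (ginv[dm v0] (g (Some v0))) (ginv[k] ?h)"
			"ginv[dl v1] (G v1) = block (dm v1) k (ginv[dm v1] (g (Some v1))) (ginv[k] ?h)"
			using Gi(2)[OF v(1)] Gi(2)[OF v(2)] by (simp_all add: hv)
		note bc = block_c[OF A0(1) H(4)] block_c[OF A0(2) H(1)] block_c[OF A1 H(1)]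
		note d = bc[THEN mdim] H(1,4)[THEN mdim]
		have "?h * (K0 * block (dm v0) k (ginv[dm v0] (g (Some v0))) (ginv[k] ?h)) = K0"
			unfolding J_block(2)[OF A0(2) H(1)] using d by (simp add: mat_cancel[OF H(2)] mat_one_left)
		then show "ff (uu (actL g y)) = ff (fact (G, ?h) (uu y))"
			using d by (simp add: Gi0 mat_assoc)
		have rd: "block (dm v0) k (g (Some v0)) ?h * (K0\<^sup>T * K1) * block (dm v1) k (ginv[dm v1] (g (Some v1))) (ginv[k] ?h)
			= K0\<^sup>T * K1"
		proof -
			have "block (dm v0) k (g (Some v0)) ?h * (K0\<^sup>T * K1) * block (dm v1) k (ginv[dm v1] (g (Some v1))) (ginv[k] ?h)
				= (block (dm v0) k (g (Some v0)) ?h * K0\<^sup>T) * (K1 * block (dm v1) k (ginv[dm v1] (g (Some v1))) (ginv[k] ?h))"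
				using d by (simp add: mat_assoc)
			also have "\<dots> = K0\<^sup>T * K1"
				unfolding J_block(2)[OF A1 H(1)] J_block(3)[OF A0(1) H(4)] using d by (simp add: mat_dim_simps mat_cancel[OF H(2)])
			finally show ?thesis .
		qed
		show "rp (uu (actL g y)) = rp (fact (G, ?h) (uu y))"
		proof
			fix a show "rp (uu (actL g y)) a = rp (fact (G, ?h) (uu y)) a"
			proof (cases "a \<in> arcs QT & a ~= Arrow_d")
				case True
				then have w: "head QT a \<in> verts Q" "tail QT a \<in> verts Q" using QT_wf by auto
				show ?thesis using True GL_c_mat[OF Gi(1)[OF w(1)]] GL_inv(2)[OF Gi(1)[OF w(2)]]
					by (auto simp: base_change_def)
			next
				case False
				then show ?thesis using rd by (auto simp: base_change_def G0 Gi0)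
			qed
		qed
	qed
	then show ?thesis using G h by (intro bexI[of _ "(G, ?h)"]) auto
qed

lemma cts_uu:
	assumes F: "continuous_map X TL F"
	shows "continuous_map X Y (%x. uu (F x))"
	unfolding cts_Y
proof (intro conjI ballI)
	have top: "uu (F x) \<in> topspace Y" if "x \<in> topspace X" for x
		using continuous_map_funspace[OF F] that by (intro uu_tops) auto
	have "continuous_map X (EGL_topology QL ldim) (%x. fst (F x))"
		using F by (simp add: stk_top_def continuous_map_pairwise o_def)
	then have c: "continuous_map X (frame_topology k) (%x. fst (F x) None)"
		"!!i. i \<in> verts Q ==> continuous_map X (frame_topology (dm i)) (%x. fst (F x) (Some i))"
		by (auto simp: cts_EGL)
	show "uu (F x) \<in> topspace Y" if "x \<in> topspace X" for x by (rule top[OF that])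
	show "continuous_map X (frame_topology k) (%x. fk (uu (F x)))" using c by simp
	fix i assume i: "i \<in> verts Q"
	have e: "cfun X (%x. fst (F x) (Some i) j)" if "j < dm i" for j
		using c(2)[OF i] that by (simp add: cts_frame)
	have e': "cfun X (%x. fst (F x) None j)" if "j < kk i" for j
		using c(1) that kk_le[of i] by (simp add: cts_frame)
	have "continuous_map X (frame_topology (dl i)) (%x. join (dl i) (fmul (dm i) (dl i) (fst (F x) (Some i)) (I1 i))
				(fmul (kk i) (dl i) (fst (F x) None) (I2 i)))"
		by (intro cts_join cts_fmul[OF e] cts_fmul[OF e'] cts_mat_const J_c)
			(use tops_YD(1)[OF top i] i in auto)
	then show "continuous_map X (frame_topology (dl i)) (%x. fr (uu (F x)) i)" using i by simp
next
	fix a assume "a \<in> arcs QT"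
	then show "continuous_map X (mat_topology (dl (head QT a)) (dl (tail QT a))) (%x. rp (uu (F x)) a)"
		by (auto intro!: cts_mat_const carrier_matI simp: dl)
next
	show "continuous_map X (mat_topology k (dl v0)) (%x. ff (uu (F x)))"
		by (auto intro!: cts_mat_const carrier_matI simp: dl)
qed

end

context framed_shift
begin

section \<open>The inverse map by restriction of frames to kernels\<close>

definition isker where
	"isker b x \<longleftrightarrow> (ALL i:verts Q. b i \<in> carrier_mat (dl i) (dm i) & mat_inj (dl i) (dm i) (b i) & phi x i * b i = 0\<^sub>m (kk i) (dm i))"

definition retr where
	"retr b x = ((\<lambda>j\<in>verts QL. case j of None => fk x | Some i => fmul (dl i) (dm i) (fr x i) (b i)), zrep)"

lemma retr_simps [simp]: "fst (retr b x) None = fk x" "i \<in> verts Q ==> fst (retr b x) (Some i) = fmul (dl i) (dm i) (fr x i) (b i)"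
	by (simp_all add: retr_def)

lemma retr_tops:
	assumes x: "x \<in> topspace Y" and b: "!!i. i \<in> verts Q ==> mat_inj (dl i) (dm i) (b i)"
	shows "retr b x \<in> topspace TL"
	unfolding retr_def tops_stk_QL using tops_YD[OF x] b zrep_tops
	by (auto intro: fmul_frames)

lemma rep_eqI: "p = actL g q ==> g \<in> carrier (GL_L) ==> q \<in> topspace TL
	==> projL p = projL q"
	unfolding stk_proj_def using orbit_act[OF acts_on_stk[OF fin_digraph_QL, of ldim]] by simp

lemma base_change_zrep: "g \<in> carrier (GL_L) ==> base_change QL ldim g zrep = zrep"
proof
	interpret L: fin_digraph QL by (rule fin_digraph_QL)
	fix a assume g: "g \<in> carrier (GL_L)"
	show "base_change QL ldim g zrep a = zrep a"
	proof (cases "a \<in> arcs QL")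
		case True
		have "g (head QL a) \<in> carrier (GL (ldim (head QL a)))" "g (tail QL a) \<in> carrier (GL (ldim (tail QL a)))"
			using g True L.head_in_verts L.tail_in_verts by (auto simp: GL_dim_iff simp del: verts_QL)
		note c = GL_c_mat[OF this(1)] GL_inv(2)[OF this(2)]
		then show ?thesis using True c[THEN mdim]
			by (simp add: base_change_def zrep_def mat_dim_simps)
	qed (simp add: base_change_def zrep_def)
qed

lemma ex_split:
	assumes x: "x \<in> topspace Y" and i: "i \<in> verts Q"
	shows "EX b L s. splitting (kk i) (dm i) (phi x i) b L s"
	using ex_splitting[of "phi x i" "kk i" "dm i"] phi_c[OF x, of i] rank_of_surj[OF phi_surj[OF x, of i]]
	by (simp add: dl)

text \<open>Transported by the group element, the two families of kernel bases parametrise the same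
  subspaces, so they differ by an element of the smaller group. Passing to its orbits absorbs every
  choice of bases.\<close>

lemma retr_fact:
	assumes x: "x \<in> topspace Y" and g: "g \<in> carrier (GL_dim Q dl)" and h: "h \<in> carrier (GL k)"
		and b: "isker b x" and b': "isker b' (fact (g, h) x)"
	shows "projL (retr b' (fact (g, h) x)) = projL (retr b x)"
proof -
	have gi: "g i \<in> carrier (GL (dl i))" if "i \<in> verts Q" for i using g that by (simp add: GL_dim_iff)
	have "EX c. c \<in> carrier (GL (dm i)) & b' i * c = g i * b i" if i: "i \<in> verts Q" for i
	proof -
		note G = GL_inv(2-4)[OF gi[OF i], unfolded dl] GL_c_mat[OF gi[OF i], unfolded dl]
		obtain b0 L s where S: "splitting (kk i) (dm i) (phi x i) b0 L s" using ex_split[OF x i] by blast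
		have B: "b i \<in> carrier_mat (dm i + kk i) (dm i)" "mat_inj (dm i + kk i) (dm i) (b i)" "phi x i * b i = 0\<^sub>m (kk i) (dm i)"
			and B': "b' i \<in> carrier_mat (dm i + kk i) (dm i)" "mat_inj (dm i + kk i) (dm i) (b' i)"
				"phi (fact (g, h) x) i * b' i = 0\<^sub>m (kk i) (dm i)"
			using b b' i by (auto simp: isker_def dl)
		note H = GL_inv(2-4)[OF hh_GL[OF h, of i]] GL_c_mat[OF hh_GL[OF h, of i]]
		note p = phi_c[OF x, of i, unfolded dl]
		note d = G(1,4)[THEN mdim] H(1,4)[THEN mdim]
			B(1)[THEN mdim] B'(1)[THEN mdim]
			p[THEN mdim]
		let ?gi = "ginv[dm i + kk i] (g i)" and ?hi = "ginv[kk i] (hh h i)"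
		have c1: "?gi * b' i \<in> carrier_mat (dm i + kk i) (dm i)" using d by (auto intro!: carrier_matI)
		have c2: "mat_inj (dm i + kk i) (dm i) (?gi * b' i)"
			unfolding mat_inj_mult[OF c1]
		proof (intro ballI impI)
			fix c assume c: "c \<in> carrier_mat (dm i) 1" "?gi * b' i * c = 0\<^sub>m (dm i + kk i) 1"
			note dc = c(1)[THEN mdim]
			have "b' i * c = g i * (?gi * b' i * c)"
				using d dc by (simp add: mat_dim_simps mat_cancel[OF G(2)])
			also have "\<dots> = 0\<^sub>m (dm i + kk i) 1" unfolding c(2) using d by (simp add: mat_zero_right del: One_nat_def)
			finally show "c = 0\<^sub>m (dm i) 1" using B'(2) c(1) unfolding mat_inj_mult[OF B'(1)] by blast
		qed
		have c3: "phi x i * (?gi * b' i) = 0\<^sub>m (kk i) (dm i)"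
		proof -
			have "phi x i * (?gi * b' i) = ?hi * (phi (fact (g, h) x) i * b' i)"
				unfolding phi_fact[OF x g h i] dl using d by (simp add: mat_dim_simps mat_cancel[OF H(3)])
			then show ?thesis unfolding B'(3) using d by (simp add: mat_zero_right)
		qed
		note K = kernel_basis_change[OF S B] and K' = kernel_basis_change[OF S c1 c2 c3]
		note k = GL_inv(2-4)[OF K'(1)] GL_c_mat[OF K'(1)] and m = GL_c_mat[OF K(1)]
		have b0: "b0 \<in> carrier_mat (dm i + kk i) (dm i)" "L \<in> carrier_mat (dm i) (dm i + kk i)" using S by (auto simp: splitting_def)
		define A where "A = L * b i"
		define A' where "A' = L * (?gi * b' i)"
		have AA: "A \<in> carrier (GL (dm i))" "A' \<in> carrier (GL (dm i))" "b i = b0 * A" "?gi * b' i = b0 * A'"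
			using K K' by (simp_all add: A_def A'_def)
		note a = GL_inv(2-4)[OF AA(2)] GL_c_mat[OF AA(2)] GL_c_mat[OF AA(1)]
		note da = a(1,4,5)[THEN mdim] b0[THEN mdim]
		\<comment> \<open>Both kernel bases are expressed through the reference basis \<open>b0\<close>;
		  the transition matrix is the quotient of their coordinate matrices.\<close>
		let ?c = "ginv[dm i] A' * A"
		have "?c \<in> carrier (GL (dm i))"
			using group.is_monoid[OF group_GL, THEN monoid.m_closed, OF GL_inv(1)[OF AA(2)] AA(1)] by simp
		moreover have "b' i * ?c = g i * b i"
		proof -
			have "b' i * ?c = g i * ((?gi * b' i) * ?c)"
				using d da by (simp add: mat_dim_simps mat_cancel[OF G(2)])
			also have "\<dots> = g i * b i" unfolding AA(3,4) using d da by (simp add: mat_dim_simps mat_cancel[OF a(2)])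
			finally show ?thesis .
		qed
		ultimately show ?thesis by blast
	qed
	then obtain c where c: "!!i. i \<in> verts Q ==> c i \<in> carrier (GL (dm i)) & b' i * c i = g i * b i" by metis
	define u where "u = (\<lambda>j\<in>verts QL. case j of None => h | Some i => c i)"
	have u: "u \<in> carrier (GL_L)" using c h by (auto simp: u_def GL_dim_iff)
	have B: "b i \<in> carrier_mat (dl i) (dm i)" "mat_inj (dl i) (dm i) (b i)" "b' i \<in> carrier_mat (dl i) (dm i)" if "i \<in> verts Q" for i
		using b b' that by (auto simp: isker_def)
	show ?thesis
	proof (rule rep_eqI[OF _ u retr_tops[OF x B(2)]])
		show "retr b' (fact (g, h) x) = actL u (retr b x)"
		proof (rule prod_eqI)
			show "snd (retr b' (fact (g, h) x)) = snd (actL u (retr b x))"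
				by (simp add: retr_def stk_act_def base_change_zrep[OF u])
			show "fst (retr b' (fact (g, h) x)) = fst (actL u (retr b x))"
			proof
				fix j show "fst (retr b' (fact (g, h) x)) j = fst (actL u (retr b x)) j"
				proof (cases "j \<in> verts QL")
					case j: True
					show ?thesis
					proof (cases j)
						case None
						then show ?thesis by (simp add: retr_def stk_act_def EGL_action_def u_def)
					next
						case (Some i)
						with j have i: "i \<in> verts Q" by auto
						note C = GL_inv(2-4)[OF conjunct1[OF c[OF i]]] and G = GL_inv(2-4)[OF gi[OF i]] GL_c_mat[OF gi[OF i]]
						have cc: "c i \<in> carrier_mat (dm i) (dm i)" using c[OF i] GL_c_mat by blast
						note d = C(1)[THEN mdim] G(1,4)[THEN mdim]
							B(1,3)[OF i, THEN mdim] cc[THEN mdim]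
						have "ginv[dl i] (g i) * b' i = ginv[dl i] (g i) * (b' i * c i * ginv[dm i] (c i))"
							using d by (simp add: mat_dim_simps C(2))
						also have "\<dots> = b i * ginv[dm i] (c i)"
							unfolding conjunct2[OF c[OF i]] using d by (simp add: mat_dim_simps mat_cancel[OF G(3)])
						finally have e: "ginv[dl i] (g i) * b' i = b i * ginv[dm i] (c i)" .
						show ?thesis using i
							by (simp add: Some stk_act_def retr_def EGL_action_def u_def frame_action_fmul
									fmul_fmul[OF B(1)[OF i] C(1)] fmul_fmul[OF G(1) B(3)[OF i]] e)
					qed
				qed (auto simp: retr_def stk_act_def EGL_action_def)
			qed
		qed
	qed
qed

lemma fact_one: "x \<in> topspace Y ==> fact (\<one>\<^bsub>GL_dim Q dl\<^esub>, 1\<^sub>m k) x = x"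
	using acts_on_fact by (auto simp: acts_on_def DirProd_def simp del: GL_dim_simps)

lemma retr_unique:
	assumes x: "x \<in> topspace Y" and b: "isker b x" and b': "isker b' x"
	shows "projL (retr b' x) = projL (retr b x)"
proof -
	have o: "\<one>\<^bsub>GL_dim Q dl\<^esub> \<in> carrier (GL_dim Q dl)" "1\<^sub>m k \<in> carrier (GL k)"
		using group.is_monoid[OF group_GL_dim, THEN monoid.one_closed] group.is_monoid[OF group_GL, THEN monoid.one_closed, of k] by simp_all
	show ?thesis using retr_fact[OF x o b] b' by (simp only: fact_one[OF x])
qed

definition vv where "vv x = projL (retr (SOME b. isker b x) x)"

lemma ex_isker:
	assumes x: "x \<in> topspace Y"
	shows "EX b. isker b x"
proof -
	obtain b L s where S: "!!i. i \<in> verts Q ==> splitting (kk i) (dm i) (phi x i) (b i) (L i) (s i)"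
		using ex_split[OF x] by metis
	have "isker b x"
		unfolding isker_def
	proof (intro ballI conjI)
		fix i assume "i \<in> verts Q"
		then have "splitting (kk i) (dm i) (phi x i) (b i) (L i) (s i)" by (rule S)
		then show "b i \<in> carrier_mat (dl i) (dm i)" "mat_inj (dl i) (dm i) (b i)" "phi x i * b i = 0\<^sub>m (kk i) (dm i)"
			using left_inverse_inj[of "b i" "dl i" "dm i" "L i"] by (auto simp: splitting_def dl)
	qed
	then show ?thesis by blast
qed

lemma vv_eq: "x \<in> topspace Y ==> isker b x ==> vv x = projL (retr b x)"
	unfolding vv_def using retr_unique[of x b "SOME b. isker b x"] someI_ex[OF ex_isker[of x]] by blast

lemma vv_fact:
	assumes x: "x \<in> topspace Y" and g: "g \<in> carrier (GL_dim Q dl)" and h: "h \<in> carrier (GL k)"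
	shows "vv (fact (g, h) x) = vv x"
proof -
	have "fact (g, h) x \<in> topspace Y" using acts_on_fact x g h by (auto simp: acts_on_def)
	then obtain b b' where b: "isker b x" "isker b' (fact (g, h) x)" using ex_isker x by metis
	show ?thesis
		using vv_eq[OF x b(1)] vv_eq[OF \<open>fact (g, h) x \<in> topspace Y\<close> b(2)] retr_fact[OF x g h b] by simp
qed

text \<open>Near \<open>x0\<close> the basis of its kernels, projected to the nearby kernels,
  remains a basis. On that neighbourhood \<open>vv\<close> is given by a continuous choice of bases,
  which suffices since its value does not depend on the choice.\<close>

lemma cts_vv: "continuous_map Y SL vv"
proof (rule cts_locally)
	fix x0 assume x0: "x0 \<in> topspace Y"
	obtain b L s where S: "!!i. i \<in> verts Q ==> splitting (kk i) (dm i) (phi x0 i) (b i) (L i) (s i)"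
		using ex_split[OF x0] by metis
	have bL: "b i \<in> carrier_mat (dl i) (dm i)" "L i \<in> carrier_mat (dm i) (dl i)" "L i * b i = 1\<^sub>m (dm i)" "phi x0 i * b i = 0\<^sub>m (kk i) (dm i)"
		if "i \<in> verts Q" for i using S[OF that] by (auto simp: splitting_def dl)
	\<comment> \<open>The fixed basis projected to the kernel at \<open>x\<close>. It lies in the
	  kernel everywhere; its injectivity is the open condition, detected by the determinants of
	  \<open>L i * B x i\<close>.\<close>
	define B where "B x i = mixm 1 x i * b i" for x i
	have id: "continuous_map Y Y (%x. x)" by simp
	have mcont: "continuous_map Y (mat_topology (dl i) (dl i)) (%x. mixm 1 x i)" if i: "i \<in> verts Q" for i
	proof (rule cts_eq')
		show "continuous_map Y (mat_topology (dl i) (dl i)) (%x. 1\<^sub>m (dl i) + (- 1) \<cdot>\<^sub>m (sig x i * phi x i))"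
			by (intro cts_mat_add cts_mat_smult cts_mat_const one_carrier_mat
					cts_mat_mult[OF cts_sig[OF id i] cts_phi[OF id i]]) simp
		fix x assume x: "x \<in> topspace Y"
		have "sig x i * phi x i \<in> carrier_mat (dl i) (dl i)"
			using sig(1)[OF x i] phi_c[OF x, of i] by (rule mult_carrier_mat)
		then show "1\<^sub>m (dl i) + (- 1) \<cdot>\<^sub>m (sig x i * phi x i) = mixm 1 x i"
			unfolding mixm_def by (intro eq_matI) (auto simp del: index_mult_mat(1))
	qed
	have Bcont: "continuous_map Y (mat_topology (dl i) (dm i)) (%x. B x i)" if i: "i \<in> verts Q" for i
		unfolding B_def by (intro cts_mat_mult[OF mcont[OF i]] cts_mat_const bL(1) i)
	define U where "U = {x \<in> topspace Y. ALL i:verts Q. det (L i * B x i) ~= 0}"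
	have dcont: "cfun Y (%x. det (L i * B x i))" if i: "i \<in> verts Q" for i
		by (rule cts_det[OF cts_mat_mult[OF cts_mat_const[OF bL(2)[OF i]] Bcont[OF i]]])
	have Uopen: "openin Y U"
	proof -
		have "U = topspace Y Int (\<Inter>i\<in>verts Q. {x \<in> topspace Y. det (L i * B x i) \<in> - {0}})" by (auto simp: U_def)
		moreover have "openin Y {x \<in> topspace Y. det (L i * B x i) \<in> - {0}}" if "i \<in> verts Q" for i
			by (rule openin_continuous_map_preimage[OF dcont[OF that]]) auto
		ultimately show ?thesis by (auto intro!: openin_Int_Inter)
	qed
	have Bx: "phi x i * B x i = 0\<^sub>m (kk i) (dm i)" if x: "x \<in> topspace Y" and i: "i \<in> verts Q" for x i
	proof -
		note s = sig[OF x i] and p = phi_c[OF x, of i]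
		note d = s(1)[THEN mdim] p[THEN mdim]
			bL(1)[OF i, THEN mdim]
		have "1 \<cdot>\<^sub>m (sig x i * phi x i) = sig x i * phi x i" by (auto intro!: eq_matI)
		then show ?thesis unfolding B_def mixm_def using d
			by (simp add: mat_dim_simps mat_cancel[OF s(2)])
	qed
	have x0U: "x0 \<in> U"
		unfolding U_def
	proof (intro CollectI conjI ballI x0)
		fix i assume i: "i \<in> verts Q"
		note s = sig[OF x0 i] and p = phi_c[OF x0, of i]
		note d = s(1)[THEN mdim] p[THEN mdim]
			bL(1)[OF i, THEN mdim]
		have "1 \<cdot>\<^sub>m (sig x0 i * phi x0 i) = sig x0 i * phi x0 i" by (auto intro!: eq_matI)
		then have "B x0 i = b i" unfolding B_def mixm_def using d
			by (simp add: mat_dim_simps bL(4)[OF i])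
		then show "det (L i * B x0 i) ~= 0" using bL(3)[OF i] by simp
	qed
	have Bker: "isker (B x) x" if x: "x \<in> U" for x
		unfolding isker_def
	proof (intro ballI conjI)
		fix i assume i: "i \<in> verts Q"
		have xY: "x \<in> topspace Y" using x by (simp add: U_def)
		show Bc: "B x i \<in> carrier_mat (dl i) (dm i)" using cts_mat_c[OF Bcont[OF i] xY] .
		show "phi x i * B x i = 0\<^sub>m (kk i) (dm i)" by (rule Bx[OF xY i])
		have "L i * B x i \<in> carrier (GL (dm i))"
			using x i mult_carrier_mat[OF bL(2)[OF i] Bc] by (simp add: U_def GL_iff)
		note g = GL_inv(2-4)[OF this]
		show "mat_inj (dl i) (dm i) (B x i)"
			by (rule left_inverse_inj[OF Bc mult_carrier_mat[OF g(1) bL(2)[OF i]]])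
				(use g(3) assoc_mult_mat[OF g(1) bL(2)[OF i] Bc] in simp)
	qed
	have sub: "continuous_map (subtopology Y U) Y (%x. x)" using continuous_map_from_subtopology[OF id] .
	note c = cts_YD[OF sub]
	have topU: "topspace (subtopology Y U) = U" using Uopen openin_subset by auto
	have "continuous_map (subtopology Y U) TL (%x. retr (B x) x)"
	proof -
		have "continuous_map (subtopology Y U) (EGL_topology QL ldim) (%x. fst (retr (B x) x))"
			unfolding cts_EGL
		proof (intro conjI ballI)
			fix x show "fst (retr (B x) x) \<in> extensional (verts QL)" by (simp add: retr_def)
		next
			fix j assume j: "j \<in> verts QL"
			show "continuous_map (subtopology Y U) (frame_topology (ldim j)) (%x. fst (retr (B x) x) j)"
			proof (cases j)
				case None then show ?thesis using c(2) by simp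
			next
				case (Some i)
				with j have i: "i \<in> verts Q" by auto
				have "continuous_map (subtopology Y U) (frame_topology (dm i)) (%x. fmul (dl i) (dm i) (fr x i) (B x i))"
					unfolding cts_frame
				proof (intro conjI ballI allI impI)
					fix x assume "x \<in> topspace (subtopology Y U)"
					then have "x \<in> U" "x \<in> topspace Y" using topU by (auto simp: U_def)
					then show "fmul (dl i) (dm i) (fr x i) (B x i) \<in> frames (dm i)"
						using Bker i tops_YD(1) by (intro fmul_frames) (auto simp: isker_def)
				next
					fix j assume "j < dm i"
					then show "cfun (subtopology Y U) (%x. fmul (dl i) (dm i) (fr x i) (B x i) j)"
						using c(1)[OF i] by (intro cts_fmul continuous_map_from_subtopology[OF Bcont[OF i]]) (auto simp: cts_frame)
				qed
				then show ?thesis using i by (simp add: Some)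
			qed
		qed
		moreover have "continuous_map (subtopology Y U) (rep_topology QL ldim) (%x. snd (retr (B x) x))"
			using zrep_tops by (simp add: retr_def)
		ultimately show ?thesis by (simp add: stk_top_def continuous_map_pairwise o_def)
	qed
	then have "continuous_map (subtopology Y U) SL (%x. projL (retr (B x) x))"
		using continuous_map_compose[OF _ quotient_imp_continuous_map[OF quot_map_stk]] by (force simp: o_def)
	then have "continuous_map (subtopology Y U) SL vv"
	proof (rule cts_eq')
		fix x assume "x \<in> topspace (subtopology Y U)"
		then have "x \<in> U" "x \<in> topspace Y" using topU by (auto simp: U_def)
		then show "projL (retr (B x) x) = vv x" using vv_eq[OF _ Bker] by simp
	qed
	then show "EX U. openin Y U & x0 \<in> U & continuous_map (subtopology Y U) SL vv"
		using Uopen x0U by blast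
qed

end

context framed_shift
begin

section \<open>The two composites and their homotopies to the identity\<close>

definition uuq where "uuq y = fproj (uu y)"

lemma fproj_act: "x \<in> topspace Y ==> gh \<in> carrier (GL_dim Q dl \<times>\<times> GL k) ==> fproj (fact gh x) = fproj x"
	unfolding fproj_def by (rule orbit_act[OF acts_on_fact])

lemma fproj_eq: "x \<in> topspace Y ==> z \<in> topspace Y ==> fproj x = fproj z ==>
		EX g h. g \<in> carrier (GL_dim Q dl) & h \<in> carrier (GL k) & z = fact (g, h) x"
	unfolding fproj_def using orbit_eq_iff[OF acts_on_fact, of x z] by auto

lemma stk_eq: "x \<in> topspace TL ==> z \<in> topspace TL ==> projL x = projL z ==>
		EX g:carrier (GL_L). z = actL g x"
	unfolding stk_proj_def using orbit_eq_iff[OF acts_on_stk[OF fin_digraph_QL]] by blast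

lemma cts_uuq: "continuous_map TL FS uuq"
	unfolding uuq_def
	using continuous_map_compose[OF cts_uu[OF continuous_map_id[unfolded id_def]] quotient_imp_continuous_map[OF quot_map_framed]]
	by (simp add: o_def)

lemma uuq_compat:
	assumes "x \<in> topspace TL" "z \<in> topspace TL" "projL x = projL z"
	shows "uuq x = uuq z"
proof -
	obtain g where g: "g \<in> carrier (GL_L)" "z = actL g x" using stk_eq[OF assms] by blast
	obtain gh where "gh \<in> carrier (GL_dim Q dl \<times>\<times> GL k)" "uu z = fact gh (uu x)" using uu_act[OF assms(1) g(1)] g(2) by blast
	then show ?thesis unfolding uuq_def using fproj_act[OF uu_tops[OF assms(1)]] by simp
qed

lemma vv_compat: "x \<in> topspace Y ==> z \<in> topspace Y ==> fproj x = fproj z ==> vv x = vv z"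
	using fproj_eq vv_fact by metis

definition hom1 where
	"hom1 t y = ((\<lambda>j\<in>verts QL. case j of None => fst y None | Some i => spread_path (dm i) t (fst y (Some i))),
		(\<lambda>a\<in>arcs QL. cor (1 - t) \<cdot>\<^sub>m snd y a))"

lemma hom1_tops: "y \<in> topspace TL ==> hom1 t y \<in> topspace TL"
	by (cases y) (auto simp: hom1_def tops_stk_QL tops_rep PiE_iff intro: spread_path_frames)

lemma hom1_act:
	assumes y: "y \<in> topspace TL" and g: "g \<in> carrier (GL_L)"
	shows "hom1 t (actL g y) = actL g (hom1 t y)"
proof (rule prod_eqI)
	interpret L: fin_digraph QL by (rule fin_digraph_QL)
	obtain E R where yy: "y = (E, R)" by (cases y)
	show "fst (hom1 t (actL g y)) = fst (actL g (hom1 t y))"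
		by (auto simp: yy hom1_def stk_act_def EGL_action_def fun_eq_iff frame_action_fmul fmul_spread_path split: option.splits)
	show "snd (hom1 t (actL g y)) = snd (actL g (hom1 t y))"
	proof
		fix a show "snd (hom1 t (actL g y)) a = snd (actL g (hom1 t y)) a"
		proof (cases "a \<in> arcs QL")
			case a: True
			have "g (head QL a) \<in> carrier (GL (ldim (head QL a)))" "g (tail QL a) \<in> carrier (GL (ldim (tail QL a)))"
				using g a L.head_in_verts L.tail_in_verts by (auto simp: GL_dim_iff simp del: verts_QL)
			note c = GL_c_mat[OF this(1)] GL_inv(2)[OF this(2)]
			have "R a \<in> carrier_mat (ldim (head QL a)) (ldim (tail QL a))"
				using y a by (auto simp: yy tops_stk_QL tops_rep)
			note c = c this
			show ?thesis using a c[THEN mdim]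
				by (simp add: yy hom1_def stk_act_def base_change_def smult_dim_simps)
		qed (simp add: yy hom1_def stk_act_def base_change_def)
	qed
qed

lemma cts_hom1:
	assumes F: "continuous_map X TL F" and t: "continuous_map X euclideanreal t"
	shows "continuous_map X TL (%x. hom1 (t x) (F x))"
proof -
	have t1: "cfun X (%x. cor (1 - t x))"
		by (rule cts_compose_UNIV[OF t]) (intro continuous_intros)
	have c: "continuous_map X (EGL_topology QL ldim) (%x. fst (F x))" "continuous_map X (rep_topology QL ldim) (%x. snd (F x))"
		using F by (simp_all add: stk_top_def continuous_map_pairwise o_def)
	have cN: "continuous_map X (frame_topology k) (%x. fst (F x) None)"
		and cS: "!!i. i \<in> verts Q ==> continuous_map X (frame_topology (dm i)) (%x. fst (F x) (Some i))"
		using c(1) by (auto simp: cts_EGL)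
	have "continuous_map X (EGL_topology QL ldim) (%x. fst (hom1 (t x) (F x)))"
		unfolding cts_EGL
	proof (intro conjI ballI)
		fix j assume j: "j \<in> verts QL"
		show "continuous_map X (frame_topology (ldim j)) (%x. fst (hom1 (t x) (F x)) j)"
		proof (cases j)
			case None
			then show ?thesis using cN by (simp add: hom1_def)
		next
			case (Some i)
			with j have "i \<in> verts Q" by auto
			then show ?thesis using cts_spread_path[OF cS t] Some by (simp add: hom1_def)
		qed
	qed (simp add: hom1_def)
	moreover have "continuous_map X (rep_topology QL ldim) (%x. snd (hom1 (t x) (F x)))"
		using c(2) by (auto simp: hom1_def cts_rep intro!: cts_mat_smult t1[simplified])
	ultimately show ?thesis by (simp add: stk_top_def continuous_map_pairwise o_def)
qed

lemma hom1_0: "y \<in> topspace TL ==> hom1 0 y = y"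
proof (rule prod_eqI)
	assume "y \<in> topspace TL"
	then obtain E R where yy: "y = (E, R)" and y: "(E, R) \<in> topspace TL" by (cases y) auto
	note E = y[unfolded tops_stk_QL]
	show "fst (hom1 0 y) = fst y"
	proof
		fix j show "fst (hom1 0 y) j = fst y j"
			using E by (cases j) (auto simp: yy hom1_def spread_path_0 extensional_def)
	qed
	show "snd (hom1 0 y) = snd y"
	proof
		fix a show "snd (hom1 0 y) a = snd y a"
			using E by (cases "a \<in> arcs QL") (auto simp: yy hom1_def tops_rep PiE_iff extensional_def intro!: eq_matI)
	qed
qed

text \<open>The kernel of the standard framing is parametrised by the transpose of
  \<open>I1 i\<close>. Restricting the joined frame to it leaves the original frame on the even
  positions, which is where \<open>hom1\<close> ends.\<close>

lemma vv_uu: "y \<in> topspace TL ==> vv (uu y) = projL (hom1 1 y)"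
proof -
	assume y: "y \<in> topspace TL"
	obtain E R where yy: "y = (E, R)" by (cases y)
	note E = y[unfolded yy tops_stk_QL]
	define b where "b i = (I1 i)\<^sup>T" for i
	have bc: "b i \<in> carrier_mat (dl i) (dm i)" for i by (auto simp: b_def dl intro!: carrier_matI)
	have "isker b (uu y)"
		unfolding isker_def
	proof (intro ballI conjI bc)
		fix i assume i: "i \<in> verts Q"
		show "mat_inj (dl i) (dm i) (b i)"
			by (rule left_inverse_inj[OF bc J_c(1)]) (simp add: b_def J_mult)
		show "phi (uu y) i * b i = 0\<^sub>m (kk i) (dm i)" unfolding phi_uu[OF i] b_def by (rule J_mult)
	qed
	then have "vv (uu y) = projL (retr b (uu y))" by (rule vv_eq[OF uu_tops[OF y]])
	also have "retr b (uu y) = hom1 1 y"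
	proof (rule prod_eqI)
		show "fst (retr b (uu y)) = fst (hom1 1 y)"
		proof
			fix j show "fst (retr b (uu y)) j = fst (hom1 1 y) j"
			proof (cases "j \<in> verts QL")
				case True
				show ?thesis
				proof (cases j)
					case None then show ?thesis by (simp add: retr_def hom1_def)
				next
					case (Some i)
					with True have i: "i \<in> verts Q" by auto
					have "fmul (dl i) (dm i) (fr (uu y) i) (b i) = join (dm i) (fmul (dm i) (dm i) (E (Some i)) (1\<^sub>m (dm i)))
						(fmul (kk i) (dm i) (E None) (0\<^sub>m (kk i) (dm i)))"
						using i by (simp add: yy fmul_join fmul_fmul[OF J_c(1) bc] fmul_fmul[OF J_c(2) bc]) (simp add: b_def J_mult)
					also have "fmul (kk i) (dm i) (E None) (0\<^sub>m (kk i) (dm i)) = fmul 0 (dm i) (E None) (0\<^sub>m (kk i) (dm i))"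
						using bounded_bilinear.zero_left[OF bounded_bilinear_cmul] by (simp add: fmul_def cong: restrict_cong)
					also have "fmul (dm i) (dm i) (E (Some i)) (1\<^sub>m (dm i)) = E (Some i)"
						using E i by (intro fmul_one frames_extensional) auto
					finally show ?thesis using i by (simp add: Some retr_def hom1_def yy join_zero)
				qed
			qed (auto simp: retr_def hom1_def)
		qed
		show "snd (retr b (uu y)) = snd (hom1 1 y)"
		proof
			fix a show "snd (retr b (uu y)) a = snd (hom1 1 y) a"
			proof (cases "a \<in> arcs QL")
				case True
				then have "R a \<in> carrier_mat (ldim (head QL a)) (ldim (tail QL a))" using E by (auto simp: tops_rep)
				then show ?thesis using True by (auto simp: retr_def hom1_def zrep_def yy intro!: eq_matI)
			qed (simp add: retr_def hom1_def zrep_def)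
		qed
	qed
	finally show ?thesis .
qed

text \<open>With coefficient zero nothing is joined on the odd positions, so the second homotopy
  starts exactly where the first one ends.\<close>

lemma st_eq: "x \<in> topspace Y ==> st2 0 x = st1 1 x"
proof (rule quad_eqI)
	assume x: "x \<in> topspace Y"
	note D = tops_YD[OF x]
	show "fk (st2 0 x) = fk (st1 1 x)" "ff (st2 0 x) = ff (st1 1 x)" by simp_all
	show "fr (st2 0 x) = fr (st1 1 x)"
	proof
		fix i show "fr (st2 0 x) i = fr (st1 1 x) i"
		proof (cases "i \<in> verts Q")
			case i: True
			have m: "mixm 0 x i = 1\<^sub>m (dl i)" unfolding mixm_def using sig(1)[OF x i] phi_c[OF x, of i]
				by (auto intro!: eq_matI)
			have "fmul (kk i) (dl i) (fk x) (cor 0 \<cdot>\<^sub>m phi x i) = fmul 0 (dl i) (fk x) (cor 0 \<cdot>\<^sub>m phi x i)"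
				using bounded_bilinear.zero_left[OF bounded_bilinear_cmul] phi_c[OF x, of i]
				by (auto simp add: fmul_def fun_eq_iff intro!: sum.neutral)
			then show ?thesis using i D(1)[OF i] by (simp add: m fmul_one frames_extensional join_zero)
		qed simp
	qed
	show "rp (st2 0 x) = rp (st1 1 x)"
	proof
		fix a show "rp (st2 0 x) a = rp (st1 1 x) a"
		proof (cases "a \<in> arcs QT")
			case a: True
			have "1 \<cdot>\<^sub>m rp x a + 0\<^sub>m (dl (head QT a)) (dl (tail QT a)) = rp x a"
				using D(4)[OF a] by (auto intro!: eq_matI)
			moreover have "0 \<cdot>\<^sub>m (sig x v0 * phi x v1) = 0\<^sub>m (dl v0) (dl v1)"
				using sig(1)[OF x v(1)] phi_c[OF x, of v1] by (auto intro!: eq_matI)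
			ultimately show ?thesis using a by auto
		qed (use D(5) in \<open>auto simp: extensional_def\<close>)
	qed
qed

text \<open>\<open>st2 1 x\<close> is already a standard framing when written in the basis composed
  of a kernel basis and the section \<open>sig\<close>. The change to this basis is the required
  group element.\<close>

lemma uuq_retr:
	assumes x: "x \<in> topspace Y"
	shows "EX b. isker b x & fproj (uu (retr b x)) = fproj (st2 1 x)"
proof -
	note D = tops_YD[OF x]
	obtain b L0 s where S: "!!i. i \<in> verts Q ==> splitting (kk i) (dm i) (phi x i) (b i) (L0 i) (s i)"
		using ex_split[OF x] by metis
	define P where "P i = 1\<^sub>m (dl i) - sig x i * phi x i" for i
	define L where "L i = L0 i * P i" for i
	\<comment> \<open>The columns of \<open>M i\<close> are the kernel basis followed by the section,
	  and \<open>N i\<close> is its inverse. Projecting before \<open>L0\<close> makes \<open>L\<close>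
	  vanish on the section.\<close>
	define M where "M i = b i * I1 i + sig x i * I2 i" for i
	define N where "N i = (I1 i)\<^sup>T * L i + (I2 i)\<^sup>T * phi x i" for i
	have B: "b i \<in> carrier_mat (dl i) (dm i)" "L0 i \<in> carrier_mat (dm i) (dl i)" "L0 i * b i = 1\<^sub>m (dm i)"
		"phi x i * b i = 0\<^sub>m (kk i) (dm i)" "s i \<in> carrier_mat (dl i) (kk i)" "b i * L0 i + s i * phi x i = 1\<^sub>m (dl i)"
		if "i \<in> verts Q" for i
		using S[OF that] by (auto simp: splitting_def dl)
	have ker: "isker b x"
		unfolding isker_def using B left_inverse_inj[OF B(1) B(2) B(3)] by blast
	have main: "M i \<in> carrier (GL (dl i)) & N i \<in> carrier (GL (dl i)) & ginv[dl i] (N i) = M i & mixm 1 x i * M i = b i * I1 i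
			& phi x i * M i = I2 i & N i * sig x i = (I2 i)\<^sup>T" if i: "i \<in> verts Q" for i
	proof -
		note s = sig[OF x i] and p = phi_c[OF x, of i]
		note d = s(1)[THEN mdim] p[THEN mdim]
			B(1,2,5)[OF i, THEN mdim] dl[of i]
		have P: "P i \<in> carrier_mat (dl i) (dl i)" using d by (auto simp: P_def intro!: carrier_matI)
		have Lc: "L i \<in> carrier_mat (dm i) (dl i)" using P B(2)[OF i] by (auto simp: L_def)
		note d = d P[THEN mdim] Lc[THEN mdim]
		have "1 \<cdot>\<^sub>m (sig x i * phi x i) = sig x i * phi x i" by (auto intro!: eq_matI)
		then have mP: "mixm 1 x i = P i" by (simp add: mixm_def P_def)
		have Pb: "P i * b i = b i" unfolding P_def using d
			by (simp add: mat_dim_simps B(4)[OF i])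
		have Ps: "P i * sig x i = 0\<^sub>m (dl i) (kk i)" unfolding P_def using d
			by (simp add: mat_dim_simps s(2))
		have pP: "phi x i * P i = 0\<^sub>m (kk i) (dl i)" unfolding P_def using d
			by (simp add: mat_dim_simps mat_cancel[OF s(2)])
		have Lb: "L i * b i = 1\<^sub>m (dm i)" unfolding L_def using d B(3)[OF i] Pb by (simp add: mat_assoc)
		have Ls: "L i * sig x i = 0\<^sub>m (dm i) (kk i)" unfolding L_def using d Ps by (simp add: mat_dim_simps)
		have bL: "b i * L i = P i"
		proof -
			have "P i = (b i * L0 i + s i * phi x i) * P i" unfolding B(6)[OF i] using d by (simp add: mat_one_left)
			also have "\<dots> = b i * L i" unfolding L_def using d pP by (simp add: mat_dim_simps)
			finally show ?thesis by simp
		qed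
		have Mc: "M i \<in> carrier_mat (dl i) (dl i)" and Nc: "N i \<in> carrier_mat (dl i) (dl i)"
			using d by (auto simp: M_def N_def intro!: carrier_matI)
		have "M i * N i = b i * L i + sig x i * phi x i"
			unfolding M_def N_def using d
			by (simp add: mat_dim_simps J_mult(1-4)[THEN mat_cancel])
		also have "\<dots> = 1\<^sub>m (dl i)" unfolding bL P_def using d by (auto intro!: eq_matI simp del: index_mult_mat(1))
		finally have MN: "M i * N i = 1\<^sub>m (dl i)" .
		have 1: "mixm 1 x i * M i = b i * I1 i"
			unfolding mP M_def using d
			by (simp add: mat_dim_simps mat_cancel[OF Pb] mat_cancel[OF Ps])
		have 2: "phi x i * M i = I2 i"
			unfolding M_def using d
			by (simp add: mat_dim_simps mat_cancel[OF B(4)[OF i]] mat_cancel[OF s(2)])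
		have 3: "N i * sig x i = (I2 i)\<^sup>T"
			unfolding N_def using d
			by (simp add: mat_dim_simps Ls s(2))
		show ?thesis using GL_invI[OF Mc Nc MN] 1 2 3 by blast
	qed
	define g where "g = (\<lambda>i\<in>verts Q. N i)"
	have g: "g \<in> carrier (GL_dim Q dl)" using main by (auto simp: g_def GL_dim_iff)
	have h: "1\<^sub>m k \<in> carrier (GL k)" by (simp add: GL_iff)
	have ih: "ginv[k] (1\<^sub>m k) = 1\<^sub>m k" by (rule GL_invI(3)) auto
	have "uu (retr b x) = fact (g, 1\<^sub>m k) (st2 1 x)"
	proof (rule quad_eqI)
		show "fk (uu (retr b x)) = fk (fact (g, 1\<^sub>m k) (st2 1 x))"
			using D(3) by (simp add: frame_action_one)
		have M0: "ginv[dl v0] (N v0) = M v0" "ff x * M v0 = K0" using main[OF v(1)] by (auto simp: phi_def)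
		show "ff (uu (retr b x)) = ff (fact (g, 1\<^sub>m k) (st2 1 x))"
			using v D(7) M0 by (simp add: g_def)
		show "fr (uu (retr b x)) = fr (fact (g, 1\<^sub>m k) (st2 1 x))"
		proof
			fix i show "fr (uu (retr b x)) i = fr (fact (g, 1\<^sub>m k) (st2 1 x)) i"
			proof (cases "i \<in> verts Q")
				case i: True
				note m = main[OF i]
				have mc: "mixm 1 x i \<in> carrier_mat (dl i) (dl i)" "M i \<in> carrier_mat (dl i) (dl i)"
					using mixm_c[OF x i] m GL_c_mat by blast+
				note pc = phi_c[OF x, of i]
				have one: "cor 1 \<cdot>\<^sub>m phi x i = phi x i" by (auto intro!: eq_matI)
				show ?thesis
					using i m by (simp add: EGL_action_def frame_action_fmul g_def fmul_join one[simplified] fmul_fmul[OF mc] fmul_fmul[OF pc mc(2)]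
						fmul_fmul[OF B(1)[OF i] J_c(1)])
			qed (simp add: EGL_action_def)
		qed
		show "rp (uu (retr b x)) = rp (fact (g, 1\<^sub>m k) (st2 1 x))"
		proof
			fix a show "rp (uu (retr b x)) a = rp (fact (g, 1\<^sub>m k) (st2 1 x)) a"
			proof (cases "a \<in> arcs QT")
				case a: True
				note w = QT_wf[OF a]
				have M1: "ginv[dl (tail QT a)] (N (tail QT a)) = M (tail QT a)" using main[OF w(2)] by blast
				have c: "N (head QT a) \<in> carrier_mat (dl (head QT a)) (dl (head QT a))" "M (tail QT a) \<in> carrier_mat (dl (tail QT a)) (dl (tail QT a))"
					using main[OF w(1)] main[OF w(2)] GL_c_mat by blast+
				note d = c[THEN mdim] D(4)[OF a, THEN mdim]
				have z: "0 \<cdot>\<^sub>m rp x a = 0\<^sub>m (dl (head QT a)) (dl (tail QT a))" using D(4)[OF a] by (auto intro!: eq_matI)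
				show ?thesis
				proof (cases "a = Arrow_d")
					case False
					then show ?thesis using a w d by (simp add: base_change_def g_def M1 z mat_dim_simps)
				next
					case True
					note s = sig[OF x v(1)] and p = phi_c[OF x, of v1]
					note d' = s(1)[THEN mdim] p[THEN mdim]
					have e: "N v0 * sig x v0 = K0\<^sup>T" "phi x v1 * M v1 = K1"
						using main[OF v(1)] main[OF v(2)] by simp_all
					have "1 \<cdot>\<^sub>m (sig x v0 * phi x v1) = sig x v0 * phi x v1" by (auto intro!: eq_matI)
					moreover have "N v0 * (sig x v0 * phi x v1) * M v1 = K0\<^sup>T * K1"
						using d d' True by (simp add: mat_assoc mat_cancel[OF e(1)] e(2))
					ultimately show ?thesis using a True d d' M1 z v
						by (simp add: base_change_def g_def mat_add_zero)
				qed
			qed (simp add: base_change_def)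
		qed
	qed
	then have "fproj (uu (retr b x)) = fproj (st2 1 x)"
		using fproj_act[OF st2_tops[OF x], of "(g, 1\<^sub>m k)"] g h by simp
	then show ?thesis using ker by blast
qed

text \<open>One composite is connected with the identity by \<open>hom1\<close>. For the other,
  \<open>st1\<close> and \<open>st2\<close> are run in succession through the map that both induce
  at their common point.\<close>

theorem ex_hequiv: "EX h. homotopy_equivalence SL FS h"
proof (rule hequiv_quots[OF quot_map_stk quot_map_framed cts_uuq uuq_compat cts_vv vv_compat])
	fix u' v'
	assume u': "continuous_map SL FS u'" "!!y. y \<in> topspace TL ==> u' (projL y) = uuq y"
		and v': "continuous_map FS SL v'" "!!y. y \<in> topspace Y ==> v' (fproj y) = vv y"
	let ?I = "top_of_set {0..1::real}"
	have t: "continuous_map (prod_topology ?I X) euclideanreal fst" for X :: "'x topology"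
		using continuous_map_fst[of ?I X] by (metis continuous_map_in_subtopology)
	have sq: "continuous_map TL SL projL"
		by (rule quotient_imp_continuous_map[OF quot_map_stk])
	have fq: "continuous_map Y FS fproj"
		by (rule quotient_imp_continuous_map[OF quot_map_framed])
	have A: "homotopic_with (%_. True) SL SL id (v' \<circ> u')"
	proof (rule homotopic_with_descend[OF quot_map_stk, where H = "%(t, y). projL (hom1 t y)"])
		show "continuous_map (prod_topology ?I TL) SL (%(t, y). projL (hom1 t y))"
			using continuous_map_compose[OF cts_hom1[OF continuous_map_snd t] sq] by (simp add: o_def case_prod_unfold)
		fix t :: real and y z assume yz: "y \<in> topspace TL" "z \<in> topspace TL" "projL y = projL z"
		obtain g where g: "g \<in> carrier (GL_L)" "z = actL g y" using stk_eq[OF yz] by blast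
		show "(%(t, y). projL (hom1 t y)) (t, y) = (%(t, y). projL (hom1 t y)) (t, z)"
			using rep_eqI[OF hom1_act[OF yz(1) g(1)] g(1) hom1_tops[OF yz(1)], of t] g(2) by simp
	next
		fix y assume y: "y \<in> topspace TL"
		show "(%(t, y). projL (hom1 t y)) (0, y) = id (projL y)" using hom1_0[OF y] by simp
		show "(%(t, y). projL (hom1 t y)) (1, y) = (v' \<circ> u') (projL y)"
			using vv_uu[OF y] u'(2)[OF y] v'(2)[OF uu_tops[OF y]] by (simp add: uuq_def)
	qed simp_all
	have c1: "continuous_map Y FS (%x. fproj (st1 1 x))"
		using continuous_map_compose[OF cts_st1[OF continuous_map_id[unfolded id_def], of "%_. 1"] fq] by (simp add: o_def)
	have compat1: "fproj (st1 t y) = fproj (st1 t z)" if yz: "y \<in> topspace Y" "z \<in> topspace Y" "fproj y = fproj z" for t y z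
	proof -
		obtain g h where g: "g \<in> carrier (GL_dim Q dl)" "h \<in> carrier (GL k)" "z = fact (g, h) y" using fproj_eq[OF yz] by blast
		show ?thesis using fproj_act[OF st1_tops[OF yz(1)], of "(g, h)" t] g by (simp add: st1_fact)
	qed
	have compat2: "fproj (st2 t y) = fproj (st2 t z)" if yz: "y \<in> topspace Y" "z \<in> topspace Y" "fproj y = fproj z" for t y z
	proof -
		obtain g h where g: "g \<in> carrier (GL_dim Q dl)" "h \<in> carrier (GL k)" "z = fact (g, h) y" using fproj_eq[OF yz] by blast
		show ?thesis using fproj_act[OF st2_tops[OF yz(1)], of "(g, h)" t] g by (simp add: st2_fact[OF yz(1) g(1,2)])
	qed
	\<comment> \<open>The end of the first homotopy as a self-map of the orbit space, where the two
	  homotopies are glued.\<close>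
	obtain K where K: "continuous_map FS FS K" "!!y. y \<in> topspace Y ==> K (fproj y) = fproj (st1 1 y)"
		using cts_descend[OF quot_map_framed c1 compat1] by blast
	have B1: "homotopic_with (%_. True) FS FS id K"
	proof (rule homotopic_with_descend[OF quot_map_framed, where H = "%(t, y). fproj (st1 t y)"])
		show "continuous_map (prod_topology ?I Y) FS (%(t, y). fproj (st1 t y))"
			using continuous_map_compose[OF cts_st1[OF continuous_map_snd t] fq] by (simp add: o_def case_prod_unfold)
		fix y assume y: "y \<in> topspace Y"
		have "st1 0 y = y"
			using tops_YD(1,2)[OF y] by (intro quad_eqI) (auto simp: spread_path_0 fun_eq_iff extensional_def)
		then show "(%(t, y). fproj (st1 t y)) (0, y) = id (fproj y)" by simp
	next
		fix t :: real and y z assume "y \<in> topspace Y" "z \<in> topspace Y" "fproj y = fproj z"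
		then show "(%(t, y). fproj (st1 t y)) (t, y) = (%(t, y). fproj (st1 t y)) (t, z)" using compat1[of y z t] by simp
	qed (use K(2) in auto)
	have B2: "homotopic_with (%_. True) FS FS K (u' \<circ> v')"
	proof (rule homotopic_with_descend[OF quot_map_framed, where H = "%(t, y). fproj (st2 t y)"])
		show "continuous_map (prod_topology ?I Y) FS (%(t, y). fproj (st2 t y))"
			using continuous_map_compose[OF cts_st2[OF continuous_map_snd t] fq] by (simp add: o_def case_prod_unfold)
		fix y assume y: "y \<in> topspace Y"
		show "(%(t, y). fproj (st2 t y)) (0, y) = K (fproj y)" using K(2)[OF y] st_eq[OF y] by simp
		\<comment> \<open>This kernel basis may differ from the one chosen inside \<open>vv\<close>;
		  \<open>vv_eq\<close> allows the exchange.\<close>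
		obtain b where b: "isker b y" "fproj (uu (retr b y)) = fproj (st2 1 y)" using uuq_retr[OF y] by blast
		have rt: "retr b y \<in> topspace TL" using b(1) by (intro retr_tops[OF y]) (auto simp: isker_def)
		show "(%(t, y). fproj (st2 t y)) (1, y) = (u' \<circ> v') (fproj y)"
			using v'(2)[OF y] vv_eq[OF y b(1)] u'(2)[OF rt] b(2) by (simp add: uuq_def)
	next
		fix t :: real and y z assume "y \<in> topspace Y" "z \<in> topspace Y" "fproj y = fproj z"
		then show "(%(t, y). fproj (st2 t y)) (t, y) = (%(t, y). fproj (st2 t y)) (t, z)" using compat2[of y z t] by simp
	qed simp_all
	show "homotopic_with (%_. True) SL SL (v' \<circ> u') id
		& homotopic_with (%_. True) FS FS (u' \<circ> v') id"
		using homotopic_with_symD[OF A] homotopic_with_symD[OF homotopic_with_trans[OF B1 B2]] by simp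
qed

end

section \<open>Dimensions\<close>

text \<open>The variable of the series has cohomological degree 2, and after the shifts
  \<open>j\<close> may be negative.\<close>

definition coeff_at :: "nat fps => int => nat" where
	"coeff_at F j = (if even j & 0 <= j then fps_nth F (nat (j div 2)) else 0)"

lemma coeff_at_shift: "coeff_at (XX ^ p * F) j = coeff_at F (j - 2 * int p)"
proof (cases "even j")
	case True
	then obtain i where j: "j = 2 * i" by blast
	have e: "coeff_at G (2 * i') = (if 0 <= i' then fps_nth G (nat i') else 0)" for G i'
		by (simp add: coeff_at_def)
	have "j - 2 * int p = 2 * (i - int p)" using j by simp
	then show ?thesis
		unfolding j by (simp only: e fps_X_power_mult_nth) (auto simp: nat_diff_distrib)
next
	case False
	then show ?thesis by (simp add: coeff_at_def)
qed

lemma coeff_at_add: "coeff_at (F + G) j = coeff_at F j + coeff_at G j"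
	by (simp add: coeff_at_def)

lemma has_dim_rep_stack:
	assumes "fin_digraph Q"
	shows "has_dim (singular_cohomology (rep_stack Q dm) j) (coeff_at (\<Prod>i\<in>verts Q. W (dm i)) j)"
proof -
	interpret schubert Q dm by (rule schubert.intro) (rule assms)
	consider "j < 0" | "odd j" | c where "j = 2 * int c" "even j" "0 <= j"
	proof -
		have "j = 2 * int (nat (j div 2))" if "even j" "0 <= j" using that by simp
		then show thesis using that not_le by blast
	qed
	then show ?thesis
	proof cases
		case 1 then show ?thesis using has_dim_cohomology_neg[OF 1] by (simp add: coeff_at_def)
	next
		case 2 then show ?thesis using has_dim_odd by (simp add: coeff_at_def)
	next
		case 3 then show ?thesis using has_dim_even[of c] by (simp add: coeff_at_def card_indices)
	qed
qed

text \<open>Covers framings whose rank exceeds the dimension at the vertex 0 or 1.\<close>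

lemma has_dim_empty:
	assumes "topspace X = {}"
	shows "has_dim (singular_cohomology X n) 0"
proof -
	have ns: "\<not> singular_simplex p X sg" for p sg
	proof
		assume s: "singular_simplex p X sg"
		have "(%i. if i = 0 then 1 else 0) \<in> standard_simplex p" using basis_in_standard_simplex[of 0 p] by (simp add: eq_commute)
		moreover have "sg \<in> standard_simplex p \<rightarrow> topspace X"
			using s by (auto simp: singular_simplex_def continuous_map_def)
		ultimately show False using assms by (metis PiE empty_iff)
	qed
	then have "carrier (cochain_space X n) = {%sg. 0}" by (auto simp: cochain_space_def)
	then have "zcyc X n <= {%sg. 0}" unfolding zcyc_def by blast
	moreover have "(%sg. 0) \<in> zcyc X n" using fun_subspace_zcyc[of X n] by (simp add: fun_subspace_def)
	ultimately have "zcyc X n = {%sg. 0}" by (intro equalityI) simp_all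
	then have "carrier (singular_cohomology X n) = {cls (zbd X n) (%sg. 0)}"
		by (simp add: cohomology_simps)
	then have "coords (singular_cohomology X n) 0 (%_ _. undefined)"
		unfolding coords_def bij_betw_def by (simp add: restrict_def)
	then show ?thesis unfolding has_dim_def by blast
qed

lemma lin_map:
	fixes V :: "(rat, 'm) module" and V' :: "(rat, 'n) module"
	assumes "lmap V V' f"
	shows "vsp V" "vsp V'"
		"x \<in> carrier V ==> f x \<in> carrier V'"
		"x \<in> carrier V ==> y \<in> carrier V ==> f (x \<oplus>\<^bsub>V\<^esub> y) = f x \<oplus>\<^bsub>V'\<^esub> f y"
		"x \<in> carrier V ==> f (c \<odot>\<^bsub>V\<^esub> x) = c \<odot>\<^bsub>V'\<^esub> f x"
proof -
	from assms have m: "vsp V" "vsp V'" "mod_hom class_ring V V' f"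
		by (auto simp: linear_map_def)
	then show "vsp V" "vsp V'" by auto
	interpret mod_hom class_ring V V' f by (rule m(3))
	show "x \<in> carrier V ==> f x \<in> carrier V'" by (rule f_im)
	show "x \<in> carrier V ==> y \<in> carrier V ==> f (x \<oplus>\<^bsub>V\<^esub> y) = f x \<oplus>\<^bsub>V'\<^esub> f y" by (rule f_add)
	show "x \<in> carrier V ==> f (c \<odot>\<^bsub>V\<^esub> x) = c \<odot>\<^bsub>V'\<^esub> f x" by (rule f_smult) (simp add: class_ring_simps)
qed

lemma has_dim_transfer:
	fixes V :: "(rat, 'm) module" and V' :: "(rat, 'n) module"
	assumes l: "lmap V' V f" and b: "bij_betw f (carrier V') (carrier V)" and d: "has_dim V N"
	shows "has_dim V' N"
proof -
	obtain g where g: "coords V N g" using d by (auto simp: has_dim_def)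
	note L = lin_map[OF l]
	have "coords V' N (%x. g (f x))"
		unfolding coords_def
	proof (intro conjI ballI allI)
		show "bij_betw (%x. g (f x)) (carrier V') ({..<N} \<rightarrow>\<^sub>E UNIV)"
			using bij_betw_trans[OF b, of g] g by (simp add: coords_def o_def)
	qed (use g L(3-5) in \<open>simp_all add: coords_def\<close>)
	then show ?thesis by (auto simp: has_dim_def)
qed

context framed
begin

lemma fin_Q: "fin_digraph Q" by (rule fin_digraph_axioms)

lemma euler_QT: "euler_form QT d d = euler_form Q d d - 2 * int (d v0) * int (d v1)"
proof -
	have "arcs QT = Orig ` arcs Q Un {Arrow_c, Arrow_d}" by (simp add: add_two_cycle_def)
	moreover have "finite (Orig ` arcs Q)" "Orig ` arcs Q Int {Arrow_c, Arrow_d} = {}" by auto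
	moreover have "inj_on Orig (arcs Q)" by (simp add: inj_on_def)
	ultimately show ?thesis
		by (simp add: euler_form_def sum.union_disjoint sum.reindex)
qed

lemma sum_verts: "(\<Sum>i\<in>verts Q. F i) = F v0 + F v1 + (\<Sum>i\<in>verts Q - {v0, v1}. F i)" for F :: "'v => int"
proof -
	have "(\<Sum>i\<in>verts Q. F i) = F v0 + (\<Sum>i\<in>verts Q - {v0}. F i)" by (rule sum.remove[OF finite_verts v(1)])
	also have "(\<Sum>i\<in>verts Q - {v0}. F i) = F v1 + (\<Sum>i\<in>verts Q - {v0} - {v1}. F i)"
		by (rule sum.remove) (use v in auto)
	finally show ?thesis by (simp add: Diff_insert2[symmetric] insert_commute)
qed

lemma prod_verts: "(\<Prod>i\<in>verts Q. F i) = F v0 * F v1 * (\<Prod>i\<in>verts Q - {v0, v1}. F i)" for F :: "'v => nat fps"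
proof -
	have "(\<Prod>i\<in>verts Q. F i) = F v0 * (\<Prod>i\<in>verts Q - {v0}. F i)" by (rule prod.remove[OF finite_verts v(1)])
	also have "(\<Prod>i\<in>verts Q - {v0}. F i) = F v1 * (\<Prod>i\<in>verts Q - {v0} - {v1}. F i)"
		by (rule prod.remove) (use v in auto)
	finally show ?thesis by (simp add: Diff_insert2[symmetric] insert_commute mult.assoc)
qed

end

context framed_shift
begin

text \<open>The arrows derived from \<open>a\<close> contribute the terms of the expanded product of
  the values of \<open>dl\<close> at its two ends. At the vertices 0 and 1, the squares and the
  two-cycle combine to the square of the difference of the dimensions, which adding k to both leaves
  unchanged; the new vertex contributes k^2.\<close>

lemma euler_QL: "euler_form QL ldim ldim = euler_form QT dl dl + (int k)\<^sup>2"
proof -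
	define H where "H a = (if head Q a \<in> {v0, v1} then int k else 0)" for a
	define T where "T a = (if tail Q a \<in> {v0, v1} then int k else 0)" for a
	have A: "arcs QL = ({Arrow_alpha, Arrow_beta} Un Plain ` arcs Q) Un (From_square ` {a \<in> arcs Q. tail Q a \<in> {v0, v1}}
				Un (To_square ` {a \<in> arcs Q. head Q a \<in> {v0, v1}}
				Un Loop_square ` {a \<in> arcs Q. tail Q a \<in> {v0, v1} & head Q a \<in> {v0, v1}}))"
		by (auto simp: linked_quiver_def)
	have s: "(\<Sum>a\<in>{a \<in> arcs Q. P a}. F a) = (\<Sum>a\<in>arcs Q. if P a then F a else 0)" for P and F :: "'a => int"
		by (rule sum.inter_filter) simp
	have ht: "head QL Arrow_alpha = Some v1" "tail QL Arrow_alpha = Some v0" "head QL Arrow_beta = Some v0" "tail QL Arrow_beta = Some v1"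
		"head QL (Plain a) = Some (head Q a)" "tail QL (Plain a) = Some (tail Q a)"
		"head QL (From_square a) = Some (head Q a)" "tail QL (From_square a) = None"
		"head QL (To_square a) = None" "tail QL (To_square a) = Some (tail Q a)"
		"head QL (Loop_square a) = None" "tail QL (Loop_square a) = None" for a
		by (simp_all add: linked_quiver_def)
	have "(\<Sum>a\<in>arcs QL. int (ldim (head QL a)) * int (ldim (tail QL a)))
		= (2 * int (dm v0) * int (dm v1) + (\<Sum>a\<in>arcs Q. int (dm (head Q a)) * int (dm (tail Q a))))
			+ ((\<Sum>a\<in>arcs Q. int (dm (head Q a)) * T a) + ((\<Sum>a\<in>arcs Q. H a * int (dm (tail Q a))) + (\<Sum>a\<in>arcs Q. H a * T a)))"
	proof -
		let ?F = "%a. int (ldim (head QL a)) * int (ldim (tail QL a))"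
		have 1: "sum ?F {Arrow_alpha, Arrow_beta} = 2 * int (dm v0) * int (dm v1)" by (simp add: ht)
		have 2: "sum ?F (Plain ` arcs Q) = (\<Sum>a\<in>arcs Q. int (dm (head Q a)) * int (dm (tail Q a)))"
			by (subst sum.reindex) (simp_all add: inj_on_def ht)
		have 3: "sum ?F (From_square ` {a \<in> arcs Q. tail Q a \<in> {v0, v1}}) = (\<Sum>a\<in>arcs Q. int (dm (head Q a)) * T a)"
			by (subst sum.reindex) (simp_all add: inj_on_def ht s T_def if_distrib[of "%x. _ * x"] cong: if_cong)
		have 4: "sum ?F (To_square ` {a \<in> arcs Q. head Q a \<in> {v0, v1}}) = (\<Sum>a\<in>arcs Q. H a * int (dm (tail Q a)))"
			by (subst sum.reindex) (simp_all add: inj_on_def ht s H_def if_distrib[of "%x. x * _"] cong: if_cong)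
		have 5: "sum ?F (Loop_square ` {a \<in> arcs Q. tail Q a \<in> {v0, v1} & head Q a \<in> {v0, v1}}) = (\<Sum>a\<in>arcs Q. H a * T a)"
		proof -
			have "sum ?F (Loop_square ` {a \<in> arcs Q. tail Q a \<in> {v0, v1} & head Q a \<in> {v0, v1}})
				= (\<Sum>a\<in>{a \<in> arcs Q. tail Q a \<in> {v0, v1} & head Q a \<in> {v0, v1}}. int k * int k)"
				by (subst sum.reindex) (simp_all add: inj_on_def ht)
			also have "\<dots> = (\<Sum>a\<in>arcs Q. H a * T a)" unfolding s by (rule sum.cong) (auto simp: H_def T_def)
			finally show ?thesis .
		qed
		have "sum ?F (arcs QL) = sum ?F {Arrow_alpha, Arrow_beta} + sum ?F (Plain ` arcs Q)
			+ (sum ?F (From_square ` {a \<in> arcs Q. tail Q a \<in> {v0, v1}}) + (sum ?F (To_square ` {a \<in> arcs Q. head Q a \<in> {v0, v1}})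
			+ sum ?F (Loop_square ` {a \<in> arcs Q. tail Q a \<in> {v0, v1} & head Q a \<in> {v0, v1}})))"
			unfolding A by (subst sum.union_disjoint; (simp; fail)?; (force; fail)?)+
		then show ?thesis unfolding 1 2 3 4 5 .
	qed
	also have "\<dots> = 2 * int (dm v0) * int (dm v1) + (\<Sum>a\<in>arcs Q. (int (dm (head Q a)) + H a) * (int (dm (tail Q a)) + T a))"
		by (simp add: distrib_left distrib_right sum.distrib)
	also have "(\<Sum>a\<in>arcs Q. (int (dm (head Q a)) + H a) * (int (dm (tail Q a)) + T a)) = (\<Sum>a\<in>arcs Q. int (dl (head Q a)) * int (dl (tail Q a)))"
		by (rule sum.cong) (auto simp: dl kk_def H_def T_def)
	finally have arcs: "(\<Sum>a\<in>arcs QL. int (ldim (head QL a)) * int (ldim (tail QL a)))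
		= 2 * int (dm v0) * int (dm v1) + (\<Sum>a\<in>arcs Q. int (dl (head Q a)) * int (dl (tail Q a)))" .
	have r: "(\<Sum>i\<in>verts Q - {v0, v1}. int (dl i) * int (dl i)) = (\<Sum>i\<in>verts Q - {v0, v1}. int (dm i) * int (dm i))"
		by (rule sum.cong) (auto simp: dl kk_def)
	have verts: "(\<Sum>i\<in>verts QL. int (ldim i) * int (ldim i)) = int k * int k + (\<Sum>i\<in>verts Q. int (dm i) * int (dm i))"
		by (simp add: sum.reindex)
	have L: "euler_form QL ldim ldim = int k * int k + (int (dm v0) * int (dm v0) + int (dm v1) * int (dm v1)
				+ (\<Sum>i\<in>verts Q - {v0, v1}. int (dm i) * int (dm i)))
			- (2 * int (dm v0) * int (dm v1) + (\<Sum>a\<in>arcs Q. int (dl (head Q a)) * int (dl (tail Q a))))"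
		unfolding euler_form_def arcs verts by (subst sum_verts) simp
	have R: "euler_form Q dl dl = int (dl v0) * int (dl v0) + int (dl v1) * int (dl v1)
				+ (\<Sum>i\<in>verts Q - {v0, v1}. int (dm i) * int (dm i)) - (\<Sum>a\<in>arcs Q. int (dl (head Q a)) * int (dl (tail Q a)))"
		unfolding euler_form_def by (subst sum_verts) (simp only: r)
	have dv: "int (dl v0) = int (dm v0) + int k" "int (dl v1) = int (dm v1) + int k" by (simp_all add: dl)
	show ?thesis
		unfolding euler_QT L R dv by (simp add: algebra_simps power2_eq_square)
qed

lemma has_dim_framed_shift:
	"has_dim (framed_coha Q v0 v1 k dl n)
		(coeff_at (W k * (W (dm v0) * W (dm v1)) * (\<Prod>i\<in>verts Q - {v0, v1}. W (dl i))) (n - euler_form QT dl dl - (int k)\<^sup>2))"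
proof -
	obtain h where h: "homotopy_equivalence SL FS h"
		using ex_hequiv by blast
	then have c: "continuous_map SL FS h" by (simp add: homotopy_equivalence_def)
	have "(\<Prod>i\<in>verts QL. W (ldim i)) = W k * (\<Prod>i\<in>verts Q. W (dm i))"
		by (simp add: prod.reindex)
	also have "\<dots> = W k * (W (dm v0) * W (dm v1)) * (\<Prod>i\<in>verts Q - {v0, v1}. W (dm i))"
		by (simp only: prod_verts mult.assoc)
	also have "(\<Prod>i\<in>verts Q - {v0, v1}. W (dm i)) = (\<Prod>i\<in>verts Q - {v0, v1}. W (dl i))"
		by (rule prod.cong) (auto simp: dl kk_def)
	finally have P: "(\<Prod>i\<in>verts QL. W (ldim i)) = W k * (W (dm v0) * W (dm v1)) * (\<Prod>i\<in>verts Q - {v0, v1}. W (dl i))" .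
	show ?thesis
		unfolding framed_coha_def
		by (rule has_dim_transfer[OF lin_cohomology_pullback[OF c] bij_betw_cohomology_pullback[OF h]
					has_dim_rep_stack[OF fin_digraph_QL, of ldim, unfolded P]])
qed

end

text \<open>The intended dimension of the image of the map that leaves the \<open>k\<close>-th term,
  which for \<open>k = 0\<close> is the whole resolved space. Here \<open>n\<close> labels a
  diagonal: its \<open>k\<close>-th term sits in degree n + k.\<close>

definition res_dim :: "('v, 'a) pre_digraph => 'v => 'v => ('v => nat) => int => nat => nat" where
	"res_dim Q v0 v1 d n k = coeff_at (RR (d v0) (d v1) k * (\<Prod>i\<in>verts Q - {v0, v1}. W (d i)))
		(n - euler_form (add_two_cycle v0 v1 Q) d d)"

lemma framed_dim_exceeds:
	assumes "framed Q v0 v1" "\<not> (k <= d v0 & k <= d v1)"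
	shows "topspace (framed_stack Q v0 v1 k d) = {}"
proof -
	interpret framed Q v0 v1 k d by fact
	have "topspace Y = {}"
	proof (rule ccontr)
		assume "topspace Y ~= {}"
		then obtain x where "x \<in> topspace Y" by blast
		then have "mat_surj k (d v0) (ff x)" "mat_surj k (d v1) (ff x * rp x Arrow_d)" using tops_YD(8,9) by blast+
		then show False using assms(2) surj_le by blast
	qed
	then show ?thesis using quot_map_framed by (auto simp: quotient_map_def)
qed

text \<open>In degree n + k the shift by k^2 leaves k - k^2, which is minus twice the exponent in
  \<open>VV\<close>. If \<open>k\<close> exceeds a dimension at 0 or 1, both \<open>VV\<close> and
  the cohomology vanish.\<close>

lemma has_dim_framed:
	assumes Q: "framed Q v0 v1"
	shows "has_dim (framed_coha Q v0 v1 k d (n + int k)) (res_dim Q v0 v1 d n k + res_dim Q v0 v1 d n (Suc k))"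
proof -
	interpret F: framed Q v0 v1 k d by fact
	let ?R = "\<Prod>i\<in>verts Q - {v0, v1}. W (d i)"
	let ?s = "n - euler_form (add_two_cycle v0 v1 Q) d d"
	have V: "res_dim Q v0 v1 d n k + res_dim Q v0 v1 d n (Suc k) = coeff_at (VV (d v0) (d v1) k * ?R) ?s"
		unfolding res_dim_def VV_RR by (simp only: distrib_right coeff_at_add)
	show ?thesis
	proof (cases "k <= d v0 & k <= d v1")
		case False
		have "VV (d v0) (d v1) k = 0" unfolding VV_def if_not_P[OF False] ..
		then have "res_dim Q v0 v1 d n k + res_dim Q v0 v1 d n (Suc k) = 0" unfolding V by (simp add: coeff_at_def)
		then show ?thesis unfolding framed_coha_def using has_dim_empty[OF framed_dim_exceeds[where k = k, OF Q False]] by simp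
	next
		case True
		\<comment> \<open>The truncated subtraction is exact by \<open>True\<close>, so shifting back
		  recovers \<open>d\<close>.\<close>
		define dm where "dm i = d i - F.kk i" for i
		have d: "shift_dim v0 v1 k dm = d" using True F.v by (auto simp: shift_dim_def dm_def F.kk_def fun_eq_iff)
		interpret S: framed_shift Q v0 v1 k dm by unfold_locales
		have k2: "k * (k - 1) div 2 + k * (k - 1) div 2 + k = k * k" 
		proof -
			have "even (k * (k - 1))" by (cases "even k") auto
			then have "k * (k - 1) div 2 + k * (k - 1) div 2 = k * (k - 1)" by presburger
			moreover have "k * (k - 1) + k = k * k" by (cases k) auto
			ultimately show ?thesis by simp
		qed
		have "int (k * (k - 1) div 2 + k * (k - 1) div 2 + k) = int (k * k)" by (simp only: k2)
		then have e: "n + int k - euler_form (add_two_cycle v0 v1 Q) d d - (int k)\<^sup>2 = ?s - 2 * int (k * (k - 1) div 2)"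
			by (simp add: power2_eq_square)
		have "VV (d v0) (d v1) k * ?R = XX ^ (k * (k - 1) div 2) * (W k * (W (dm v0) * W (dm v1)) * ?R)"
			unfolding VV_def if_P[OF True] by (simp add: dm_def mult.assoc)
		then have "coeff_at (VV (d v0) (d v1) k * ?R) ?s = coeff_at (W k * (W (dm v0) * W (dm v1)) * ?R) (?s - 2 * int (k * (k - 1) div 2))"
			by (simp only: coeff_at_shift)
		then show ?thesis unfolding V using S.has_dim_framed_shift[of "n + int k"] unfolding d e by simp
	qed
qed

lemma has_dim_coha:
	assumes Q: "framed Q v0 v1"
	shows "has_dim (coha Q d n) (res_dim Q v0 v1 d n 0)"
proof -
	interpret F: framed Q v0 v1 0 d by fact
	have e: "n - euler_form Q d d = n - euler_form (add_two_cycle v0 v1 Q) d d - 2 * int (d v0 * d v1)"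
		unfolding F.euler_QT by simp
	show ?thesis
		unfolding coha_def res_dim_def RR_0 mult.assoc coeff_at_shift e
		using has_dim_rep_stack[OF F.fin_Q, of d] by (simp only: F.prod_verts mult.assoc)
qed

section \<open>Exact sequences from dimensions\<close>

lemma coordsD:
	assumes "coords V N g"
	shows "x \<in> carrier V ==> y \<in> carrier V ==> (!!i. i < N ==> g x i = g y i) ==> x = y"
		"EX x:carrier V. ALL i<N. g x i = u i"
		"x \<in> carrier V ==> y \<in> carrier V ==> i < N ==> g (x \<oplus>\<^bsub>V\<^esub> y) i = g x i + g y i"
		"x \<in> carrier V ==> i < N ==> g (c \<odot>\<^bsub>V\<^esub> x) i = c * g x i"
proof -
	have b: "bij_betw g (carrier V) ({..<N} \<rightarrow>\<^sub>E UNIV)" using assms by (simp add: coords_def)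
	show "x \<in> carrier V ==> y \<in> carrier V ==> (!!i. i < N ==> g x i = g y i) ==> x = y"
	proof -
		assume x: "x \<in> carrier V" "y \<in> carrier V" and e: "!!i. i < N ==> g x i = g y i"
		have "g x \<in> {..<N} \<rightarrow>\<^sub>E UNIV" "g y \<in> {..<N} \<rightarrow>\<^sub>E UNIV" using b x by (auto dest: bij_betwE)
		then have "g x = g y" using e by (intro PiE_ext[of "g x" "{..<N}" "%_. UNIV" "g y"]) auto
		then show "x = y" using b x by (auto simp: bij_betw_def inj_on_def)
	qed
	have "(\<lambda>i\<in>{..<N}. u i) \<in> g ` carrier V" using b by (auto simp: bij_betw_def)
	then obtain x where "x \<in> carrier V" "g x = (\<lambda>i\<in>{..<N}. u i)" by force
	then show "EX x:carrier V. ALL i<N. g x i = u i" by (intro bexI[of _ x]) auto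
qed (use assms in \<open>auto simp: coords_def\<close>)

context
	fixes V :: "(rat, 'm) module"
	assumes V: "vsp V"
begin

interpretation vectorspace class_ring V by (rule V)

lemma vs_laws: "\<zero>\<^bsub>V\<^esub> \<in> carrier V"
		"x \<in> carrier V ==> y \<in> carrier V ==> x \<oplus>\<^bsub>V\<^esub> y \<in> carrier V"
		"x \<in> carrier V ==> y \<in> carrier V ==> x \<oplus>\<^bsub>V\<^esub> y = y \<oplus>\<^bsub>V\<^esub> x"
		"x \<in> carrier V ==> y \<in> carrier V ==> z \<in> carrier V ==> x \<oplus>\<^bsub>V\<^esub> y \<oplus>\<^bsub>V\<^esub> z = x \<oplus>\<^bsub>V\<^esub> (y \<oplus>\<^bsub>V\<^esub> z)"
		"x \<in> carrier V ==> \<zero>\<^bsub>V\<^esub> \<oplus>\<^bsub>V\<^esub> x = x" "x \<in> carrier V ==> x \<oplus>\<^bsub>V\<^esub> \<zero>\<^bsub>V\<^esub> = x"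
		"x \<in> carrier V ==> c \<odot>\<^bsub>V\<^esub> x \<in> carrier V" "c \<odot>\<^bsub>V\<^esub> \<zero>\<^bsub>V\<^esub> = \<zero>\<^bsub>V\<^esub>"
		"x \<in> carrier V ==> (c + c') \<odot>\<^bsub>V\<^esub> x = c \<odot>\<^bsub>V\<^esub> x \<oplus>\<^bsub>V\<^esub> c' \<odot>\<^bsub>V\<^esub> x"
		"x \<in> carrier V ==> y \<in> carrier V ==> c \<odot>\<^bsub>V\<^esub> (x \<oplus>\<^bsub>V\<^esub> y) = c \<odot>\<^bsub>V\<^esub> x \<oplus>\<^bsub>V\<^esub> c \<odot>\<^bsub>V\<^esub> y"
		"x \<in> carrier V ==> (c * c') \<odot>\<^bsub>V\<^esub> x = c \<odot>\<^bsub>V\<^esub> (c' \<odot>\<^bsub>V\<^esub> x)" "x \<in> carrier V ==> 1 \<odot>\<^bsub>V\<^esub> x = x"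
		"x \<in> carrier V ==> 0 \<odot>\<^bsub>V\<^esub> x = \<zero>\<^bsub>V\<^esub>" "x \<in> carrier V ==> (- 1) \<odot>\<^bsub>V\<^esub> x \<oplus>\<^bsub>V\<^esub> x = \<zero>\<^bsub>V\<^esub>"
proof -
	have K: "c \<in> carrier class_ring" for c :: rat by (simp add: class_ring_simps)
	note l = smult_l_distr[OF K K, unfolded class_ring_simps] and n = smult_l_null[unfolded class_ring_simps]
		and o = smult_one[unfolded class_ring_simps]
	show "x \<in> carrier V ==> (c + c') \<odot>\<^bsub>V\<^esub> x = c \<odot>\<^bsub>V\<^esub> x \<oplus>\<^bsub>V\<^esub> c' \<odot>\<^bsub>V\<^esub> x"
		"x \<in> carrier V ==> 1 \<odot>\<^bsub>V\<^esub> x = x" "x \<in> carrier V ==> 0 \<odot>\<^bsub>V\<^esub> x = \<zero>\<^bsub>V\<^esub>"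
		"x \<in> carrier V ==> (- 1) \<odot>\<^bsub>V\<^esub> x \<oplus>\<^bsub>V\<^esub> x = \<zero>\<^bsub>V\<^esub>"
		using l[of x "- 1" 1] by (auto simp: l n o)
	show "x \<in> carrier V ==> (c * c') \<odot>\<^bsub>V\<^esub> x = c \<odot>\<^bsub>V\<^esub> (c' \<odot>\<^bsub>V\<^esub> x)"
		using smult_assoc1[OF K K] by (simp add: class_ring_simps)
qed (auto simp: class_ring_simps a_ac smult_r_null smult_r_distr)

end

lemma coords_zero:
	assumes V: "vsp V" and c: "coords V N g" and x: "x \<in> carrier V"
	shows "x = \<zero>\<^bsub>V\<^esub> \<longleftrightarrow> (ALL i<N. g x i = 0)"
proof -
	note z = vs_laws(1,5)[OF V]
	have "g \<zero>\<^bsub>V\<^esub> i = 0" if "i < N" for i using coordsD(3)[OF c z(1,1) that] z by simp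
	then show ?thesis using coordsD(1)[OF c x z(1)] by auto
qed

text \<open>A reindexing of coordinates, with zeros where \<open>P\<close> fails, is linear. The
  differentials and the augmentation are both of this kind.\<close>

lemma ex_coord_map:
	fixes V :: "(rat, 'm) module" and V' :: "(rat, 'n) module"
	assumes V: "vsp V" "coords V N g" and V': "vsp V'" "coords V' N' g'"
		and s: "!!i. i < N' ==> P i ==> s i < N"
	shows "EX f. lmap V V' f & (ALL x:carrier V. ALL i<N'. g' (f x) i = (if P i then g x (s i) else 0))"
proof -
	have "ALL x. EX y. y \<in> carrier V' & (ALL i<N'. g' y i = (if P i then g x (s i) else 0))"
	proof
		fix x show "EX y. y \<in> carrier V' & (ALL i<N'. g' y i = (if P i then g x (s i) else 0))"
			using coordsD(2)[OF V'(2), of "%i. if P i then g x (s i) else 0"] by blast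
	qed
	from choice[OF this] obtain f where "ALL x. f x \<in> carrier V' & (ALL i<N'. g' (f x) i = (if P i then g x (s i) else 0))" ..
	then have f: "!!x. f x \<in> carrier V'" "!!x i. i < N' ==> g' (f x) i = (if P i then g x (s i) else 0)"
		by blast+
	note L = vs_laws[OF V(1)] vs_laws[OF V'(1)]
	have "lmap V V' f"
	proof (rule lin_class_ringI[OF V(1) V'(1)])
		fix x y assume xy: "x \<in> carrier V" "y \<in> carrier V"
		show "f (x \<oplus>\<^bsub>V\<^esub> y) = f x \<oplus>\<^bsub>V'\<^esub> f y"
			by (rule coordsD(1)[OF V'(2)]) (use f xy s L in \<open>auto simp: coordsD(3)[OF V(2)] coordsD(3)[OF V'(2)]\<close>)
	next
		fix c x assume x: "x \<in> carrier V"
		show "f (c \<odot>\<^bsub>V\<^esub> x) = c \<odot>\<^bsub>V'\<^esub> f x"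
			by (rule coordsD(1)[OF V'(2)]) (use f x s L in \<open>auto simp: coordsD(4)[OF V(2)] coordsD(4)[OF V'(2)]\<close>)
	qed (rule f)
	then show ?thesis using f(2) by blast
qed

definition is_resolution :: "(nat => (rat, 'm) module) => (rat, 'n) module => (nat => 'm => 'm) => ('m => 'n) => bool" where
	"is_resolution V C d e \<longleftrightarrow> (ALL k. lmap (V (Suc k)) (V k) (d k)) & lmap (V 0) C e
		& e ` carrier (V 0) = carrier C & {x \<in> carrier (V 0). e x = \<zero>\<^bsub>C\<^esub>} = d 0 ` carrier (V 1)
		& (ALL k. {x \<in> carrier (V (Suc k)). d k x = \<zero>\<^bsub>V k\<^esub>} = d (Suc k) ` carrier (V (Suc (Suc k))))"

lemma is_resolutionD:
	assumes "is_resolution V C d e"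
	shows "lmap (V (Suc k)) (V k) (d k)" "lmap (V 0) C e"
		"e ` carrier (V 0) = carrier C" "{x \<in> carrier (V 0). e x = \<zero>\<^bsub>C\<^esub>} = d 0 ` carrier (V 1)"
		"{x \<in> carrier (V (Suc k)). d k x = \<zero>\<^bsub>V k\<^esub>} = d (Suc k) ` carrier (V (Suc (Suc k)))"
	using assms unfolding is_resolution_def by blast+

text \<open>Exactness is a matter of dimensions: if \<open>V k\<close> has dimension \<open>R k + R (k + 1)\<close>, the differential
	identifies the first block of coordinates with the second one of the next space.\<close>

lemma ex_resolution:
	fixes V :: "nat => (rat, 'm) module" and C :: "(rat, 'n) module"
	assumes V: "!!k. vsp (V k)" "!!k. has_dim (V k) (R k + R (Suc k))"
		and C: "vsp C" "has_dim C (R 0)"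
	shows "EX d e. is_resolution V C d e"
proof -
	obtain g where g: "!!k. coords (V k) (R k + R (Suc k)) (g k)" using V(2) unfolding has_dim_def by metis
	obtain gC where gC: "coords C (R 0) gC" using C(2) unfolding has_dim_def by metis
	have "EX d. lmap (V (Suc k)) (V k) d & (ALL x:carrier (V (Suc k)). ALL i<R k + R (Suc k).
			g k (d x) i = (if \<not> i < R k then g (Suc k) x (i - R k) else 0))" for k
		by (rule ex_coord_map[OF V(1) g V(1) g]) auto
	then obtain d where d: "!!k. lmap (V (Suc k)) (V k) (d k)"
		"!!k x i. x \<in> carrier (V (Suc k)) ==> i < R k + R (Suc k) ==> g k (d k x) i = (if \<not> i < R k then g (Suc k) x (i - R k) else 0)"
		by metis
	obtain e where e: "lmap (V 0) C e" "!!x i. x \<in> carrier (V 0) ==> i < R 0 ==> gC (e x) i = g 0 x i"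
		using ex_coord_map[OF V(1)[of 0] g[of 0] C(1) gC, where P = "%_. True" and s = "%i. i"] by auto
	\<comment> \<open>Images and kernels are both described by the vanishing of the first block of
	  coordinates, which is why they coincide.\<close>
	have im: "d k ` carrier (V (Suc k)) = {x \<in> carrier (V k). ALL i<R k. g k x i = 0}" for k
	proof (intro equalityI subsetI)
		fix y assume "y \<in> d k ` carrier (V (Suc k))"
		then obtain x where x: "x \<in> carrier (V (Suc k))" "y = d k x" by blast
		then show "y \<in> {x \<in> carrier (V k). ALL i<R k. g k x i = 0}" using d(2)[OF x(1)] lin_map(3)[OF d(1) x(1)] by auto
	next
		fix y assume y: "y \<in> {x \<in> carrier (V k). ALL i<R k. g k x i = 0}"
		obtain x where x: "x \<in> carrier (V (Suc k))" "ALL i<R (Suc k) + R (Suc (Suc k)). g (Suc k) x i = g k y (i + R k)"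
			using coordsD(2)[OF g[of "Suc k"], of "%i. g k y (i + R k)"] by blast
		have "y = d k x"
			by (rule coordsD(1)[OF g[of k]]) (use y x d(2)[OF x(1)] lin_map(3)[OF d(1) x(1)] in auto)
		then show "y \<in> d k ` carrier (V (Suc k))" using x(1) by blast
	qed
	have ker: "d k x = \<zero>\<^bsub>V k\<^esub> \<longleftrightarrow> (ALL i<R (Suc k). g (Suc k) x i = 0)" if x: "x \<in> carrier (V (Suc k))" for k x
	proof -
		have "d k x = \<zero>\<^bsub>V k\<^esub> \<longleftrightarrow> (ALL i<R k + R (Suc k). (if \<not> i < R k then g (Suc k) x (i - R k) else 0) = 0)"
			using coords_zero[OF V(1) g lin_map(3)[OF d(1) x]] d(2)[OF x] by simp
		also have "\<dots> \<longleftrightarrow> (ALL i<R (Suc k). g (Suc k) x i = 0)"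
		proof
			assume *: "ALL i<R k + R (Suc k). (if \<not> i < R k then g (Suc k) x (i - R k) else 0) = 0"
			show "ALL i<R (Suc k). g (Suc k) x i = 0"
			proof (intro allI impI)
				fix i assume "i < R (Suc k)"
				then show "g (Suc k) x i = 0" using *[rule_format, of "i + R k"] by simp
			qed
		qed auto
		finally show ?thesis .
	qed
	have kere: "e x = \<zero>\<^bsub>C\<^esub> \<longleftrightarrow> (ALL i<R 0. g 0 x i = 0)" if x: "x \<in> carrier (V 0)" for x
		using coords_zero[OF C(1) gC lin_map(3)[OF e(1) x]] e(2)[OF x] by simp
	have sur: "e ` carrier (V 0) = carrier C"
	proof (intro equalityI subsetI)
		fix y assume y: "y \<in> carrier C"
		obtain x where x: "x \<in> carrier (V 0)" "ALL i<R 0 + R (Suc 0). g 0 x i = gC y i" using coordsD(2)[OF g[of 0], of "gC y"] by blast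
		have "y = e x"
			by (rule coordsD(1)[OF gC]) (use y x e(2)[OF x(1)] lin_map(3)[OF e(1) x(1)] in auto)
		then show "y \<in> e ` carrier (V 0)" using x(1) by blast
	qed (use lin_map(3)[OF e(1)] in auto)
	show ?thesis
		unfolding is_resolution_def
	proof (intro exI[of _ d] exI[of _ e] conjI allI)
		show "{x \<in> carrier (V 0). e x = \<zero>\<^bsub>C\<^esub>} = d 0 ` carrier (V 1)" using im[of 0] kere by auto
		show "{x \<in> carrier (V (Suc k)). d k x = \<zero>\<^bsub>V k\<^esub>} = d (Suc k) ` carrier (V (Suc (Suc k)))" for k
			unfolding im using ker by auto
	qed (use d(1) e(1) sur in auto)
qed

lemma lin_zero:
	assumes "lmap (V :: (rat, 'm) module) (V' :: (rat, 'n) module) f"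
	shows "f \<zero>\<^bsub>V\<^esub> = \<zero>\<^bsub>V'\<^esub>"
	using lin_map(5)[OF assms, of "\<zero>\<^bsub>V\<^esub>" 0] lin_map(1-3)[OF assms] vs_laws
	by metis

section \<open>Direct sums of vector spaces\<close>

lemma dirsum_space_simps [simp]:
	"zero (dirsum I M) = (\<lambda>i\<in>I. \<zero>\<^bsub>M i\<^esub>)"
	"x \<oplus>\<^bsub>dirsum I M\<^esub> y = (\<lambda>i\<in>I. x i \<oplus>\<^bsub>M i\<^esub> y i)"
	"c \<odot>\<^bsub>dirsum I M\<^esub> x = (\<lambda>i\<in>I. c \<odot>\<^bsub>M i\<^esub> x i)"
	by (simp_all add: direct_sum_space_def)

lemma dirsum_c: "x \<in> carrier (dirsum I M) \<longleftrightarrow>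
		x \<in> extensional I & (ALL i:I. x i \<in> carrier (M i)) & finite {i \<in> I. x i ~= \<zero>\<^bsub>M i\<^esub>}"
	by (auto simp: direct_sum_space_def PiE_def)

lemma dirsum_cI:
	assumes "x \<in> extensional I" "!!i. i \<in> I ==> x i \<in> carrier (M i)" "finite F" "!!i. i \<in> I ==> i ~: F ==> x i = \<zero>\<^bsub>M i\<^esub>"
	shows "x \<in> carrier (dirsum I M)"
proof -
	have "{i \<in> I. x i ~= \<zero>\<^bsub>M i\<^esub>} <= F" using assms(4) by blast
	then show ?thesis using assms by (simp add: dirsum_c finite_subset)
qed

lemma dirsum_comp: "x \<in> carrier (dirsum I M) ==> i \<in> I ==> x i \<in> carrier (M i)"
	by (simp add: dirsum_c)

lemma vectorspace_dirsum:
	fixes M :: "'i => (rat, 'm) module"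
	assumes M: "!!i. i \<in> I ==> vsp (M i)"
	shows "vsp (dirsum I M)" (is "vsp ?D")
proof (rule vectorspace_class_ringI)
	note L = vs_laws[OF M]
	let ?s = "%x. {i \<in> I. x i ~= \<zero>\<^bsub>M i\<^esub>}"
	note c = dirsum_comp and e = fun_eq_iff extensional_def
	fix x y c assume x: "x \<in> carrier ?D" and y: "y \<in> carrier ?D"
	show "x \<oplus>\<^bsub>?D\<^esub> y \<in> carrier ?D"
		by (rule dirsum_cI[where F = "?s x Un ?s y"]) (use x y L(1,2,5) in \<open>auto simp: dirsum_c\<close>)
	show "x \<oplus>\<^bsub>?D\<^esub> y = y \<oplus>\<^bsub>?D\<^esub> x" using L(3) c[OF x] c[OF y] by (auto simp: e)
	show "c \<odot>\<^bsub>?D\<^esub> (x \<oplus>\<^bsub>?D\<^esub> y) = c \<odot>\<^bsub>?D\<^esub> x \<oplus>\<^bsub>?D\<^esub> c \<odot>\<^bsub>?D\<^esub> y"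
		using L(10) c[OF x] c[OF y] by (auto simp: e)
next
	note L = vs_laws[OF M]
	show "zero ?D \<in> carrier ?D" using L(1) by (simp add: dirsum_c)
next
	note L = vs_laws[OF M]
	fix x y z assume "x \<in> carrier ?D" "y \<in> carrier ?D" "z \<in> carrier ?D"
	then show "x \<oplus>\<^bsub>?D\<^esub> y \<oplus>\<^bsub>?D\<^esub> z = x \<oplus>\<^bsub>?D\<^esub> (y \<oplus>\<^bsub>?D\<^esub> z)" using L(4) by (auto simp: dirsum_c fun_eq_iff)
next
	note L = vs_laws[OF M]
	note e = dirsum_c fun_eq_iff extensional_def
	fix x c c' assume x: "x \<in> carrier ?D"
	then show "\<zero>\<^bsub>?D\<^esub> \<oplus>\<^bsub>?D\<^esub> x = x" "(- 1) \<odot>\<^bsub>?D\<^esub> x \<oplus>\<^bsub>?D\<^esub> x = \<zero>\<^bsub>?D\<^esub>" "1 \<odot>\<^bsub>?D\<^esub> x = x"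
		"(c + c') \<odot>\<^bsub>?D\<^esub> x = c \<odot>\<^bsub>?D\<^esub> x \<oplus>\<^bsub>?D\<^esub> c' \<odot>\<^bsub>?D\<^esub> x" "(c * c') \<odot>\<^bsub>?D\<^esub> x = c \<odot>\<^bsub>?D\<^esub> (c' \<odot>\<^bsub>?D\<^esub> x)"
		using L(5,9,11,12,14) by (auto simp: e)
	show "c \<odot>\<^bsub>?D\<^esub> x \<in> carrier ?D"
		by (rule dirsum_cI[where F = "{i \<in> I. x i ~= \<zero>\<^bsub>M i\<^esub>}"])
			(use x L(7,8) in \<open>auto simp: dirsum_c\<close>)
qed

text \<open>One pattern for three maps: \<open>t\<close> shifts the index k for the differential,
  selects k = 0 for the augmentation, and translates dimension vectors for the comparison with the
  linked quiver.\<close>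

definition dsum_map :: "'j set => ('j => 'i) => ('j => 'm => 'n) => ('i => 'm) => 'j => 'n" where
	"dsum_map J t p x = (\<lambda>j\<in>J. p j (x (t j)))"

lemma lin_dsum:
	fixes M :: "'i => (rat, 'm) module" and N :: "'j => (rat, 'n) module"
	assumes M: "!!i. i \<in> I ==> vsp (M i)" and N: "!!j. j \<in> J ==> vsp (N j)"
		and t: "inj_on t J" "t ` J <= I"
		and p: "!!j. j \<in> J ==> lmap (M (t j)) (N j) (p j)"
	shows "lmap (dirsum I M) (dirsum J N) (dsum_map J t p)"
proof (rule lin_class_ringI[OF vectorspace_dirsum[OF M] vectorspace_dirsum[OF N]])
	note L = lin_map[OF p]
	have tI: "t j \<in> I" if "j \<in> J" for j using t(2) that by blast
	fix x assume x: "x \<in> carrier (dirsum I M)"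
	show "dsum_map J t p x \<in> carrier (dirsum J N)"
	proof (rule dirsum_cI[where F = "{j \<in> J. x (t j) ~= \<zero>\<^bsub>M (t j)\<^esub>}"])
		have "t ` {j \<in> J. x (t j) ~= \<zero>\<^bsub>M (t j)\<^esub>} <= {i \<in> I. x i ~= \<zero>\<^bsub>M i\<^esub>}" using tI by auto
		moreover have "finite {i \<in> I. x i ~= \<zero>\<^bsub>M i\<^esub>}" using x by (simp add: dirsum_c)
		ultimately have "finite (t ` {j \<in> J. x (t j) ~= \<zero>\<^bsub>M (t j)\<^esub>})" by (rule finite_subset)
		then show "finite {j \<in> J. x (t j) ~= \<zero>\<^bsub>M (t j)\<^esub>}"
			by (rule finite_imageD) (rule inj_on_subset[OF t(1)], blast)
	qed (use L(3) x tI lin_zero[OF p] in \<open>auto simp: dsum_map_def dirsum_comp\<close>)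
	fix c
	show "dsum_map J t p (c \<odot>\<^bsub>dirsum I M\<^esub> x) = c \<odot>\<^bsub>dirsum J N\<^esub> dsum_map J t p x"
		using L(5) tI dirsum_comp[OF x] by (auto simp: dsum_map_def fun_eq_iff)
next
	note L = lin_map[OF p]
	have tI: "t j \<in> I" if "j \<in> J" for j using t(2) that by blast
	fix x y assume "x \<in> carrier (dirsum I M)" "y \<in> carrier (dirsum I M)"
	then show "dsum_map J t p (x \<oplus>\<^bsub>dirsum I M\<^esub> y) = dsum_map J t p x \<oplus>\<^bsub>dirsum J N\<^esub> dsum_map J t p y"
		using L(4) tI by (auto simp: dsum_map_def fun_eq_iff dirsum_comp)
qed

text \<open>\<open>t\<close> may miss part of \<open>I\<close>, but the summands missed are zero, so
  the direct sum loses nothing.\<close>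

lemma bij_betw_dsum:
	fixes M :: "'i => (rat, 'm) module" and N :: "'j => (rat, 'n) module"
	assumes M: "!!i. i \<in> I ==> vsp (M i)" and N: "!!j. j \<in> J ==> vsp (N j)"
		and t: "inj_on t J" "t ` J <= I"
		and p: "!!j. j \<in> J ==> lmap (M (t j)) (N j) (p j)"
		and b: "!!j. j \<in> J ==> bij_betw (p j) (carrier (M (t j))) (carrier (N j))"
		and z: "!!i. i \<in> I ==> i ~: t ` J ==> carrier (M i) = {\<zero>\<^bsub>M i\<^esub>}"
	shows "bij_betw (dsum_map J t p) (carrier (dirsum I M)) (carrier (dirsum J N))"
	unfolding bij_betw_def
proof
	have lin: "lmap (dirsum I M) (dirsum J N) (dsum_map J t p)"
		by (rule lin_dsum) (use M N t p in auto)
	have tI: "t j \<in> I" if "j \<in> J" for j using t(2) that by blast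
	show "inj_on (dsum_map J t p) (carrier (dirsum I M))"
	proof (rule inj_onI)
		fix x y assume xy: "x \<in> carrier (dirsum I M)" "y \<in> carrier (dirsum I M)"
			and e: "dsum_map J t p x = dsum_map J t p y"
		have "x i = y i" if i: "i \<in> I" for i
		proof (cases "i \<in> t ` J")
			case True
			then obtain j where j: "j \<in> J" "i = t j" by blast
			have "p j (x (t j)) = p j (y (t j))" using fun_cong[OF e, of j] j(1) by (simp add: dsum_map_def)
			then show ?thesis using b[OF j(1)] dirsum_comp[OF xy(1) tI[OF j(1)]] dirsum_comp[OF xy(2) tI[OF j(1)]] j(2)
				by (auto simp: bij_betw_def inj_on_def)
		next
			case False
			then show ?thesis using z[OF i False] dirsum_comp[OF xy(1) i] dirsum_comp[OF xy(2) i] by simp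
		qed
		then show "x = y" using xy by (intro extensionalityI[of x I y]) (auto simp: dirsum_c)
	qed
	show "dsum_map J t p ` carrier (dirsum I M) = carrier (dirsum J N)"
	proof (intro equalityI subsetI)
		fix y assume y: "y \<in> carrier (dirsum J N)"
		let ?inv = "%j. inv_into (carrier (M (t j))) (p j)"
		define x where "x = (\<lambda>i\<in>I. if i \<in> t ` J then ?inv (the_inv_into J t i) (y (the_inv_into J t i)) else \<zero>\<^bsub>M i\<^esub>)"
		have xt: "x (t j) = ?inv j (y j)" if "j \<in> J" for j
			using that tI[OF that] the_inv_into_f_f[OF t(1) that] by (simp add: x_def)
		have py: "p j (x (t j)) = y j" "x (t j) \<in> carrier (M (t j))" if j: "j \<in> J" for j
		proof -
			have "y j \<in> p j ` carrier (M (t j))" using b[OF j] dirsum_comp[OF y j] by (simp add: bij_betw_def)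
			then show "p j (x (t j)) = y j" "x (t j) \<in> carrier (M (t j))"
				unfolding xt[OF j] by (rule f_inv_into_f, rule inv_into_into)
		qed
		have "x \<in> carrier (dirsum I M)"
		proof (rule dirsum_cI[where F = "t ` {j \<in> J. y j ~= \<zero>\<^bsub>N j\<^esub>}"])
			show "finite (t ` {j \<in> J. y j ~= \<zero>\<^bsub>N j\<^esub>})" using y by (simp add: dirsum_c)
			fix i assume i: "i \<in> I"
			show "x i \<in> carrier (M i)"
			proof (cases "i \<in> t ` J")
				case True then show ?thesis using py(2) by auto
			next
				case False then show ?thesis using i z[OF i False] by (simp add: x_def)
			qed
			assume F: "i ~: t ` {j \<in> J. y j ~= \<zero>\<^bsub>N j\<^esub>}"
			show "x i = \<zero>\<^bsub>M i\<^esub>"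
			proof (cases "i \<in> t ` J")
				case True
				then obtain j where j: "j \<in> J" "i = t j" by blast
				then have yj: "y j = \<zero>\<^bsub>N j\<^esub>" using F by blast
				have "p j \<zero>\<^bsub>M i\<^esub> = p j (x i)" using py(1)[OF j(1)] lin_zero[OF p[OF j(1)]] yj j by simp
				moreover have "\<zero>\<^bsub>M i\<^esub> \<in> carrier (M i)"
					by (rule vs_laws(1)[OF M[OF i]])
				ultimately show ?thesis using b[OF j(1)] py(2)[OF j(1)] j(2) by (auto simp: bij_betw_def inj_on_def)
			next
				case False then show ?thesis using i by (simp add: x_def)
			qed
		qed (simp add: x_def)
		moreover have "dsum_map J t p x = y"
			using y py(1) by (intro extensionalityI[of _ J]) (auto simp: dsum_map_def dirsum_c)
		ultimately show "y \<in> dsum_map J t p ` carrier (dirsum I M)" by blast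
	next
		fix y assume "y \<in> dsum_map J t p ` carrier (dirsum I M)"
		then show "y \<in> carrier (dirsum J N)" using lin_map(3)[OF lin] by blast
	qed
qed

lemma lin_comp:
	fixes V :: "(rat, 'm) module" and V' :: "(rat, 'n) module" and V'' :: "(rat, 'l) module"
	assumes f: "lmap V V' f" and g: "lmap V' V'' g"
	shows "lmap V V'' (%x. g (f x))"
	by (rule lin_class_ringI)
		(use lin_map[OF f] lin_map[OF g] in auto)

lemma lin_inv:
	fixes V :: "(rat, 'm) module" and V' :: "(rat, 'n) module"
	assumes l: "lmap V V' f" and b: "bij_betw f (carrier V) (carrier V')"
	shows "lmap V' V (inv_into (carrier V) f)"
proof (rule lin_class_ringI)
	note L = lin_map[OF l]
	let ?i = "inv_into (carrier V) f"
	note V = vs_laws[OF L(1)]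
	have bi: "bij_betw ?i (carrier V') (carrier V)" by (rule bij_betw_inv_into[OF b])
	have fi: "f (?i y) = y" "?i y \<in> carrier V" if "y \<in> carrier V'" for y
		using bij_betw_inv_into_right[OF b that] bij_betwE[OF bi] that by auto
	show "vsp V'" "vsp V" by (rule L(2), rule L(1))
	show "?i x \<in> carrier V" if "x \<in> carrier V'" for x by (rule fi(2)[OF that])
	show "?i (x \<oplus>\<^bsub>V'\<^esub> y) = ?i x \<oplus>\<^bsub>V\<^esub> ?i y" if "x \<in> carrier V'" "y \<in> carrier V'" for x y
	proof -
		have m: "?i x \<oplus>\<^bsub>V\<^esub> ?i y \<in> carrier V" using fi that V(2) by auto
		show ?thesis using L(4)[of "?i x" "?i y"] fi that bij_betw_inv_into_left[OF b m] by simp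
	qed
	show "?i (c \<odot>\<^bsub>V'\<^esub> x) = c \<odot>\<^bsub>V\<^esub> ?i x" if "x \<in> carrier V'" for c x
	proof -
		have m: "c \<odot>\<^bsub>V\<^esub> ?i x \<in> carrier V" using fi that V(7) by auto
		show ?thesis using L(5)[of "?i x" c] fi that bij_betw_inv_into_left[OF b m] by simp
	qed
qed

lemma lin_minus:
	fixes V :: "(rat, 'm) module" and V' :: "(rat, 'n) module"
	assumes l: "lmap V V' f" and x: "x \<in> carrier V" and y: "y \<in> carrier V" and e: "f x = f y"
	shows "EX w:carrier V. f w = \<zero>\<^bsub>V'\<^esub> & x = w \<oplus>\<^bsub>V\<^esub> y"
proof -
	note L = lin_map[OF l]
	note V = vs_laws[OF L(1)] and V' = vs_laws[OF L(2)]
	let ?w = "x \<oplus>\<^bsub>V\<^esub> (- 1) \<odot>\<^bsub>V\<^esub> y"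
	have "f ?w = \<zero>\<^bsub>V'\<^esub>" using L(3-5) x y e V(7) V'(3,7,14) by simp
	moreover have "x = ?w \<oplus>\<^bsub>V\<^esub> y" using x y V by simp
	ultimately show ?thesis using x y V(2,7) by (intro bexI[of _ ?w]) auto
qed

text \<open>The target carries the zero differential, so that its homology consists of the cosets of \<open>0\<close>.\<close>

lemma quasi_isomorphismI:
	fixes C :: "int => (rat, 'm) module" and C' :: "int => (rat, 'n) module"
	assumes D: "!!n. lmap (C n) (C (n - 1)) (D n)"
		and q: "!!n. lmap (C n) (C' n) (q n)"
		and qD: "!!n x. x \<in> carrier (C n) ==> q (n - 1) (D n x) = \<zero>\<^bsub>C' (n - 1)\<^esub>"
		and ker: "!!n x. x \<in> carrier (C n) ==> D n x = \<zero>\<^bsub>C (n - 1)\<^esub> ==> q n x = \<zero>\<^bsub>C' n\<^esub> ==> x \<in> D (n + 1) ` carrier (C (n + 1))"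
		and sur: "!!n y. y \<in> carrier (C' n) ==> EX x:carrier (C n). D n x = \<zero>\<^bsub>C (n - 1)\<^esub> & q n x = y"
	shows "quasi_isomorphism class_ring (- 1) C D C' (%n _. \<zero>\<^bsub>C' (n - 1)\<^esub>) q"
	unfolding quasi_isomorphism_def
proof (intro allI conjI ballI q)
	fix n x assume "x \<in> carrier (C n)"
	then show "q (n + - 1) (D n x) = \<zero>\<^bsub>C' (n - 1)\<^esub>" using qD by simp
next
	fix n
	note L = lin_map[OF q[of n]] and LD = lin_map[OF D[of "n + 1"]]
	note V = vs_laws[OF L(1)] and V' = vs_laws[OF L(2)]
	let ?B = "complex_boundaries (- 1) C D n" and ?B' = "complex_boundaries (- 1) C' (%n _. \<zero>\<^bsub>C' (n - 1)\<^esub>) n"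
	let ?Z = "{x \<in> carrier (C n). D n x = \<zero>\<^bsub>C (n - 1)\<^esub>}"
	have B: "?B = D (n + 1) ` carrier (C (n + 1))" by (simp add: complex_boundaries_def)
	have ne: "carrier (C' (n + 1)) ~= {}" using vs_laws(1)[OF lin_map(2)[OF q]] by blast
	then have B': "?B' = {\<zero>\<^bsub>C' n\<^esub>}" by (simp add: complex_boundaries_def image_constant_conv)
	have Bc: "b \<in> carrier (C n)" "q n b = \<zero>\<^bsub>C' n\<^esub>" if "b \<in> ?B" for b
		using that LD(3) qD[of _ "n + 1"] by (auto simp: B)
	have B0: "\<zero>\<^bsub>C n\<^esub> \<in> ?B" unfolding B
		using lin_zero[OF D[of "n + 1"]] vs_laws(1)[OF LD(1)] by (metis add_diff_cancel_right' image_eqI)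
	have Badd: "b \<oplus>\<^bsub>C n\<^esub> b' \<in> ?B" if b: "b \<in> ?B" "b' \<in> ?B" for b b'
	proof -
		obtain u u' where u: "u \<in> carrier (C (n + 1))" "b = D (n + 1) u" "u' \<in> carrier (C (n + 1))" "b' = D (n + 1) u'"
			using b unfolding B by blast
		have "b \<oplus>\<^bsub>C n\<^esub> b' = D (n + 1) (u \<oplus>\<^bsub>C (n + 1)\<^esub> u')" using LD(4)[OF u(1,3)] u by simp
		then show ?thesis unfolding B using vs_laws(2)[OF LD(1) u(1,3)] by blast
	qed
	have cos: "?B +>\<^bsub>C n\<^esub> x = (%b. b \<oplus>\<^bsub>C n\<^esub> x) ` ?B" for x by (auto simp: a_r_coset_def')
	have cos': "?B' +>\<^bsub>C' n\<^esub> y = {y}" if "y \<in> carrier (C' n)" for y using that V'(5) by (auto simp: a_r_coset_def' B')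
	have H: "carrier (complex_homology (- 1) C D n) = (%x. ?B +>\<^bsub>C n\<^esub> x) ` ?Z"
		by (simp add: complex_homology_def subquotient_def)
	have H': "carrier (complex_homology (- 1) C' (%n _. \<zero>\<^bsub>C' (n - 1)\<^esub>) n) = (%y. {y}) ` carrier (C' n)"
		by (auto simp: complex_homology_def subquotient_def cos' image_iff)
	have ind: "induced_map (C' n) ?B' (q n) (?B +>\<^bsub>C n\<^esub> x) = {q n x}" if x: "x \<in> carrier (C n)" for x
	proof -
		have "q n (b \<oplus>\<^bsub>C n\<^esub> x) = q n x" if "b \<in> ?B" for b using L(4)[OF Bc(1)[OF that] x] Bc(2)[OF that] L(3)[OF x] V'(5) by simp
		then have "induced_map (C' n) ?B' (q n) (?B +>\<^bsub>C n\<^esub> x) = (\<Union>b\<in>?B. {q n x})"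
			unfolding induced_map_def cos using cos'[OF L(3)[OF x]] by simp
		then show ?thesis using B0 by auto
	qed
	\<comment> \<open>Two cycles with the same image differ by a cycle that \<open>q\<close> kills,
	  which is a boundary by \<open>ker\<close>; hence their cosets agree.\<close>
	have inj: "?B +>\<^bsub>C n\<^esub> x = ?B +>\<^bsub>C n\<^esub> y" if xy: "x \<in> ?Z" "y \<in> ?Z" and e: "q n x = q n y" for x y
	proof -
		have key: "?B +>\<^bsub>C n\<^esub> x <= ?B +>\<^bsub>C n\<^esub> y" if xy: "x \<in> ?Z" "y \<in> ?Z" and e: "q n x = q n y" for x y
		proof -
			obtain w where w: "w \<in> carrier (C n)" "q n w = \<zero>\<^bsub>C' n\<^esub>" "x = w \<oplus>\<^bsub>C n\<^esub> y"
				using lin_minus[OF q _ _ e] xy by auto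
			note LDn = lin_map[OF D[of n]]
			have "D n w = \<zero>\<^bsub>C (n - 1)\<^esub>" using LDn(4)[OF w(1), of y] xy w(3) vs_laws(6)[OF LDn(2) LDn(3)[OF w(1)]] by simp
			then have wB: "w \<in> ?B" unfolding B using ker w(1,2) by blast
			show ?thesis
			proof
				fix z assume "z \<in> ?B +>\<^bsub>C n\<^esub> x"
				then obtain b where b: "b \<in> ?B" "z = b \<oplus>\<^bsub>C n\<^esub> x" unfolding cos by blast
				have "z = (b \<oplus>\<^bsub>C n\<^esub> w) \<oplus>\<^bsub>C n\<^esub> y" using b w xy Bc(1)[OF b(1)] by (simp add: V(4))
				then show "z \<in> ?B +>\<^bsub>C n\<^esub> y" unfolding cos using Badd[OF b(1) wB] by blast
			qed
		qed
		show ?thesis using key[OF xy e] key[OF xy(2,1) e[symmetric]] by blast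
	qed
	show "bij_betw (induced_map (C' n) ?B' (q n)) (carrier (complex_homology (- 1) C D n))
			(carrier (complex_homology (- 1) C' (%n _. \<zero>\<^bsub>C' (n - 1)\<^esub>) n))"
		unfolding bij_betw_def H H'
	proof
		show "inj_on (induced_map (C' n) ?B' (q n)) ((%x. ?B +>\<^bsub>C n\<^esub> x) ` ?Z)"
		proof (rule inj_onI)
			fix S T assume "S \<in> (%x. ?B +>\<^bsub>C n\<^esub> x) ` ?Z" "T \<in> (%x. ?B +>\<^bsub>C n\<^esub> x) ` ?Z"
				and e: "induced_map (C' n) ?B' (q n) S = induced_map (C' n) ?B' (q n) T"
			then obtain x y where xy: "x \<in> ?Z" "y \<in> ?Z" "S = ?B +>\<^bsub>C n\<^esub> x" "T = ?B +>\<^bsub>C n\<^esub> y" by blast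
			then have "q n x = q n y" using e ind by simp
			then show "S = T" unfolding xy(3,4) by (rule inj[OF xy(1,2)])
		qed
		show "induced_map (C' n) ?B' (q n) ` ((%x. ?B +>\<^bsub>C n\<^esub> x) ` ?Z) = (%y. {y}) ` carrier (C' n)"
		proof (intro equalityI subsetI)
			fix S assume "S \<in> induced_map (C' n) ?B' (q n) ` ((%x. ?B +>\<^bsub>C n\<^esub> x) ` ?Z)"
			then obtain x where "x \<in> ?Z" "S = induced_map (C' n) ?B' (q n) (?B +>\<^bsub>C n\<^esub> x)" by blast
			then show "S \<in> (%y. {y}) ` carrier (C' n)" using ind L(3) by auto
		next
			fix S assume "S \<in> (%y. {y}) ` carrier (C' n)"
			then obtain y where y: "y \<in> carrier (C' n)" "S = {y}" by blast
			obtain x where x: "x \<in> carrier (C n)" "D n x = \<zero>\<^bsub>C (n - 1)\<^esub>" "q n x = y" using sur[OF y(1)] by blast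
			then have "S = induced_map (C' n) ?B' (q n) (?B +>\<^bsub>C n\<^esub> x)" using ind y by simp
			then show "S \<in> induced_map (C' n) ?B' (q n) ` ((%x. ?B +>\<^bsub>C n\<^esub> x) ` ?Z)" using x by blast
		qed
	qed
qed

section \<open>The total complex of a graded resolution\<close>

locale resolution =
	fixes S :: "'d set" and F :: "nat => 'd => int => (rat, 'm) module" and C :: "'d => int => (rat, 'n) module"
		and d :: "nat => 'd => int => 'm => 'm" and \<epsilon> :: "'d => int => 'm => 'n"
	assumes lin_d: "dm \<in> S ==> lmap (F (k + 1) dm n) (F k dm (n - 1)) (d k dm n)"
		and lin_\<epsilon>: "dm \<in> S ==> lmap (F 0 dm n) (C dm n) (\<epsilon> dm n)"
		and surj: "dm \<in> S ==> \<epsilon> dm n ` carrier (F 0 dm n) = carrier (C dm n)"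
		and exact0: "dm \<in> S ==> {x \<in> carrier (F 0 dm n). \<epsilon> dm n x = \<zero>\<^bsub>C dm n\<^esub>} = d 0 dm (n + 1) ` carrier (F 1 dm (n + 1))"
		and exact: "dm \<in> S ==> {x \<in> carrier (F (k + 1) dm n). d k dm n x = \<zero>\<^bsub>F k dm (n - 1)\<^esub>}
			= d (k + 1) dm (n + 1) ` carrier (F (k + 2) dm (n + 1))"
begin

abbreviation "I \<equiv> (UNIV :: nat set) \<times> S"
abbreviation "FF n \<equiv> %(k, dm). F k dm n"
abbreviation "T n \<equiv> dirsum I (FF n)"
abbreviation "CT n \<equiv> dirsum S (%dm. C dm n)"

definition dtot where "dtot n x = (\<lambda>(k, dm)\<in>I. d k dm n (x (k + 1, dm)))"
definition etot where "etot n x = (\<lambda>dm\<in>S. \<epsilon> dm n (x (0 :: nat, dm)))"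

lemma vs_F: "dm \<in> S ==> vsp (F k dm n)"
	using lin_map(1)[OF lin_d, of dm "k - 1" n] lin_map(1)[OF lin_\<epsilon>, of dm n]
	by (cases k) auto

lemma vs_FF: "i \<in> I ==> vsp (FF n i)"
	using vs_F by (cases i) auto

lemma vs_C: "dm \<in> S ==> vsp (C dm n)"
	by (rule lin_map(2)[OF lin_\<epsilon>])

lemmas zero_closed = vs_laws(1)[OF vs_F]

lemma lin_dtot: "lmap (T n) (T (n - 1)) (dtot n)"
proof -
	have "dtot n = dsum_map I (%(k, dm). (k + 1, dm)) (%(k, dm). d k dm n)"
		by (auto simp: dtot_def dsum_map_def fun_eq_iff)
	moreover have "lmap (T n) (T (n - 1)) (dsum_map I (%(k, dm). (k + 1, dm)) (%(k, dm). d k dm n))"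
		by (rule lin_dsum[OF vs_FF vs_FF]) (use lin_d in \<open>auto simp: inj_on_def\<close>)
	ultimately show ?thesis by (simp only:)
qed

lemma lin_etot: "lmap (T n) (CT n) (etot n)"
proof -
	have "etot n = dsum_map S (%dm. (0, dm)) (%dm. \<epsilon> dm n)"
		by (auto simp: etot_def dsum_map_def fun_eq_iff)
	moreover have "lmap (T n) (CT n) (dsum_map S (%dm. (0, dm)) (%dm. \<epsilon> dm n))"
		by (rule lin_dsum[OF vs_FF vs_C]) (use lin_\<epsilon> in \<open>auto simp: inj_on_def\<close>)
	ultimately show ?thesis by (simp only:)
qed

lemma comp: "x \<in> carrier (T n) ==> dm \<in> S ==> x (k, dm) \<in> carrier (F k dm n)"
	using dirsum_comp[of x I "FF n" "(k, dm)"] by simp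

lemma dd: "dm \<in> S ==> u \<in> carrier (F (k + 2) dm n) ==> d k dm (n - 1) (d (k + 1) dm n u) = \<zero>\<^bsub>F k dm (n - 2)\<^esub>"
	using exact[of dm k "n - 1"] by (auto simp: algebra_simps)

lemma ed: "dm \<in> S ==> u \<in> carrier (F 1 dm n) ==> \<epsilon> dm (n - 1) (d 0 dm n u) = \<zero>\<^bsub>C dm (n - 1)\<^esub>"
	using exact0[of dm "n - 1"] by auto

lemma dtot_dtot: "x \<in> carrier (T n) ==> dtot (n - 1) (dtot n x) = \<zero>\<^bsub>T (n - 2)\<^esub>"
	using dd comp[of x n _ "_ + 2"] by (auto simp: dtot_def fun_eq_iff)

lemma etot_dtot: "x \<in> carrier (T n) ==> etot (n - 1) (dtot n x) = \<zero>\<^bsub>CT (n - 1)\<^esub>"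
	using ed comp[of x n _ 1] by (auto simp: dtot_def etot_def fun_eq_iff)

text \<open>Exactness holds component by component; what remains is to choose the preimages with
  finite support.\<close>

lemma ex_dtot:
	assumes x: "x \<in> carrier (T n)" and d0: "dtot n x = \<zero>\<^bsub>T (n - 1)\<^esub>" and e0: "etot n x = \<zero>\<^bsub>CT n\<^esub>"
	shows "x \<in> dtot (n + 1) ` carrier (T (n + 1))"
proof -
	have d0': "d k dm n (x (k + 1, dm)) = \<zero>\<^bsub>F k dm (n - 1)\<^esub>" if "dm \<in> S" for k dm
		using fun_cong[OF d0, of "(k, dm)"] that by (simp add: dtot_def)
	have e0': "\<epsilon> dm n (x (0, dm)) = \<zero>\<^bsub>C dm n\<^esub>" if "dm \<in> S" for dm
		using fun_cong[OF e0, of dm] that by (simp add: etot_def)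
	have "EX u:carrier (F (k + 1) dm (n + 1)). d k dm (n + 1) u = x (k, dm)" if "dm \<in> S" for k dm
	proof (cases k)
		case 0
		have "x (0, dm) \<in> {y \<in> carrier (F 0 dm n). \<epsilon> dm n y = \<zero>\<^bsub>C dm n\<^esub>}" using comp[OF x that] e0'[OF that] by simp
		then show ?thesis unfolding exact0[OF that] 0 by auto
	next
		case (Suc j)
		have "x (j + 1, dm) \<in> {y \<in> carrier (F (j + 1) dm n). d j dm n y = \<zero>\<^bsub>F j dm (n - 1)\<^esub>}"
			using comp[OF x that] d0'[OF that] by simp
		then show ?thesis unfolding exact[OF that] Suc by auto
	qed
	then have "ALL i:I. EX u. u \<in> carrier (F (fst i + 1) (snd i) (n + 1)) & d (fst i) (snd i) (n + 1) u = x i"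
		by fastforce
	from bchoice[OF this] obtain u where u: "!!k dm. dm \<in> S ==> u (k, dm) \<in> carrier (F (k + 1) dm (n + 1)) & d k dm (n + 1) (u (k, dm)) = x (k, dm)"
		by force
	\<comment> \<open>Where a component of \<open>x\<close> is zero, the chosen preimage is replaced by
	  zero: the choices could otherwise be nonzero at infinitely many indices.\<close>
	define y where "y = (\<lambda>(k, dm)\<in>I. if k = 0 \<or> x (k - 1, dm) = \<zero>\<^bsub>F (k - 1) dm n\<^esub> then \<zero>\<^bsub>F k dm (n + 1)\<^esub> else u (k - 1, dm))"
	have "y \<in> carrier (T (n + 1))"
	proof (rule dirsum_cI[where F = "(%(k, dm). (k + 1, dm)) ` {i \<in> I. x i ~= \<zero>\<^bsub>FF n i\<^esub>}"])
		show "finite ((%(k, dm). (k + 1, dm)) ` {i \<in> I. x i ~= \<zero>\<^bsub>FF n i\<^esub>})" using x by (simp add: dirsum_c)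
		fix i assume "i \<in> I"
		then obtain k dm where i: "i = (k, dm)" "dm \<in> S" by auto
		show "y i \<in> carrier (FF (n + 1) i)"
			using i zero_closed[OF i(2)] u[OF i(2), of "k - 1"] by (cases k) (auto simp: y_def)
		assume ni: "i ~: (%(k, dm). (k + 1, dm)) ` {i \<in> I. x i ~= \<zero>\<^bsub>FF n i\<^esub>}"
		show "y i = \<zero>\<^bsub>FF (n + 1) i\<^esub>"
		proof (cases k)
			case 0
			then show ?thesis using i by (simp add: y_def)
		next
			case (Suc j)
			have "x (j, dm) = \<zero>\<^bsub>F j dm n\<^esub>"
			proof (rule ccontr)
				assume "x (j, dm) ~= \<zero>\<^bsub>F j dm n\<^esub>"
				then have "(j, dm) \<in> {i \<in> I. x i ~= \<zero>\<^bsub>FF n i\<^esub>}" using i by simp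
				then show False using ni i Suc by (auto simp: image_iff)
			qed
			then show ?thesis using i Suc by (simp add: y_def)
		qed
	qed (simp add: y_def)
	moreover have "dtot (n + 1) y = x"
	proof (rule extensionalityI[of _ I])
		show "x \<in> extensional I" using x by (simp add: dirsum_c)
		fix i assume "i \<in> I"
		then obtain k dm where i: "i = (k, dm)" "dm \<in> S" by auto
		show "dtot (n + 1) y i = x i"
			using i u[OF i(2), of k] lin_zero[OF lin_d[OF i(2), of k "n + 1"]]
			by (auto simp: dtot_def y_def)
	qed (simp add: dtot_def)
	ultimately show ?thesis by blast
qed

lemma ex_etot:
	assumes w: "w \<in> carrier (CT n)"
	shows "EX x:carrier (T n). dtot n x = \<zero>\<^bsub>T (n - 1)\<^esub> & etot n x = w"
proof -
	have "EX u. u \<in> carrier (F 0 dm n) & \<epsilon> dm n u = w dm" if "dm \<in> S" for dm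
		using surj[OF that, of n] dirsum_comp[OF w that] by (metis imageE)
	then obtain u where u: "!!dm. dm \<in> S ==> u dm \<in> carrier (F 0 dm n) & \<epsilon> dm n (u dm) = w dm" by metis
	define x where "x = (\<lambda>(k, dm)\<in>I. if k = 0 & w dm ~= \<zero>\<^bsub>C dm n\<^esub> then u dm else \<zero>\<^bsub>F k dm n\<^esub>)"
	have "x \<in> carrier (T n)"
	proof (rule dirsum_cI[where F = "Pair 0 ` {dm \<in> S. w dm ~= \<zero>\<^bsub>C dm n\<^esub>}"])
		show "finite (Pair 0 ` {dm \<in> S. w dm ~= \<zero>\<^bsub>C dm n\<^esub>})" using w by (simp add: dirsum_c)
		fix i assume "i \<in> I"
		then obtain k dm where i: "i = (k, dm)" "dm \<in> S" by auto
		show "x i \<in> carrier (FF n i)" using i u[OF i(2)] zero_closed[OF i(2)] by (auto simp: x_def)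
		assume "i ~: Pair 0 ` {dm \<in> S. w dm ~= \<zero>\<^bsub>C dm n\<^esub>}"
		then show "x i = \<zero>\<^bsub>FF n i\<^esub>" using i by (auto simp: x_def)
	qed (simp add: x_def)
	moreover have "dtot n x = \<zero>\<^bsub>T (n - 1)\<^esub>"
		using lin_zero[OF lin_d] by (auto simp: dtot_def x_def fun_eq_iff)
	moreover have "etot n x = w"
	proof (rule extensionalityI[of _ S])
		show "w \<in> extensional S" using w by (simp add: dirsum_c)
		fix dm assume s: "dm \<in> S"
		then show "etot n x dm = w dm" using u[OF s] lin_zero[OF lin_\<epsilon>[OF s, of n]] by (auto simp: etot_def x_def)
	qed (simp add: etot_def)
	ultimately show ?thesis by blast
qed

text \<open>Conjugation with the bijections \<open>\<Psi>\<close> carries the complex over, so the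
  prescribed formulas hold by construction and exactness is inherited.\<close>

lemma transport:
	fixes L :: "int => (rat, 'l) module"
	assumes \<Psi>: "!!n. lmap (T n) (L n) (\<Psi> n)" "!!n. bij_betw (\<Psi> n) (carrier (T n)) (carrier (L n))"
	shows "EX D q. (ALL n. ALL x:carrier (T n). D n (\<Psi> n x) = \<Psi> (n - 1) (dtot n x) & q n (\<Psi> n x) = etot n x)
		& dg_space class_ring (- 1) L D & quasi_isomorphism class_ring (- 1) L D CT (%n _. \<zero>\<^bsub>CT (n - 1)\<^esub>) q"
proof -
	let ?i = "%n. inv_into (carrier (T n)) (\<Psi> n)"
	define D where "D n z = \<Psi> (n - 1) (dtot n (?i n z))" for n z
	define q where "q n z = etot n (?i n z)" for n z
	have i: "?i n (\<Psi> n x) = x" if "x \<in> carrier (T n)" for n x using bij_betw_inv_into_left[OF \<Psi>(2) that] .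
	have li: "lmap (L n) (T n) (?i n)" for n by (rule lin_inv[OF \<Psi>])
	have \<Psi>i: "\<Psi> n (?i n z) = z" "?i n z \<in> carrier (T n)" if "z \<in> carrier (L n)" for n z
		using bij_betw_inv_into_right[OF \<Psi>(2) that] lin_map(3)[OF li that] by auto
	have Dc: "dtot n x \<in> carrier (T (n - 1))" if "x \<in> carrier (T n)" for n x by (rule lin_map(3)[OF lin_dtot that])
	have lD: "lmap (L n) (L (n - 1)) (D n)" for n
		unfolding D_def by (rule lin_comp[OF lin_comp[OF li lin_dtot] \<Psi>(1)])
	have lq: "lmap (L n) (CT n) (q n)" for n
		unfolding q_def by (rule lin_comp[OF li lin_etot])
	have Dz: "?i (n - 1) (D n z) = dtot n (?i n z)" if "z \<in> carrier (L n)" for n z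
		unfolding D_def by (rule i[OF Dc[OF \<Psi>i(2)[OF that]]])
	have D0: "dtot n (?i n z) = \<zero>\<^bsub>T (n - 1)\<^esub>" if "z \<in> carrier (L n)" "D n z = \<zero>\<^bsub>L (n - 1)\<^esub>" for n z
		using Dz[OF that(1)] lin_zero[OF li, of "n - 1"] that(2) by simp
	have "quasi_isomorphism class_ring (- 1) L D CT (%n _. \<zero>\<^bsub>CT (n - 1)\<^esub>) q"
	proof (rule quasi_isomorphismI[where C = L and D = D and C' = CT and q = q])
		show "lmap (L n) (L (n - 1)) (D n)" "lmap (L n) (CT n) (q n)" for n
			by (rule lD, rule lq)
	next
		fix n z assume z: "z \<in> carrier (L n)"
		show "q (n - 1) (D n z) = \<zero>\<^bsub>CT (n - 1)\<^esub>"
			unfolding q_def Dz[OF z] by (rule etot_dtot[OF \<Psi>i(2)[OF z]])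
		assume "D n z = \<zero>\<^bsub>L (n - 1)\<^esub>" "q n z = \<zero>\<^bsub>CT n\<^esub>"
		then obtain y where y: "y \<in> carrier (T (n + 1))" "?i n z = dtot (n + 1) y"
			using ex_dtot[OF \<Psi>i(2)[OF z] D0[OF z]] unfolding q_def by blast
		have "D (n + 1) (\<Psi> (n + 1) y) = z"
			unfolding D_def i[OF y(1)] y(2)[symmetric] using \<Psi>i(1)[OF z] by simp
		then show "z \<in> D (n + 1) ` carrier (L (n + 1))"
			using lin_map(3)[OF \<Psi>(1) y(1)] by blast
	next
		fix n w assume "w \<in> carrier (CT n)"
		then obtain x where x: "x \<in> carrier (T n)" "dtot n x = \<zero>\<^bsub>T (n - 1)\<^esub>" "etot n x = w" using ex_etot by blast
		have "D n (\<Psi> n x) = \<zero>\<^bsub>L (n - 1)\<^esub>" unfolding D_def i[OF x(1)] x(2) by (rule lin_zero[OF \<Psi>(1)])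
		moreover have "q n (\<Psi> n x) = w" unfolding q_def i[OF x(1)] by (rule x(3))
		ultimately show "EX z:carrier (L n). D n z = \<zero>\<^bsub>L (n - 1)\<^esub> & q n z = w"
			using lin_map(3)[OF \<Psi>(1) x(1)] by blast
	qed
	moreover have "dg_space class_ring (- 1) L D"
		unfolding dg_space_def
	proof (intro allI conjI ballI)
		fix n show "lmap (L n) (L (n + - 1)) (D n)" using lD by simp
		fix z assume z: "z \<in> carrier (L n)"
		have "D (n - 1) (D n z) = \<Psi> (n - 1 - 1) \<zero>\<^bsub>T (n - 2)\<^esub>"
			unfolding D_def[of "n - 1"] Dz[OF z] dtot_dtot[OF \<Psi>i(2)[OF z]] ..
		also have "\<dots> = \<zero>\<^bsub>L (n - 2)\<^esub>" using lin_zero[OF \<Psi>(1), of "n - 2"] by simp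
		finally show "D (n + - 1) (D n z) = \<zero>\<^bsub>L (n + - 1 + - 1)\<^esub>" by simp
	qed
	moreover have "D n (\<Psi> n x) = \<Psi> (n - 1) (dtot n x) & q n (\<Psi> n x) = etot n x" if "x \<in> carrier (T n)" for n x
		unfolding D_def q_def i[OF that] by simp
	ultimately show ?thesis by blast
qed

end

lemma vectorspace_framed_coha: "vsp (framed_coha Q v0 v1 k dm n)"
	unfolding framed_coha_def by (rule vectorspace_cohomology)

lemma vectorspace_coha: "vsp (coha Q dm n)"
	unfolding coha_def by (rule vectorspace_cohomology)

text \<open>Fixing the difference between the degree and the index k cuts the graded sequence into
  independent sequences of vector spaces, one for each dimension vector and each diagonal.\<close>

lemma ex_framed_resolution:
	assumes "framed Q v0 v1"
	shows "EX d \<epsilon>. resolution (dimvecs Q) (framed_coha Q v0 v1) (coha Q) d \<epsilon>"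
proof -
	let ?F = "framed_coha Q v0 v1"
	let ?V = "%dm n k. ?F k dm (n + int k)"
	have "EX d e. is_resolution (?V dm n) (coha Q dm n) d e" for dm n
		by (rule ex_resolution[OF vectorspace_framed_coha has_dim_framed[OF assms] vectorspace_coha has_dim_coha[OF assms]])
	then have ex: "EX de. is_resolution (?V dm n) (coha Q dm n) (fst de) (snd de)" for dm n by simp
	define f where "f dm n = (SOME de. is_resolution (?V dm n) (coha Q dm n) (fst de) (snd de))" for dm n
	define d where "d dm n = fst (f dm n)" for dm n
	define e where "e dm n = snd (f dm n)" for dm n
	have P: "is_resolution (?V dm n) (coha Q dm n) (d dm n) (e dm n)" for dm n
		unfolding d_def e_def f_def by (rule someI_ex[OF ex])
	have d: "lmap (?V dm n (Suc k)) (?V dm n k) (d dm n k)"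
		and e: "lmap (?V dm n 0) (coha Q dm n) (e dm n)"
		and sur: "e dm n ` carrier (?V dm n 0) = carrier (coha Q dm n)"
		and ex0: "{x \<in> carrier (?V dm n 0). e dm n x = \<zero>\<^bsub>coha Q dm n\<^esub>} = d dm n 0 ` carrier (?V dm n 1)"
		and ex: "{x \<in> carrier (?V dm n (Suc k)). d dm n k x = \<zero>\<^bsub>?V dm n k\<^esub>} = d dm n (Suc k) ` carrier (?V dm n (Suc (Suc k)))" for dm n k
		by (rule is_resolutionD[OF P])+
	\<comment> \<open>The map \<open>d k\<close> starts in term k + 1 and degree n, which lies on the
	  diagonal n - (k + 1).\<close>
	have "resolution (dimvecs Q) (framed_coha Q v0 v1) (coha Q) (%k dm n. d dm (n - 1 - int k) k) e"
	proof (rule resolution.intro)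
		fix dm n and k :: nat
		show "lmap (?F (k + 1) dm n) (?F k dm (n - 1)) (d dm (n - 1 - int k) k)"
			using d[where dm = dm and n = "n - 1 - int k" and k = k] by simp
		show "lmap (?F 0 dm n) (coha Q dm n) (e dm n)"
			"e dm n ` carrier (?F 0 dm n) = carrier (coha Q dm n)"
			using e[of dm n] sur[of dm n] by simp_all
		show "{x \<in> carrier (?F 0 dm n). e dm n x = \<zero>\<^bsub>coha Q dm n\<^esub>} = d dm (n + 1 - 1 - int 0) 0 ` carrier (?F 1 dm (n + 1))"
			using ex0[of dm n] by simp
		have i: "n - 1 - int k + int (Suc k) = n" "n - 1 - int k + int (Suc (Suc k)) = n + 1" "n + 1 - 1 - int (k + 1) = n - 1 - int k" "n - 1 - int k + int k = n - 1"
			"k + 1 = Suc k" "k + 2 = Suc (Suc k)"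
			by simp_all
		show "{x \<in> carrier (?F (k + 1) dm n). d dm (n - 1 - int k) k x = \<zero>\<^bsub>?F k dm (n - 1)\<^esub>}
			= d dm (n + 1 - 1 - int (k + 1)) (k + 1) ` carrier (?F (k + 2) dm (n + 1))"
			using ex[where dm = dm and n = "n - 1 - int k" and k = k] unfolding i(1,2,4,5,6) by (simp only: i(3)[unfolded i(5)])
	qed
	then show ?thesis by blast
qed

theorem theorem3:
  fixes Q :: "('v, 'a) pre_digraph" and v0 v1 :: 'v
  assumes "fin_digraph Q" and "v0 \<in> verts Q" and "v1 \<in> verts Q" and "v0 \<noteq> v1"
  shows "\<exists>d \<epsilon>.
    (\<forall>\<delta>\<in>dimvecs Q. \<forall>n.
       (\<forall>k. linear_map class_ring
          (framed_coha Q v0 v1 (k + 1) \<delta> n) (framed_coha Q v0 v1 k \<delta> (n - 1)) (d k \<delta> n)) \<and>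
       linear_map class_ring (framed_coha Q v0 v1 0 \<delta> n) (coha Q \<delta> n) (\<epsilon> \<delta> n) \<and>
       \<epsilon> \<delta> n ` carrier (framed_coha Q v0 v1 0 \<delta> n) = carrier (coha Q \<delta> n) \<and>
       {x \<in> carrier (framed_coha Q v0 v1 0 \<delta> n). \<epsilon> \<delta> n x = \<zero>\<^bsub>coha Q \<delta> n\<^esub>}
         = d 0 \<delta> (n + 1) ` carrier (framed_coha Q v0 v1 1 \<delta> (n + 1)) \<and>
       (\<forall>k. {x \<in> carrier (framed_coha Q v0 v1 (k + 1) \<delta> n).
               d k \<delta> n x = \<zero>\<^bsub>framed_coha Q v0 v1 k \<delta> (n - 1)\<^esub>}
         = d (k + 1) \<delta> (n + 1) ` carrier (framed_coha Q v0 v1 (k + 2) \<delta> (n + 1)))) \<and>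
    (\<exists>h \<Psi> D q.
       (\<forall>\<delta>\<in>dimvecs Q. \<forall>k. homotopy_equivalence
          (rep_stack (linked_quiver v0 v1 Q) (linked_dim \<delta> k))
          (framed_stack Q v0 v1 k (shift_dim v0 v1 k \<delta>)) (h \<delta> k)) \<and>
       (\<forall>n. linear_map class_ring
              (framed_total Q v0 v1 n) (coha_total (linked_quiver v0 v1 Q) n) (\<Psi> n) \<and>
            bij_betw (\<Psi> n) (carrier (framed_total Q v0 v1 n))
              (carrier (coha_total (linked_quiver v0 v1 Q) n))) \<and>
       (\<forall>n. \<forall>\<delta>\<in>dimvecs Q. \<forall>k. \<forall>y\<in>carrier (framed_coha Q v0 v1 k (shift_dim v0 v1 k \<delta>) n).
          \<Psi> n (summand_inj (UNIV \<times> dimvecs Q) (\<lambda>(k, \<delta>). framed_coha Q v0 v1 k \<delta> n)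
                (k, shift_dim v0 v1 k \<delta>) y)
          = summand_inj (dimvecs (linked_quiver v0 v1 Q))
              (\<lambda>\<gamma>. coha (linked_quiver v0 v1 Q) \<gamma> n) (linked_dim \<delta> k)
              (cohomology_pullback (rep_stack (linked_quiver v0 v1 Q) (linked_dim \<delta> k)) (h \<delta> k)
                (n - euler_form (linked_quiver v0 v1 Q) (linked_dim \<delta> k) (linked_dim \<delta> k)) y)) \<and>
       (\<forall>n. \<forall>x\<in>carrier (framed_total Q v0 v1 n).
          D n (\<Psi> n x) = \<Psi> (n - 1) (\<lambda>(k, \<delta>)\<in>UNIV \<times> dimvecs Q. d k \<delta> n (x (k + 1, \<delta>))) \<and>
          q n (\<Psi> n x) = (\<lambda>\<delta>\<in>dimvecs Q. \<epsilon> \<delta> n (x (0, \<delta>)))) \<and>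
       dg_space class_ring (- 1) (coha_total (linked_quiver v0 v1 Q)) D \<and>
       quasi_isomorphism class_ring (- 1) (coha_total (linked_quiver v0 v1 Q)) D
         (coha_total Q) (\<lambda>n _. \<zero>\<^bsub>coha_total Q (n - 1)\<^esub>) q)"
proof -
	have Q: "framed Q v0 v1" using assms by (intro framed.intro framed_axioms.intro)
	have QS: "framed_shift Q v0 v1" using Q by (rule framed_shift.intro)
	let ?QL = "linked_quiver v0 v1 Q" and ?F = "%k dm n. framed_coha Q v0 v1 k dm n" and ?sh = "shift_dim v0 v1"
	let ?S = "%dm k. rep_stack ?QL (linked_dim dm k)" and ?X = "%dm k. framed_stack Q v0 v1 k (?sh k dm)"
	obtain d \<epsilon> where "resolution (dimvecs Q) ?F (coha Q) d \<epsilon>" using ex_framed_resolution[OF Q] by blast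
	then interpret R: resolution "dimvecs Q" ?F "coha Q" d \<epsilon> .
	have "EX f. homotopy_equivalence (?S dm k) (?X dm k) f" for dm k
		by (rule framed_shift.ex_hequiv[OF QS])
	then obtain h where h: "!!dm k. homotopy_equivalence (?S dm k) (?X dm k) (h dm k)"
		by metis
	\<comment> \<open>A dimension vector of the linked quiver is split into its restriction to the old
	  vertices and its value at the new one, and \<open>t\<close> sends it to the index of the matching
	  framed summand.\<close>
	define res where "res \<gamma> = (%i. \<gamma> (Some i))" for \<gamma> :: "'v option => nat"
	define t where "t \<gamma> = (\<gamma> None, ?sh (\<gamma> None) (res \<gamma>))" for \<gamma>
	define p where "p n \<gamma> = cohomology_pullback (rep_stack ?QL \<gamma>) (h (res \<gamma>) (\<gamma> None)) (n - euler_form ?QL \<gamma> \<gamma>)" for n \<gamma>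
	define \<Psi> where "\<Psi> n = dsum_map (dimvecs ?QL) t (p n)" for n
	have ld: "linked_dim (res \<gamma>) (\<gamma> None) = \<gamma>" for \<gamma>
		by (auto simp: linked_dim_def res_def fun_eq_iff split: option.split)
	have rl: "res (linked_dim dm k) = dm" "linked_dim dm k None = k" for dm k
		by (auto simp: linked_dim_def res_def)
	\<comment> \<open>The degree shifts on the two sides agree by \<open>euler_QL\<close>, so the
	  pullback preserves the grading.\<close>
	have deg: "?F k (?sh k dm) n = singular_cohomology (?X dm k)
			(n - euler_form ?QL (linked_dim dm k) (linked_dim dm k))" for k dm n
		unfolding framed_coha_def framed_shift.euler_QL[OF QS] by (simp add: diff_diff_eq)
	have vq: "verts ?QL = insert None (Some ` verts Q)" by (simp add: linked_quiver_def)
	have dv: "res \<gamma> \<in> dimvecs Q" "?sh k (res \<gamma>) \<in> dimvecs Q" if "\<gamma> \<in> dimvecs ?QL" for \<gamma> k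
		using that assms(2,3) by (auto simp: dimvecs_def vq res_def shift_dim_def)
	have dl: "linked_dim dm k \<in> dimvecs ?QL" if "dm \<in> dimvecs Q" for dm k
		using that by (auto simp: dimvecs_def vq linked_dim_def split: option.split)
	have tl: "t (linked_dim dm k) = (k, ?sh k dm)" for dm k by (simp add: t_def rl)
	have tinj: "inj_on t (dimvecs ?QL)"
	proof (rule inj_onI)
		fix \<gamma> \<gamma>' assume "t \<gamma> = t \<gamma>'"
		then have "\<gamma> None = \<gamma>' None" "res \<gamma> = res \<gamma>'" by (auto simp: t_def shift_dim_def fun_eq_iff)
		then have "linked_dim (res \<gamma>) (\<gamma> None) = linked_dim (res \<gamma>') (\<gamma>' None)" by (rule arg_cong2[where f = linked_dim, rotated])
		then show "\<gamma> = \<gamma>'" unfolding ld .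
	qed
	have tim: "t ` dimvecs ?QL <= UNIV \<times> dimvecs Q" using dv by (auto simp: t_def)
	have pl: "lmap (R.FF n (t \<gamma>)) (coha ?QL \<gamma> n) (p n \<gamma>)"
		and pb: "bij_betw (p n \<gamma>) (carrier (R.FF n (t \<gamma>))) (carrier (coha ?QL \<gamma> n))" for n \<gamma>
	proof -
		note H = h[of "res \<gamma>" "\<gamma> None", unfolded ld]
		have c: "continuous_map (rep_stack ?QL \<gamma>) (?X (res \<gamma>) (\<gamma> None)) (h (res \<gamma>) (\<gamma> None))"
			using H by (simp add: homotopy_equivalence_def)
		have e: "R.FF n (t \<gamma>) = singular_cohomology (?X (res \<gamma>) (\<gamma> None)) (n - euler_form ?QL \<gamma> \<gamma>)"
			using deg[of "\<gamma> None" "res \<gamma>" n] by (simp add: t_def ld)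
		show "lmap (R.FF n (t \<gamma>)) (coha ?QL \<gamma> n) (p n \<gamma>)"
			unfolding e p_def coha_def by (rule lin_cohomology_pullback[OF c])
		show "bij_betw (p n \<gamma>) (carrier (R.FF n (t \<gamma>))) (carrier (coha ?QL \<gamma> n))"
			unfolding e p_def coha_def by (rule bij_betw_cohomology_pullback[OF H])
	qed
	\<comment> \<open>A framed summand that does not arise from the linked quiver has \<open>k\<close>
	  larger than the dimension at 0 or 1. Its space is empty, so nothing is lost.\<close>
	have out: "carrier (R.FF n i) = {\<zero>\<^bsub>R.FF n i\<^esub>}" if i: "i \<in> UNIV \<times> dimvecs Q" "i ~: t ` dimvecs ?QL" for n i
	proof -
		obtain k d where kd: "i = (k, d)" "d \<in> dimvecs Q" using i(1) by auto
		have "\<not> (k <= d v0 & k <= d v1)"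
		proof
			assume le: "k <= d v0 & k <= d v1"
			\<comment> \<open>As \<open>v0\<close> and \<open>v1\<close> are distinct, at most one copy of
			  \<open>k\<close> is subtracted at each vertex, so by \<open>le\<close> no truncation
			  occurs.\<close>
			define dm where "dm i = d i - k * (of_bool (i = v0) + of_bool (i = v1))" for i
			have "?sh k dm = d" using le assms(4) by (auto simp: shift_dim_def dm_def fun_eq_iff)
			moreover have "dm \<in> dimvecs Q" using kd(2) by (auto simp: dm_def dimvecs_def)
			ultimately have "i \<in> t ` dimvecs ?QL" using tl[of dm k] dl[of dm k] kd(1) by (metis imageI)
			then show False using i(2) by simp
		qed
		then have "has_dim (?F k d n) 0"
			unfolding framed_coha_def by (intro has_dim_empty framed_dim_exceeds[OF Q])
		then obtain g where g: "coords (?F k d n) 0 g" by (auto simp: has_dim_def)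
		have "x = \<zero>\<^bsub>?F k d n\<^esub>" if "x \<in> carrier (?F k d n)" for x
			using coords_zero[OF vectorspace_framed_coha g that] by simp
		then have "carrier (?F k d n) = {\<zero>\<^bsub>?F k d n\<^esub>}" using R.zero_closed[OF kd(2), of k n] by blast
		then show ?thesis unfolding kd(1) prod.case .
	qed
	have T: "framed_total Q v0 v1 n = R.T n" and L: "coha_total ?QL n = dirsum (dimvecs ?QL) (%\<gamma>. coha ?QL \<gamma> n)"
		and C: "coha_total Q n = R.CT n" for n
		by (simp_all add: framed_total_def coha_total_def)
	have \<Psi>l: "lmap (R.T n) (coha_total ?QL n) (\<Psi> n)" for n
		unfolding L \<Psi>_def
		by (rule lin_dsum[where M = "R.FF n" and N = "%\<gamma>. coha ?QL \<gamma> n" and t = t and p = "p n", OF R.vs_FF vectorspace_coha tinj tim pl])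
	have \<Psi>b: "bij_betw (\<Psi> n) (carrier (R.T n)) (carrier (coha_total ?QL n))" for n
		unfolding L \<Psi>_def
		by (rule bij_betw_dsum[where M = "R.FF n" and N = "%\<gamma>. coha ?QL \<gamma> n" and t = t and p = "p n", OF R.vs_FF vectorspace_coha tinj tim pl pb out])
	obtain D q where Dq: "!!n x. x \<in> carrier (R.T n) ==> D n (\<Psi> n x) = \<Psi> (n - 1) (R.dtot n x) & q n (\<Psi> n x) = R.etot n x"
		and dg: "dg_space class_ring (- 1) (coha_total ?QL) D"
		and qi: "quasi_isomorphism class_ring (- 1) (coha_total ?QL) D R.CT (%n _. \<zero>\<^bsub>R.CT (n - 1)\<^esub>) q"
		using R.transport[OF \<Psi>l \<Psi>b] by blast
	have CT: "coha_total Q = R.CT" by (rule ext) (rule C)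
	have summand: "\<Psi> n (summand_inj (UNIV \<times> dimvecs Q) (R.FF n) (k, ?sh k dm) y)
			= summand_inj (dimvecs ?QL) (%\<gamma>. coha ?QL \<gamma> n) (linked_dim dm k)
					(cohomology_pullback (?S dm k) (h dm k) (n - euler_form ?QL (linked_dim dm k) (linked_dim dm k)) y)"
		(is "?l = ?r") if dm: "dm \<in> dimvecs Q" for n dm k y
	proof
		fix \<gamma> show "?l \<gamma> = ?r \<gamma>"
		proof (cases "\<gamma> \<in> dimvecs ?QL")
			case g: True
			then have tI: "t \<gamma> \<in> UNIV \<times> dimvecs Q" using tim by blast
			have eq: "t \<gamma> = (k, ?sh k dm) \<longleftrightarrow> \<gamma> = linked_dim dm k"
				using inj_onD[OF tinj _ g dl[OF dm, of k]] tl[of dm k] by auto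
			then show ?thesis using g tI lin_zero[OF pl]
				by (cases "\<gamma> = linked_dim dm k") (simp_all add: \<Psi>_def dsum_map_def summand_inj_def p_def rl)
		qed (simp add: \<Psi>_def dsum_map_def summand_inj_def)
	qed
	show ?thesis
		unfolding T CT
	proof (intro exI[of _ d] exI[of _ \<epsilon>] conjI exI[of _ h] exI[of _ \<Psi>] exI[of _ D] exI[of _ q] ballI allI)
		fix n x assume x: "x \<in> carrier (R.T n)"
		show "D n (\<Psi> n x) = \<Psi> (n - 1) (\<lambda>(k, dm)\<in>UNIV \<times> dimvecs Q. d k dm n (x (k + 1, dm)))"
			"q n (\<Psi> n x) = (\<lambda>dm\<in>dimvecs Q. \<epsilon> dm n (x (0, dm)))"
			using Dq[OF x] by (simp_all add: R.dtot_def R.etot_def)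
	qed (assumption | rule R.lin_d R.lin_\<epsilon> R.surj R.exact0 R.exact h \<Psi>l \<Psi>b dg qi | simp add: summand)+
qed

end
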